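(* Let $X$ be a reflexive Banach space such that $X$ and $X^*$ have finite cotype. Let $T=(T_1,\ldots,T_d)$ be commuting Ritt operators on $X$ such that every $T_k$ is $R$-Ritt of $R$-type $\delta_k\in(0,\frac{\pi}{2})$ for $k=1,\ldots,d$. Suppose that there exists a constant $C>0$ such that for any subset $\Lambda$ of $\{1,\ldots,d\}$, there exist $\alpha_\Lambda=(\alpha_k)_{k\in\Lambda}$ and $\beta_\Lambda=(\beta_k)_{k\in\Lambda}$ in $(\mathbb{R}_+^* )^\Lambda$ such that $$\|x\|_{T,\alpha_\Lambda}\le C\|x\|,\quad x\in X,\qquad\text{and}\qquad \|y\|_{T^*,\beta_\Lambda}\le C\|y\|,\quad y\in X^*,$$ where $T^*=(T_1^*,\ldots,T_d^* )$. Then $(T_1,\ldots,T_d)$ admits an $H^\infty(B_{\gamma_1}\times\cdots\times B_{\gamma_d})$ joint functional calculus for every $\gamma_k\in(\delta_k,\frac{\pi}{2})$, $k=1,\ldots,d$.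
   Context: Banach spaces are complex, $d\ge 1$ is an integer, $B(X)$ is the algebra of bounded operators on $X$, $R(\lambda,T)=(\lambda I_X-T)^{-1}$, $\mathbb{N}=\{0,1,2,\ldots\}$, $\mathbb{N}^*=\{1,2,\ldots\}$, $\mathbb{R}_+^*=(0,\infty)$. Ritt operators. $T\in B(X)$ is a Ritt operator if there is $C>0$ with $\|T^n\|\le C$ and $\|n(T^n-T^{n-1})\|\le C$ for all $n\ge 1$. For $a\in(0,\frac{\pi}{2})$, the Stolz domain $B_a$ is the interior of the convex hull of $1$ and the disc $D(0,\sin a)$. A Ritt operator $T$ is of type $a\in(0,\frac\pi2)$ if $\sigma(T)\subset\overline{B_a}$ and for every $b\in(a,\frac{\pi}{2})$ there is $K_b>0$ with $\|(\lambda-1)R(\lambda,T)\|\le K_b$ for all $\lambda\in\mathbb{C}\setminus\overline{B_b}$. Every Ritt operator is of type $a$ for some $a\in(0,\frac\pi2)$. Rademacher averages and $R$-Ritt operators. For a nonempty countable set $\mathcal{I}$ and a family $(r_\iota)_{\iota\in\mathcal{I}}$ of independent Rademacher variables on a probability space $\Omega_0$, $\mathrm{Rad}(\mathcal{I};X)$ is the closure in $L_2(\Omega_0;X)$ of the set of finite sums $\sum_\iota r_\iota\otimes x_\iota$, $x_\iota\in X$; $\mathrm{Rad}(X)=\mathrm{Rad}(\mathbb{N}^*;X)$. A set $E\subset B(X)$ is $R$-bounded if there is $C\ge0$ such that $\|\sum_{k=1}^n r_k\otimes S_kx_k\|_{\mathrm{Rad}(X)}\le C\|\sum_{k=1}^n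 r_k\otimes x_k\|_{\mathrm{Rad}(X)}$ for all $n\ge1$, $S_1,\ldots,S_n\in E$, $x_1,\ldots,x_n\in X$. A Ritt operator $T$ is $R$-Ritt if the sets $\{T^n:n\in\mathbb{N}\}$ and $\{n(T^n-T^{n-1}):n\ge1\}$ are $R$-bounded. In this case there is $\delta\in(0,\frac\pi2)$ such that $\sigma(T)\subset\overline{B_\delta}$ and $\{(\lambda-1)R(\lambda,T):\lambda\in\mathbb{C}\setminus\overline{B_\delta}\}$ is $R$-bounded; the $R$-type of $T$ is the infimum of all such $\delta$. Joint functional calculus. Let $\gamma_1,\ldots,\gamma_d\in(0,\frac{\pi}{2})$. For $\Lambda\subset\{1,\ldots,d\}$, $H_0^\infty(\prod_{i\in\Lambda}B_{\gamma_i})$ is the algebra of bounded holomorphic functions $f$ on $B_{\gamma_1}\times\cdots\times B_{\gamma_d}$ depending only on the variables $(\lambda_i)_{i\in\Lambda}$ and for which there are positive constants $c,(s_i)_{i\in\Lambda}$ with $|f(\lambda_1,\ldots,\lambda_d)|\le c\prod_{i\in\Lambda}|1-\lambda_i|^{s_i}$ (constant functions if $\Lambda=\emptyset$). Let $(T_1,\ldots,T_d)$ be commuting Ritt operators, $T_k$ of type $a_k\in(0,\gamma_k)$, and let $b_k\in(a_k,\gamma_k)$. For $\Lambda\neq\emptyset$ and $f\in H_0^\infty(\prod_{i\in\Lambda}B_{\gamma_i})$, set $$f(T_1,\ldots,T_d)=\Big(\frac{1}{2\pi i}\Big)^{|\Lambda|}\int_{\prod_{i\in\Lambda}\partial B_{b_i}}f(\lambda_1,\ldots,\lambda_d)\prod_{i\in\Lambda}R(\lambda_i,T_i)\prod_{i\in\Lambda}d\lambda_i$$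 (counterclockwise orientation; absolutely convergent and independent of the $b_i$), and $f(T_1,\ldots,T_d)=cI_X$ if $f\equiv c$. Extend linearly to the direct sum $H_{0,1}^\infty(B_{\gamma_1}\times\cdots\times B_{\gamma_d})=\bigoplus_{\Lambda\subset\{1,\ldots,d\}}H_0^\infty(\prod_{i\in\Lambda}B_{\gamma_i})$. The tuple $(T_1,\ldots,T_d)$ (with $T_k$ of some type $a_k<\gamma_k$) admits an $H^\infty(B_{\gamma_1}\times\cdots\times B_{\gamma_d})$ joint functional calculus if there is $K>0$ with $\|f(T_1,\ldots,T_d)\|\le K\sup_{B_{\gamma_1}\times\cdots\times B_{\gamma_d}}|f|$ for all $f\in H_{0,1}^\infty(B_{\gamma_1}\times\cdots\times B_{\gamma_d})$. Square functions. For a Ritt operator $T$ of type $a\in(0,\frac\pi2)$ and $\alpha>0$, $(I_X-T)^\alpha=p_\alpha(T)=\frac{1}{2\pi i}\int_{\partial B_b}p_\alpha(\lambda)R(\lambda,T)\,d\lambda$, where $p_\alpha(z)=(1-z)^\alpha$, $b\in(a,\frac\pi2)$ and $\partial B_b$ is oriented counterclockwise (the integral is absolutely convergent and independent of $b$). For commuting Ritt operators $T=(T_1,\ldots,T_d)$ on $X$, $\Lambda\subset\{1,\ldots,d\}$, $\alpha_\Lambda=(\alpha_i)_{i\in\Lambda}\in(\mathbb{R}_+^* )^\Lambda$ and $x\in X$, set $x_{(k_i)}=\prod_{i\in\Lambda}k_i^{\alpha_i-\frac12}T_i^{k_i-1}(I_X-T_i)^{\alpha_i}x$ for $(k_i)_{i\in\Lambda}\in(\mathbb{N}^*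 )^\Lambda$ and $$\|x\|_{T,\alpha_\Lambda}=\Big\|\sum_{(k_i)\in(\mathbb{N}^* )^\Lambda}r_{(k_i)}\otimes x_{(k_i)}\Big\|_{\mathrm{Rad}((\mathbb{N}^* )^\Lambda;X)}$$ if the family $(r_{(k_i)}\otimes x_{(k_i)})$ is summable in $\mathrm{Rad}((\mathbb{N}^* )^\Lambda;X)$, and $\|x\|_{T,\alpha_\Lambda}=\infty$ otherwise (for $\Lambda=\emptyset$ this is just $\|x\|$). The same definition is used for the commuting Ritt operators $T^*$ on $X^*$. *)

theory Defs
  imports "HOL-Complex_Analysis.Complex_Analysis"
begin

section \<open>Complex Banach spaces and bounded complex-linear operators\<close>

class complex_normed_vector = real_normed_vector +
  fixes scaleC :: "complex \<Rightarrow> 'a \<Rightarrow> 'a"  (infixr \<open>*\<^sub>C\<close> 75)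
  assumes scaleC_add_right: "c *\<^sub>C (x + y) = c *\<^sub>C x + c *\<^sub>C y"
    and scaleC_add_left: "(c + d) *\<^sub>C x = c *\<^sub>C x + d *\<^sub>C x"
    and scaleC_scaleC: "c *\<^sub>C d *\<^sub>C x = (c * d) *\<^sub>C x"
    and scaleC_of_real: "of_real r *\<^sub>C x = r *\<^sub>R x"
    and norm_scaleC: "norm (c *\<^sub>C x) = cmod c * norm x"

class complex_banach = complex_normed_vector + banach

instantiation complex :: complex_normed_vector
begin

definition scaleC_complex :: "complex \<Rightarrow> complex \<Rightarrow> complex"
  where "scaleC_complex c x = c * x"

instance
  by standard (auto simp: scaleC_complex_def algebra_simps scaleR_conv_of_real norm_mult)

end

instance complex :: complex_banach ..

lemma bounded_linear_scaleC: "bounded_linear (\<lambda>x::'a::complex_normed_vector. c *\<^sub>C x)"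
proof (rule bounded_linear_intro[where K = "cmod c"])
  fix r :: real and x :: 'a
  show "c *\<^sub>C r *\<^sub>R x = r *\<^sub>R c *\<^sub>C x"
    by (simp add: scaleC_of_real[symmetric] scaleC_scaleC mult.commute)
qed (auto simp: scaleC_add_right norm_scaleC mult.commute)

lemmas scaleC_simps =
  scaleC_add_right
  linear_diff[OF bounded_linear.linear[OF bounded_linear_scaleC]]
  linear_neg[OF bounded_linear.linear[OF bounded_linear_scaleC]]
  linear_0[OF bounded_linear.linear[OF bounded_linear_scaleC]]
  linear_scale[OF bounded_linear.linear[OF bounded_linear_scaleC]]

text \<open>The complex-linear elements of the library's space of bounded real-linear maps, with the
  operator norm.  \<open>('a, 'a) cblinfun\<close> is $B(X)$ and \<open>('a, complex) cblinfun\<close> is $X^*$.\<close>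

typedef (overloaded) ('a, 'b) cblinfun =
  "{f :: 'a::complex_normed_vector \<Rightarrow>\<^sub>L 'b::complex_normed_vector.
      \<forall>c x. blinfun_apply f (c *\<^sub>C x) = c *\<^sub>C blinfun_apply f x}"
  morphisms blinfun_of_cblinfun CBlinfun
  by (rule exI[of _ 0]) (simp add: scaleC_simps)

setup_lifting type_definition_cblinfun

lift_definition cblinfun_apply ::
    "('a::complex_normed_vector, 'b::complex_normed_vector) cblinfun \<Rightarrow> 'a \<Rightarrow> 'b"
  is blinfun_apply .

lemma cblinfun_eqI: "(\<And>x. cblinfun_apply f x = cblinfun_apply g x) \<Longrightarrow> f = g"
  by transfer (rule blinfun_eqI)

instantiation cblinfun :: (complex_normed_vector, complex_normed_vector) complex_normed_vector
begin

lift_definition norm_cblinfun :: "('a, 'b) cblinfun \<Rightarrow> real" is norm .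

lift_definition zero_cblinfun :: "('a, 'b) cblinfun" is 0
  by (simp add: scaleC_simps)

lift_definition plus_cblinfun :: "('a, 'b) cblinfun \<Rightarrow> ('a, 'b) cblinfun \<Rightarrow> ('a, 'b) cblinfun" is "(+)"
  by (simp add: blinfun.bilinear_simps scaleC_simps)

lift_definition minus_cblinfun :: "('a, 'b) cblinfun \<Rightarrow> ('a, 'b) cblinfun \<Rightarrow> ('a, 'b) cblinfun" is "(-)"
  by (simp add: blinfun.bilinear_simps scaleC_simps)

lift_definition uminus_cblinfun :: "('a, 'b) cblinfun \<Rightarrow> ('a, 'b) cblinfun" is uminus
  by (simp add: blinfun.bilinear_simps scaleC_simps)

lift_definition scaleR_cblinfun :: "real \<Rightarrow> ('a, 'b) cblinfun \<Rightarrow> ('a, 'b) cblinfun" is scaleR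
  by (simp add: blinfun.bilinear_simps scaleC_simps)

lift_definition scaleC_cblinfun :: "complex \<Rightarrow> ('a, 'b) cblinfun \<Rightarrow> ('a, 'b) cblinfun"
  is "\<lambda>c f. blinfun_compose (Blinfun ((*\<^sub>C) c)) f"
  by (simp add: bounded_linear_Blinfun_apply[OF bounded_linear_scaleC] scaleC_scaleC mult.commute)

definition dist_cblinfun :: "('a, 'b) cblinfun \<Rightarrow> ('a, 'b) cblinfun \<Rightarrow> real"
  where "dist_cblinfun f g = norm (f - g)"

definition uniformity_cblinfun :: "(('a, 'b) cblinfun \<times> ('a, 'b) cblinfun) filter"
  where "uniformity_cblinfun = (INF e\<in>{0<..}. principal {(x, y). dist x y < e})"

definition open_cblinfun :: "('a, 'b) cblinfun set \<Rightarrow> bool"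
  where "open_cblinfun S = (\<forall>x\<in>S. \<forall>\<^sub>F (x', y) in uniformity. x' = x \<longrightarrow> y \<in> S)"

definition sgn_cblinfun :: "('a, 'b) cblinfun \<Rightarrow> ('a, 'b) cblinfun"
  where "sgn_cblinfun f = scaleR (inverse (norm f)) f"

instance
proof
  fix f g h :: "('a, 'b) cblinfun" and c d :: complex and r s :: real
  show "f + g + h = f + (g + h)" "f + g = g + f" "0 + f = f" "- f + f = 0" "f - g = f + - g"
    by (transfer; simp)+
  show "r *\<^sub>R (f + g) = r *\<^sub>R f + r *\<^sub>R g" "(r + s) *\<^sub>R f = r *\<^sub>R f + s *\<^sub>R f"
    "r *\<^sub>R s *\<^sub>R f = (r * s) *\<^sub>R f" "1 *\<^sub>R f = f"
    by (transfer; simp add: algebra_simps)+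
  show "norm f = 0 \<longleftrightarrow> f = 0" "norm (r *\<^sub>R f) = \<bar>r\<bar> * norm f"
    by (transfer; simp)+
  show "norm (f + g) \<le> norm f + norm g"
    by transfer (rule norm_triangle_ineq)
  show "dist f g = norm (f - g)" "sgn f = inverse (norm f) *\<^sub>R f"
    by (simp_all add: dist_cblinfun_def sgn_cblinfun_def)
  show "uniformity = (INF e\<in>{0<..}. principal {(x::('a, 'b) cblinfun, y). dist x y < e})"
    by (rule uniformity_cblinfun_def)
  show "open S = (\<forall>x\<in>S. \<forall>\<^sub>F (x', y) in uniformity. x' = x \<longrightarrow> y \<in> S)"
    for S :: "('a, 'b) cblinfun set"
    by (rule open_cblinfun_def)
  note appl = bounded_linear_Blinfun_apply[OF bounded_linear_scaleC]
  show "c *\<^sub>C (f + g) = c *\<^sub>C f + c *\<^sub>C g" "(c + d) *\<^sub>C f = c *\<^sub>C f + d *\<^sub>C f"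
    "c *\<^sub>C d *\<^sub>C f = (c * d) *\<^sub>C f" "of_real r *\<^sub>C f = r *\<^sub>R f"
    by (transfer; intro blinfun_eqI;
        simp add: appl blinfun.bilinear_simps scaleC_add_right scaleC_add_left scaleC_scaleC
          scaleC_of_real)+
  have le: "norm (c *\<^sub>C f) \<le> cmod c * norm f" for c and f :: "('a, 'b) cblinfun"
    by transfer (auto intro!: norm_blinfun_bound mult_left_mono
        simp: appl norm_scaleC mult.assoc norm_blinfun)
  show "norm (c *\<^sub>C f) = cmod c * norm f"
  proof (cases "c = 0")
    case True
    then show ?thesis using le[of c f]
      by simp (transfer, simp)
  next
    case False
    have "(1::complex) *\<^sub>C f = f"
      by (transfer; intro blinfun_eqI) (use scaleC_of_real[of 1] in \<open>simp add: appl\<close>)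
    moreover have "inverse c *\<^sub>C c *\<^sub>C f = (inverse c * c) *\<^sub>C f"
      by (transfer; intro blinfun_eqI) (simp add: appl scaleC_scaleC)
    ultimately have "norm f \<le> inverse (cmod c) * norm (c *\<^sub>C f)"
      using le[of "inverse c" "c *\<^sub>C f"] False by (simp add: norm_inverse)
    then have "cmod c * norm f \<le> norm (c *\<^sub>C f)"
      using False by (simp add: field_simps)
    then show ?thesis using le[of c f] by simp
  qed
qed

end

lemma cblinfun_apply_simps [simp]:
  "cblinfun_apply 0 x = 0"
  "cblinfun_apply (f + g) x = cblinfun_apply f x + cblinfun_apply g x"
  "cblinfun_apply (f - g) x = cblinfun_apply f x - cblinfun_apply g x"
  "cblinfun_apply (- f) x = - cblinfun_apply f x"
  "cblinfun_apply (r *\<^sub>R f) x = r *\<^sub>R cblinfun_apply f x"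
  "cblinfun_apply (c *\<^sub>C f) x = c *\<^sub>C cblinfun_apply f x"
  by (transfer; simp add: blinfun.bilinear_simps
      bounded_linear_Blinfun_apply[OF bounded_linear_scaleC])+

lemma bounded_linear_cblinfun_apply: "bounded_linear (cblinfun_apply f)"
  by transfer (rule blinfun.bounded_linear_right)

lemma cblinfun_apply_scaleC: "cblinfun_apply f (c *\<^sub>C x) = c *\<^sub>C cblinfun_apply f x"
  by transfer simp

lemma norm_cblinfun: "norm (cblinfun_apply f x) \<le> norm f * norm x"
  by transfer (rule norm_blinfun)

lemma norm_cblinfun_bound:
  "0 \<le> b \<Longrightarrow> (\<And>x. norm (cblinfun_apply f x) \<le> b * norm x) \<Longrightarrow> norm f \<le> b"
  by transfer (rule norm_blinfun_bound)

lemma norm_cblinfun_eq_onorm: "norm f = onorm (cblinfun_apply f)"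
  by transfer (simp add: norm_blinfun.rep_eq)

instance cblinfun :: (complex_normed_vector, complex_banach) complex_banach
proof
  fix F :: "nat \<Rightarrow> ('a, 'b) cblinfun"
  let ?G = "\<lambda>n. blinfun_of_cblinfun (F n)"
  have dist_eq: "dist (blinfun_of_cblinfun f) (blinfun_of_cblinfun g) = dist f g"
    for f g :: "('a, 'b) cblinfun"
    by (simp add: dist_norm norm_cblinfun.rep_eq minus_cblinfun.rep_eq)
  assume "Cauchy F"
  then have "Cauchy ?G"
    by (simp add: Cauchy_def dist_eq)
  then obtain g where g: "?G \<longlonglongrightarrow> g"
    using Cauchy_convergent convergent_def by blast
  have lim: "(\<lambda>n. blinfun_apply (?G n) x) \<longlonglongrightarrow> blinfun_apply g x" for x
    by (intro tendsto_intros g)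
  have "blinfun_apply g (c *\<^sub>C x) = c *\<^sub>C blinfun_apply g x" for c x
  proof (rule LIMSEQ_unique[OF lim])
    have "blinfun_apply (?G n) (c *\<^sub>C x) = c *\<^sub>C blinfun_apply (?G n) x" for n
      using blinfun_of_cblinfun[of "F n"] by simp
    then show "(\<lambda>n. blinfun_apply (?G n) (c *\<^sub>C x)) \<longlonglongrightarrow> c *\<^sub>C blinfun_apply g x"
      using bounded_linear.tendsto[OF bounded_linear_scaleC lim] by simp
  qed
  then have "blinfun_of_cblinfun (CBlinfun g) = g"
    by (simp add: CBlinfun_inverse)
  then have "F \<longlonglongrightarrow> CBlinfun g"
    using g by (simp add: tendsto_iff dist_eq flip: dist_eq)
  then show "convergent F"
    by (rule convergentI)
qed

lift_definition cblinfun_id :: "('a::complex_normed_vector, 'a) cblinfun" is id_blinfun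
  by simp

lift_definition cblinfun_compose ::
    "('b::complex_normed_vector, 'c::complex_normed_vector) cblinfun \<Rightarrow>
     ('a::complex_normed_vector, 'b) cblinfun \<Rightarrow> ('a, 'c) cblinfun"  (infixl \<open>o\<^sub>C\<close> 67)
  is blinfun_compose
  by simp

lemma cblinfun_apply_id [simp]: "cblinfun_apply cblinfun_id x = x"
  by transfer simp

lemma cblinfun_apply_compose [simp]:
  "cblinfun_apply (f o\<^sub>C g) x = cblinfun_apply f (cblinfun_apply g x)"
  by transfer simp

fun cpower :: "('a::complex_normed_vector, 'a) cblinfun \<Rightarrow> nat \<Rightarrow> ('a, 'a) cblinfun" where
  "cpower T 0 = cblinfun_id"
| "cpower T (Suc n) = T o\<^sub>C cpower T n"

text \<open>The (Banach space) adjoint $T^* y = y \circ T$; no complex conjugation is involved.\<close>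

definition cadjoint ::
    "('a::complex_normed_vector, 'b::complex_normed_vector) cblinfun \<Rightarrow>
     (('b, complex) cblinfun, ('a, complex) cblinfun) cblinfun" where
  "cadjoint T = CBlinfun (Blinfun (\<lambda>y. y o\<^sub>C T))"

lemma cadjoint_apply [simp]: "cblinfun_apply (cadjoint T) y = y o\<^sub>C T"
proof -
  have "bounded_linear (\<lambda>y::('b, complex) cblinfun. y o\<^sub>C T)"
  proof (rule bounded_linear_intro[where K = "norm T"])
    fix y :: "('b, complex) cblinfun"
    show "norm (y o\<^sub>C T) \<le> norm y * norm T"
      by transfer (rule norm_blinfun_compose)
  qed (auto intro!: cblinfun_eqI)
  moreover have "(c *\<^sub>C y) o\<^sub>C T = c *\<^sub>C (y o\<^sub>C T)" for c and y :: "('b, complex) cblinfun"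
    by (rule cblinfun_eqI) simp
  ultimately show ?thesis
    by (simp add: cadjoint_def cblinfun_apply.rep_eq CBlinfun_inverse bounded_linear_Blinfun_apply)
qed

definition reflexive_space :: "'a::complex_banach itself \<Rightarrow> bool" where
  "reflexive_space _ \<longleftrightarrow>
     (\<forall>\<phi> :: (('a, complex) cblinfun, complex) cblinfun.
        \<exists>x::'a. \<forall>y. cblinfun_apply \<phi> y = cblinfun_apply y x)"

text \<open>Product of a finite family of pairwise commuting operators.\<close>

definition cprod :: "'i set \<Rightarrow> ('i \<Rightarrow> ('a::complex_normed_vector, 'a) cblinfun) \<Rightarrow> ('a, 'a) cblinfun" where
  "cprod S A = Finite_Set.fold (\<lambda>i B. A i o\<^sub>C B) cblinfun_id S"

lemma cprod_empty [simp]: "cprod {} A = cblinfun_id"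
  by (simp add: cprod_def)

lemma cprod_insert:
  fixes A :: "'i \<Rightarrow> ('a::complex_normed_vector, 'a) cblinfun"
  assumes "finite S" "i \<notin> S"
    and comm: "\<And>j k. j \<in> insert i S \<Longrightarrow> k \<in> insert i S \<Longrightarrow> A j o\<^sub>C A k = A k o\<^sub>C A j"
  shows "cprod (insert i S) A = A i o\<^sub>C cprod S A"
proof -
  have assoc: "f o\<^sub>C (g o\<^sub>C h) = f o\<^sub>C g o\<^sub>C h" for f g h :: "('a, 'a) cblinfun"
    by (rule cblinfun_eqI) simp
  interpret comp_fun_commute_on "insert i S" "\<lambda>i (B :: ('a, 'a) cblinfun). A i o\<^sub>C B"
    by standard (auto simp: fun_eq_iff assoc comm)
  show ?thesis
    unfolding cprod_def using assms(1,2) by (intro fold_insert) auto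
qed


section \<open>The Bochner integral in a general Banach space\<close>

text \<open>The library's Bochner integral assumes a second countable codomain, which $B(X)$ is not.
  The following repeats its definition, with Borel measurability replaced by strong measurability
  (the two agree for separable codomains).\<close>

definition strongly_measurable :: "'m measure \<Rightarrow> ('m \<Rightarrow> 'b::real_normed_vector) \<Rightarrow> bool" where
  "strongly_measurable M f \<longleftrightarrow>
     (\<exists>s. (\<forall>i::nat. simple_function M (s i)) \<and> (\<forall>\<omega>\<in>space M. (\<lambda>i. s i \<omega>) \<longlonglongrightarrow> f \<omega>))"

definition has_strong_integral :: "'m measure \<Rightarrow> ('m \<Rightarrow> 'b::banach) \<Rightarrow> 'b \<Rightarrow> bool" where
  "has_strong_integral M f v \<longleftrightarrow> strongly_measurable M f \<and>
     (\<exists>s. (\<forall>i::nat. Bochner_Integration.simple_bochner_integrable M (s i)) \<and>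
          (\<lambda>i. \<integral>\<^sup>+\<omega>. ennreal (norm (f \<omega> - s i \<omega>)) \<partial>M) \<longlonglongrightarrow> 0 \<and>
          (\<lambda>i. Bochner_Integration.simple_bochner_integral M (s i)) \<longlonglongrightarrow> v)"

definition strong_integral :: "'m measure \<Rightarrow> ('m \<Rightarrow> 'b::banach) \<Rightarrow> 'b" where
  "strong_integral M f = (THE v. has_strong_integral M f v)"


section \<open>Rademacher averages\<close>

text \<open>The probability space $\Omega_0$ is the product of copies, indexed by \<open>I\<close>, of the uniform
  probability on $\{-1, 1\}$, and $r_\iota$ is the coordinate $\omega \mapsto \omega_\iota$.\<close>

definition rad_measure :: "'i set \<Rightarrow> ('i \<Rightarrow> real) measure" where
  "rad_measure I = Pi\<^sub>M I (\<lambda>_. uniform_count_measure {-1, 1})"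

definition rad_sum :: "'i set \<Rightarrow> ('i \<Rightarrow> 'b::real_vector) \<Rightarrow> ('i \<Rightarrow> real) \<Rightarrow> 'b" where
  "rad_sum J u = (\<lambda>\<omega>. \<Sum>\<iota>\<in>J. \<omega> \<iota> *\<^sub>R u \<iota>)"

definition L2_enorm :: "'m measure \<Rightarrow> ('m \<Rightarrow> 'b::real_normed_vector) \<Rightarrow> ennreal" where
  "L2_enorm M f = (let s = \<integral>\<^sup>+\<omega>. ennreal ((norm (f \<omega>))\<^sup>2) \<partial>M
                   in if s = \<infinity> then \<infinity> else ennreal (sqrt (enn2real s)))"

definition rad_enorm :: "'i set \<Rightarrow> (('i \<Rightarrow> real) \<Rightarrow> 'b::real_normed_vector) \<Rightarrow> ennreal" where
  "rad_enorm I = L2_enorm (rad_measure I)"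

text \<open>$\mathrm{Rad}(I;X)$, as a set of representing functions: the closure of the finite sums in
  $L_2(\Omega_0;X)$.\<close>

definition Rad :: "'i set \<Rightarrow> (('i \<Rightarrow> real) \<Rightarrow> 'b::banach) set" where
  "Rad I = {F. strongly_measurable (rad_measure I) F \<and> rad_enorm I F < \<infinity> \<and>
     (\<forall>\<epsilon>>0. \<exists>J u. finite J \<and> J \<subseteq> I \<and> rad_enorm I (\<lambda>\<omega>. F \<omega> - rad_sum J u \<omega>) < ennreal \<epsilon>)}"

definition has_rad_sum :: "'i set \<Rightarrow> ('i \<Rightarrow> 'b::banach) \<Rightarrow> (('i \<Rightarrow> real) \<Rightarrow> 'b) \<Rightarrow> bool" where
  "has_rad_sum I u F \<longleftrightarrow> F \<in> Rad I \<and>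
     ((\<lambda>J. rad_enorm I (\<lambda>\<omega>. F \<omega> - rad_sum J u \<omega>)) \<longlongrightarrow> 0) (finite_subsets_at_top I)"

text \<open>The sum is unique up to null sets, so the choice of \<open>F\<close> does not matter.\<close>

definition rad_series_enorm :: "'i set \<Rightarrow> ('i \<Rightarrow> 'b::banach) \<Rightarrow> ennreal" where
  "rad_series_enorm I u =
     (if \<exists>F. has_rad_sum I u F then rad_enorm I (SOME F. has_rad_sum I u F) else \<infinity>)"

definition R_bounded :: "('a::complex_banach, 'a) cblinfun set \<Rightarrow> bool" where
  "R_bounded E \<longleftrightarrow> (\<exists>C\<ge>0. \<forall>n\<ge>1. \<forall>S x. (\<forall>k\<in>{1..n}. S k \<in> E) \<longrightarrow>
     rad_enorm {1::nat..} (rad_sum {1..n} (\<lambda>k. cblinfun_apply (S k) (x k)))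
       \<le> ennreal C * rad_enorm {1..} (rad_sum {1..n} x))"

definition finite_cotype :: "'a::complex_banach itself \<Rightarrow> bool" where
  "finite_cotype _ \<longleftrightarrow> (\<exists>q\<ge>2. \<exists>C\<ge>0. \<forall>n. \<forall>x :: nat \<Rightarrow> 'a.
     ennreal ((\<Sum>k=1..n. norm (x k) powr q) powr (1 / q))
       \<le> ennreal C * rad_enorm {1..} (rad_sum {1..n} x))"


section \<open>Ritt operators\<close>

definition cinvertible :: "('a::complex_banach, 'a) cblinfun \<Rightarrow> bool" where
  "cinvertible A \<longleftrightarrow> (\<exists>B. A o\<^sub>C B = cblinfun_id \<and> B o\<^sub>C A = cblinfun_id)"

definition spectrum :: "('a::complex_banach, 'a) cblinfun \<Rightarrow> complex set" where
  "spectrum T = {z. \<not> cinvertible (z *\<^sub>C cblinfun_id - T)}"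

definition resolvent :: "complex \<Rightarrow> ('a::complex_banach, 'a) cblinfun \<Rightarrow> ('a, 'a) cblinfun" where
  "resolvent z T = (THE B. (z *\<^sub>C cblinfun_id - T) o\<^sub>C B = cblinfun_id \<and>
                           B o\<^sub>C (z *\<^sub>C cblinfun_id - T) = cblinfun_id)"

definition ritt :: "('a::complex_banach, 'a) cblinfun \<Rightarrow> bool" where
  "ritt T \<longleftrightarrow> (\<exists>C>0. \<forall>n\<ge>1. norm (cpower T n) \<le> C \<and>
                 norm (real n *\<^sub>R (cpower T n - cpower T (n - 1))) \<le> C)"

definition stolz :: "real \<Rightarrow> complex set" where
  "stolz a = interior (convex hull (insert 1 (ball 0 (sin a))))"

definition ritt_of_type :: "real \<Rightarrow> ('a::complex_banach, 'a) cblinfun \<Rightarrow> bool" where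
  "ritt_of_type a T \<longleftrightarrow> 0 < a \<and> a < pi / 2 \<and> ritt T \<and> spectrum T \<subseteq> closure (stolz a) \<and>
     (\<forall>b. a < b \<and> b < pi / 2 \<longrightarrow>
        (\<exists>K>0. \<forall>z. z \<notin> closure (stolz b) \<longrightarrow> norm ((z - 1) *\<^sub>C resolvent z T) \<le> K))"

definition R_ritt :: "('a::complex_banach, 'a) cblinfun \<Rightarrow> bool" where
  "R_ritt T \<longleftrightarrow> ritt T \<and> R_bounded {cpower T n | n. True} \<and>
     R_bounded {real n *\<^sub>R (cpower T n - cpower T (n - 1)) | n. n \<ge> 1}"

definition R_type :: "('a::complex_banach, 'a) cblinfun \<Rightarrow> real" where
  "R_type T = Inf {\<delta>. 0 < \<delta> \<and> \<delta> < pi / 2 \<and> spectrum T \<subseteq> closure (stolz \<delta>) \<and>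
     R_bounded {(z - 1) *\<^sub>C resolvent z T | z. z \<notin> closure (stolz \<delta>)}}"


section \<open>Functional calculus\<close>

text \<open>The boundary of the Stolz domain, run through once counterclockwise from \<open>1\<close> to \<open>1\<close>.  The
  tangents from \<open>1\<close> touch the circle of radius $\sin b$ at $\sin(b)\, e^{\pm i(\pi/2 - b)}$.\<close>

definition stolz_contour :: "real \<Rightarrow> real \<Rightarrow> complex" where
  "stolz_contour b =
     linepath 1 (of_real (sin b) * cis (pi / 2 - b)) +++
     (part_circlepath 0 (sin b) (pi / 2 - b) (3 * pi / 2 + b) +++
      linepath (of_real (sin b) * cis (b - pi / 2)) 1)"

text \<open>The parameter interval of the contours.  The end points are omitted since both correspond to
  the point \<open>1\<close>, where the integrands need not be defined.\<close>

definition unit_measure :: "real measure" where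
  "unit_measure = restrict_space lborel {0<..<1}"

text \<open>An angle for the contour, strictly between some type of the operator and \<open>c\<close>.
  The integrals below do not depend on the choice.\<close>

definition contour_angle :: "real \<Rightarrow> ('a::complex_banach, 'a) cblinfun \<Rightarrow> real" where
  "contour_angle c T = (SOME b. b < c \<and> (\<exists>a. a < b \<and> ritt_of_type a T))"

text \<open>$(I_X - T)^\alpha$\<close>

definition frac_power :: "('a::complex_banach, 'a) cblinfun \<Rightarrow> real \<Rightarrow> ('a, 'a) cblinfun" where
  "frac_power T \<alpha> = (let g = stolz_contour (contour_angle (pi / 2) T) in
     (1 / (2 * pi * \<i>)) *\<^sub>C strong_integral unit_measure
       (\<lambda>t. ((1 - g t) powr of_real \<alpha> * vector_derivative g (at t)) *\<^sub>C resolvent (g t) T))"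

text \<open>Holomorphy in several variables: complex Frechet differentiability at every point.
  The library's \<open>holomorphic_on\<close> covers one variable only.\<close>

definition holomorphic_several :: "(complex ^ 'd \<Rightarrow> complex) \<Rightarrow> (complex ^ 'd) set \<Rightarrow> bool" where
  "holomorphic_several f U \<longleftrightarrow>
     (\<forall>z\<in>U. \<exists>D. (f has_derivative D) (at z) \<and> (\<forall>c v. D (c *s v) = c * D v))"

definition stolz_prod :: "('d \<Rightarrow> real) \<Rightarrow> (complex ^ 'd) set" where
  "stolz_prod \<gamma> = {z. \<forall>i. z $ i \<in> stolz (\<gamma> i)}"

text \<open>For \<open>\<Lambda> = {}\<close> these are the functions that are constant on the product of Stolz domains.
  Values outside that product are irrelevant.\<close>

definition H0 :: "('d::finite \<Rightarrow> real) \<Rightarrow> 'd set \<Rightarrow> (complex ^ 'd \<Rightarrow> complex) set" where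
  "H0 \<gamma> \<Lambda> = {f. holomorphic_several f (stolz_prod \<gamma>) \<and> bounded (f ` stolz_prod \<gamma>) \<and>
     (\<forall>z\<in>stolz_prod \<gamma>. \<forall>w\<in>stolz_prod \<gamma>. (\<forall>i\<in>\<Lambda>. z $ i = w $ i) \<longrightarrow> f z = f w) \<and>
     (\<exists>c>0. \<exists>s. (\<forall>i\<in>\<Lambda>. s i > 0) \<and>
        (\<forall>z\<in>stolz_prod \<gamma>. cmod (f z) \<le> c * (\<Prod>i\<in>\<Lambda>. cmod (1 - z $ i) powr s i)))}"

definition H01_decomposition ::
    "('d::finite \<Rightarrow> real) \<Rightarrow> (complex ^ 'd \<Rightarrow> complex) \<Rightarrow> ('d set \<Rightarrow> complex ^ 'd \<Rightarrow> complex) \<Rightarrow> bool" where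
  "H01_decomposition \<gamma> f g \<longleftrightarrow>
     (\<forall>\<Lambda>. g \<Lambda> \<in> H0 \<gamma> \<Lambda>) \<and> (\<forall>z\<in>stolz_prod \<gamma>. f z = (\<Sum>\<Lambda>\<in>UNIV. g \<Lambda> z))"

definition H01 :: "('d::finite \<Rightarrow> real) \<Rightarrow> (complex ^ 'd \<Rightarrow> complex) set" where
  "H01 \<gamma> = {f. \<exists>g. H01_decomposition \<gamma> f g}"

text \<open>$f(T_1, \ldots, T_d)$ for \<open>f \<in> H0 \<gamma> \<Lambda>\<close>.  The variables outside \<open>\<Lambda>\<close>, on which \<open>f\<close> does not depend,
  are set to \<open>0\<close>, a point of every Stolz domain.\<close>

definition H0_calculus ::
    "('d::finite \<Rightarrow> real) \<Rightarrow> ('d \<Rightarrow> ('a::complex_banach, 'a) cblinfun) \<Rightarrow> 'd set \<Rightarrow>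
     (complex ^ 'd \<Rightarrow> complex) \<Rightarrow> ('a, 'a) cblinfun" where
  "H0_calculus \<gamma> T \<Lambda> f =
     (if \<Lambda> = {} then f 0 *\<^sub>C cblinfun_id
      else let g = \<lambda>i. stolz_contour (contour_angle (\<gamma> i) (T i)) in
        ((1 / (2 * pi * \<i>)) ^ card \<Lambda>) *\<^sub>C
        strong_integral (Pi\<^sub>M \<Lambda> (\<lambda>_. unit_measure))
          (\<lambda>t. (f (\<chi> i. if i \<in> \<Lambda> then g i (t i) else 0) *
                 (\<Prod>i\<in>\<Lambda>. vector_derivative (g i) (at (t i)))) *\<^sub>C
               cprod \<Lambda> (\<lambda>i. resolvent (g i (t i)) (T i))))"

text \<open>Linear extension to the direct sum.  The components of \<open>f\<close> are uniquely determined on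
  \<open>stolz_prod \<gamma>\<close>, so the choice does not matter.\<close>

definition H01_calculus ::
    "('d::finite \<Rightarrow> real) \<Rightarrow> ('d \<Rightarrow> ('a::complex_banach, 'a) cblinfun) \<Rightarrow>
     (complex ^ 'd \<Rightarrow> complex) \<Rightarrow> ('a, 'a) cblinfun" where
  "H01_calculus \<gamma> T f =
     (let g = (SOME g. H01_decomposition \<gamma> f g) in \<Sum>\<Lambda>\<in>UNIV. H0_calculus \<gamma> T \<Lambda> (g \<Lambda>))"

definition admits_joint_calculus ::
    "('d::finite \<Rightarrow> real) \<Rightarrow> ('d \<Rightarrow> ('a::complex_banach, 'a) cblinfun) \<Rightarrow> bool" where
  "admits_joint_calculus \<gamma> T \<longleftrightarrow>
     (\<forall>k. \<exists>a<\<gamma> k. ritt_of_type a (T k)) \<and>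
     (\<exists>K>0. \<forall>f\<in>H01 \<gamma>. norm (H01_calculus \<gamma> T f) \<le> K * (SUP z\<in>stolz_prod \<gamma>. cmod (f z)))"


section \<open>Square functions\<close>

definition square_family ::
    "('d \<Rightarrow> ('a::complex_banach, 'a) cblinfun) \<Rightarrow> 'd set \<Rightarrow> ('d \<Rightarrow> real) \<Rightarrow> 'a \<Rightarrow> ('d \<Rightarrow> nat) \<Rightarrow> 'a" where
  "square_family T \<Lambda> \<alpha> x k =
     cblinfun_apply
       (cprod \<Lambda> (\<lambda>i. real (k i) powr (\<alpha> i - 1 / 2) *\<^sub>R (cpower (T i) (k i - 1) o\<^sub>C frac_power (T i) (\<alpha> i)))) x"

text \<open>$\|x\|_{T,\alpha_\Lambda}$; the values of \<open>\<alpha>\<close> outside \<open>\<Lambda>\<close> are not used.\<close>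

definition square_enorm ::
    "('d \<Rightarrow> ('a::complex_banach, 'a) cblinfun) \<Rightarrow> 'd set \<Rightarrow> ('d \<Rightarrow> real) \<Rightarrow> 'a \<Rightarrow> ennreal" where
  "square_enorm T \<Lambda> \<alpha> x = rad_series_enorm (\<Lambda> \<rightarrow>\<^sub>E {1..}) (square_family T \<Lambda> \<alpha> x)"

end

theory Submission imports Defs "HOL-Probability.Infinite_Product_Measure" "HOL-Real_Asymp.Real_Asymp"
begin

text \<open>
  A function \<open>f\<close> of the calculus is a sum of components, one for every set \<open>\<Lambda>\<close> of variables on which
  it may depend.  Letting the variables outside \<open>\<Lambda>\<close> tend to \<open>1\<close> shows that the supremum of
  each component is at most a constant times the supremum of \<open>f\<close> (\<open>decomposition_bound\<close>).  It
  therefore suffices to bound $f(T)$ for \<open>f \<in> H0 \<gamma> \<Lambda>\<close> with \<open>\<Lambda>\<close> fixed (\<open>H0_calculus_bound\<close>).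

  The square functions enter through a partition of unity.  In one variable,
  $1 = (1 - z)^p \sum_n c_n z^n$ for $p = \alpha + \beta + 2$ and binomial coefficients $c_n$ of
  size $n^{p-1}$, and grouping the terms in threes gives $1 = \sum_k u_k(z)\, z^{2(k-1)} (1-z)^{\alpha+\beta}$
  with $u_k$ of size $k^{p-1} |z|^{k-1} |1-z|^2$.  This is inserted in every variable of
  the contour integral that defines $f(T)$.  By power series expansion, the scalar factors
  $z^{2(k-1)} (1-z)^{\alpha+\beta}$ may be replaced by the operators
  $T^{k-1} (I-T)^\beta \cdot T^{k-1} (I-T)^\alpha$; this is done under the integral, one
  variable at a time (\<open>exchange_one_variable\<close>, \<open>contour_exchange\<close>), and allows the contour to be moved to
  an angle above the R-type.

  Paired with a vector \<open>x\<close> and a functional \<open>y\<close>, the integral with index \<open>k\<close> now contains a product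
  of the operators $(z_i - 1) R(z_i, T_i)$ between the \<open>k\<close>-th members $x_k$ and
  $y_k$ of the square function families of \<open>x\<close> and of \<open>y\<close>.  These products form an R-bounded
  set, and $\sum_k |\langle y_k, W_k x_k\rangle|$ is at most a constant times the product of the two
  Rademacher norms whenever the $W_k$ belong to an R-bounded set (\<open>R_bound_pairing\<close>).  The scalar weights that
  remain are $k^{1-\alpha-\beta} |u_k(z)| / |1 - z|$ in each variable; on the contour they are of size
  $k e^{-ckd}$ with $d = |1 - z|$, so their integrals are bounded uniformly in \<open>k\<close>
  (\<open>unity_weight_integral\<close>).  Summation over \<open>k\<close> gives the estimate by $\sup |f|\, \|x\|\, \|y\|$.

  The supporting facts are: R-Ritt operators have R-bounded sets $(z - 1) R(z, T)$ outside a Stolz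
  domain of any angle above the R-type (\<open>R_ritt_sectorial\<close>, \<open>R_type_less\<close>); the fractional powers are given by binomial
  series (\<open>frac_power_eq_frac_sum\<close>), so that they commute with every operator that commutes with \<open>T\<close> and pass to adjoints; and
  the resolvent has a singularity at the point \<open>1\<close> of the contour, which is dealt with by replacing \<open>T\<close> by
  \<open>r T\<close> and letting \<open>r\<close> tend to \<open>1\<close> from below.
\<close>


section \<open>Bounded complex-linear operators\<close>

lemma cblinfun_compose_assoc: "f o\<^sub>C (g o\<^sub>C h) = (f o\<^sub>C g) o\<^sub>C h" by (rule cblinfun_eqI) simp

lemma norm_cblinfun_compose: "norm (f o\<^sub>C g) \<le> norm f * norm g"
proof (rule norm_cblinfun_bound)
  fix x
  have "norm (cblinfun_apply f (cblinfun_apply g x)) \<le> norm f * norm (cblinfun_apply g x)"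
    by (rule norm_cblinfun)
  also have "\<dots> \<le> norm f * (norm g * norm x)" by (intro mult_left_mono norm_cblinfun) auto
  finally show "norm (cblinfun_apply (f o\<^sub>C g) x) \<le> norm f * norm g * norm x" by (simp add: mult.assoc)
qed auto

lemma cblinfun_apply_scaleR: "cblinfun_apply f (r *\<^sub>R x) = r *\<^sub>R cblinfun_apply f x"
  by (simp add: linear_scale[OF bounded_linear.linear[OF bounded_linear_cblinfun_apply]])

lemma cblinfun_apply_linear [simp]:
  "cblinfun_apply f (x + y) = cblinfun_apply f x + cblinfun_apply f y"
  "cblinfun_apply f (x - y) = cblinfun_apply f x - cblinfun_apply f y"
  "cblinfun_apply f (- x) = - cblinfun_apply f x"
  "cblinfun_apply f 0 = 0"
proof -
  note lin = bounded_linear.linear[OF bounded_linear_cblinfun_apply, of f]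
  show "cblinfun_apply f (x + y) = cblinfun_apply f x + cblinfun_apply f y"
    "cblinfun_apply f (x - y) = cblinfun_apply f x - cblinfun_apply f y"
    "cblinfun_apply f (- x) = - cblinfun_apply f x"
    "cblinfun_apply f 0 = 0"
    by (rule linear_add[OF lin] linear_diff[OF lin] linear_neg[OF lin] linear_0[OF lin])+
qed

interpretation compose_bilinear: bounded_bilinear
  "\<lambda>(f :: ('b::complex_normed_vector, 'c::complex_normed_vector) cblinfun)
    (g :: ('a::complex_normed_vector, 'b) cblinfun). f o\<^sub>C g"
proof (standard, goal_cases)
  case 5
  show ?case by (intro exI[of _ 1] allI) (simp add: norm_cblinfun_compose)
qed (auto intro!: cblinfun_eqI simp: cblinfun_apply_scaleR)

interpretation apply_bilinear: bounded_bilinear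
  "cblinfun_apply :: ('a::complex_normed_vector, 'b::complex_normed_vector) cblinfun \<Rightarrow> _"
proof (standard, goal_cases)
  case 5
  show ?case by (intro exI[of _ 1] allI) (simp add: norm_cblinfun)
qed (auto simp: cblinfun_apply_scaleR)

lemma compose_scaleC_left: "(c *\<^sub>C f) o\<^sub>C g = c *\<^sub>C (f o\<^sub>C g)" by (rule cblinfun_eqI) simp

lemma compose_scaleC_right: "f o\<^sub>C (c *\<^sub>C g) = c *\<^sub>C (f o\<^sub>C g)"
  by (rule cblinfun_eqI) (simp add: cblinfun_apply_scaleC)

lemma compose_id [simp]: "f o\<^sub>C cblinfun_id = f" "cblinfun_id o\<^sub>C f = f" by (rule cblinfun_eqI; simp)+

lemma scaleC_one [simp]: "(1::complex) *\<^sub>C (x::'a::complex_normed_vector) = x"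
  using scaleC_of_real[of 1 x] by simp

lemma scaleC_zero_left [simp]: "(0::complex) *\<^sub>C (x::'a::complex_normed_vector) = 0"
  using scaleC_of_real[of 0 x] by simp

lemma scaleC_minus_left: "(- c) *\<^sub>C (x::'a::complex_normed_vector) = - (c *\<^sub>C x)"
proof -
  have "(- c) *\<^sub>C x + c *\<^sub>C x = 0" by (simp flip: scaleC_add_left)
  then show ?thesis by (rule minus_unique[symmetric, OF trans[OF add.commute]])
qed

lemma scaleC_diff_left: "(c - d) *\<^sub>C (x::'a::complex_normed_vector) = c *\<^sub>C x - d *\<^sub>C x"
  using scaleC_add_left[of c "- d" x] by (simp add: scaleC_minus_left)

lemma bounded_bilinear_scaleC:
  "bounded_bilinear (\<lambda>(c::complex) (x::'a::complex_normed_vector). c *\<^sub>C x)"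
proof (standard, goal_cases)
  case (1 a a' b)
  show ?case by (rule scaleC_add_left)
next
  case (2 a b b')
  show ?case by (rule scaleC_add_right)
next
  case (3 r a b)
  show ?case by (simp add: scaleR_conv_of_real scaleC_of_real flip: scaleC_scaleC)
next
  case (4 a r b)
  show ?case by (simp add: scaleC_simps)
next
  case 5
  show ?case by (intro exI[of _ 1] allI) (simp add: norm_scaleC)
qed

lemmas tendsto_scaleC = bounded_bilinear.tendsto[OF bounded_bilinear_scaleC]

lemma scaleC_complex [simp]: "c *\<^sub>C (z::complex) = c * z" by (simp add: scaleC_complex_def)

lemma cpower_add: "cpower T (m + n) = cpower T m o\<^sub>C cpower T n"
  by (induction m) (simp_all add: cblinfun_compose_assoc)

lemma cpower_Suc_right: "cpower T (Suc n) = cpower T n o\<^sub>C T" using cpower_add[of T n 1] by simp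

lemma cpower_commute:
  assumes "S o\<^sub>C T = T o\<^sub>C S"
  shows "S o\<^sub>C cpower T n = cpower T n o\<^sub>C S"
proof (induction n)
  case (Suc n)
  have "S o\<^sub>C cpower T (Suc n) = (S o\<^sub>C T) o\<^sub>C cpower T n" by (simp add: cblinfun_compose_assoc)
  also have "\<dots> = T o\<^sub>C (S o\<^sub>C cpower T n)" by (simp add: assms cblinfun_compose_assoc)
  finally show ?case by (simp add: Suc cblinfun_compose_assoc)
qed simp

lemma norm_cadjoint: "norm (cadjoint A) \<le> norm A"
  by (rule norm_cblinfun_bound) (simp_all add: norm_cblinfun_compose mult.commute)

lemma cadjoint_compose: "cadjoint (A o\<^sub>C B) = cadjoint B o\<^sub>C cadjoint A"
  by (rule cblinfun_eqI) (simp add: cblinfun_compose_assoc)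

lemma cadjoint_linear:
  "cadjoint cblinfun_id = cblinfun_id"
  "cadjoint (A - B) = cadjoint A - cadjoint B"
  "cadjoint (r *\<^sub>R A) = r *\<^sub>R cadjoint A"
  "cadjoint (c *\<^sub>C A) = c *\<^sub>C cadjoint A"
  by (auto intro!: cblinfun_eqI simp: cblinfun_apply_scaleR cblinfun_apply_scaleC)

lemma cadjoint_cpower: "cadjoint (cpower T n) = cpower (cadjoint T) n"
proof (induction n)
  case (Suc n)
  then show ?case by (metis cadjoint_compose cpower.simps(2) cpower_Suc_right)
qed (simp add: cadjoint_linear)

text \<open>Products of commuting families inherit commutation, products and scalars factor by factor.\<close>

lemma cprod_commute:
  fixes A :: "'i \<Rightarrow> ('a::complex_normed_vector, 'a) cblinfun"
  assumes "finite S"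
    and "\<And>j k. j \<in> S \<Longrightarrow> k \<in> S \<Longrightarrow> A j o\<^sub>C A k = A k o\<^sub>C A j"
    and "\<And>j. j \<in> S \<Longrightarrow> B o\<^sub>C A j = A j o\<^sub>C B"
  shows "B o\<^sub>C cprod S A = cprod S A o\<^sub>C B" using assms
proof (induction S rule: finite_induct)
  case (insert i S)
  have *: "B o\<^sub>C cprod S A = cprod S A o\<^sub>C B" using insert by auto
  have "B o\<^sub>C cprod (insert i S) A = (B o\<^sub>C A i) o\<^sub>C cprod S A"
    by (subst cprod_insert) (use insert in \<open>auto simp: cblinfun_compose_assoc\<close>)
  also have "\<dots> = A i o\<^sub>C (B o\<^sub>C cprod S A)" using insert.prems by (simp add: cblinfun_compose_assoc)
  also have "\<dots> = cprod (insert i S) A o\<^sub>C B"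
    by (subst cprod_insert) (use insert * in \<open>auto simp: cblinfun_compose_assoc\<close>)
  finally show ?case .
qed simp

lemma cprod_compose:
  fixes A B :: "'i \<Rightarrow> ('a::complex_normed_vector, 'a) cblinfun"
  assumes "finite S"
    and "\<And>j k. j \<in> S \<Longrightarrow> k \<in> S \<Longrightarrow> A j o\<^sub>C A k = A k o\<^sub>C A j"
    and "\<And>j k. j \<in> S \<Longrightarrow> k \<in> S \<Longrightarrow> B j o\<^sub>C B k = B k o\<^sub>C B j"
    and "\<And>j k. j \<in> S \<Longrightarrow> k \<in> S \<Longrightarrow> A j o\<^sub>C B k = B k o\<^sub>C A j"
  shows "cprod S (\<lambda>i. A i o\<^sub>C B i) = cprod S A o\<^sub>C cprod S B" using assms
proof (induction S rule: finite_induct)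
  case (insert i S)
  have AB: "(A j o\<^sub>C B j) o\<^sub>C (A k o\<^sub>C B k) = (A k o\<^sub>C B k) o\<^sub>C (A j o\<^sub>C B j)"
    if "j \<in> insert i S" "k \<in> insert i S" for j k
    using insert.prems(1,2)[OF that] insert.prems(3)[OF that] insert.prems(3)[OF that(2,1)]
    by (metis cblinfun_compose_assoc)
  have c: "B i o\<^sub>C cprod S A = cprod S A o\<^sub>C B i" using insert by (intro cprod_commute) auto
  have "cprod (insert i S) (\<lambda>i. A i o\<^sub>C B i) = A i o\<^sub>C B i o\<^sub>C (cprod S A o\<^sub>C cprod S B)"
    by (subst cprod_insert) (use insert AB in auto)
  also have "\<dots> = A i o\<^sub>C (B i o\<^sub>C cprod S A) o\<^sub>C cprod S B" by (simp add: cblinfun_compose_assoc)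
  also have "\<dots> = (A i o\<^sub>C cprod S A) o\<^sub>C (B i o\<^sub>C cprod S B)" by (simp add: c cblinfun_compose_assoc)
  also have "\<dots> = cprod (insert i S) A o\<^sub>C cprod (insert i S) B" using insert by (subst (1 2) cprod_insert) auto
  finally show ?case .
qed simp

lemma cprod_scaleC:
  fixes A :: "'i \<Rightarrow> ('a::complex_normed_vector, 'a) cblinfun"
  assumes "finite S"
    and "\<And>j k. j \<in> S \<Longrightarrow> k \<in> S \<Longrightarrow> A j o\<^sub>C A k = A k o\<^sub>C A j"
  shows "cprod S (\<lambda>i. c i *\<^sub>C A i) = (\<Prod>i\<in>S. c i) *\<^sub>C cprod S A" using assms
proof (induction S rule: finite_induct)
  case (insert i S)
  have "cprod (insert i S) (\<lambda>i. c i *\<^sub>C A i) = (c i *\<^sub>C A i) o\<^sub>C cprod S (\<lambda>i. c i *\<^sub>C A i)"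
  proof (rule cprod_insert)
    fix j k assume "j \<in> insert i S" "k \<in> insert i S"
    then have "A j o\<^sub>C A k = A k o\<^sub>C A j" by (rule insert.prems)
    then show "(c j *\<^sub>C A j) o\<^sub>C (c k *\<^sub>C A k) = (c k *\<^sub>C A k) o\<^sub>C (c j *\<^sub>C A j)"
      by (simp add: compose_scaleC_left compose_scaleC_right scaleC_scaleC mult.commute)
  qed (use insert in auto)
  also have "\<dots> = (c i *\<^sub>C A i) o\<^sub>C ((\<Prod>i\<in>S. c i) *\<^sub>C cprod S A)" using insert by auto
  also have "\<dots> = (\<Prod>i\<in>insert i S. c i) *\<^sub>C (A i o\<^sub>C cprod S A)"
    using insert by (simp add: compose_scaleC_left compose_scaleC_right scaleC_scaleC mult.commute)
  also have "A i o\<^sub>C cprod S A = cprod (insert i S) A" by (rule cprod_insert[symmetric]) (use insert in auto)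
  finally show ?case .
qed simp

lemma cprod_cong: "(\<And>i. i \<in> S \<Longrightarrow> A i = B i) \<Longrightarrow> cprod S A = cprod S B"
  unfolding cprod_def by (rule Finite_Set.fold_closed_eq[where B = UNIV]) auto

lemma cprod_cadjoint:
  fixes A :: "'i \<Rightarrow> ('a::complex_normed_vector, 'a) cblinfun"
  assumes "finite S"
    and "\<And>j k. j \<in> S \<Longrightarrow> k \<in> S \<Longrightarrow> A j o\<^sub>C A k = A k o\<^sub>C A j"
  shows "cprod S (\<lambda>i. cadjoint (A i)) = cadjoint (cprod S A)" using assms
proof (induction S rule: finite_induct)
  case (insert i S)
  have "cprod (insert i S) (\<lambda>i. cadjoint (A i)) = cadjoint (A i) o\<^sub>C cprod S (\<lambda>i. cadjoint (A i))"
    by (rule cprod_insert) (use insert in \<open>auto simp flip: cadjoint_compose\<close>)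
  also have "\<dots> = cadjoint (cprod S A o\<^sub>C A i)" using insert by (simp add: cadjoint_compose)
  also have "cprod S A o\<^sub>C A i = A i o\<^sub>C cprod S A" by (rule cprod_commute[symmetric]) (use insert in auto)
  also have "\<dots> = cprod (insert i S) A" by (rule cprod_insert[symmetric]) (use insert in auto)
  finally show ?case .
qed (simp add: cadjoint_linear)

lemma norm_cprod_le:
  fixes A :: "'i \<Rightarrow> ('a::complex_normed_vector, 'a) cblinfun"
  assumes "finite S"
    and "\<And>j k. j \<in> S \<Longrightarrow> k \<in> S \<Longrightarrow> A j o\<^sub>C A k = A k o\<^sub>C A j"
  shows "norm (cprod S A) \<le> (\<Prod>i\<in>S. norm (A i))" using assms
proof (induction S rule: finite_induct)
  case empty
  show ?case by (simp add: norm_cblinfun_bound)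
next
  case (insert i S)
  have "norm (cprod (insert i S) A) \<le> norm (A i) * norm (cprod S A)"
    by (subst cprod_insert) (use insert in \<open>auto intro: norm_cblinfun_compose\<close>)
  also have "\<dots> \<le> norm (A i) * (\<Prod>i\<in>S. norm (A i))" using insert by (intro mult_left_mono) auto
  finally show ?case using insert by simp
qed


section \<open>Norming functionals\<close>

definition sublinear :: "('a::real_vector \<Rightarrow> real) \<Rightarrow> bool" where
  "sublinear p \<longleftrightarrow> (\<forall>x y. p (x + y) \<le> p x + p y) \<and> (\<forall>r>0. \<forall>x. p (r *\<^sub>R x) = r * p x)"

lemma sublinear_zero: "sublinear p \<Longrightarrow> p 0 = 0"
  unfolding sublinear_def by (metis mult_cancel_right2 scaleR_zero_right one_add_one
      zero_less_numeral numeral_One numeral_eq_iff semiring_norm(85))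

lemma sublinear_minus: "sublinear p \<Longrightarrow> - p (- x) \<le> p x" using sublinear_zero[of p] unfolding sublinear_def
  by (metis add.right_inverse le_minus_iff minus_le_iff neg_le_iff_le add.inverse_inverse
      diff_ge_0_iff_ge diff_minus_eq_add)

text \<open>Subtracting from \<open>p\<close> as much as possible along the direction \<open>x\<close> keeps it sublinear.  This
  is the step that makes a minimal sublinear functional additive.\<close>

lemma sublinear_lower:
  fixes p :: "'a::real_vector \<Rightarrow> real" and x :: 'a
  assumes p: "sublinear p"
  assumes q_def: "\<And>v. q v = (INF t\<in>{0..}. p (v + t *\<^sub>R x) - t * p x)"
  shows "sublinear q" "q v \<le> p v" "q (v - x) \<le> p v - p x"
proof -
  have add: "p (u + w) \<le> p u + p w" for u w using p by (simp add: sublinear_def)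
  have hom: "p (r *\<^sub>R u) = r * p u" if "r > 0" for r u using p that by (simp add: sublinear_def)
  have hom0: "p (r *\<^sub>R u) = r * p u" if "r \<ge> 0" for r u
    using that hom[of r u] sublinear_zero[OF p] by (cases "r = 0") auto
  have lb: "- p (- v) \<le> p (v + t *\<^sub>R x) - t * p x" if "t \<ge> 0" for t v
    using add[of "v + t *\<^sub>R x" "- v"] hom0[OF that, of x] by simp
  have bdd: "bdd_below ((\<lambda>t. p (v + t *\<^sub>R x) - t * p x) ` {0..})" for v
    using lb by (intro bdd_belowI[of _ "- p (- v)"]) auto
  have le: "q v \<le> p (v + t *\<^sub>R x) - t * p x" if "t \<ge> 0" for t v
    unfolding q_def using that by (intro cINF_lower bdd) auto
  show "q v \<le> p v" using le[of 0 v] by simp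
  show "q (v - x) \<le> p v - p x" using le[of 1 "v - x"] by simp
  have "q (u + v) \<le> q u + q v" for u v
  proof -
    have "q (u + v) - q v \<le> q u" unfolding q_def[of u]
    proof (rule cINF_greatest)
      fix s :: real assume s: "s \<in> {0..}"
      have "q (u + v) - (p (u + s *\<^sub>R x) - s * p x) \<le> q v" unfolding q_def[of v]
      proof (rule cINF_greatest)
        fix t :: real assume t: "t \<in> {0..}"
        have "q (u + v) \<le> p (u + v + (s + t) *\<^sub>R x) - (s + t) * p x" using s t by (intro le) auto
        also have "p (u + v + (s + t) *\<^sub>R x) \<le> p (u + s *\<^sub>R x) + p (v + t *\<^sub>R x)"
          using add[of "u + s *\<^sub>R x" "v + t *\<^sub>R x"] by (simp add: algebra_simps)
        finally show "q (u + v) - (p (u + s *\<^sub>R x) - s * p x) \<le> p (v + t *\<^sub>R x) - t * p x"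
          by (simp add: algebra_simps)
      qed auto
      then show "q (u + v) - q v \<le> p (u + s *\<^sub>R x) - s * p x" by simp
    qed auto
    then show ?thesis by simp
  qed
  moreover have "q (r *\<^sub>R v) = r * q v" if r: "r > 0" for r v
  proof -
    have ge: "r * q v \<le> q (r *\<^sub>R v)" if r: "r > 0" for r v unfolding q_def[of "r *\<^sub>R v"]
    proof (rule cINF_greatest)
      fix t :: real assume "t \<in> {0..}"
      then have "r * q v \<le> r * (p (v + (t / r) *\<^sub>R x) - t / r * p x)" using r by (intro mult_left_mono le) auto
      also have "\<dots> = p (r *\<^sub>R v + t *\<^sub>R x) - t * p x"
        using hom[OF r, of "v + (t / r) *\<^sub>R x"] r by (simp add: algebra_simps)
      finally show "r * q v \<le> p (r *\<^sub>R v + t *\<^sub>R x) - t * p x" .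
    qed auto
    have "inverse r * q (r *\<^sub>R v) \<le> q v" using ge[of "inverse r" "r *\<^sub>R v"] r by simp
    then show ?thesis using ge[OF r, of v] r by (simp add: field_simps)
  qed
  ultimately show "sublinear q" by (auto simp: sublinear_def)
qed

lemma minimal_sublinear:
  fixes q :: "'a::real_vector \<Rightarrow> real"
  assumes q: "sublinear q"
  obtains p where "sublinear p" "p \<le> q" "\<And>p'. sublinear p' \<Longrightarrow> p' \<le> p \<Longrightarrow> p' = p"
proof -
  let ?A = "{p. sublinear p \<and> p \<le> q}"
  have "\<exists>m\<in>?A. \<forall>a\<in>?A. m \<ge> a \<longrightarrow> a = m"
  proof (rule predicate_Zorn)
    show "partial_order_on ?A (relation_of (\<lambda>x y. x \<ge> y) ?A)" by (rule partial_order_on_relation_ofI) auto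
    fix C assume "C \<in> Chains (relation_of (\<lambda>x y. x \<ge> y) ?A)"
    then have CA: "C \<subseteq> ?A" and chain: "\<And>a b. a \<in> C \<Longrightarrow> b \<in> C \<Longrightarrow> a \<le> b \<or> b \<le> a"
      by (auto simp: Chains_def relation_of_def)
    show "\<exists>u\<in>?A. \<forall>a\<in>C. a \<ge> u"
    proof (cases "C = {}")
      case True
      then show ?thesis using q by auto
    next
      case False
      define u where "u x = (INF p\<in>C. p x)" for x
      have lb: "- q (- x) \<le> p x" if "p \<in> C" for p x
      proof -
        have "- q (- x) \<le> - p (- x)" using CA that by (auto simp: le_fun_def)
        also have "\<dots> \<le> p x" using CA that by (intro sublinear_minus) auto
        finally show ?thesis .
      qed
      then have bdd: "bdd_below ((\<lambda>p. p x) ` C)" for x by (intro bdd_belowI[of _ "- q (- x)"]) auto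
      have le: "u x \<le> p x" if "p \<in> C" for p x unfolding u_def by (intro cINF_lower bdd that)
      have ex: "\<exists>p\<in>C. p x < u x + e" if "e > 0" for x e
        using cINF_less_iff[OF False bdd, of x "u x + e"] that by (simp add: u_def)
      have "u (x + y) \<le> u x + u y" for x y
      proof (rule field_le_epsilon)
        fix e :: real assume e: "e > 0"
        obtain p p' where p: "p \<in> C" "p x < u x + e / 2" "p' \<in> C" "p' y < u y + e / 2"
          using ex[of "e / 2"] e by (metis half_gt_zero)
        obtain r where r: "r \<in> C" "r \<le> p" "r \<le> p'" using chain[OF p(1,3)] p by auto
        have "u (x + y) \<le> r (x + y)" by (rule le[OF r(1)])
        also have "\<dots> \<le> r x + r y" using CA r(1) by (auto simp: sublinear_def)
        also have "\<dots> \<le> p x + p' y" using r by (intro add_mono) (auto simp: le_fun_def)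
        finally show "u (x + y) \<le> u x + u y + e" using p by simp
      qed
      moreover have "u (r *\<^sub>R x) = r * u x" if r: "r > 0" for r x
      proof -
        have ge: "r * u x \<le> u (r *\<^sub>R x)" if r: "r > 0" for r x unfolding u_def[of "r *\<^sub>R x"]
        proof (rule cINF_greatest[OF False])
          fix p assume p: "p \<in> C"
          then have "r * u x \<le> r * p x" using r by (intro mult_left_mono le) auto
          also have "\<dots> = p (r *\<^sub>R x)" using CA p r by (auto simp: sublinear_def)
          finally show "r * u x \<le> p (r *\<^sub>R x)" .
        qed
        have "inverse r * u (r *\<^sub>R x) \<le> u x" using ge[of "inverse r" "r *\<^sub>R x"] r by simp
        then show ?thesis using ge[OF r, of x] r by (simp add: field_simps)
      qed
      ultimately have "sublinear u" by (auto simp: sublinear_def)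
      moreover have "u \<le> q"
      proof -
        obtain p where p: "p \<in> C" using False by auto
        then have "u x \<le> q x" for x using le[OF p, of x] CA by (auto simp: le_fun_def intro: order_trans)
        then show ?thesis by (simp add: le_fun_def)
      qed
      ultimately show ?thesis using le by (auto simp: le_fun_def)
    qed
  qed
  then show ?thesis using that by fastforce
qed

lemma minimal_sublinear_linear:
  assumes p: "sublinear p" and min: "\<And>p'. sublinear p' \<Longrightarrow> p' \<le> p \<Longrightarrow> p' = p"
  shows "linear p"
proof -
  have ge: "p u + p x \<le> p (u + x)" for u x
  proof -
    define q where "q v = (INF t\<in>{0..}. p (v + t *\<^sub>R x) - t * p x)" for v
    note lower = sublinear_lower[OF p q_def]
    have "q = p" using lower by (intro min) (auto simp: le_fun_def)
    then show ?thesis using lower(3)[of "u + x"] by simp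
  qed
  have add: "p (u + x) = p u + p x" for u x using ge[of u x] p by (auto simp: sublinear_def intro: antisym)
  have neg: "p (- x) = - p x" for x using add[of x "- x"] sublinear_zero[OF p] by simp
  have "p (r *\<^sub>R x) = r * p x" for r x
  proof (cases r "0 :: real" rule: linorder_cases)
    case less
    then have "p ((- r) *\<^sub>R x) = (- r) * p x" using p unfolding sublinear_def by (metis neg_0_less_iff_less)
    then show ?thesis using neg[of "r *\<^sub>R x"] by simp
  qed (use p sublinear_zero[OF p] in \<open>auto simp: sublinear_def\<close>)
  then show ?thesis by (intro linearI) (simp_all add: add)
qed

text \<open>The Hahn-Banach theorem in the form that is needed here.  A minimal sublinear functional below
  the norm that takes the value \<open>- norm x\<close> at \<open>- x\<close> is real-linear; it is the real part
  of the complex functional.\<close>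

theorem ex_norming_functional:
  fixes x :: "'a::complex_normed_vector"
  obtains y :: "('a, complex) cblinfun" where "norm y \<le> 1" "norm x \<le> norm (cblinfun_apply y x)"
proof -
  have "sublinear (norm :: 'a \<Rightarrow> real)" by (auto simp: sublinear_def norm_triangle_ineq)
  moreover define q where "q v = (INF t\<in>{0..}. norm (v + t *\<^sub>R x) - t * norm x)" for v
  ultimately have lower: "sublinear q" "q v \<le> norm v" "q (v - x) \<le> norm v - norm x" for v
    by (rule sublinear_lower)+
  obtain p where p: "sublinear p" "p \<le> q" "\<And>p'. sublinear p' \<Longrightarrow> p' \<le> p \<Longrightarrow> p' = p"
    using minimal_sublinear[OF lower(1)] by blast
  have lin: "linear p" using p(1,3) by (rule minimal_sublinear_linear)
  have pn: "p v \<le> norm v" for v using p(2) lower(2)[of v] by (auto simp: le_fun_def intro: order_trans)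
  have "p (0 - x) \<le> norm (0::'a) - norm x"
    using p(2) lower(3)[of 0] by (auto simp: le_fun_def intro: order_trans)
  then have px: "norm x \<le> p x" using linear_neg[OF lin, of x] by simp
  define f where "f v = Complex (p v) (- p (\<i> *\<^sub>C v))" for v
  have fadd: "f (u + v) = f u + f v" for u v
    by (simp add: f_def scaleC_add_right linear_add[OF lin] complex_eq_iff)
  have freal: "f (r *\<^sub>R v) = r *\<^sub>R f v" for r v
    by (simp add: f_def scaleC_simps linear_scale[OF lin] complex_eq_iff)
  have fi: "f (\<i> *\<^sub>C v) = \<i> * f v" for v
    by (simp add: f_def scaleC_scaleC scaleC_minus_left linear_neg[OF lin] complex_eq_iff)
  have fc: "f (c *\<^sub>C v) = c * f v" for c v
  proof -
    have "Re c *\<^sub>R v + Im c *\<^sub>R (\<i> *\<^sub>C v) = (of_real (Re c) + of_real (Im c) * \<i>) *\<^sub>C v"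
      by (simp only: scaleC_add_left scaleC_of_real scaleC_scaleC[symmetric])
    also have "of_real (Re c) + of_real (Im c) * \<i> = c" by (simp add: complex_eq_iff)
    finally have "c *\<^sub>C v = Re c *\<^sub>R v + Im c *\<^sub>R (\<i> *\<^sub>C v)" by simp
    then show ?thesis by (simp add: fadd freal fi complex_eq_iff)
  qed
  have bound: "cmod (f v) \<le> norm v" for v
  proof (cases "f v = 0")
    case False
    define c where "c = cnj (sgn (f v))"
    have c: "c * f v = of_real (cmod (f v))" by (simp add: c_def sgn_eq mult.commute flip: complex_norm_square)
         (simp add: complex_norm_square[symmetric] power2_eq_square)
    have "cmod (f v) = Re (f (c *\<^sub>C v))" by (simp add: fc c)
    also have "\<dots> \<le> norm (c *\<^sub>C v)" by (simp add: f_def pn)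
    also have "\<dots> = norm v" using False by (simp add: norm_scaleC c_def norm_sgn)
    finally show ?thesis .
  qed simp
  have bl: "bounded_linear f" by (rule bounded_linear_intro[where K = 1]) (auto simp: fadd freal bound)
  define y where "y = CBlinfun (Blinfun f)"
  have y: "cblinfun_apply y v = f v" for v unfolding y_def cblinfun_apply.rep_eq
    by (subst CBlinfun_inverse) (simp_all add: bounded_linear_Blinfun_apply[OF bl] fc)
  have "norm y \<le> 1" by (rule norm_cblinfun_bound) (simp_all add: y bound)
  moreover have "norm x \<le> norm (cblinfun_apply y x)" using px abs_Re_le_cmod[of "f x"] by (simp add: y f_def)
  ultimately show ?thesis using that by blast
qed

lemma cblinfun_norm_le_by_pairing:
  fixes A :: "('a::complex_normed_vector, 'a) cblinfun"
  assumes "K \<ge> 0"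
    and "\<And>x (y :: ('a, complex) cblinfun).
      cmod (cblinfun_apply y (cblinfun_apply A x)) \<le> K * norm x * norm y"
  shows "norm A \<le> K"
proof (rule norm_cblinfun_bound[OF assms(1)])
  fix x
  obtain y :: "('a, complex) cblinfun" where y: "norm y \<le> 1"
    "norm (cblinfun_apply A x) \<le> norm (cblinfun_apply y (cblinfun_apply A x))" using ex_norming_functional .
  note y(2)
  also have "\<dots> \<le> K * norm x * norm y" by (rule assms(2))
  also have "\<dots> \<le> K * norm x * 1" using assms(1) y(1) by (intro mult_left_mono) auto
  finally show "norm (cblinfun_apply A x) \<le> K * norm x" by simp
qed

lemma cblinfun_eq_by_pairing:
  fixes A B :: "('a::complex_normed_vector, 'a) cblinfun"
  assumes "\<And>x (y :: ('a, complex) cblinfun).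
      cblinfun_apply y (cblinfun_apply A x) = cblinfun_apply y (cblinfun_apply B x)"
  shows "A = B" using cblinfun_norm_le_by_pairing[of 0 "A - B"] assms by simp


section \<open>Strong integrals\<close>

lemma strongly_measurable_norm:
  fixes F :: "'m \<Rightarrow> 'b::real_normed_vector"
  assumes "strongly_measurable M F"
  shows "(\<lambda>\<omega>. norm (F \<omega>)) \<in> borel_measurable M"
proof -
  obtain s where s: "\<And>i::nat. simple_function M (s i)"
    "\<And>\<omega>. \<omega> \<in> space M \<Longrightarrow> (\<lambda>i. s i \<omega>) \<longlonglongrightarrow> F \<omega>" using assms by (auto simp: strongly_measurable_def)
  show ?thesis
  proof (rule borel_measurable_LIMSEQ_real)
    show "(\<lambda>\<omega>. norm (s i \<omega>)) \<in> borel_measurable M" for i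
      by (rule borel_measurable_simple_function[OF simple_function_compose1[OF s(1)]])
    show "(\<lambda>i. norm (s i \<omega>)) \<longlonglongrightarrow> norm (F \<omega>)" if "\<omega> \<in> space M" for \<omega> using s(2)[OF that] by (rule tendsto_norm)
  qed
qed

lemma strongly_measurable_continuous_image:
  fixes F :: "'m \<Rightarrow> 'b::real_normed_vector" and h :: "'b \<Rightarrow> 'c::real_normed_vector"
  assumes "strongly_measurable M F" "\<And>z. isCont h z"
  shows "strongly_measurable M (\<lambda>\<omega>. h (F \<omega>))"
proof -
  obtain s where s: "\<And>i::nat. simple_function M (s i)"
    "\<And>\<omega>. \<omega> \<in> space M \<Longrightarrow> (\<lambda>i. s i \<omega>) \<longlonglongrightarrow> F \<omega>" using assms by (auto simp: strongly_measurable_def)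
  show ?thesis unfolding strongly_measurable_def by (rule exI[of _ "\<lambda>i \<omega>. h (s i \<omega>)"])
       (auto intro: simple_function_compose1[OF s(1)] isCont_tendsto_compose[OF assms(2)] s(2))
qed

lemma strongly_measurable_diff_simple:
  fixes F :: "'m \<Rightarrow> 'b::real_normed_vector"
  assumes "strongly_measurable M F" "simple_function M u"
  shows "strongly_measurable M (\<lambda>\<omega>. F \<omega> - u \<omega>)"
proof -
  obtain s where s: "\<And>i::nat. simple_function M (s i)"
    "\<And>\<omega>. \<omega> \<in> space M \<Longrightarrow> (\<lambda>i. s i \<omega>) \<longlonglongrightarrow> F \<omega>" using assms by (auto simp: strongly_measurable_def)
  show ?thesis unfolding strongly_measurable_def by (rule exI[of _ "\<lambda>i \<omega>. s i \<omega> - u \<omega>"])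
       (auto intro: simple_function_compose2[OF s(1) assms(2)] tendsto_diff s(2))
qed

lemma strongly_measurable_borel:
  fixes F :: "'m \<Rightarrow> complex"
  assumes "strongly_measurable M F"
  shows "F \<in> borel_measurable M"
proof -
  obtain s where s: "\<And>i::nat. simple_function M (s i)"
    "\<And>\<omega>. \<omega> \<in> space M \<Longrightarrow> (\<lambda>i. s i \<omega>) \<longlonglongrightarrow> F \<omega>" using assms by (auto simp: strongly_measurable_def)
  show ?thesis by (rule borel_measurable_LIMSEQ_metric[OF borel_measurable_simple_function[OF s(1)] s(2)])
qed

lemma strongly_measurable_scaleC:
  fixes F :: "'m \<Rightarrow> 'b::complex_normed_vector" and c :: "'m \<Rightarrow> complex"
  assumes "strongly_measurable M F" "c \<in> borel_measurable M"
  shows "strongly_measurable M (\<lambda>\<omega>. c \<omega> *\<^sub>C F \<omega>)"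
proof -
  obtain s where s: "\<And>i::nat. simple_function M (s i)"
    "\<And>\<omega>. \<omega> \<in> space M \<Longrightarrow> (\<lambda>i. s i \<omega>) \<longlonglongrightarrow> F \<omega>" using assms by (auto simp: strongly_measurable_def)
  obtain u where u: "\<And>i::nat. simple_function M (u i)"
    "\<And>\<omega>. \<omega> \<in> space M \<Longrightarrow> (\<lambda>i. u i \<omega>) \<longlonglongrightarrow> c \<omega>"
    using borel_measurable_implies_sequence_metric[OF assms(2), of 0] by blast
  show ?thesis unfolding strongly_measurable_def by (rule exI[of _ "\<lambda>i \<omega>. u i \<omega> *\<^sub>C s i \<omega>"])
       (auto intro: simple_function_compose2[OF u(1) s(1)] tendsto_scaleC u(2) s(2))
qed

text \<open>Simple approximations that are cut off where they exceed twice the function are dominated, so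
  they converge in mean.\<close>

lemma strongly_integrable_approximation:
  fixes F :: "'m \<Rightarrow> 'b::real_normed_vector"
  assumes F: "strongly_measurable M F" and fin: "(\<integral>\<^sup>+\<omega>. norm (F \<omega>) \<partial>M) < \<infinity>"
  obtains s where "\<And>i::nat. Bochner_Integration.simple_bochner_integrable M (s i)"
    "(\<lambda>i. \<integral>\<^sup>+\<omega>. norm (F \<omega> - s i \<omega>) \<partial>M) \<longlonglongrightarrow> 0"
proof -
  obtain u where u: "\<And>i::nat. simple_function M (u i)"
    "\<And>\<omega>. \<omega> \<in> space M \<Longrightarrow> (\<lambda>i. u i \<omega>) \<longlonglongrightarrow> F \<omega>" using F by (auto simp: strongly_measurable_def)
  define s where "s i \<omega> = (if norm (u i \<omega>) \<le> 2 * norm (F \<omega>) then u i \<omega> else 0)" for i \<omega>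
  have [measurable]: "(\<lambda>\<omega>. norm (F \<omega>)) \<in> borel_measurable M" by (rule strongly_measurable_norm[OF F])
  have [measurable]: "(\<lambda>\<omega>. norm (u i \<omega>)) \<in> borel_measurable M" for i
    by (rule borel_measurable_simple_function[OF simple_function_compose1[OF u(1)]])
  have simple: "simple_function M (s i)" for i unfolding s_def by (rule simple_function_If) (auto intro: u)
  have norm_s: "norm (s i \<omega>) \<le> 2 * norm (F \<omega>)" for i \<omega> by (auto simp: s_def)
  have meas: "(\<lambda>\<omega>. ennreal (norm (F \<omega> - s i \<omega>))) \<in> borel_measurable M" for i
    using strongly_measurable_norm[OF strongly_measurable_diff_simple[OF F simple]] by measurable
  have conv: "(\<lambda>i. \<integral>\<^sup>+\<omega>. norm (F \<omega> - s i \<omega>) \<partial>M) \<longlonglongrightarrow> (\<integral>\<^sup>+\<omega>. 0 \<partial>M)"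
  proof (rule nn_integral_dominated_convergence[where w = "\<lambda>\<omega>. 3 * ennreal (norm (F \<omega>))"])
    have "ennreal (norm (F \<omega> - s i \<omega>)) \<le> 3 * ennreal (norm (F \<omega>))" for i \<omega>
    proof -
      have "norm (F \<omega> - s i \<omega>) \<le> 3 * norm (F \<omega>)"
        using norm_triangle_ineq4[of "F \<omega>" "s i \<omega>"] norm_s[of i \<omega>] by linarith
      then have "ennreal (norm (F \<omega> - s i \<omega>)) \<le> ennreal (3 * norm (F \<omega>))" by (rule ennreal_leI)
      then show ?thesis by (simp add: ennreal_mult)
    qed
    then show "AE \<omega> in M. ennreal (norm (F \<omega> - s i \<omega>)) \<le> 3 * ennreal (norm (F \<omega>))" for i by simp
    show "(\<integral>\<^sup>+\<omega>. 3 * ennreal (norm (F \<omega>)) \<partial>M) < \<infinity>"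
      using fin by (simp add: nn_integral_cmult ennreal_mult_less_top)
    have "(\<lambda>i. ennreal (norm (F \<omega> - s i \<omega>))) \<longlonglongrightarrow> 0" if \<omega>: "\<omega> \<in> space M" for \<omega>
    proof -
      have "(\<lambda>i. norm (F \<omega> - s i \<omega>)) \<longlonglongrightarrow> 0"
      proof (cases "F \<omega> = 0")
        case True
        then have "s i \<omega> = 0" for i by (auto simp: s_def)
        with True show ?thesis by simp
      next
        case False
        have "(\<lambda>i. norm (u i \<omega>)) \<longlonglongrightarrow> norm (F \<omega>)" using u(2)[OF \<omega>] by (rule tendsto_norm)
        then have "\<forall>\<^sub>F i in sequentially. norm (u i \<omega>) < 2 * norm (F \<omega>)"
          using False by (intro order_tendstoD(2)) auto
        then have "\<forall>\<^sub>F i in sequentially. norm (F \<omega> - u i \<omega>) = norm (F \<omega> - s i \<omega>)"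
          by eventually_elim (simp add: s_def)
        moreover have "(\<lambda>i. norm (F \<omega> - u i \<omega>)) \<longlonglongrightarrow> norm (F \<omega> - F \<omega>)" by (intro tendsto_intros u(2) \<omega>)
        ultimately show ?thesis by (simp add: tendsto_cong)
      qed
      then show ?thesis using tendsto_ennrealI by fastforce
    qed
    then show "AE \<omega> in M. (\<lambda>i. ennreal (norm (F \<omega> - s i \<omega>))) \<longlonglongrightarrow> 0" by simp
  qed (use meas in auto)
  moreover have "Bochner_Integration.simple_bochner_integrable M (s i)" for i
  proof (rule simple_bochner_integrableI_bounded[OF simple])
    have "(\<integral>\<^sup>+\<omega>. norm (s i \<omega>) \<partial>M) \<le> (\<integral>\<^sup>+\<omega>. 2 * ennreal (norm (F \<omega>)) \<partial>M)"
    proof (rule nn_integral_mono)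
      fix \<omega>
      have "ennreal (norm (s i \<omega>)) \<le> ennreal (2 * norm (F \<omega>))" by (rule ennreal_leI[OF norm_s])
      then show "ennreal (norm (s i \<omega>)) \<le> 2 * ennreal (norm (F \<omega>))" by (simp add: ennreal_mult)
    qed
    also have "\<dots> < \<infinity>" using fin by (simp add: nn_integral_cmult ennreal_mult_less_top)
    finally show "(\<integral>\<^sup>+\<omega>. norm (s i \<omega>) \<partial>M) < \<infinity>" .
  qed
  ultimately show ?thesis using that[of s] by simp
qed

lemma simple_integral_diff_le:
  fixes F :: "'m \<Rightarrow> 'b::real_normed_vector"
  assumes F: "strongly_measurable M F"
    and s: "Bochner_Integration.simple_bochner_integrable M s"
      "Bochner_Integration.simple_bochner_integrable M t"
  shows "ennreal (norm (Bochner_Integration.simple_bochner_integral M s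
          - Bochner_Integration.simple_bochner_integral M t))
    \<le> (\<integral>\<^sup>+\<omega>. norm (F \<omega> - s \<omega>) \<partial>M) + (\<integral>\<^sup>+\<omega>. norm (F \<omega> - t \<omega>) \<partial>M)"
proof -
  have st: "Bochner_Integration.simple_bochner_integrable M (\<lambda>\<omega>. s \<omega> - t \<omega>)"
    by (rule simple_bochner_integrable_compose2[where p = "\<lambda>x y. x - y", OF _ s]) auto
  have meas: "(\<lambda>\<omega>. ennreal (norm (F \<omega> - s \<omega>))) \<in> borel_measurable M"
    if "Bochner_Integration.simple_bochner_integrable M s" for s
    using strongly_measurable_norm[OF strongly_measurable_diff_simple[OF F]] that
    by (auto elim!: simple_bochner_integrable.cases)
  have "ennreal (norm (Bochner_Integration.simple_bochner_integral M s
          - Bochner_Integration.simple_bochner_integral M t))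
      \<le> ennreal (Bochner_Integration.simple_bochner_integral M (\<lambda>\<omega>. norm (s \<omega> - t \<omega>)))"
    using simple_bochner_integral_norm_bound[OF st] s
    by (auto simp: simple_bochner_integral_diff intro: ennreal_leI)
  also have "\<dots> = (\<integral>\<^sup>+\<omega>. norm (s \<omega> - t \<omega>) \<partial>M)" by (rule simple_bochner_integral_eq_nn_integral
        [OF simple_bochner_integrable_compose2[where p = "\<lambda>x y. norm (x - y)", OF _ s]]) auto
  also have "\<dots> \<le> (\<integral>\<^sup>+\<omega>. ennreal (norm (F \<omega> - s \<omega>)) + ennreal (norm (F \<omega> - t \<omega>)) \<partial>M)"
  proof (rule nn_integral_mono)
    fix \<omega>
    have "norm (s \<omega> - t \<omega>) \<le> norm (F \<omega> - s \<omega>) + norm (F \<omega> - t \<omega>)"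
      using norm_triangle_ineq4[of "F \<omega> - t \<omega>" "F \<omega> - s \<omega>"] by simp
    then show "ennreal (norm (s \<omega> - t \<omega>)) \<le> ennreal (norm (F \<omega> - s \<omega>)) + ennreal (norm (F \<omega> - t \<omega>))"
      by (metis ennreal_leI ennreal_plus norm_ge_zero)
  qed
  also have "\<dots> = (\<integral>\<^sup>+\<omega>. norm (F \<omega> - s \<omega>) \<partial>M) + (\<integral>\<^sup>+\<omega>. norm (F \<omega> - t \<omega>) \<partial>M)" by (intro nn_integral_add meas s)
  finally show ?thesis .
qed

lemma has_strong_integral_exists:
  fixes F :: "'m \<Rightarrow> 'b::banach"
  assumes F: "strongly_measurable M F" and fin: "(\<integral>\<^sup>+\<omega>. norm (F \<omega>) \<partial>M) < \<infinity>"
  shows "\<exists>v. has_strong_integral M F v"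
proof -
  obtain s where s: "\<And>i::nat. Bochner_Integration.simple_bochner_integrable M (s i)"
    "(\<lambda>i. \<integral>\<^sup>+\<omega>. norm (F \<omega> - s i \<omega>) \<partial>M) \<longlonglongrightarrow> 0" using strongly_integrable_approximation[OF assms] by blast
  let ?I = "\<lambda>i. Bochner_Integration.simple_bochner_integral M (s i)"
  have "Cauchy ?I"
  proof (rule CauchyI)
    fix e :: real assume e: "e > 0"
    have "\<forall>\<^sub>F i in sequentially. (\<integral>\<^sup>+\<omega>. norm (F \<omega> - s i \<omega>) \<partial>M) < ennreal (e / 2)"
      using s(2) e by (intro order_tendstoD(2)) auto
    then obtain N where N: "\<And>i. i \<ge> N \<Longrightarrow> (\<integral>\<^sup>+\<omega>. norm (F \<omega> - s i \<omega>) \<partial>M) < ennreal (e / 2)"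
      by (auto simp: eventually_sequentially)
    have "norm (?I m - ?I n) < e" if "m \<ge> N" "n \<ge> N" for m n
    proof -
      have "ennreal (norm (?I m - ?I n)) < ennreal (e / 2) + ennreal (e / 2)"
        using simple_integral_diff_le[OF F s(1) s(1), of m n] N[OF that(1)] N[OF that(2)]
        by (meson add_strict_mono le_less_trans)
      also have "\<dots> = ennreal e" using e by (simp flip: ennreal_plus)
      finally show ?thesis using e by (simp add: ennreal_less_iff)
    qed
    then show "\<exists>N. \<forall>m\<ge>N. \<forall>n\<ge>N. norm (?I m - ?I n) < e" by blast
  qed
  then obtain v where "?I \<longlonglongrightarrow> v" using Cauchy_convergent convergent_def by blast
  then show ?thesis using F s unfolding has_strong_integral_def by blast
qed

lemma has_strong_integral_functional:
  fixes F :: "'m \<Rightarrow> 'b::banach" and \<phi> :: "'b \<Rightarrow> complex"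
  assumes v: "has_strong_integral M F v" and \<phi>: "bounded_linear \<phi>"
    and fin: "(\<integral>\<^sup>+\<omega>. norm (F \<omega>) \<partial>M) < \<infinity>"
  shows "integrable M (\<lambda>\<omega>. \<phi> (F \<omega>))" "\<phi> v = (\<integral>\<omega>. \<phi> (F \<omega>) \<partial>M)"
proof -
  obtain s where F: "strongly_measurable M F"
    and s: "\<And>i::nat. Bochner_Integration.simple_bochner_integrable M (s i)"
      "(\<lambda>i. \<integral>\<^sup>+\<omega>. norm (F \<omega> - s i \<omega>) \<partial>M) \<longlonglongrightarrow> 0"
      "(\<lambda>i. Bochner_Integration.simple_bochner_integral M (s i)) \<longlonglongrightarrow> v"
    using v unfolding has_strong_integral_def by blast
  interpret \<phi>: bounded_linear \<phi> by fact
  obtain K where K: "K \<ge> 0" "\<And>b. norm (\<phi> b) \<le> norm b * K" using \<phi>.nonneg_bounded by blast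
  have meas: "(\<lambda>\<omega>. \<phi> (F \<omega>)) \<in> borel_measurable M"
    by (rule strongly_measurable_borel[OF strongly_measurable_continuous_image[OF F]])
       (rule \<phi>.isCont[OF continuous_ident])
  have [measurable]: "(\<lambda>\<omega>. norm (F \<omega>)) \<in> borel_measurable M" by (rule strongly_measurable_norm[OF F])
  have le: "(\<integral>\<^sup>+\<omega>. norm (\<phi> (G \<omega>)) \<partial>M) \<le> ennreal K * (\<integral>\<^sup>+\<omega>. norm (G \<omega>) \<partial>M)"
    if "(\<lambda>\<omega>. norm (G \<omega>)) \<in> borel_measurable M" for G
  proof -
    have "(\<integral>\<^sup>+\<omega>. norm (\<phi> (G \<omega>)) \<partial>M) \<le> (\<integral>\<^sup>+\<omega>. ennreal K * norm (G \<omega>) \<partial>M)" by (intro nn_integral_mono)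
         (use K in \<open>simp add: ennreal_mult[symmetric] mult.commute[of K] ennreal_leI\<close>)
    also have "\<dots> = ennreal K * (\<integral>\<^sup>+\<omega>. norm (G \<omega>) \<partial>M)" using that by (intro nn_integral_cmult) auto
    finally show ?thesis .
  qed
  show int: "integrable M (\<lambda>\<omega>. \<phi> (F \<omega>))"
  proof (rule integrableI_bounded[OF meas])
    show "(\<integral>\<^sup>+\<omega>. norm (\<phi> (F \<omega>)) \<partial>M) < \<infinity>"
      using le[of F] fin by (auto simp: ennreal_mult_less_top intro: le_less_trans)
  qed
  have "has_bochner_integral M (\<lambda>\<omega>. \<phi> (F \<omega>)) (\<phi> v)"
  proof (rule has_bochner_integral.intros[OF meas])
    show "Bochner_Integration.simple_bochner_integrable M (\<lambda>\<omega>. \<phi> (s i \<omega>))" for i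
      using simple_bochner_integrable_compose2[where p = "\<lambda>x y. \<phi> x", OF _ s(1) s(1)] by simp
    have "(\<lambda>i. ennreal K * (\<integral>\<^sup>+\<omega>. norm (F \<omega> - s i \<omega>) \<partial>M)) \<longlonglongrightarrow> ennreal K * 0"
      by (intro ennreal_tendsto_cmult s) auto
    then have lim: "(\<lambda>i. ennreal K * (\<integral>\<^sup>+\<omega>. norm (F \<omega> - s i \<omega>) \<partial>M)) \<longlonglongrightarrow> 0" by simp
    show "(\<lambda>i. \<integral>\<^sup>+\<omega>. norm (\<phi> (F \<omega>) - \<phi> (s i \<omega>)) \<partial>M) \<longlonglongrightarrow> 0"
    proof (rule tendsto_sandwich[OF _ _ tendsto_const lim])
      have "(\<lambda>\<omega>. norm (F \<omega> - s i \<omega>)) \<in> borel_measurable M" for i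
        using strongly_measurable_norm[OF strongly_measurable_diff_simple[OF F]] s(1)[of i]
        by (auto elim!: simple_bochner_integrable.cases)
      from le[OF this] show "\<forall>\<^sub>F i in sequentially. (\<integral>\<^sup>+\<omega>. norm (\<phi> (F \<omega>) - \<phi> (s i \<omega>)) \<partial>M)
          \<le> ennreal K * (\<integral>\<^sup>+\<omega>. norm (F \<omega> - s i \<omega>) \<partial>M)" by (simp add: \<phi>.diff)
    qed auto
    have "(\<lambda>i. \<phi> (Bochner_Integration.simple_bochner_integral M (s i))) \<longlonglongrightarrow> \<phi> v" by (rule \<phi>.tendsto[OF s(3)])
    then show "(\<lambda>i. Bochner_Integration.simple_bochner_integral M (\<lambda>\<omega>. \<phi> (s i \<omega>))) \<longlonglongrightarrow> \<phi> v"
      by (simp add: simple_bochner_integral_linear[OF \<phi>.linear_axioms s(1)])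
  qed
  then show "\<phi> v = (\<integral>\<omega>. \<phi> (F \<omega>) \<partial>M)" by (simp add: has_bochner_integral_integral_eq)
qed

text \<open>The only access to operator-valued integrals below: pairing with a vector and a functional
  turns them into scalar Lebesgue integrals.  Since such pairings separate operators, they also
  give the uniqueness of the integral.\<close>

lemma strong_integral_pairing:
  fixes F :: "'m \<Rightarrow> ('a::complex_banach, 'a) cblinfun" and y :: "('a, complex) cblinfun"
  assumes F: "strongly_measurable M F" and fin: "(\<integral>\<^sup>+\<omega>. norm (F \<omega>) \<partial>M) < \<infinity>"
  shows "integrable M (\<lambda>\<omega>. cblinfun_apply y (cblinfun_apply (F \<omega>) x))"
    and "cblinfun_apply y (cblinfun_apply (strong_integral M F) x)
      = (\<integral>\<omega>. cblinfun_apply y (cblinfun_apply (F \<omega>) x) \<partial>M)"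
proof -
  have bl: "bounded_linear (\<lambda>A::('a, 'a) cblinfun. cblinfun_apply y (cblinfun_apply A x))"
    for y :: "('a, complex) cblinfun" and x
    using bounded_linear_compose[OF bounded_linear_cblinfun_apply apply_bilinear.bounded_linear_left] .
  obtain v where v: "has_strong_integral M F v" using has_strong_integral_exists[OF assms] by blast
  have "w = v" if w: "has_strong_integral M F w" for w by (rule cblinfun_eq_by_pairing)
       (simp add: has_strong_integral_functional(2)[OF w bl fin]
         has_strong_integral_functional(2)[OF v bl fin])
  with v have "strong_integral M F = v" unfolding strong_integral_def by (intro the_equality)
  then show "integrable M (\<lambda>\<omega>. cblinfun_apply y (cblinfun_apply (F \<omega>) x))"
    "cblinfun_apply y (cblinfun_apply (strong_integral M F) x)
      = (\<integral>\<omega>. cblinfun_apply y (cblinfun_apply (F \<omega>) x) \<partial>M)"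
    using has_strong_integral_functional[OF v bl fin] by auto
qed

subsection \<open>The open unit cube\<close>

lemma space_unit_measure [simp]: "space unit_measure = {0<..<1}"
  by (simp add: unit_measure_def space_restrict_space)

lemma measurable_unit_measure: "f \<in> borel_measurable borel \<Longrightarrow> f \<in> borel_measurable unit_measure"
  unfolding unit_measure_def by (rule measurable_restrict_space1) simp

lemma emeasure_unit_measure: "emeasure unit_measure (space unit_measure) = 1"
  by (simp add: unit_measure_def emeasure_restrict_space space_restrict_space)

interpretation unit_prob: prob_space unit_measure by (rule prob_spaceI) (rule emeasure_unit_measure)

interpretation unit_cube: product_prob_space "\<lambda>_::'i. unit_measure" UNIV by standard

abbreviation cube :: "'i set \<Rightarrow> ('i \<Rightarrow> real) measure" where
  "cube S \<equiv> Pi\<^sub>M S (\<lambda>_. unit_measure)"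

lemma space_cube: "space (cube S) = S \<rightarrow>\<^sub>E {0<..<1}" by (simp add: space_PiM)

text \<open>The midpoint of the interval of length \<open>1 / (n + 1)\<close> that contains \<open>t\<close>.  It stays in the open
  unit interval, where the integrands are continuous.\<close>

definition mesh :: "nat \<Rightarrow> real \<Rightarrow> real" where
  "mesh n t = (of_int \<lfloor>real (Suc n) * t\<rfloor> + 1 / 2) / real (Suc n)"

lemma mesh_in: "t \<in> {0<..<1} \<Longrightarrow> mesh n t \<in> {0<..<1}"
proof -
  assume t: "t \<in> {0<..<1}"
  have "\<lfloor>real (Suc n) * t\<rfloor> \<ge> 0" using t by simp
  moreover have "\<lfloor>real (Suc n) * t\<rfloor> \<le> int n"
  proof -
    have "real (Suc n) * t < real (Suc n) * 1" using t by (intro mult_strict_left_mono) auto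
    then show ?thesis by (simp add: floor_le_iff add.commute)
  qed
  ultimately have "0 \<le> real_of_int \<lfloor>real (Suc n) * t\<rfloor>" "real_of_int \<lfloor>real (Suc n) * t\<rfloor> \<le> real n" by linarith+
  moreover define k where "k = real_of_int \<lfloor>real (Suc n) * t\<rfloor>"
  ultimately have "0 \<le> k" "k \<le> real n" by auto
  then show ?thesis unfolding mesh_def k_def[symmetric] by (simp add: divide_simps)
qed

lemma mesh_finite: "finite (mesh n ` {0<..<1})"
proof (rule finite_subset)
  show "mesh n ` {0<..<1} \<subseteq> (\<lambda>k. (of_int k + 1 / 2) / real (Suc n)) ` {0..int (Suc n)}"
  proof
    fix s assume "s \<in> mesh n ` {0<..<1}"
    then obtain t where t: "t \<in> {0<..<1}" "s = mesh n t" by blast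
    have "real (Suc n) * t \<le> real (Suc n) * 1" using t by (intro mult_left_mono) auto
    then have "\<lfloor>real (Suc n) * t\<rfloor> \<le> int (Suc n)" by (metis floor_mono floor_of_nat mult.right_neutral)
    then have "\<lfloor>real (Suc n) * t\<rfloor> \<in> {0..int (Suc n)}" using t by simp
    then show "s \<in> (\<lambda>k. (of_int k + 1 / 2) / real (Suc n)) ` {0..int (Suc n)}"
      using t(2) by (auto simp: mesh_def)
  qed
qed auto

lemma mesh_measurable: "mesh n \<in> borel_measurable borel" unfolding mesh_def by measurable

lemma mesh_tendsto: "(\<lambda>n. mesh n t) \<longlonglongrightarrow> t"
proof (rule tendsto_sandwich)
  have eq: "mesh n t - t = (of_int \<lfloor>real (Suc n) * t\<rfloor> - real (Suc n) * t + 1 / 2) / real (Suc n)" for n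
    by (simp add: mesh_def field_simps)
  have bounds: "real_of_int \<lfloor>real (Suc n) * t\<rfloor> - real (Suc n) * t + 1 / 2 \<le> 1"
    "- 1 \<le> real_of_int \<lfloor>real (Suc n) * t\<rfloor> - real (Suc n) * t + 1 / 2" for n by linarith+
  have "mesh n t - t \<le> 1 / real (Suc n)" "- 1 / real (Suc n) \<le> mesh n t - t" for n
    unfolding eq by (intro divide_right_mono bounds; simp)+
  then have "t - 1 / real (Suc n) \<le> mesh n t" "mesh n t \<le> t + 1 / real (Suc n)" for n
    by (simp_all add: algebra_simps)
  then show "\<forall>\<^sub>F n in sequentially. t - 1 / real (Suc n) \<le> mesh n t"
    "\<forall>\<^sub>F n in sequentially. mesh n t \<le> t + 1 / real (Suc n)" by simp_all
  have "(\<lambda>n. 1 / real (Suc n)) \<longlonglongrightarrow> 0" using LIMSEQ_inverse_real_of_nat by (simp add: inverse_eq_divide)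
  then show "(\<lambda>n. t - 1 / real (Suc n)) \<longlonglongrightarrow> t" "(\<lambda>n. t + 1 / real (Suc n)) \<longlonglongrightarrow> t"
    using tendsto_diff[OF tendsto_const, of _ 0 _ t] tendsto_add[OF tendsto_const, of _ 0 _ t] by fastforce+
qed

text \<open>Functions that are continuous on the cube are pointwise limits of their values at mesh
  points, hence strongly measurable.\<close>

lemma strongly_measurable_cube:
  fixes F :: "('i \<Rightarrow> real) \<Rightarrow> 'b::real_normed_vector"
  assumes S: "finite S"
    and lim: "\<And>t. t \<in> S \<rightarrow>\<^sub>E {0<..<1} \<Longrightarrow> (\<lambda>n. F (\<lambda>i\<in>S. mesh n (t i))) \<longlonglongrightarrow> F t"
  shows "strongly_measurable (cube S) F"
proof -
  let ?M = "cube S"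
  have "simple_function ?M (\<lambda>t. \<lambda>i\<in>S. mesh n (t i))" for n unfolding simple_function_def
  proof (intro conjI ballI)
    have "(\<lambda>t. \<lambda>i\<in>S. mesh n (t i)) ` space ?M \<subseteq> S \<rightarrow>\<^sub>E mesh n ` {0<..<1}" by (auto simp: space_cube)
    then show "finite ((\<lambda>t. \<lambda>i\<in>S. mesh n (t i)) ` space ?M)"
      by (rule finite_subset) (intro finite_PiE S mesh_finite)
    fix u assume "u \<in> (\<lambda>t. \<lambda>i\<in>S. mesh n (t i)) ` space ?M"
    then have u: "u \<in> extensional S" by auto
    have "(\<lambda>t. \<lambda>i\<in>S. mesh n (t i)) -` {u} \<inter> space ?M
        = {t \<in> space ?M. \<forall>i\<in>S. mesh n (t i) = u i}"
      using u by (auto simp: fun_eq_iff extensional_def restrict_def)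
    also have "\<dots> \<in> sets ?M"
    proof (rule sets.sets_Collect_finite_All[OF _ S])
      fix i assume i: "i \<in> S"
      have "(\<lambda>t. mesh n (t i)) \<in> borel_measurable ?M"
        using measurable_compose[OF measurable_component_singleton[OF i]
            measurable_unit_measure[OF mesh_measurable]] .
      then show "{t \<in> space ?M. mesh n (t i) = u i} \<in> sets ?M" by measurable
    qed
    finally show "(\<lambda>t. \<lambda>i\<in>S. mesh n (t i)) -` {u} \<inter> space ?M \<in> sets ?M" .
  qed
  then have "simple_function ?M (\<lambda>t. F (\<lambda>i\<in>S. mesh n (t i)))" for n by (rule simple_function_compose1)
  then show ?thesis unfolding strongly_measurable_def using lim
    by (intro exI[of _ "\<lambda>n t. F (\<lambda>i\<in>S. mesh n (t i))"]) (auto simp: space_cube)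
qed

lemma strongly_measurable_unit_interval:
  fixes F :: "real \<Rightarrow> 'b::real_normed_vector"
  assumes "continuous_on {0<..<1} F"
  shows "strongly_measurable unit_measure F"
proof -
  have "simple_function unit_measure (mesh n)" for n
    using mesh_finite measurable_unit_measure[OF mesh_measurable]
    by (simp add: simple_function_borel_measurable)
  then have "simple_function unit_measure (\<lambda>t. F (mesh n t))" for n by (rule simple_function_compose1)
  moreover have "(\<lambda>n. F (mesh n t)) \<longlonglongrightarrow> F t" if t: "t \<in> {0<..<1}" for t
    by (rule continuous_on_tendsto_compose[OF assms mesh_tendsto t]) (use mesh_in[OF t] in auto)
  ultimately show ?thesis unfolding strongly_measurable_def by (intro exI[of _ "\<lambda>n t. F (mesh n t)"]) auto
qed


section \<open>Finite Rademacher averages\<close>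

abbreviation signs :: "'i set \<Rightarrow> ('i \<Rightarrow> real) set" where
  "signs J \<equiv> J \<rightarrow>\<^sub>E {- 1, 1}"

text \<open>The norm of a finite Rademacher sum, as an average over all choices of signs.\<close>

definition rad_norm :: "'i set \<Rightarrow> ('i \<Rightarrow> 'b::real_normed_vector) \<Rightarrow> real" where
  "rad_norm J u = L2_set (\<lambda>\<epsilon>. norm (rad_sum J u \<epsilon>)) (signs J) / sqrt (2 ^ card J)"

lemma finite_signs: "finite J \<Longrightarrow> finite (signs J)" by (intro finite_PiE) auto

lemma card_signs: "finite J \<Longrightarrow> card (signs J) = 2 ^ card J" by (simp add: card_PiE numeral_2_eq_2)

lemma rad_norm_nonneg [simp]: "0 \<le> rad_norm J u" by (simp add: rad_norm_def)

lemma rad_norm_power2: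
  "(rad_norm J u)\<^sup>2 = (\<Sum>\<epsilon>\<in>signs J. (norm (rad_sum J u \<epsilon>))\<^sup>2) / 2 ^ card J"
  by (simp add: rad_norm_def L2_set_def power_divide sum_nonneg)

lemma rad_norm_cong: "(\<And>j. j \<in> J \<Longrightarrow> u j = v j) \<Longrightarrow> rad_norm J u = rad_norm J v"
  by (simp add: rad_norm_def rad_sum_def cong: sum.cong)

lemma rad_norm_triangle: "rad_norm J (\<lambda>j. u j + v j) \<le> rad_norm J u + rad_norm J v"
proof -
  have "L2_set (\<lambda>\<epsilon>. norm (rad_sum J (\<lambda>j. u j + v j) \<epsilon>)) (signs J)
      \<le> L2_set (\<lambda>\<epsilon>. norm (rad_sum J u \<epsilon>) + norm (rad_sum J v \<epsilon>)) (signs J)" by (rule L2_set_mono)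
       (auto simp: rad_sum_def scaleR_add_right sum.distrib norm_triangle_ineq)
  also have "\<dots> \<le> L2_set (\<lambda>\<epsilon>. norm (rad_sum J u \<epsilon>)) (signs J)
      + L2_set (\<lambda>\<epsilon>. norm (rad_sum J v \<epsilon>)) (signs J)" by (rule L2_set_triangle_ineq)
  finally show ?thesis by (simp add: rad_norm_def add_divide_distrib[symmetric] divide_right_mono)
qed

lemma rad_norm_scale:
  assumes "\<And>\<epsilon>. norm (rad_sum J v \<epsilon>) = c * norm (rad_sum J u \<epsilon>)" "c \<ge> 0"
  shows "rad_norm J v = c * rad_norm J u" using assms by (simp add: rad_norm_def L2_set_right_distrib)

lemma rad_norm_scaleR: "rad_norm J (\<lambda>j. c *\<^sub>R u j) = \<bar>c\<bar> * rad_norm J u"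
proof (rule rad_norm_scale)
  fix \<epsilon>
  have "rad_sum J (\<lambda>j. c *\<^sub>R u j) \<epsilon> = c *\<^sub>R rad_sum J u \<epsilon>"
    by (simp add: rad_sum_def scaleR_sum_right mult.commute)
  then show "norm (rad_sum J (\<lambda>j. c *\<^sub>R u j) \<epsilon>) = \<bar>c\<bar> * norm (rad_sum J u \<epsilon>)" by simp
qed auto

lemma rad_norm_scaleC: "rad_norm J (\<lambda>j. c *\<^sub>C u j) = cmod c * rad_norm J u"
proof (rule rad_norm_scale)
  fix \<epsilon>
  have "rad_sum J (\<lambda>j. c *\<^sub>C u j) \<epsilon> = c *\<^sub>C rad_sum J u \<epsilon>"
    by (simp add: rad_sum_def linear_sum[OF bounded_linear.linear[OF bounded_linear_scaleC]]
        scaleC_simps)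
  then show "norm (rad_sum J (\<lambda>j. c *\<^sub>C u j) \<epsilon>) = cmod c * norm (rad_sum J u \<epsilon>)" by (simp add: norm_scaleC)
qed auto

lemma rad_norm_zero [simp]: "rad_norm J (\<lambda>_. 0) = 0" by (simp add: rad_norm_def rad_sum_def L2_set_def)

lemma rad_norm_reindex:
  assumes \<pi>: "bij_betw \<pi> K J"
  shows "rad_norm J u = rad_norm K (\<lambda>k. u (\<pi> k))"
proof -
  define \<rho> where "\<rho> = the_inv_into K \<pi>"
  have \<rho>: "\<And>j. j \<in> J \<Longrightarrow> \<rho> j \<in> K \<and> \<pi> (\<rho> j) = j" "\<And>k. k \<in> K \<Longrightarrow> \<pi> k \<in> J \<and> \<rho> (\<pi> k) = k"
    using \<pi> unfolding \<rho>_def bij_betw_def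
    by (auto simp: the_inv_into_f_f f_the_inv_into_f intro: the_inv_into_into)
  have "(\<Sum>\<epsilon>\<in>signs J. (norm (rad_sum J u \<epsilon>))\<^sup>2)
      = (\<Sum>\<epsilon>\<in>signs K. (norm (rad_sum K (\<lambda>k. u (\<pi> k)) \<epsilon>))\<^sup>2)"
  proof (rule sum.reindex_bij_witness[where i = "\<lambda>\<epsilon>. \<lambda>j\<in>J. \<epsilon> (\<rho> j)" and j = "\<lambda>\<epsilon>. \<lambda>k\<in>K. \<epsilon> (\<pi> k)"])
    fix \<epsilon> assume \<epsilon>: "\<epsilon> \<in> signs J"
    show "(\<lambda>j\<in>J. (\<lambda>k\<in>K. \<epsilon> (\<pi> k)) (\<rho> j)) = \<epsilon>" using \<epsilon> \<rho> by (auto simp: fun_eq_iff PiE_def extensional_def)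
    show "(\<lambda>k\<in>K. \<epsilon> (\<pi> k)) \<in> signs K" using \<epsilon> \<rho> by auto
    have "rad_sum J u \<epsilon> = rad_sum K (\<lambda>k. u (\<pi> k)) (\<lambda>k\<in>K. \<epsilon> (\<pi> k))"
      unfolding rad_sum_def by (subst sum.reindex_bij_betw[OF \<pi>, symmetric]) simp
    then show "(norm (rad_sum K (\<lambda>k. u (\<pi> k)) (\<lambda>k\<in>K. \<epsilon> (\<pi> k))))\<^sup>2 = (norm (rad_sum J u \<epsilon>))\<^sup>2" by simp
  next
    fix \<epsilon> assume \<epsilon>: "\<epsilon> \<in> signs K"
    show "(\<lambda>k\<in>K. (\<lambda>j\<in>J. \<epsilon> (\<rho> j)) (\<pi> k)) = \<epsilon>" using \<epsilon> \<rho> by (auto simp: fun_eq_iff PiE_def extensional_def)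
    show "(\<lambda>j\<in>J. \<epsilon> (\<rho> j)) \<in> signs J" using \<epsilon> \<rho> by auto
  qed
  then show ?thesis using bij_betw_same_card[OF \<pi>] by (simp add: rad_norm_def L2_set_def)
qed

lemma sum_signs_insert:
  assumes "i \<notin> J" "finite J"
  shows "(\<Sum>\<epsilon>\<in>signs (insert i J). h \<epsilon>) = (\<Sum>\<epsilon>\<in>signs J. h (\<epsilon>(i := 1)) + h (\<epsilon>(i := - 1 :: real)))"
proof -
  have "(\<Sum>\<epsilon>\<in>signs (insert i J). h \<epsilon>)
      = (\<Sum>(s, \<epsilon>)\<in>{- 1, 1} \<times> signs J. h (\<epsilon>(i := s)))"
  proof (subst PiE_insert_eq, subst sum.reindex)
    show "inj_on (\<lambda>(y, g). g(i := y)) ({- 1, 1} \<times> signs J)" using assms by (intro inj_combinator)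
  qed (auto intro!: sum.cong)
  also have "\<dots> = (\<Sum>s\<in>{- 1, 1}. \<Sum>\<epsilon>\<in>signs J. h (\<epsilon>(i := s)))" by (rule sum.cartesian_product[symmetric])
  also have "\<dots> = (\<Sum>\<epsilon>\<in>signs J. h (\<epsilon>(i := 1)) + h (\<epsilon>(i := - 1)))" by (simp add: sum.distrib add.commute)
  finally show ?thesis .
qed

text \<open>Dropping terms does not increase a Rademacher average: a vector is the mean of its two
  perturbations by the same vector with opposite signs.\<close>

lemma rad_norm_mono:
  assumes "J \<subseteq> K" "finite K"
  shows "rad_norm J u \<le> rad_norm K u"
proof -
  have "rad_norm J u \<le> rad_norm (J \<union> L) u" if "finite L" "L \<inter> J = {}" for L using that
  proof (induction L rule: finite_induct)
    case (insert i L)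
    let ?J = "J \<union> L"
    have J: "finite ?J" "i \<notin> ?J" using insert assms finite_subset by auto
    have par: "(norm a)\<^sup>2 \<le> ((norm (a + b))\<^sup>2 + (norm (a - b))\<^sup>2) / 2" for a b :: 'b
    proof -
      have "norm (2 *\<^sub>R a) \<le> norm (a + b) + norm (a - b)"
        using norm_triangle_ineq[of "a + b" "a - b"] by (simp add: scaleR_2)
      then have "norm a \<le> (norm (a + b) + norm (a - b)) / 2" by simp
      then have "(norm a)\<^sup>2 \<le> ((norm (a + b) + norm (a - b)) / 2)\<^sup>2" by (rule power_mono) simp
      also have "\<dots> \<le> ((norm (a + b))\<^sup>2 + (norm (a - b))\<^sup>2) / 2"
        using sum_squares_bound[of "norm (a + b)" "norm (a - b)"] by (simp add: power2_eq_square algebra_simps)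
      finally show ?thesis .
    qed
    have upd: "rad_sum (insert i ?J) u (\<epsilon>(i := s)) = rad_sum ?J u \<epsilon> + s *\<^sub>R u i" for \<epsilon> s
    proof -
      have "(\<Sum>j\<in>?J. (\<epsilon>(i := s)) j *\<^sub>R u j) = (\<Sum>j\<in>?J. \<epsilon> j *\<^sub>R u j)" using J by (intro sum.cong) auto
      then show ?thesis unfolding rad_sum_def using J by simp
    qed
    have "(rad_norm ?J u)\<^sup>2 \<le> (\<Sum>\<epsilon>\<in>signs ?J.
        ((norm (rad_sum ?J u \<epsilon> + u i))\<^sup>2 + (norm (rad_sum ?J u \<epsilon> - u i))\<^sup>2) / 2) / 2 ^ card ?J"
      unfolding rad_norm_power2 by (intro divide_right_mono sum_mono par) auto
    also have "\<dots> = (rad_norm (insert i ?J) u)\<^sup>2" unfolding rad_norm_power2 using J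
      by (simp add: sum_signs_insert upd sum_divide_distrib[symmetric])
    finally have "rad_norm ?J u \<le> rad_norm (insert i ?J) u" by (rule power2_le_imp_le) simp
    then show ?case using insert by simp
  qed simp
  from this[of "K - J"] show ?thesis
    using assms by (simp add: Un_absorb1 Un_Diff_cancel Diff_disjoint Int_commute)
qed

lemma rad_norm_sign_change:
  assumes "\<And>j. j \<in> J \<Longrightarrow> s j = 1 \<or> s j = (- 1 :: real)"
  shows "rad_norm J (\<lambda>j. s j *\<^sub>R u j) = rad_norm J u"
proof -
  have ss: "s j * s j = 1" if "j \<in> J" for j using assms[OF that] by auto
  have "(\<Sum>\<epsilon>\<in>signs J. (norm (rad_sum J (\<lambda>j. s j *\<^sub>R u j) \<epsilon>))\<^sup>2)
      = (\<Sum>\<epsilon>\<in>signs J. (norm (rad_sum J u \<epsilon>))\<^sup>2)"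
  proof (rule sum.reindex_bij_witness[where i = "\<lambda>\<epsilon>. \<lambda>j\<in>J. s j * \<epsilon> j" and j = "\<lambda>\<epsilon>. \<lambda>j\<in>J. s j * \<epsilon> j"])
    fix \<epsilon> assume \<epsilon>: "\<epsilon> \<in> signs J"
    show inv: "(\<lambda>j\<in>J. s j * (\<lambda>j\<in>J. s j * \<epsilon> j) j) = \<epsilon>"
      using \<epsilon> ss by (auto simp: fun_eq_iff PiE_def extensional_def mult.assoc[symmetric])
    have "s j * \<epsilon> j \<in> {- 1, 1}" if "j \<in> J" for j using assms[OF that] PiE_mem[OF \<epsilon> that] by auto
    then show "(\<lambda>j\<in>J. s j * \<epsilon> j) \<in> signs J" by auto
    show "(norm (rad_sum J u (\<lambda>j\<in>J. s j * \<epsilon> j)))\<^sup>2 = (norm (rad_sum J (\<lambda>j. s j *\<^sub>R u j) \<epsilon>))\<^sup>2"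
      by (simp add: rad_sum_def mult.commute)
  next
    fix \<epsilon> assume \<epsilon>: "\<epsilon> \<in> signs J"
    show "(\<lambda>j\<in>J. s j * (\<lambda>j\<in>J. s j * \<epsilon> j) j) = \<epsilon>"
      using \<epsilon> ss by (auto simp: fun_eq_iff PiE_def extensional_def mult.assoc[symmetric])
    have "s j * \<epsilon> j \<in> {- 1, 1}" if "j \<in> J" for j using assms[OF that] PiE_mem[OF \<epsilon> that] by auto
    then show "(\<lambda>j\<in>J. s j * \<epsilon> j) \<in> signs J" by auto
  qed
  then show ?thesis by (simp add: rad_norm_def L2_set_def)
qed

text \<open>By orthogonality of the signs, the sum of the pairings is the mean of the pairings of the two
  Rademacher sums.\<close>

lemma sum_pairing_le_rad_norm:
  fixes x :: "'i \<Rightarrow> 'a::complex_normed_vector" and y :: "'i \<Rightarrow> ('a, complex) cblinfun"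
  assumes "finite J"
  shows "cmod (\<Sum>j\<in>J. cblinfun_apply (y j) (x j)) \<le> rad_norm J x * rad_norm J y"
proof -
  have mean: "(\<Sum>\<epsilon>\<in>signs J. cblinfun_apply (rad_sum J y \<epsilon>) (rad_sum J x \<epsilon>))
      = 2 ^ card J * (\<Sum>j\<in>J. cblinfun_apply (y j) (x j))" using assms
  proof (induction J rule: finite_induct)
    case (insert i J)
    have upd: "rad_sum (insert i J) u (\<epsilon>(i := s)) = rad_sum J u \<epsilon> + s *\<^sub>R u i"
      for \<epsilon> s and u :: "'i \<Rightarrow> 'c::real_vector"
    proof -
      have "(\<Sum>j\<in>J. (\<epsilon>(i := s)) j *\<^sub>R u j) = (\<Sum>j\<in>J. \<epsilon> j *\<^sub>R u j)" using insert by (intro sum.cong) auto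
      then show ?thesis unfolding rad_sum_def using insert by simp
    qed
    have "(\<Sum>\<epsilon>\<in>signs (insert i J). cblinfun_apply (rad_sum (insert i J) y \<epsilon>) (rad_sum (insert i J) x \<epsilon>))
        = (\<Sum>\<epsilon>\<in>signs J. 2 * cblinfun_apply (rad_sum J y \<epsilon>) (rad_sum J x \<epsilon>)
            + 2 * cblinfun_apply (y i) (x i))" using insert by (simp add: sum_signs_insert upd algebra_simps)
    also have "\<dots> = 2 * (2 ^ card J * (\<Sum>j\<in>J. cblinfun_apply (y j) (x j)))
        + 2 ^ card J * (2 * cblinfun_apply (y i) (x i))"
      using insert by (simp add: sum.distrib sum_distrib_left[symmetric] card_signs)
    also have "\<dots> = 2 ^ card (insert i J) * (\<Sum>j\<in>insert i J. cblinfun_apply (y j) (x j))"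
      using insert by (simp add: algebra_simps)
    finally show ?case .
  qed (simp add: rad_sum_def)
  have "2 ^ card J * cmod (\<Sum>j\<in>J. cblinfun_apply (y j) (x j))
      = cmod (\<Sum>\<epsilon>\<in>signs J. cblinfun_apply (rad_sum J y \<epsilon>) (rad_sum J x \<epsilon>))"
    by (simp add: mean norm_mult norm_power)
  also have "\<dots> \<le> (\<Sum>\<epsilon>\<in>signs J. \<bar>norm (rad_sum J y \<epsilon>)\<bar> * \<bar>norm (rad_sum J x \<epsilon>)\<bar>)"
    by (rule order_trans[OF norm_sum]) (intro sum_mono, simp add: norm_cblinfun)
  also have "\<dots> \<le> L2_set (\<lambda>\<epsilon>. norm (rad_sum J y \<epsilon>)) (signs J) * L2_set (\<lambda>\<epsilon>. norm (rad_sum J x \<epsilon>)) (signs J)"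
    by (rule L2_set_mult_ineq)
  also have "\<dots> = 2 ^ card J * (rad_norm J x * rad_norm J y)" by (simp add: rad_norm_def)
  finally show ?thesis by simp
qed

subsection \<open>Comparison with the infinite product space\<close>

lemma prob_space_signs: "prob_space (uniform_count_measure {- 1, 1 :: real})"
  by (rule prob_space_uniform_count_measure) auto

lemma rad_nn_integral:
  assumes J: "finite J" "J \<subseteq> I"
    and h: "\<And>\<omega>. h \<omega> = h (restrict \<omega> J)"
  shows "(\<integral>\<^sup>+\<omega>. h \<omega> \<partial>rad_measure I) = (\<Sum>\<epsilon>\<in>signs J. h \<epsilon> * ennreal (1 / 2 ^ card J))"
proof -
  interpret prob_space "uniform_count_measure {- 1, 1 :: real}" by (rule prob_space_signs)
  interpret product_prob_space "\<lambda>_::'a. uniform_count_measure {- 1, 1 :: real}" I by standard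
  let ?M = "Pi\<^sub>M I (\<lambda>_. uniform_count_measure {- 1, 1 :: real})"
  let ?A = "\<lambda>\<epsilon>. {\<omega>\<in>space ?M. \<forall>j\<in>J. \<omega> j \<in> {\<epsilon> j}}"
  have sp: "space ?M = signs I" by (simp add: space_PiM space_uniform_count_measure)
  have sets: "{\<epsilon> j} \<in> sets (uniform_count_measure {- 1, 1 :: real})" if "\<epsilon> \<in> signs J" "j \<in> J" for \<epsilon> j
    using PiE_mem[OF that] by (simp add: sets_uniform_count_measure)
  have meas: "?A \<epsilon> \<in> sets ?M" if "\<epsilon> \<in> signs J" for \<epsilon>
  proof (rule sets.sets_Collect_finite_All[OF _ J(1)])
    fix j assume j: "j \<in> J"
    have "(\<lambda>\<omega>. \<omega> j) -` {\<epsilon> j} \<inter> space ?M \<in> sets ?M"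
      using J j by (intro measurable_sets[OF measurable_component_singleton] sets[OF that]) auto
    also have "(\<lambda>\<omega>. \<omega> j) -` {\<epsilon> j} \<inter> space ?M = {\<omega> \<in> space ?M. \<omega> j \<in> {\<epsilon> j}}" by auto
    finally show "{\<omega> \<in> space ?M. \<omega> j \<in> {\<epsilon> j}} \<in> sets ?M" .
  qed
  have em: "emeasure ?M (?A \<epsilon>) = ennreal (1 / 2 ^ card J)" if "\<epsilon> \<in> signs J" for \<epsilon>
  proof -
    have "emeasure ?M (?A \<epsilon>) = (\<Prod>j\<in>J. emeasure (uniform_count_measure {- 1, 1 :: real}) {\<epsilon> j})"
      using J sets[OF that] by (intro emeasure_PiM_Collect) auto
    also have "\<dots> = (\<Prod>j\<in>J. ennreal (1 / 2))" using PiE_mem[OF that]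
      by (intro prod.cong refl) (subst emeasure_uniform_count_measure, auto simp: numeral_2_eq_2)
    also have "\<dots> = ennreal (1 / 2 ^ card J)"
      by (subst prod_constant, subst ennreal_power) (simp_all only: power_one_over zero_le_divide_1_iff zero_le_numeral)
    finally show ?thesis .
  qed
  have "(\<integral>\<^sup>+\<omega>. h \<omega> \<partial>rad_measure I) = (\<integral>\<^sup>+\<omega>. (\<Sum>\<epsilon>\<in>signs J. h \<epsilon> * indicator (?A \<epsilon>) \<omega>) \<partial>?M)"
    unfolding rad_measure_def
  proof (rule nn_integral_cong)
    fix \<omega> assume \<omega>: "\<omega> \<in> space ?M"
    have r: "restrict \<omega> J \<in> signs J" using \<omega> J by (auto simp: sp PiE_iff)
    have "(\<Sum>\<epsilon>\<in>signs J. h \<epsilon> * indicator (?A \<epsilon>) \<omega>)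
        = (\<Sum>\<epsilon>\<in>signs J. if \<epsilon> = restrict \<omega> J then h \<epsilon> else 0)"
    proof (rule sum.cong[OF refl])
      fix \<epsilon> assume \<epsilon>: "\<epsilon> \<in> signs J"
      have "\<omega> \<in> ?A \<epsilon> \<longleftrightarrow> \<epsilon> = restrict \<omega> J" using \<omega> \<epsilon> by (auto simp: fun_eq_iff PiE_def extensional_def)
      then show "h \<epsilon> * indicator (?A \<epsilon>) \<omega> = (if \<epsilon> = restrict \<omega> J then h \<epsilon> else 0)" by (simp add: indicator_def)
    qed
    also have "\<dots> = h \<omega>" using finite_signs[OF J(1)] r h[of \<omega>] by simp
    finally show "h \<omega> = (\<Sum>\<epsilon>\<in>signs J. h \<epsilon> * indicator (?A \<epsilon>) \<omega>)" by simp
  qed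
  also have "\<dots> = (\<Sum>\<epsilon>\<in>signs J. h \<epsilon> * emeasure ?M (?A \<epsilon>))"
    by (subst nn_integral_sum) (use meas in \<open>auto simp: nn_integral_cmult_indicator\<close>)
  also have "\<dots> = (\<Sum>\<epsilon>\<in>signs J. h \<epsilon> * ennreal (1 / 2 ^ card J))" by (intro sum.cong refl) (simp only: em)
  finally show ?thesis .
qed

lemma rad_sum_nn_integral:
  assumes J: "finite J" "J \<subseteq> I"
  shows "(\<integral>\<^sup>+\<omega>. ennreal ((norm (rad_sum J u \<omega>))\<^sup>2) \<partial>rad_measure I) = ennreal ((rad_norm J u)\<^sup>2)"
proof -
  have "rad_sum J u \<omega> = rad_sum J u (restrict \<omega> J)" for \<omega> unfolding rad_sum_def by (intro sum.cong) auto
  then have "(\<integral>\<^sup>+\<omega>. ennreal ((norm (rad_sum J u \<omega>))\<^sup>2) \<partial>rad_measure I)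
      = (\<Sum>\<epsilon>\<in>signs J. ennreal ((norm (rad_sum J u \<epsilon>))\<^sup>2) * ennreal (1 / 2 ^ card J))"
    by (intro rad_nn_integral J) metis
  also have "\<dots> = ennreal (\<Sum>\<epsilon>\<in>signs J. (norm (rad_sum J u \<epsilon>))\<^sup>2 * (1 / 2 ^ card J))"
    by (subst sum_ennreal[symmetric]) (auto simp: ennreal_mult[symmetric])
  also have "(\<Sum>\<epsilon>\<in>signs J. (norm (rad_sum J u \<epsilon>))\<^sup>2 * (1 / 2 ^ card J)) = (rad_norm J u)\<^sup>2"
    by (simp add: rad_norm_power2 sum_divide_distrib)
  finally show ?thesis .
qed

lemma rad_enorm_rad_sum:
  assumes "finite J" "J \<subseteq> I"
  shows "rad_enorm I (rad_sum J u) = ennreal (rad_norm J u)"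
  unfolding rad_enorm_def L2_enorm_def by (simp add: rad_sum_nn_integral[OF assms])

lemma L2_enorm_less_imp:
  assumes "L2_enorm M f < ennreal c" "c \<ge> 0"
  shows "(\<integral>\<^sup>+\<omega>. ennreal ((norm (f \<omega>))\<^sup>2) \<partial>M) \<le> ennreal (c\<^sup>2)"
proof (cases "(\<integral>\<^sup>+\<omega>. ennreal ((norm (f \<omega>))\<^sup>2) \<partial>M) = \<infinity>")
  case True
  then show ?thesis using assms by (simp add: L2_enorm_def)
next
  case False
  define s where "s = enn2real (\<integral>\<^sup>+\<omega>. ennreal ((norm (f \<omega>))\<^sup>2) \<partial>M)"
  have s: "(\<integral>\<^sup>+\<omega>. ennreal ((norm (f \<omega>))\<^sup>2) \<partial>M) = ennreal s"
    using False by (simp add: s_def ennreal_enn2real less_top[symmetric])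
  have s0: "s \<ge> 0" by (simp add: s_def)
  have "ennreal (sqrt s) < ennreal c" using assms(1) s s0 by (simp add: L2_enorm_def)
  then have "sqrt s < c" using s0 by (simp add: ennreal_less_iff)
  then have "s < c\<^sup>2" using s0 by (metis real_less_lsqrt real_sqrt_less_iff real_sqrt_unique less_le_trans
        assms(2) real_sqrt_abs abs_of_nonneg)
  then show ?thesis by (simp add: s ennreal_leI)
qed

lemma simple_function_rad_sum:
  fixes u :: "'i \<Rightarrow> 'b::real_vector"
  assumes J: "finite J" "J \<subseteq> I"
  shows "simple_function (rad_measure I) (rad_sum J u)"
proof -
  let ?M = "Pi\<^sub>M I (\<lambda>_. uniform_count_measure {- 1, 1 :: real})"
  have sp: "space ?M = signs I" by (simp add: space_PiM space_uniform_count_measure)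
  have "simple_function ?M (\<lambda>\<omega>. \<Sum>j\<in>J. \<omega> j *\<^sub>R u j)"
  proof (rule simple_function_sum)
    fix j assume j: "j \<in> J"
    have "simple_function ?M (\<lambda>\<omega>. \<omega> j)" unfolding simple_function_def
    proof (intro conjI ballI)
      have "(\<lambda>\<omega>. \<omega> j) ` space ?M \<subseteq> {- 1, 1}" using J j by (auto simp: sp PiE_iff)
      then show "finite ((\<lambda>\<omega>. \<omega> j) ` space ?M)" by (rule finite_subset) auto
      fix s assume "s \<in> (\<lambda>\<omega>. \<omega> j) ` space ?M"
      then have "s \<in> {- 1, 1}" using J j by (auto simp: sp PiE_iff)
      then have "{s} \<in> sets (uniform_count_measure {- 1, 1 :: real})" by (auto simp: sets_uniform_count_measure)
      then show "(\<lambda>\<omega>. \<omega> j) -` {s} \<inter> space ?M \<in> sets ?M"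
        using J j by (intro measurable_sets[OF measurable_component_singleton]) auto
    qed
    then show "simple_function ?M (\<lambda>\<omega>. \<omega> j *\<^sub>R u j)" by (rule simple_function_compose1)
  qed
  then show ?thesis by (simp add: rad_measure_def rad_sum_def)
qed

text \<open>The partial sums of a Rademacher series are dominated by its sum.\<close>

lemma rad_norm_le_rad_series_enorm:
  fixes u :: "'i \<Rightarrow> 'b::banach"
  assumes le: "rad_series_enorm I u \<le> ennreal c" and c: "c \<ge> 0"
    and J: "finite J" "J \<subseteq> I"
  shows "rad_norm J u \<le> c"
proof -
  have "\<exists>F. has_rad_sum I u F" using le by (auto simp: rad_series_enorm_def top_unique split: if_splits)
  then have "has_rad_sum I u (SOME F. has_rad_sum I u F)" by (rule someI_ex)
  moreover have "rad_enorm I (SOME F. has_rad_sum I u F) \<le> ennreal c"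
    using le \<open>\<exists>F. has_rad_sum I u F\<close> by (simp add: rad_series_enorm_def)
  ultimately obtain F where F: "has_rad_sum I u F" "rad_enorm I F \<le> ennreal c" by blast
  have bound: "rad_norm J u \<le> c + e" if e: "e > 0" for e
  proof -
    define d where "d = e / 2"
    have d: "d > 0" using e by (simp add: d_def)
    let ?M = "rad_measure I"
    define near where "near K \<longleftrightarrow> rad_enorm I (\<lambda>\<omega>. F \<omega> - rad_sum K u \<omega>) < ennreal d" for K
    have "((\<lambda>J. rad_enorm I (\<lambda>\<omega>. F \<omega> - rad_sum J u \<omega>)) \<longlongrightarrow> 0) (finite_subsets_at_top I)"
      using F(1) by (simp add: has_rad_sum_def)
    then have "\<forall>\<^sub>F K in finite_subsets_at_top I. near K"
      unfolding near_def by (rule order_tendstoD(2)) (use d in simp)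
    then have "\<exists>X. finite X \<and> X \<subseteq> I \<and> (\<forall>Y. finite Y \<and> X \<subseteq> Y \<and> Y \<subseteq> I \<longrightarrow> near Y)"
      by (simp only: eventually_finite_subsets_at_top)
    then obtain K0 where K0: "finite K0 \<and> K0 \<subseteq> I \<and> (\<forall>Y. finite Y \<and> K0 \<subseteq> Y \<and> Y \<subseteq> I \<longrightarrow> near Y)" ..
    define K where "K = K0 \<union> J"
    have K: "finite K" "K \<subseteq> I" "J \<subseteq> K" using K0 J by (simp_all add: K_def)
    have G: "(\<integral>\<^sup>+\<omega>. ennreal ((norm (F \<omega> - rad_sum K u \<omega>))\<^sup>2) \<partial>?M) \<le> ennreal (d\<^sup>2)"

    proof (rule L2_enorm_less_imp)
      have "near K" using K0 K by (simp add: K_def)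
      then show "L2_enorm ?M (\<lambda>\<omega>. F \<omega> - rad_sum K u \<omega>) < ennreal d" by (simp add: near_def rad_enorm_def)
    qed (use d in simp)
    have "rad_enorm I F < ennreal (c + d)"
      using F(2) c d by (auto intro!: le_less_trans[OF F(2)] simp: ennreal_less_iff)
    then have FI: "(\<integral>\<^sup>+\<omega>. ennreal ((norm (F \<omega>))\<^sup>2) \<partial>?M) \<le> ennreal ((c + d)\<^sup>2)"
      using c d by (intro L2_enorm_less_imp) (auto simp: rad_enorm_def)
    have sF: "strongly_measurable ?M F" using F(1) by (auto simp: has_rad_sum_def Rad_def)
    have [measurable]: "(\<lambda>\<omega>. norm (F \<omega>)) \<in> borel_measurable ?M"
      "(\<lambda>\<omega>. norm (F \<omega> - rad_sum K u \<omega>)) \<in> borel_measurable ?M"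
      using K by (auto intro!: strongly_measurable_norm strongly_measurable_diff_simple
          sF simple_function_rad_sum)
    \<comment> \<open>Minkowski's inequality in the form
      $(a + b)^2 \<le> (1 + t) a^2 + (1 + 1/t) b^2$ with \<open>t = d / (c + d)\<close>\<close>
    define A B where "A = (c + 2 * d) / (c + d)" and "B = (c + 2 * d) / d"
    have AB: "A \<ge> 0" "B \<ge> 0" using c d by (auto simp: A_def B_def)
    have ineq: "(a + b)\<^sup>2 \<le> A * a\<^sup>2 + B * b\<^sup>2" for a b :: real
    proof -
      have e: "A * (c + d) = c + 2 * d" "B * d = c + 2 * d" using c d by (auto simp: A_def B_def)
      have "(A * a\<^sup>2 + B * b\<^sup>2 - (a + b)\<^sup>2) * (d * (c + d))
          = (A * (c + d)) * (d * a\<^sup>2) + (B * d) * ((c + d) * b\<^sup>2) - (a + b)\<^sup>2 * (d * (c + d))"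
        by (simp add: algebra_simps)
      also have "\<dots> = (d * a - (c + d) * b)\<^sup>2" unfolding e by (simp add: power2_eq_square algebra_simps)
      finally have "0 \<le> (A * a\<^sup>2 + B * b\<^sup>2 - (a + b)\<^sup>2) * (d * (c + d))" by simp
      moreover have "0 < d * (c + d)" using c d by simp
      ultimately have "0 \<le> A * a\<^sup>2 + B * b\<^sup>2 - (a + b)\<^sup>2" by (metis linorder_not_le mult_less_0_iff)
      then show ?thesis by simp
    qed
    have "ennreal ((rad_norm K u)\<^sup>2) = (\<integral>\<^sup>+\<omega>. ennreal ((norm (rad_sum K u \<omega>))\<^sup>2) \<partial>?M)"
      using K by (intro rad_sum_nn_integral[symmetric])
    also have "\<dots> \<le> (\<integral>\<^sup>+\<omega>. ennreal A * ennreal ((norm (F \<omega>))\<^sup>2)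
        + ennreal B * ennreal ((norm (F \<omega> - rad_sum K u \<omega>))\<^sup>2) \<partial>?M)"
    proof (rule nn_integral_mono)
      fix \<omega>
      have "norm (rad_sum K u \<omega>) \<le> norm (F \<omega>) + norm (F \<omega> - rad_sum K u \<omega>)"
        using norm_triangle_ineq4[of "F \<omega>" "F \<omega> - rad_sum K u \<omega>"] by simp
      then have "(norm (rad_sum K u \<omega>))\<^sup>2 \<le> (norm (F \<omega>) + norm (F \<omega> - rad_sum K u \<omega>))\<^sup>2"
        by (intro power_mono) auto
      also note ineq
      finally show "ennreal ((norm (rad_sum K u \<omega>))\<^sup>2) \<le> ennreal A * ennreal ((norm (F \<omega>))\<^sup>2)
          + ennreal B * ennreal ((norm (F \<omega> - rad_sum K u \<omega>))\<^sup>2)"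
        using AB by (simp add: ennreal_mult[symmetric] ennreal_plus[symmetric] ennreal_leI del: ennreal_plus)
    qed
    also have "\<dots> = ennreal A * (\<integral>\<^sup>+\<omega>. ennreal ((norm (F \<omega>))\<^sup>2) \<partial>?M)
        + ennreal B * (\<integral>\<^sup>+\<omega>. ennreal ((norm (F \<omega> - rad_sum K u \<omega>))\<^sup>2) \<partial>?M)"
      by (subst nn_integral_add, measurable) (subst (1 2) nn_integral_cmult, measurable)
    also have "\<dots> \<le> ennreal A * ennreal ((c + d)\<^sup>2) + ennreal B * ennreal (d\<^sup>2)"
      by (intro add_mono mult_left_mono FI G) auto
    also have "\<dots> = ennreal (A * (c + d)\<^sup>2 + B * d\<^sup>2)"
      using AB by (simp add: ennreal_mult[symmetric] ennreal_plus[symmetric] del: ennreal_plus)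
    also have "A * (c + d)\<^sup>2 + B * d\<^sup>2 = (A * (c + d)) * (c + d) + (B * d) * d"
      by (simp add: power2_eq_square algebra_simps)
    also have "\<dots> = (c + 2 * d)\<^sup>2"
    proof -
      have "A * (c + d) = c + 2 * d" "B * d = c + 2 * d" using c d by (auto simp: A_def B_def)
      then show ?thesis by (simp only: power2_eq_square) (simp add: algebra_simps)
    qed
    finally have "(rad_norm K u)\<^sup>2 \<le> (c + 2 * d)\<^sup>2" by simp
    then have "rad_norm K u \<le> c + 2 * d" by (rule power2_le_imp_le) (use c d in simp)
    then show ?thesis using rad_norm_mono[OF K(3,1), of u] by (simp add: d_def)
  qed
  show ?thesis by (rule field_le_epsilon) (rule bound)
qed


section \<open>R-boundedness\<close>

definition R_bound :: "('a::complex_banach, 'a) cblinfun set \<Rightarrow> real \<Rightarrow> bool" where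
  "R_bound E C \<longleftrightarrow> C \<ge> 0 \<and> (\<forall>(J :: nat set) S x. finite J \<longrightarrow> (\<forall>k\<in>J. S k \<in> E) \<longrightarrow>
     rad_norm J (\<lambda>k. cblinfun_apply (S k) (x k)) \<le> C * rad_norm J x)"

lemma R_bound_nonneg: "R_bound E C \<Longrightarrow> C \<ge> 0" by (simp add: R_bound_def)

lemma R_boundD:
  assumes "R_bound E C" "finite J" "\<And>k. k \<in> J \<Longrightarrow> S k \<in> E"
  shows "rad_norm J (\<lambda>k. cblinfun_apply (S k) (x k)) \<le> C * rad_norm J x"
proof -
  obtain \<pi> :: "nat \<Rightarrow> 'b" where \<pi>: "bij_betw \<pi> {0..<card J} J" using ex_bij_betw_nat_finite[OF assms(2)] by blast
  have "S (\<pi> k) \<in> E" if "k \<in> {0..<card J}" for k using assms(3) bij_betw_apply[OF \<pi> that] by blast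
  then show ?thesis using assms(1) unfolding R_bound_def rad_norm_reindex[OF \<pi>] by auto
qed

lemma R_bounded_imp_R_bound:
  assumes "R_bounded E"
  obtains C where "R_bound E C"
proof -
  obtain C where C: "C \<ge> 0" "\<And>n S x. n \<ge> 1 \<Longrightarrow> (\<forall>k\<in>{1..n}. S k \<in> E) \<Longrightarrow>
      rad_enorm {1::nat..} (rad_sum {1..n} (\<lambda>k. cblinfun_apply (S k) (x k)))
       \<le> ennreal C * rad_enorm {1..} (rad_sum {1..n} x)" using assms unfolding R_bounded_def by blast
  have "R_bound E C" unfolding R_bound_def
  proof (intro conjI allI impI C(1))
    fix J :: "nat set" and S and x :: "nat \<Rightarrow> 'a"
    assume J: "finite J" "\<forall>k\<in>J. S k \<in> E"
    show "rad_norm J (\<lambda>k. cblinfun_apply (S k) (x k)) \<le> C * rad_norm J x"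
    proof (cases "J = {}")
      case True
      then show ?thesis using C(1) by (simp add: rad_norm_def rad_sum_def L2_set_def)
    next
      case False
      obtain \<pi> :: "nat \<Rightarrow> nat" where \<pi>: "bij_betw \<pi> {1..card J} J"
        using ex_bij_betw_nat_finite_1[OF J(1)] by blast
      have n: "card J \<ge> 1" using False J(1) by (simp add: Suc_le_eq card_gt_0_iff)
      have "\<forall>k\<in>{1..card J}. S (\<pi> k) \<in> E" using J(2) bij_betw_apply[OF \<pi>] by blast
      from C(2)[OF n this, of "\<lambda>k. x (\<pi> k)"]
      have "ennreal (rad_norm {1..card J} (\<lambda>k. cblinfun_apply (S (\<pi> k)) (x (\<pi> k))))
          \<le> ennreal (C * rad_norm {1..card J} (\<lambda>k. x (\<pi> k)))"
        using C(1) by (subst (asm) (1 2) rad_enorm_rad_sum) (auto simp: ennreal_mult)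
      then show ?thesis using C(1) by (simp add: rad_norm_reindex[OF \<pi>])
    qed
  qed
  then show ?thesis using that by blast
qed

lemma R_bound_imp_R_bounded:
  assumes "R_bound E C"
  shows "R_bounded E" unfolding R_bounded_def
proof (intro exI[of _ C] conjI allI impI)
  show C: "C \<ge> 0" using assms by (rule R_bound_nonneg)
  fix n :: nat and S and x :: "nat \<Rightarrow> 'a"
  assume S: "\<forall>k\<in>{1..n}. S k \<in> E"
  have "rad_norm {1..n} (\<lambda>k. cblinfun_apply (S k) (x k)) \<le> C * rad_norm {1..n} x"
    using S by (intro R_boundD[OF assms]) auto
  then have "ennreal (rad_norm {1..n} (\<lambda>k. cblinfun_apply (S k) (x k)))
      \<le> ennreal C * ennreal (rad_norm {1..n} x)" using C by (simp add: ennreal_mult[symmetric] ennreal_leI)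
  then show "rad_enorm {1::nat..} (rad_sum {1..n} (\<lambda>k. cblinfun_apply (S k) (x k)))
       \<le> ennreal C * rad_enorm {1..} (rad_sum {1..n} x)" by (subst (1 2) rad_enorm_rad_sum) auto
qed

lemma R_bound_subset: "R_bound E C \<Longrightarrow> F \<subseteq> E \<Longrightarrow> R_bound F C" unfolding R_bound_def by blast

lemma R_bound_norm:
  assumes "R_bound E C" "A \<in> E"
  shows "norm A \<le> C"
proof (rule norm_cblinfun_bound)
  show "C \<ge> 0" using assms(1) by (rule R_bound_nonneg)
  fix x
  have one: "rad_norm {0::nat} (\<lambda>_. v) = norm v" for v :: 'a
  proof -
    have "(rad_norm {0::nat} (\<lambda>_. v))\<^sup>2 = (norm v)\<^sup>2"
      by (simp add: rad_norm_power2 sum_signs_insert rad_sum_def)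
    then show ?thesis by simp
  qed
  show "norm (cblinfun_apply A x) \<le> C * norm x"
    using R_boundD[OF assms(1), of "{0::nat}" "\<lambda>_. A" "\<lambda>_. x"] assms(2) by (simp add: one)
qed

lemma R_bound_compose:
  assumes "R_bound E C" "R_bound F D" "\<And>A. A \<in> G \<Longrightarrow> \<exists>B\<in>E. \<exists>B'\<in>F. A = B o\<^sub>C B'"
  shows "R_bound G (C * D)" unfolding R_bound_def
proof (intro conjI allI impI)
  show "C * D \<ge> 0" using R_bound_nonneg[OF assms(1)] R_bound_nonneg[OF assms(2)] by simp
  fix J :: "nat set" and S and x :: "nat \<Rightarrow> 'a"
  assume J: "finite J" "\<forall>k\<in>J. S k \<in> G"
  have "\<exists>p. fst p \<in> E \<and> snd p \<in> F \<and> S k = fst p o\<^sub>C snd p" if "k \<in> J" for k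
    using assms(3)[of "S k"] J(2) that by auto
  then obtain p where p: "\<And>k. k \<in> J \<Longrightarrow> fst (p k) \<in> E \<and> snd (p k) \<in> F \<and> S k = fst (p k) o\<^sub>C snd (p k)" by metis
  define B B' where "B k = fst (p k)" and "B' k = snd (p k)" for k
  with p have B: "\<And>k. k \<in> J \<Longrightarrow> B k \<in> E" "\<And>k. k \<in> J \<Longrightarrow> B' k \<in> F"
    "\<And>k. k \<in> J \<Longrightarrow> S k = B k o\<^sub>C B' k" by auto
  have "rad_norm J (\<lambda>k. cblinfun_apply (S k) (x k))
      = rad_norm J (\<lambda>k. cblinfun_apply (B k) (cblinfun_apply (B' k) (x k)))"
    using B by (intro rad_norm_cong) simp
  also have "\<dots> \<le> C * rad_norm J (\<lambda>k. cblinfun_apply (B' k) (x k))" by (rule R_boundD[OF assms(1) J(1) B(1)])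
  also have "\<dots> \<le> C * (D * rad_norm J x)"
    by (rule mult_left_mono[OF R_boundD[OF assms(2) J(1) B(2)] R_bound_nonneg[OF assms(1)]])
  finally show "rad_norm J (\<lambda>k. cblinfun_apply (S k) (x k)) \<le> C * D * rad_norm J x" by (simp add: mult.assoc)
qed

lemma R_bound_add:
  assumes "R_bound E C" "R_bound F D" "\<And>A. A \<in> G \<Longrightarrow> \<exists>B\<in>E. \<exists>B'\<in>F. A = B + B'"
  shows "R_bound G (C + D)" unfolding R_bound_def
proof (intro conjI allI impI)
  show "C + D \<ge> 0" using R_bound_nonneg[OF assms(1)] R_bound_nonneg[OF assms(2)] by simp
  fix J :: "nat set" and S and x :: "nat \<Rightarrow> 'a"
  assume J: "finite J" "\<forall>k\<in>J. S k \<in> G"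
  have "\<exists>p. fst p \<in> E \<and> snd p \<in> F \<and> S k = fst p + snd p" if "k \<in> J" for k
    using assms(3)[of "S k"] J(2) that by auto
  then obtain p where p: "\<And>k. k \<in> J \<Longrightarrow> fst (p k) \<in> E \<and> snd (p k) \<in> F \<and> S k = fst (p k) + snd (p k)" by metis
  define B B' where "B k = fst (p k)" and "B' k = snd (p k)" for k
  with p have B: "\<And>k. k \<in> J \<Longrightarrow> B k \<in> E" "\<And>k. k \<in> J \<Longrightarrow> B' k \<in> F"
    "\<And>k. k \<in> J \<Longrightarrow> S k = B k + B' k" by auto
  have "rad_norm J (\<lambda>k. cblinfun_apply (S k) (x k))
      = rad_norm J (\<lambda>k. cblinfun_apply (B k) (x k) + cblinfun_apply (B' k) (x k))"
    using B by (intro rad_norm_cong) simp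
  also have "\<dots> \<le> rad_norm J (\<lambda>k. cblinfun_apply (B k) (x k)) + rad_norm J (\<lambda>k. cblinfun_apply (B' k) (x k))"
    by (rule rad_norm_triangle)
  also have "\<dots> \<le> C * rad_norm J x + D * rad_norm J x"
    by (rule add_mono[OF R_boundD[OF assms(1) J(1) B(1)] R_boundD[OF assms(2) J(1) B(2)]])
  finally show "rad_norm J (\<lambda>k. cblinfun_apply (S k) (x k)) \<le> (C + D) * rad_norm J x"
    by (simp add: algebra_simps)
qed

lemma R_bound_scale:
  assumes "R_bound E C" "r \<ge> 0" "\<And>A. A \<in> G \<Longrightarrow> \<exists>B\<in>E. A = r *\<^sub>R B"
  shows "R_bound G (r * C)" unfolding R_bound_def
proof (intro conjI allI impI)
  show "r * C \<ge> 0" using R_bound_nonneg[OF assms(1)] assms(2) by simp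
  fix J :: "nat set" and S and x :: "nat \<Rightarrow> 'a"
  assume J: "finite J" "\<forall>k\<in>J. S k \<in> G"
  have "\<forall>k\<in>J. \<exists>B. B \<in> E \<and> S k = r *\<^sub>R B" using assms(3) J(2) by blast
  from bchoice[OF this] obtain B where "\<forall>k\<in>J. B k \<in> E \<and> S k = r *\<^sub>R B k" ..
  then have B: "\<And>k. k \<in> J \<Longrightarrow> B k \<in> E" "\<And>k. k \<in> J \<Longrightarrow> S k = r *\<^sub>R B k" by auto
  have "rad_norm J (\<lambda>k. cblinfun_apply (S k) (x k)) = rad_norm J (\<lambda>k. r *\<^sub>R cblinfun_apply (B k) (x k))"
    using B by (intro rad_norm_cong) simp
  also have "\<dots> = r * rad_norm J (\<lambda>k. cblinfun_apply (B k) (x k))" using assms(2) by (simp add: rad_norm_scaleR)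
  also have "\<dots> \<le> r * (C * rad_norm J x)" by (rule mult_left_mono[OF R_boundD[OF assms(1) J(1) B(1)] assms(2)])
  finally show "rad_norm J (\<lambda>k. cblinfun_apply (S k) (x k)) \<le> r * C * rad_norm J x" by (simp add: mult.assoc)
qed

text \<open>As a function of one of the operators, the Rademacher average is convex and continuous.
  Hence the operators can be replaced one after the other by elements of the closed convex hull.\<close>

lemma R_bound_closure_convex_hull:
  assumes E: "R_bound E C"
  shows "R_bound (closure (convex hull E)) C" unfolding R_bound_def
proof (intro conjI allI impI)
  show "C \<ge> 0" using E by (rule R_bound_nonneg)
  fix J :: "nat set" and S and x :: "nat \<Rightarrow> 'a"
  assume J: "finite J" and S: "\<forall>k\<in>J. S k \<in> closure (convex hull E)"
  have "rad_norm J (\<lambda>k. cblinfun_apply (S k) (x k)) \<le> C * rad_norm J x"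
    if "L \<subseteq> J" "\<forall>k\<in>L. S k \<in> closure (convex hull E)" "\<forall>k\<in>J - L. S k \<in> E" for L S
    using finite_subset[OF that(1) J] that
  proof (induction L arbitrary: S rule: finite_induct)
    case empty
    then show ?case by (intro R_boundD[OF E] J) auto
  next
    case (insert i L)
    define p where "p A = rad_norm J (\<lambda>k. cblinfun_apply ((S(i := A)) k) (x k))" for A
    define G where "G = {A. p A \<le> C * rad_norm J x}"
    have conv: "convex G" unfolding convex_alt
    proof (intro ballI allI impI)
      fix A B and t :: real assume AB: "A \<in> G" "B \<in> G" and t: "0 \<le> t \<and> t \<le> 1"
      have "p ((1 - t) *\<^sub>R A + t *\<^sub>R B) = rad_norm J (\<lambda>k.
          (1 - t) *\<^sub>R cblinfun_apply ((S(i := A)) k) (x k) + t *\<^sub>R cblinfun_apply ((S(i := B)) k) (x k))"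
        unfolding p_def by (intro rad_norm_cong) (auto simp: scaleR_left_diff_distrib)
      also have "\<dots> \<le> (1 - t) * p A + t * p B"
        using t by (intro order_trans[OF rad_norm_triangle]) (auto simp: rad_norm_scaleR p_def)
      also have "\<dots> \<le> (1 - t) * (C * rad_norm J x) + t * (C * rad_norm J x)"
        using AB t by (intro add_mono mult_left_mono) (auto simp: G_def)
      finally show "(1 - t) *\<^sub>R A + t *\<^sub>R B \<in> G" by (simp add: G_def algebra_simps)
    qed
    have "continuous_on UNIV p" unfolding p_def rad_norm_def L2_set_def rad_sum_def
    proof (intro continuous_intros)
      fix k
      show "continuous_on UNIV (\<lambda>A. cblinfun_apply ((S(i := A)) k) (x k))"
        by (cases "k = i") (auto intro!: bounded_linear.continuous_on[OF apply_bilinear.bounded_linear_left]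
            continuous_intros)
    qed auto
    then have "closed G" unfolding G_def by (intro closed_Collect_le continuous_intros)
    moreover have "E \<subseteq> G"
    proof
      fix A assume A: "A \<in> E"
      have "p A \<le> C * rad_norm J x" unfolding p_def using insert.prems insert.hyps A by (intro insert.IH) auto
      then show "A \<in> G" by (simp add: G_def)
    qed
    ultimately have "closure (convex hull E) \<subseteq> G" using conv by (intro closure_minimal hull_minimal) auto
    then have "S i \<in> G" using insert.prems by auto
    then show ?case unfolding G_def p_def by (simp only: fun_upd_triv mem_Collect_eq)
  qed
  from this[of J S] show "rad_norm J (\<lambda>k. cblinfun_apply (S k) (x k)) \<le> C * rad_norm J x" using S by auto
qed

lemma R_bound_contraction_real:
  assumes E: "R_bound E C" and G: "\<And>A. A \<in> G \<Longrightarrow> \<exists>t B. \<bar>t\<bar> \<le> 1 \<and> B \<in> E \<and> A = t *\<^sub>R B"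
  shows "R_bound G C"
proof -
  have "R_bound (E \<union> uminus ` E) C" unfolding R_bound_def
  proof (intro conjI allI impI)
    show "C \<ge> 0" using E by (rule R_bound_nonneg)
    fix J :: "nat set" and S and x :: "nat \<Rightarrow> 'a"
    assume J: "finite J" and S: "\<forall>k\<in>J. S k \<in> E \<union> uminus ` E"
    define s :: "nat \<Rightarrow> real" where "s k = (if S k \<in> E then 1 else - 1)" for k
    have sS: "s k *\<^sub>R S k \<in> E" if "k \<in> J" for k using S that by (auto simp: s_def)
    have "rad_norm J (\<lambda>k. cblinfun_apply (S k) (x k))
        = rad_norm J (\<lambda>k. s k *\<^sub>R cblinfun_apply (s k *\<^sub>R S k) (x k))"
      by (intro rad_norm_cong) (auto simp: s_def)
    also have "\<dots> = rad_norm J (\<lambda>k. cblinfun_apply (s k *\<^sub>R S k) (x k))"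
      by (rule rad_norm_sign_change) (simp add: s_def)
    also have "\<dots> \<le> C * rad_norm J x" using sS by (intro R_boundD[OF E] J)
    finally show "rad_norm J (\<lambda>k. cblinfun_apply (S k) (x k)) \<le> C * rad_norm J x" .
  qed
  note R_bound_closure_convex_hull[OF this]
  moreover have "G \<subseteq> closure (convex hull (E \<union> uminus ` E))"
  proof
    fix A assume "A \<in> G"
    then obtain t B where A: "\<bar>t\<bar> \<le> 1" "B \<in> E" "A = t *\<^sub>R B" using G by blast
    have "((1 + t) / 2) *\<^sub>R B + ((1 - t) / 2) *\<^sub>R (- B) \<in> convex hull (E \<union> uminus ` E)"
      using A by (intro convexD[OF convex_convex_hull] hull_inc) (auto simp: field_simps)
    also have "((1 + t) / 2) *\<^sub>R B + ((1 - t) / 2) *\<^sub>R (- B) = t *\<^sub>R B"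
      by (simp flip: scaleR_minus_left scaleR_add_left add: field_simps)
    finally show "A \<in> closure (convex hull (E \<union> uminus ` E))" using A(3) closure_subset by blast
  qed
  ultimately show ?thesis by (rule R_bound_subset)
qed

lemma R_bound_contraction_complex:
  assumes E: "R_bound E C" and G: "\<And>A. A \<in> G \<Longrightarrow> \<exists>c B. cmod c \<le> 1 \<and> B \<in> E \<and> A = c *\<^sub>C B"
  shows "R_bound G (2 * C)"
proof -
  define E' where "E' = {t *\<^sub>R B | t B. \<bar>t\<bar> \<le> 1 \<and> B \<in> E}"
  have E': "R_bound E' C" by (rule R_bound_contraction_real[OF E]) (auto simp: E'_def)
  have "R_bound ((\<lambda>A. \<i> *\<^sub>C A) ` E') C" unfolding R_bound_def
  proof (intro conjI allI impI)
    show "C \<ge> 0" using E by (rule R_bound_nonneg)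
    fix J :: "nat set" and S and x :: "nat \<Rightarrow> 'a"
    assume J: "finite J" and S: "\<forall>k\<in>J. S k \<in> (\<lambda>A. \<i> *\<^sub>C A) ` E'"
    then have "\<forall>k\<in>J. \<exists>B. B \<in> E' \<and> S k = \<i> *\<^sub>C B" by blast
    from bchoice[OF this] obtain B where "\<forall>k\<in>J. B k \<in> E' \<and> S k = \<i> *\<^sub>C B k" ..
    then have B: "\<And>k. k \<in> J \<Longrightarrow> B k \<in> E' \<and> S k = \<i> *\<^sub>C B k" by auto
    have "rad_norm J (\<lambda>k. cblinfun_apply (S k) (x k)) = rad_norm J (\<lambda>k. \<i> *\<^sub>C cblinfun_apply (B k) (x k))"
      using B by (intro rad_norm_cong) simp
    also have "\<dots> \<le> C * rad_norm J x" using B by (simp add: rad_norm_scaleC R_boundD[OF E' J])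
    finally show "rad_norm J (\<lambda>k. cblinfun_apply (S k) (x k)) \<le> C * rad_norm J x" .
  qed
  then have "R_bound G (C + C)"
  proof (rule R_bound_add[OF E'])
    fix A assume "A \<in> G"
    then obtain c B where A: "cmod c \<le> 1" "B \<in> E" "A = c *\<^sub>C B" using G by blast
    have "A = Re c *\<^sub>R B + \<i> *\<^sub>C (Im c *\<^sub>R B)" unfolding A(3) by (subst complex_eq[of c])
        (simp add: scaleC_add_left flip: scaleC_of_real scaleC_scaleC)
    moreover have "\<bar>Re c\<bar> \<le> 1" "\<bar>Im c\<bar> \<le> 1" using A(1) abs_Re_le_cmod[of c] abs_Im_le_cmod[of c] by auto
    ultimately show "\<exists>B\<in>E'. \<exists>B'\<in>(\<lambda>A. \<i> *\<^sub>C A) ` E'. A = B + B'" using A(2) by (auto simp: E'_def)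
  qed
  then show ?thesis by simp
qed

text \<open>Absolutely convergent combinations with uniformly bounded coefficient sums preserve
  R-boundedness, since after normalisation they lie in the closed absolutely convex hull.\<close>

lemma R_bound_series:
  fixes E :: "('a::complex_banach, 'a) cblinfun set"
  assumes E: "R_bound E C" and M: "M > 0"
    and G: "\<And>B. B \<in> G \<Longrightarrow> \<exists>c A. (\<forall>n::nat. A n \<in> E) \<and> (\<forall>m. (\<Sum>n<m. cmod (c n)) \<le> M)
      \<and> (\<lambda>n. c n *\<^sub>C A n) sums B"
  shows "R_bound G (M * (2 * C))"
proof -
  define E' where "E' = {c *\<^sub>C B | c B. cmod c \<le> 1 \<and> B \<in> E}"
  have "R_bound E' (2 * C)" by (rule R_bound_contraction_complex[OF E]) (auto simp: E'_def)
  then have "R_bound (closure (convex hull E')) (2 * C)" by (rule R_bound_closure_convex_hull)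
  then show ?thesis
  proof (rule R_bound_scale)
    fix B assume "B \<in> G"
    then obtain c A where cA: "\<And>n::nat. A n \<in> E" "\<And>m. (\<Sum>n<m. cmod (c n)) \<le> M"
      "(\<lambda>n. c n *\<^sub>C A n) sums B" using G by meson
    have mem: "(1 / M) *\<^sub>R (\<Sum>n<m. c n *\<^sub>C A n) \<in> convex hull E'" for m
    proof -
      define s where "s = (\<Sum>n<m. cmod (c n)) / M"
      define w where "w n = (if n = m then 1 - s else cmod (c n) / M)" for n
      define D where "D n = (if n = m then 0 else sgn (c n)) *\<^sub>C A n" for n
      have s: "s \<le> 1" using cA(2)[of m] M by (simp add: s_def)
      have "(\<Sum>n\<in>{..m}. w n *\<^sub>R D n) \<in> convex hull E'"
      proof (rule convex_sum[OF _ convex_convex_hull])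
        have "sum w {..m} = sum w {..<m} + w m" by (simp add: lessThan_Suc_atMost[symmetric])
        also have "sum w {..<m} = s" by (simp add: w_def s_def sum_divide_distrib)
        finally show "sum w {..m} = 1" by (simp add: w_def)
        show "0 \<le> w n" if "n \<in> {..m}" for n using s M by (simp add: w_def)
        show "D n \<in> convex hull E'" for n
        proof (rule hull_inc)
          show "D n \<in> E'" unfolding D_def E'_def
            by (intro CollectI exI[of _ "if n = m then 0 else sgn (c n)"] exI[of _ "A n"])
              (simp add: norm_sgn cA(1))
        qed
      qed auto
      also have "(\<Sum>n\<in>{..m}. w n *\<^sub>R D n) = (\<Sum>n<m. w n *\<^sub>R D n)"
        by (simp add: lessThan_Suc_atMost[symmetric] D_def)
      also have "\<dots> = (\<Sum>n<m. (1 / M) *\<^sub>R (c n *\<^sub>C A n))"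
      proof (intro sum.cong refl)
        fix n assume "n \<in> {..<m}"
        then show "w n *\<^sub>R D n = (1 / M) *\<^sub>R (c n *\<^sub>C A n)"
          by (simp add: w_def D_def scaleC_scaleC flip: scaleC_of_real)
             (simp add: sgn_eq mult.commute)
      qed
      finally show ?thesis by (simp add: scaleR_sum_right)
    qed
    have "(\<lambda>m. (1 / M) *\<^sub>R (\<Sum>n<m. c n *\<^sub>C A n)) \<longlonglongrightarrow> (1 / M) *\<^sub>R B"
      using cA(3) unfolding sums_def by (intro tendsto_intros)
    then have "(1 / M) *\<^sub>R B \<in> closure (convex hull E')"
      using mem by (intro closure_sequential[THEN iffD2] exI[of _ "\<lambda>m. (1 / M) *\<^sub>R (\<Sum>n<m. c n *\<^sub>C A n)"])
        auto
    then show "\<exists>B'\<in>closure (convex hull E'). B = M *\<^sub>R B'" using M by (intro bexI[of _ "(1 / M) *\<^sub>R B"]) auto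
  qed (use M in simp)
qed

text \<open>Pairing with a second Rademacher sum, R-boundedness controls the sum of the absolute values
  of the terms, because moduli can be removed by choosing signs.\<close>

lemma R_bound_pairing:
  fixes x :: "'i \<Rightarrow> 'a::complex_banach" and y :: "'i \<Rightarrow> ('a, complex) cblinfun"
  assumes E: "R_bound E C" and J: "finite J" and S: "\<And>j. j \<in> J \<Longrightarrow> S j \<in> E"
  shows "(\<Sum>j\<in>J. cmod (cblinfun_apply (y j) (cblinfun_apply (S j) (x j))))
    \<le> 2 * C * (rad_norm J x * rad_norm J y)"
proof -
  let ?z = "\<lambda>j. cblinfun_apply (y j) (cblinfun_apply (S j) (x j))"
  have signed: "cmod (\<Sum>j\<in>J. s j *\<^sub>R ?z j) \<le> C * (rad_norm J x * rad_norm J y)"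
    if s: "\<And>j. s j = 1 \<or> s j = (- 1 :: real)" for s
  proof -
    have "cmod (\<Sum>j\<in>J. s j *\<^sub>R ?z j)
        = cmod (\<Sum>j\<in>J. cblinfun_apply (s j *\<^sub>R y j) (cblinfun_apply (S j) (x j)))" by simp
    also have "\<dots> \<le> rad_norm J (\<lambda>j. cblinfun_apply (S j) (x j)) * rad_norm J (\<lambda>j. s j *\<^sub>R y j)"
      by (rule sum_pairing_le_rad_norm[OF J])
    also have "rad_norm J (\<lambda>j. s j *\<^sub>R y j) = rad_norm J y" using s by (rule rad_norm_sign_change)
    also have "rad_norm J (\<lambda>j. cblinfun_apply (S j) (x j)) * rad_norm J y
        \<le> (C * rad_norm J x) * rad_norm J y" by (rule mult_right_mono[OF R_boundD[OF E J S] rad_norm_nonneg])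
    finally show ?thesis by (simp add: mult.assoc)
  qed
  have sgn_abs: "(if a \<ge> 0 then 1 else - 1) * a = \<bar>a\<bar>" for a :: real by simp
  define s where "s j = (if Re (?z j) \<ge> 0 then 1 else - 1 :: real)" for j
  define t where "t j = (if Im (?z j) \<ge> 0 then 1 else - 1 :: real)" for j
  have "(\<Sum>j\<in>J. cmod (?z j)) \<le> (\<Sum>j\<in>J. \<bar>Re (?z j)\<bar> + \<bar>Im (?z j)\<bar>)" by (intro sum_mono cmod_le)
  also have "\<dots> = Re (\<Sum>j\<in>J. s j *\<^sub>R ?z j) + Im (\<Sum>j\<in>J. t j *\<^sub>R ?z j)"
    by (simp add: sum.distrib s_def t_def sgn_abs)
  also have "\<dots> \<le> cmod (\<Sum>j\<in>J. s j *\<^sub>R ?z j) + cmod (\<Sum>j\<in>J. t j *\<^sub>R ?z j)"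
    by (rule add_mono[OF complex_Re_le_cmod order_trans[OF abs_ge_self abs_Im_le_cmod]])
  also have "\<dots> \<le> C * (rad_norm J x * rad_norm J y) + C * (rad_norm J x * rad_norm J y)"
    by (rule add_mono; rule signed) (auto simp: s_def t_def)
  finally show ?thesis by simp
qed

lemma R_bound_pairing_sup:
  fixes x :: "'i \<Rightarrow> 'a::complex_banach" and y :: "'i \<Rightarrow> ('a, complex) cblinfun"
  assumes E: "R_bound E C" and J: "finite J"
  obtains s where "\<And>j A. j \<in> J \<Longrightarrow> A \<in> E \<Longrightarrow> cmod (cblinfun_apply (y j) (cblinfun_apply A (x j))) \<le> s j"
    "(\<Sum>j\<in>J. s j) \<le> 2 * C * (rad_norm J x * rad_norm J y)"
proof (cases "E = {}")
  case True
  then show ?thesis using that[of "\<lambda>_. 0"] R_bound_nonneg[OF E] by simp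
next
  case False
  let ?v = "\<lambda>j A. cmod (cblinfun_apply (y j) (cblinfun_apply A (x j)))"
  define s where "s j = (SUP A\<in>E. ?v j A)" for j
  have bdd: "bdd_above (?v j ` E)" for j
  proof (rule bdd_aboveI2)
    fix A assume A: "A \<in> E"
    have "?v j A \<le> norm (y j) * norm (cblinfun_apply A (x j))" by (rule norm_cblinfun)
    also have "\<dots> \<le> norm (y j) * (norm A * norm (x j))" by (intro mult_left_mono norm_cblinfun) auto
    also have "\<dots> \<le> norm (y j) * (C * norm (x j))"
      using R_bound_norm[OF E A] by (intro mult_left_mono mult_right_mono) auto
    finally show "?v j A \<le> norm (y j) * (C * norm (x j))" .
  qed
  have "(\<Sum>j\<in>J. s j) \<le> 2 * C * (rad_norm J x * rad_norm J y) + e" if e: "e > 0" for e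
  proof -
    define d where "d = e / (real (card J) + 1)"
    have d: "d > 0" "real (card J) * d \<le> e" using e by (auto simp: d_def field_simps)
    have "\<exists>A\<in>E. s j - d < ?v j A" for j
      using less_cSUP_iff[OF False bdd, of "s j - d" j] d(1) by (simp add: s_def)
    then have "\<forall>j. \<exists>A. A \<in> E \<and> s j - d < ?v j A" by blast
    from choice[OF this] obtain A where "\<forall>j. A j \<in> E \<and> s j - d < ?v j (A j)" ..
    then have A: "\<And>j. A j \<in> E" "\<And>j. s j - d < ?v j (A j)" by auto
    have "(\<Sum>j\<in>J. s j) \<le> (\<Sum>j\<in>J. ?v j (A j) + d)" using A(2) by (intro sum_mono) (smt (verit))
    also have "\<dots> = (\<Sum>j\<in>J. ?v j (A j)) + real (card J) * d" by (simp add: sum.distrib)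
    also have "\<dots> \<le> 2 * C * (rad_norm J x * rad_norm J y) + e"
      by (rule add_mono[OF R_bound_pairing[OF E J A(1)] d(2)])
    finally show ?thesis .
  qed
  then have "(\<Sum>j\<in>J. s j) \<le> 2 * C * (rad_norm J x * rad_norm J y)" by (rule field_le_epsilon)
  moreover have "?v j A \<le> s j" if "A \<in> E" for j A unfolding s_def using that by (intro cSUP_upper bdd)
  ultimately show ?thesis using that by blast
qed


section \<open>Stolz domains\<close>

lemma sin_angle: "0 < a \<Longrightarrow> a < pi / 2 \<Longrightarrow> 0 < sin a \<and> sin a < 1"
  using sin_gt_zero[of a] sin_monotone_2pi[of a "pi / 2"] by auto

lemma sin_angle_mono: "0 < a \<Longrightarrow> a < b \<Longrightarrow> b < pi / 2 \<Longrightarrow> sin a < sin b" by (rule sin_monotone_2pi) auto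

text \<open>The Stolz domain is the union of the discs with centre \<open>1 - t\<close> and radius \<open>t * sin a\<close>.  This
  description and its closed version replace all other geometry of the domain.\<close>

lemma stolz_hull:
  assumes "0 < s" "s < 1"
  shows "convex hull (insert 1 (ball (0::complex) s))
    = insert 1 {z. \<exists>t. 0 < t \<and> t \<le> 1 \<and> cmod (z - of_real (1 - t)) < t * s}"
proof -
  have "convex hull (insert 1 (ball (0::complex) s))
      = {x. \<exists>u\<ge>0. \<exists>v\<ge>0. \<exists>b. u + v = 1 \<and> b \<in> ball 0 s \<and> x = u *\<^sub>R 1 + v *\<^sub>R b}"
    using assms by (subst convex_hull_insert) (auto simp: hull_same convex_ball)
  also have "\<dots> = insert 1 {z. \<exists>t. 0 < t \<and> t \<le> 1 \<and> cmod (z - of_real (1 - t)) < t * s}"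
  proof (intro equalityI subsetI)
    fix z :: complex assume "z \<in> {x. \<exists>u\<ge>0. \<exists>v\<ge>0. \<exists>b. u + v = 1 \<and> b \<in> ball 0 s \<and> x = u *\<^sub>R 1 + v *\<^sub>R b}"
    then obtain u v :: real and b :: complex where uv: "u \<ge> 0" "v \<ge> 0" "u + v = 1" "cmod b < s"
      "z = u *\<^sub>R 1 + v *\<^sub>R b" by auto
    have u: "u = 1 - v" using uv by simp
    show "z \<in> insert 1 {z. \<exists>t. 0 < t \<and> t \<le> 1 \<and> cmod (z - of_real (1 - t)) < t * s}"
    proof (cases "v = 0")
      case False
      have "z - of_real (1 - v) = v *\<^sub>R b" by (simp add: uv(5) u scaleR_conv_of_real)
      then have "cmod (z - of_real (1 - v)) = v * cmod b" using uv(2) by simp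
      also have "\<dots> < v * s" using False uv by (intro mult_strict_left_mono) auto
      finally show ?thesis using uv False by (intro insertI2 CollectI exI[of _ v]) auto
    qed (use uv in simp)
  next
    fix z :: complex assume "z \<in> insert 1 {z. \<exists>t. 0 < t \<and> t \<le> 1 \<and> cmod (z - of_real (1 - t)) < t * s}"
    then consider "z = 1" | t where "0 < t" "t \<le> 1" "cmod (z - of_real (1 - t)) < t * s" by blast
    then show "z \<in> {x. \<exists>u\<ge>0. \<exists>v\<ge>0. \<exists>b. u + v = 1 \<and> b \<in> ball 0 s \<and> x = u *\<^sub>R 1 + v *\<^sub>R b}"
    proof cases
      case 1
      then show ?thesis using assms by (intro CollectI exI[of _ 1] conjI exI[of _ 0]) auto
    next
      case 2
      define b where "b = (z - of_real (1 - t)) / of_real t"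
      have "cmod b = cmod (z - of_real (1 - t)) / t" using 2 by (simp add: b_def norm_divide)
      then have "cmod b < s" using 2 by (simp add: divide_less_eq mult.commute)
      moreover have "z = (1 - t) *\<^sub>R 1 + t *\<^sub>R b" using 2 by (simp add: b_def scaleR_conv_of_real)
      ultimately show ?thesis using 2 by (intro CollectI exI[of _ "1 - t"] conjI exI[of _ t] exI[of _ b]) auto
    qed
  qed
  finally show ?thesis .
qed

lemma stolz_iff:
  assumes "0 < a" "a < pi / 2"
  shows "z \<in> stolz a \<longleftrightarrow> (\<exists>t. 0 < t \<and> t \<le> 1 \<and> cmod (z - of_real (1 - t)) < t * sin a)"
proof -
  note s = sin_angle[OF assms]
  let ?U = "{z. \<exists>t. 0 < t \<and> t \<le> 1 \<and> cmod (z - of_real (1 - t)) < t * sin a}"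
  let ?H = "convex hull (insert 1 (ball (0::complex) (sin a)))"
  have H: "?H = insert 1 ?U" using s by (intro stolz_hull) auto
  have "?U = (\<Union>t\<in>{0<..1}. ball (of_real (1 - t)) (t * sin a))" by (auto simp: dist_norm norm_minus_commute)
  moreover have "open (\<Union>t\<in>{0<..1}. ball (complex_of_real (1 - t)) (t * sin a))"
    by (intro open_UN ballI open_ball)
  ultimately have "open ?U" by (simp only:)
  then have 1: "?U \<subseteq> interior ?H" using H by (intro interior_maximal) auto
  have 2: "1 \<notin> interior ?H"
  proof
    assume "1 \<in> interior ?H"
    then obtain e where e: "e > 0" "ball 1 e \<subseteq> ?H" using mem_interior by blast
    have "1 + of_real (e / 2) \<in> ball (1::complex) e" using e(1) by (simp add: dist_norm)
    then have "1 + of_real (e / 2) \<in> insert 1 ?U" using e(2) H by blast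
    then obtain t where t: "0 < t" "t \<le> 1" "cmod (1 + of_real (e / 2) - of_real (1 - t)) < t * sin a"
      using e(1) by (auto simp: complex_eq_iff)
    have "1 + of_real (e / 2) - of_real (1 - t) = complex_of_real (e / 2 + t)" by simp
    then have "e / 2 + t < t * sin a" using t e(1) by (simp only: norm_of_real)
    moreover have "t * sin a \<le> t * 1" using s t by (intro mult_left_mono) auto
    ultimately show False using e(1) by simp
  qed
  have "I = A" if "A \<subseteq> I" "1 \<notin> I" "I \<subseteq> H" "H = insert 1 A" for A I H :: "complex set" using that by blast
  from this[OF 1 2 interior_subset H] have "stolz a = ?U" unfolding stolz_def .
  then show ?thesis by simp
qed

lemma open_stolz: "open (stolz a)" by (simp add: stolz_def)

lemma convex_stolz: "convex (stolz a)" by (simp add: stolz_def convex_interior)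

lemma zero_in_stolz: "0 < a \<Longrightarrow> a < pi / 2 \<Longrightarrow> 0 \<in> stolz a"
  using sin_angle[of a] by (auto simp: stolz_iff intro!: exI[of _ 1])

lemma closure_stolz_iff:
  assumes "0 < a" "a < pi / 2"
  shows "z \<in> closure (stolz a) \<longleftrightarrow> (\<exists>t. 0 \<le> t \<and> t \<le> 1 \<and> cmod (z - of_real (1 - t)) \<le> t * sin a)"
proof -
  note s = sin_angle[OF assms]
  let ?K = "{z. \<exists>t. 0 \<le> t \<and> t \<le> 1 \<and> cmod (z - of_real (1 - t)) \<le> t * sin a}"
  let ?g = "\<lambda>(t, b). complex_of_real (1 - t) + of_real t * b"
  have K: "?K = ?g ` ({0..1} \<times> cball 0 (sin a))"
  proof (intro equalityI subsetI)
    fix z assume "z \<in> ?K"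
    then obtain t where t: "0 \<le> t" "t \<le> 1" "cmod (z - of_real (1 - t)) \<le> t * sin a" by blast
    show "z \<in> ?g ` ({0..1} \<times> cball 0 (sin a))"
    proof (cases "t = 0")
      case True
      then show ?thesis using t s by (intro image_eqI[of _ _ "(0, 0)"]) auto
    next
      case False
      define b where "b = (z - of_real (1 - t)) / of_real t"
      have "cmod b = cmod (z - of_real (1 - t)) / t" using t by (simp add: b_def norm_divide)
      then have "cmod b \<le> sin a" using t False by (simp add: divide_le_eq mult.commute)
      moreover have "z = ?g (t, b)" using False by (simp add: b_def)
      ultimately show ?thesis using t by (intro image_eqI[of _ _ "(t, b)"]) auto
    qed
  next
    fix z assume "z \<in> ?g ` ({0..1} \<times> cball 0 (sin a))"
    then obtain t b where tb: "0 \<le> t" "t \<le> 1" "cmod b \<le> sin a" "z = ?g (t, b)" by auto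
    have "z - of_real (1 - t) = of_real t * b" using tb(4) by simp
    then have "cmod (z - of_real (1 - t)) = t * cmod b" using tb by (simp add: norm_mult)
    also have "\<dots> \<le> t * sin a" using tb by (intro mult_left_mono) auto
    finally show "z \<in> ?K" using tb by blast
  qed
  have "compact ?K" unfolding K by (intro compact_continuous_image compact_Times compact_cball compact_Icc)
      (auto simp: case_prod_beta' intro!: continuous_intros)
  then have "closed ?K" by (rule compact_imp_closed)
  moreover have "stolz a \<subseteq> ?K" using assms by (auto simp: stolz_iff) (meson less_imp_le)
  ultimately have "closure (stolz a) \<subseteq> ?K" by (intro closure_minimal)
  moreover have "?K \<subseteq> closure (stolz a)"
  proof -
    let ?H = "convex hull (insert 1 (ball (0::complex) (sin a)))"
    have cl: "closure (stolz a) = closure ?H" unfolding stolz_def using zero_in_stolz[OF assms]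
      by (intro convex_closure_interior convex_convex_hull) (auto simp: stolz_def)
    have conv: "convex (closure ?H)" by (intro convex_closure convex_convex_hull)
    have "1 \<in> closure ?H" by (intro closure_subset[THEN subsetD] hull_inc) simp
    moreover have "cball 0 (sin a) \<subseteq> closure ?H"
    proof -
      have "closure (ball 0 (sin a)) \<subseteq> closure ?H" by (intro closure_mono) (auto intro: hull_inc)
      then show ?thesis using s by simp
    qed
    ultimately have "?g (t, b) \<in> closure ?H" if "0 \<le> t" "t \<le> 1" "b \<in> cball 0 (sin a)" for t b
      using convexD_alt[OF conv, of 1 b t] that by (auto simp: scaleR_conv_of_real)
    then show ?thesis unfolding K cl by auto
  qed
  ultimately show ?thesis by blast
qed

lemma one_in_closure_stolz: "0 < a \<Longrightarrow> a < pi / 2 \<Longrightarrow> 1 \<in> closure (stolz a)"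
  by (auto simp: closure_stolz_iff intro!: exI[of _ 0])

lemma closure_stolz_one_minus_norm:
  assumes "0 < a" "a < pi / 2" "z \<in> closure (stolz a)"
  shows "(1 - sin a) / 2 * cmod (1 - z) \<le> 1 - cmod z"
proof -
  note s = sin_angle[OF assms(1,2)]
  obtain t where t: "0 \<le> t" "t \<le> 1" "cmod (z - of_real (1 - t)) \<le> t * sin a"
    using assms by (auto simp: closure_stolz_iff)
  have "cmod z \<le> cmod (z - of_real (1 - t)) + cmod (of_real (1 - t))"
    by (metis diff_add_cancel norm_triangle_ineq)
  also have "cmod (complex_of_real (1 - t)) = 1 - t" using t by (simp only: norm_of_real)
  finally have 1: "t * (1 - sin a) \<le> 1 - cmod z" using t by (simp add: algebra_simps)
  have "1 - z = of_real t - (z - of_real (1 - t))" by simp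
  then have "cmod (1 - z) \<le> cmod (of_real t) + cmod (z - of_real (1 - t))" by (metis norm_triangle_ineq4)
  also have "cmod (complex_of_real t) = t" using t by simp
  finally have "cmod (1 - z) \<le> t + t * sin a" using t(3) by linarith
  moreover have "t * sin a \<le> t * 1" using t(1) s by (intro mult_left_mono) auto
  ultimately have "cmod (1 - z) \<le> 2 * t" by simp
  then have "(1 - sin a) / 2 * cmod (1 - z) \<le> (1 - sin a) / 2 * (2 * t)"
    by (rule mult_left_mono) (use s in simp_all)
  also have "\<dots> = t * (1 - sin a)" by simp
  finally show ?thesis using 1 by linarith
qed

lemma closure_stolz_norm_less:
  assumes "0 < a" "a < pi / 2" "z \<in> closure (stolz a)" "z \<noteq> 1"
  shows "cmod z < 1"
proof -
  have "0 < (1 - sin a) / 2 * cmod (1 - z)" using sin_angle[OF assms(1,2)] assms(4) by simp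
  then show ?thesis using closure_stolz_one_minus_norm[OF assms(1-3)] by simp
qed

lemma stolz_ne_one: "0 < a \<Longrightarrow> a < pi / 2 \<Longrightarrow> z \<in> stolz a \<Longrightarrow> z \<noteq> 1"
proof
  assume a: "0 < a" "a < pi / 2" and z: "z \<in> stolz a" "z = 1"
  then obtain t where t: "0 < t" "t \<le> 1" "cmod (1 - of_real (1 - t)) < t * sin a" by (auto simp: stolz_iff)
  have "1 - of_real (1 - t) = complex_of_real t" by simp
  then have "cmod (1 - of_real (1 - t)) = t" using t(1) by (simp only: norm_of_real abs_of_pos)
  moreover have "t * sin a \<le> t * 1" using sin_angle[OF a] t(1) by (intro mult_left_mono) auto
  ultimately show False using t(3) by linarith
qed

lemma stolz_norm_less: "0 < a \<Longrightarrow> a < pi / 2 \<Longrightarrow> z \<in> stolz a \<Longrightarrow> cmod z < 1"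
  using closure_stolz_norm_less stolz_ne_one closure_subset by blast

lemma closure_stolz_subset_stolz:
  assumes "0 < a" "a < b" "b < pi / 2" "z \<in> closure (stolz a)" "z \<noteq> 1"
  shows "z \<in> stolz b"
proof -
  obtain t where t: "0 \<le> t" "t \<le> 1" "cmod (z - of_real (1 - t)) \<le> t * sin a"
    using assms by (auto simp: closure_stolz_iff)
  have "t \<noteq> 0" using t assms(5) by auto
  then have "t * sin a < t * sin b" using t sin_angle_mono[OF assms(1-3)] by (intro mult_strict_left_mono) auto
  then have "0 < t \<and> t \<le> 1 \<and> cmod (z - of_real (1 - t)) < t * sin b" using t \<open>t \<noteq> 0\<close> by linarith
  then show ?thesis using assms by (subst stolz_iff) auto
qed

lemma closure_stolz_mono:
  assumes "0 < a" "a \<le> b" "b < pi / 2"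
  shows "closure (stolz a) \<subseteq> closure (stolz b)"
proof
  fix z assume z: "z \<in> closure (stolz a)"
  show "z \<in> closure (stolz b)"
  proof (cases "a = b \<or> z = 1")
    case True
    then show ?thesis using z assms one_in_closure_stolz[of b] by auto
  next
    case False
    then have "z \<in> stolz b" using z assms by (intro closure_stolz_subset_stolz[of a]) auto
    then show ?thesis using closure_subset by blast
  qed
qed

lemma stolz_scale:
  assumes "0 < a" "a < pi / 2" "z \<in> closure (stolz a)" "0 \<le> r" "r < 1"
  shows "of_real r * z \<in> stolz a"
proof -
  note s = sin_angle[OF assms(1,2)]
  obtain t where t: "0 \<le> t" "t \<le> 1" "cmod (z - of_real (1 - t)) \<le> t * sin a"
    using assms by (auto simp: closure_stolz_iff)
  define t' where "t' = 1 - r + r * t"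
  have t': "r * t < t'" "t' \<le> 1" "0 < t'"
    using t assms mult_left_mono[of t 1 r] by (auto simp: t'_def add_pos_nonneg)
  have "of_real r * z - of_real (1 - t') = of_real r * (z - of_real (1 - t))"
    by (simp add: t'_def algebra_simps)
  then have "cmod (of_real r * z - of_real (1 - t')) = r * cmod (z - of_real (1 - t))"
    using assms(4) by (simp add: norm_mult)
  also have "\<dots> \<le> r * (t * sin a)" using t assms by (intro mult_left_mono) auto
  also have "\<dots> < t' * sin a" using t' s by (simp add: mult.assoc[symmetric])
  finally show ?thesis using assms t' by (subst stolz_iff) (auto intro!: exI[of _ t'])
qed

lemma closure_stolz_scale:
  assumes "0 < a" "a < pi / 2" "z \<in> closure (stolz a)" "0 \<le> r" "r \<le> 1"
  shows "of_real r * z \<in> closure (stolz a)" using stolz_scale[OF assms(1-4)] assms closure_subset[of "stolz a"]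
  by (cases "r = 1") auto

lemma dist_real_segment:
  assumes "0 < a" "a < pi / 2" "z \<notin> closure (stolz a)" "0 \<le> r" "r \<le> 1"
  shows "(1 - r) * sin a < cmod (z - of_real r)"
  using assms by (auto simp: closure_stolz_iff not_le dest!: spec[of _ "1 - r"])

text \<open>Squaring the hypothesis gives $e |1 - \mu| \le \mathrm{Re} (1 - \mu)$, so \<open>\<mu>\<close> lies in the sector with
  vertex \<open>1\<close> and half-angle \<open>arccos e\<close>; a suitable disc that is tangent to the sides of the sector contains it.\<close>

lemma closure_stolz_criterion:
  assumes e: "0 < e" "e < 1" and \<mu>: "e * cmod (1 - \<mu>) \<le> 1 - cmod \<mu>"
  shows "\<mu> \<in> closure (stolz (arccos e))"
proof -
  have a: "0 < arccos e" "arccos e < pi / 2" using e arccos_lt_bounded[of e] arccos_less_arccos[of 0 e] by auto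
  have s: "sin (arccos e) = sqrt (1 - e\<^sup>2)" using e by (intro sin_arccos) auto
  define u where "u = 1 - \<mu>"
  define R where "R = Re u"
  have e2: "e\<^sup>2 < 1" using e by (simp add: power_less_one_iff)
  have \<mu>u: "\<mu> = 1 - u" by (simp add: u_def)
  have n\<mu>: "(cmod \<mu>)\<^sup>2 = 1 - 2 * R + (cmod u)\<^sup>2"
    unfolding \<mu>u cmod_power2 R_def by (simp add: power2_eq_square algebra_simps)
  have le1: "cmod \<mu> \<le> 1 - e * cmod u" using \<mu> by (simp add: u_def)
  have "(cmod \<mu>)\<^sup>2 \<le> (1 - e * cmod u)\<^sup>2" using le1 by (intro power_mono) auto
  then have R: "2 * e * cmod u + (1 - e\<^sup>2) * (cmod u)\<^sup>2 \<le> 2 * R"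
    unfolding n\<mu> by (simp add: power2_eq_square algebra_simps)
  moreover have "0 \<le> (1 - e\<^sup>2) * (cmod u)\<^sup>2" using e2 by simp
  ultimately have R1: "e * cmod u \<le> R" by simp
  show ?thesis
  proof (cases "u = 0")
    case True
    then show ?thesis using one_in_closure_stolz[OF a] by (simp add: \<mu>u)
  next
    case False
    have u0: "cmod u > 0" using False by simp
    have "\<exists>t. 0 \<le> t \<and> t \<le> 1 \<and> cmod (\<mu> - of_real (1 - t)) \<le> t * sqrt (1 - e\<^sup>2)"
    proof (cases "(cmod u)\<^sup>2 \<le> R")
      case True
      \<comment> \<open>the disc tangent to the ray through \<open>\<mu>\<close>\<close>
      define t where "t = (cmod u)\<^sup>2 / R"
      have R0: "R > 0" using R1 e u0 by (smt (verit) mult_pos_pos)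
      have t: "0 \<le> t" "t \<le> 1" "t * R = (cmod u)\<^sup>2" using True R0 by (auto simp: t_def)
      have "(cmod (\<mu> - of_real (1 - t)))\<^sup>2 = t\<^sup>2 - 2 * (t * R) + (cmod u)\<^sup>2"
        unfolding \<mu>u cmod_power2 R_def by (simp add: power2_eq_square algebra_simps)
      also have "\<dots> = t\<^sup>2 - (cmod u)\<^sup>2" using t(3) by simp
      also have "\<dots> \<le> t\<^sup>2 * (1 - e\<^sup>2)"
      proof -
        have "t\<^sup>2 * e\<^sup>2 \<le> (cmod u)\<^sup>2"
        proof -
          have "t * e * cmod u \<le> t * R" using mult_left_mono[OF R1 t(1)] by (simp add: mult.assoc)
          then have "t * e * cmod u \<le> cmod u * cmod u" by (simp add: t(3) power2_eq_square)
          then have "t * e \<le> cmod u" using u0 by simp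
          then have "(t * e)\<^sup>2 \<le> (cmod u)\<^sup>2" using t e by (intro power_mono) auto
          then show ?thesis by (simp add: power_mult_distrib)
        qed
        then show ?thesis by (simp add: algebra_simps)
      qed
      also have "\<dots> = (t * sqrt (1 - e\<^sup>2))\<^sup>2" using e2 by (simp add: power_mult_distrib)
      finally have "cmod (\<mu> - of_real (1 - t)) \<le> t * sqrt (1 - e\<^sup>2)"
        by (rule power2_le_imp_le) (use t e2 in auto)
      then show ?thesis using t by blast
    next
      case False
      have "e * cmod u < cmod u * cmod u" using False R1 by (simp add: power2_eq_square)
      then have "e < cmod u" using u0 by simp
      then have "e * e \<le> e * cmod u" using e by simp
      then have "cmod \<mu> \<le> 1 - e\<^sup>2" using le1 by (simp add: power2_eq_square)
      also have "1 - e\<^sup>2 \<le> sqrt (1 - e\<^sup>2)"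
        using e2 by (intro real_le_rsqrt) (simp add: power2_eq_square mult_le_cancel_left1)
      finally show ?thesis by (intro exI[of _ 1]) simp
    qed
    then show ?thesis unfolding closure_stolz_iff[OF a] s .
  qed
qed


section \<open>Resolvents\<close>

lemma resolvent_inverse:
  assumes "z \<notin> spectrum T"
  shows "(z *\<^sub>C cblinfun_id - T) o\<^sub>C resolvent z T = cblinfun_id"
    "resolvent z T o\<^sub>C (z *\<^sub>C cblinfun_id - T) = cblinfun_id"
proof -
  let ?A = "z *\<^sub>C cblinfun_id - T"
  obtain B where B: "?A o\<^sub>C B = cblinfun_id" "B o\<^sub>C ?A = cblinfun_id"
    using assms by (auto simp: spectrum_def cinvertible_def)
  have u: "B' = B" if "?A o\<^sub>C B' = cblinfun_id \<and> B' o\<^sub>C ?A = cblinfun_id" for B'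
  proof -
    have "B' = B' o\<^sub>C (?A o\<^sub>C B)" by (simp add: B)
    also have "\<dots> = B" using that by (simp add: cblinfun_compose_assoc)
    finally show ?thesis .
  qed
  have "?A o\<^sub>C resolvent z T = cblinfun_id \<and> resolvent z T o\<^sub>C ?A = cblinfun_id"
    unfolding resolvent_def by (rule theI[of _ B]) (use B u in blast)+
  then show "?A o\<^sub>C resolvent z T = cblinfun_id" "resolvent z T o\<^sub>C ?A = cblinfun_id" by auto
qed

lemma resolvent_eqI:
  assumes "(z *\<^sub>C cblinfun_id - T) o\<^sub>C B = cblinfun_id" "B o\<^sub>C (z *\<^sub>C cblinfun_id - T) = cblinfun_id"
  shows "z \<notin> spectrum T" "resolvent z T = B"
proof -
  show z: "z \<notin> spectrum T" using assms by (auto simp: spectrum_def cinvertible_def)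
  have "resolvent z T = resolvent z T o\<^sub>C ((z *\<^sub>C cblinfun_id - T) o\<^sub>C B)" by (simp add: assms)
  also have "\<dots> = B" using resolvent_inverse(2)[OF z] by (simp add: cblinfun_compose_assoc)
  finally show "resolvent z T = B" .
qed

lemma resolvent_T:
  assumes "z \<notin> spectrum T"
  shows "T o\<^sub>C resolvent z T = z *\<^sub>C resolvent z T - cblinfun_id"
    "resolvent z T o\<^sub>C T = z *\<^sub>C resolvent z T - cblinfun_id" using resolvent_inverse[OF assms]
  by (auto simp: compose_bilinear.diff_left compose_bilinear.diff_right compose_scaleC_left
      compose_scaleC_right algebra_simps)

lemma resolvent_commute:
  assumes z: "z \<notin> spectrum T" and S: "S o\<^sub>C T = T o\<^sub>C S"
  shows "S o\<^sub>C resolvent z T = resolvent z T o\<^sub>C S"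
proof -
  let ?A = "z *\<^sub>C cblinfun_id - T" and ?R = "resolvent z T"
  have A: "S o\<^sub>C ?A = ?A o\<^sub>C S"
    by (simp add: compose_bilinear.diff_left compose_bilinear.diff_right compose_scaleC_left
        compose_scaleC_right S)
  have "S o\<^sub>C ?R = (?R o\<^sub>C ?A) o\<^sub>C (S o\<^sub>C ?R)" by (simp add: resolvent_inverse[OF z])
  also have "\<dots> = ?R o\<^sub>C (?A o\<^sub>C S) o\<^sub>C ?R" by (simp add: cblinfun_compose_assoc)
  also have "\<dots> = (?R o\<^sub>C S) o\<^sub>C (?A o\<^sub>C ?R)" by (simp only: A[symmetric] cblinfun_compose_assoc)
  also have "\<dots> = ?R o\<^sub>C S" by (simp add: resolvent_inverse[OF z])
  finally show ?thesis .
qed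

lemma resolvents_commute:
  assumes "z \<notin> spectrum S" "w \<notin> spectrum T" "S o\<^sub>C T = T o\<^sub>C S"
  shows "resolvent z S o\<^sub>C resolvent w T = resolvent w T o\<^sub>C resolvent z S"
proof -
  have "resolvent w T o\<^sub>C S = S o\<^sub>C resolvent w T" by (rule resolvent_commute[OF assms(2,3), symmetric])
  from resolvent_commute[OF assms(1) this] show ?thesis by simp
qed

lemma resolvent_identity:
  assumes z: "z \<notin> spectrum T" and w: "w \<notin> spectrum T"
  shows "resolvent w T - resolvent z T = (z - w) *\<^sub>C (resolvent z T o\<^sub>C resolvent w T)"
proof -
  let ?I = "cblinfun_id"
  have "(z - w) *\<^sub>C (resolvent z T o\<^sub>C resolvent w T)
      = resolvent z T o\<^sub>C ((z *\<^sub>C ?I - T) - (w *\<^sub>C ?I - T)) o\<^sub>C resolvent w T"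
    by (simp add: compose_scaleC_left compose_scaleC_right flip: scaleC_diff_left)
  also have "\<dots> = (resolvent z T o\<^sub>C (z *\<^sub>C ?I - T)) o\<^sub>C resolvent w T
      - resolvent z T o\<^sub>C ((w *\<^sub>C ?I - T) o\<^sub>C resolvent w T)"
    by (simp only: compose_bilinear.diff_left compose_bilinear.diff_right cblinfun_compose_assoc)
  also have "\<dots> = resolvent w T - resolvent z T" by (simp add: resolvent_inverse[OF z] resolvent_inverse[OF w])
  finally show ?thesis by simp
qed

lemma neumann_series:
  fixes A :: "('a::complex_banach, 'a) cblinfun"
  assumes "summable (\<lambda>n. norm (cpower A n))"
  shows "(cblinfun_id - A) o\<^sub>C (\<Sum>n. cpower A n) = cblinfun_id"
    "(\<Sum>n. cpower A n) o\<^sub>C (cblinfun_id - A) = cblinfun_id"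
proof -
  have s: "(\<lambda>n. cpower A n) sums (\<Sum>n. cpower A n)" using summable_norm_cancel[OF assms] by (rule summable_sums)
  have sh: "(\<lambda>n. cpower A (Suc n)) sums ((\<Sum>n. cpower A n) - cblinfun_id)" using s by (subst sums_Suc_iff) simp
  have "(\<lambda>n. A o\<^sub>C cpower A n) sums (A o\<^sub>C (\<Sum>n. cpower A n))"
    using compose_bilinear.bounded_linear_right s by (rule bounded_linear.sums)
  then have 1: "A o\<^sub>C (\<Sum>n. cpower A n) = (\<Sum>n. cpower A n) - cblinfun_id" using sums_unique2[OF sh] by simp
  have "(\<lambda>n. cpower A n o\<^sub>C A) sums ((\<Sum>n. cpower A n) o\<^sub>C A)"
    using compose_bilinear.bounded_linear_left s by (rule bounded_linear.sums)
  then have 2: "(\<Sum>n. cpower A n) o\<^sub>C A = (\<Sum>n. cpower A n) - cblinfun_id"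
    using sums_unique2[OF sh] by (simp only: cpower_Suc_right)
  show "(cblinfun_id - A) o\<^sub>C (\<Sum>n. cpower A n) = cblinfun_id" by (simp add: compose_bilinear.diff_left 1)
  show "(\<Sum>n. cpower A n) o\<^sub>C (cblinfun_id - A) = cblinfun_id" by (simp add: compose_bilinear.diff_right 2)
qed

lemma norm_cpower_le: "norm (cpower A n) \<le> (if n = 0 then 1 else norm A ^ n)"
proof (induction n)
  case 0
  show ?case by (simp add: norm_cblinfun_bound)
next
  case (Suc n)
  have "norm (cpower A (Suc n)) \<le> norm A * norm (cpower A n)" by (simp add: norm_cblinfun_compose)
  also have "\<dots> \<le> norm A * norm A ^ n" using Suc by (intro mult_left_mono) (auto split: if_splits)
  finally show ?case by simp
qed

lemma resolvent_perturb:
  fixes T :: "('a::complex_banach, 'a) cblinfun"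
  assumes z: "z \<notin> spectrum T" and w: "cmod (w - z) * norm (resolvent z T) < 1"
  shows "w \<notin> spectrum T"
    "norm (resolvent w T) \<le> norm (resolvent z T) / (1 - cmod (w - z) * norm (resolvent z T))"
proof -
  let ?R = "resolvent z T" and ?I = "cblinfun_id :: ('a, 'a) cblinfun"
  define A where "A = (z - w) *\<^sub>C ?R"
  have nA: "norm A < 1" using w by (simp add: A_def norm_scaleC norm_minus_commute)
  have "summable (\<lambda>n. norm (cpower A n))"
  proof (rule summable_comparison_test)
    show "\<exists>N. \<forall>n\<ge>N. norm (norm (cpower A n)) \<le> norm A ^ n"
      using norm_cpower_le[of A] by (intro exI[of _ 0]) (simp, metis power_0)
    show "summable (\<lambda>n. norm A ^ n)" using nA by (intro summable_geometric) auto
  qed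
  note N = neumann_series[OF this]
  define S where "S = (\<Sum>n. cpower A n)"
  have wT: "w *\<^sub>C ?I - T = (z *\<^sub>C ?I - T) - (z - w) *\<^sub>C ?I" by (simp add: scaleC_diff_left)
  have f: "w *\<^sub>C ?I - T = (z *\<^sub>C ?I - T) o\<^sub>C (?I - A)" "w *\<^sub>C ?I - T = (?I - A) o\<^sub>C (z *\<^sub>C ?I - T)"
    unfolding wT by (simp_all add: compose_bilinear.diff_right[of "z *\<^sub>C ?I - T"]
        compose_bilinear.diff_left[of ?I] A_def compose_scaleC_left compose_scaleC_right resolvent_inverse[OF z])
  have 1: "(w *\<^sub>C ?I - T) o\<^sub>C (S o\<^sub>C ?R) = ?I"
  proof -
    have "(w *\<^sub>C ?I - T) o\<^sub>C (S o\<^sub>C ?R) = (z *\<^sub>C ?I - T) o\<^sub>C ((?I - A) o\<^sub>C S) o\<^sub>C ?R"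
      unfolding f(1) by (simp only: cblinfun_compose_assoc)
    then show ?thesis by (simp add: N[folded S_def] resolvent_inverse[OF z])
  qed
  have 2: "(?R o\<^sub>C S) o\<^sub>C (w *\<^sub>C ?I - T) = ?I"
  proof -
    have "(?R o\<^sub>C S) o\<^sub>C (w *\<^sub>C ?I - T) = ?R o\<^sub>C (S o\<^sub>C (?I - A)) o\<^sub>C (z *\<^sub>C ?I - T)"
      unfolding f(2) by (simp only: cblinfun_compose_assoc)
    then show ?thesis by (simp add: N[folded S_def] resolvent_inverse[OF z])
  qed
  have "?R o\<^sub>C S = (?R o\<^sub>C S) o\<^sub>C ((w *\<^sub>C ?I - T) o\<^sub>C (S o\<^sub>C ?R))" by (simp add: 1)
  also have "\<dots> = S o\<^sub>C ?R" by (subst cblinfun_compose_assoc) (simp add: 2)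
  finally have 3: "(S o\<^sub>C ?R) o\<^sub>C (w *\<^sub>C ?I - T) = ?I" using 2 by simp
  show wS: "w \<notin> spectrum T" by (rule resolvent_eqI(1)[OF 1 3])
  have "resolvent w T = ?R + (z - w) *\<^sub>C (?R o\<^sub>C resolvent w T)"
    using resolvent_identity[OF z wS] by (simp add: algebra_simps)
  then have "norm (resolvent w T) \<le> norm ?R + norm ((z - w) *\<^sub>C (?R o\<^sub>C resolvent w T))"
    by (metis norm_triangle_ineq)
  also have "\<dots> \<le> norm ?R + cmod (z - w) * (norm ?R * norm (resolvent w T))"
    by (simp add: norm_scaleC mult_left_mono norm_cblinfun_compose)
  finally have "norm (resolvent w T) * (1 - cmod (w - z) * norm ?R) \<le> norm ?R"
    by (simp add: algebra_simps norm_minus_commute)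
  then show "norm (resolvent w T) \<le> norm ?R / (1 - cmod (w - z) * norm ?R)"
    using w by (simp add: pos_le_divide_eq)
qed

lemma resolvent_isCont:
  assumes z: "z \<notin> spectrum T"
  shows "isCont (\<lambda>w. resolvent w T) z"
proof -
  let ?R = "resolvent z T"
  have lim: "((\<lambda>w. cmod (z - w) * (norm ?R * (norm ?R / (1 - cmod (w - z) * norm ?R)))) \<longlongrightarrow>
      cmod (z - z) * (norm ?R * (norm ?R / (1 - cmod (z - z) * norm ?R)))) (at z)"
    by (intro tendsto_intros) auto
  have "((\<lambda>w. cmod (w - z) * norm ?R) \<longlongrightarrow> cmod (z - z) * norm ?R) (at z)" by (intro tendsto_intros)
  then have "\<forall>\<^sub>F w in at z. cmod (w - z) * norm ?R < 1" by (rule order_tendstoD(2)) simp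
  then have "\<forall>\<^sub>F w in at z. norm (resolvent w T - ?R)
      \<le> cmod (z - w) * (norm ?R * (norm ?R / (1 - cmod (w - z) * norm ?R)))"
  proof eventually_elim
    case (elim w)
    note p = resolvent_perturb[OF z elim]
    have "norm (resolvent w T - ?R) \<le> cmod (z - w) * (norm ?R * norm (resolvent w T))"
      by (simp add: resolvent_identity[OF z p(1)] norm_scaleC mult_left_mono norm_cblinfun_compose)
    also have "\<dots> \<le> cmod (z - w) * (norm ?R * (norm ?R / (1 - cmod (w - z) * norm ?R)))"
      by (intro mult_left_mono p(2)) auto
    finally show ?case .
  qed
  then have "((\<lambda>w. resolvent w T - ?R) \<longlongrightarrow> 0) (at z)" by (rule Lim_null_comparison) (use lim in simp)
  then show ?thesis by (simp add: isCont_def LIM_zero_iff)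
qed

lemma resolvent_pairing_holomorphic:
  fixes y :: "('a::complex_banach, complex) cblinfun"
  assumes "S \<inter> spectrum T = {}"
  shows "(\<lambda>z. cblinfun_apply y (cblinfun_apply (resolvent z T) x)) holomorphic_on S"
proof -
  have "(\<lambda>z. cblinfun_apply y (cblinfun_apply (resolvent z T) x)) field_differentiable (at z)"
    if z: "z \<notin> spectrum T" for z
  proof -
    let ?R = "resolvent z T"
    let ?f = "\<lambda>w. cblinfun_apply y (cblinfun_apply (resolvent w T) x)"
    have "((\<lambda>w. - cblinfun_apply y (cblinfun_apply (?R o\<^sub>C resolvent w T) x)) \<longlongrightarrow>
        - cblinfun_apply y (cblinfun_apply (?R o\<^sub>C ?R) x)) (at z)"
      using resolvent_isCont[OF z] unfolding isCont_def
      by (intro tendsto_minus bounded_linear.tendsto[OF bounded_linear_cblinfun_apply]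
          bounded_linear.tendsto[OF apply_bilinear.bounded_linear_left]
          bounded_linear.tendsto[OF compose_bilinear.bounded_linear_right])
    moreover have "\<forall>\<^sub>F w in at z. - cblinfun_apply y (cblinfun_apply (?R o\<^sub>C resolvent w T) x)
        = (?f w - ?f z) / (w - z)"
    proof -
      have "((\<lambda>w. cmod (w - z) * norm ?R) \<longlongrightarrow> cmod (z - z) * norm ?R) (at z)" by (intro tendsto_intros)
      then have "\<forall>\<^sub>F w in at z. cmod (w - z) * norm ?R < 1" by (rule order_tendstoD(2)) simp
      moreover have "\<forall>\<^sub>F w in at z. w \<noteq> z" by (simp add: eventually_at_filter)
      ultimately show ?thesis
      proof eventually_elim
        case (elim w)
        note w = resolvent_perturb(1)[OF z elim(1)]
        have "?f w - ?f z = cblinfun_apply y (cblinfun_apply (resolvent w T - ?R) x)" by simp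
        also have "\<dots> = (z - w) * cblinfun_apply y (cblinfun_apply (?R o\<^sub>C resolvent w T) x)"
          by (simp add: resolvent_identity[OF z w] cblinfun_apply_scaleC)
        finally show ?case using elim(2) by (simp add: field_simps)
      qed
    qed
    ultimately have "((\<lambda>w. (?f w - ?f z) / (w - z)) \<longlongrightarrow>
        - cblinfun_apply y (cblinfun_apply (?R o\<^sub>C ?R) x)) (at z)" by (rule Lim_transform_eventually)
    then show ?thesis unfolding field_differentiable_def has_field_derivative_iff by blast
  qed
  then show ?thesis using assms unfolding holomorphic_on_def
    by (meson disjoint_iff field_differentiable_at_within)
qed

lemma ritt_power_bounded:
  assumes "ritt T"
  obtains C where "C \<ge> 1" "\<And>n. norm (cpower T n) \<le> C"
proof -
  obtain C where C: "C > 0" "\<And>n. n \<ge> 1 \<Longrightarrow> norm (cpower T n) \<le> C" using assms by (auto simp: ritt_def)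
  have "norm (cpower T n) \<le> max C 1" for n
    using C(2)[of n] norm_cpower_le[of T 0] by (cases "n = 0") (auto simp: le_max_iff_disj)
  then show ?thesis using that[of "max C 1"] by auto
qed

text \<open>All that is used of the type of a Ritt operator.\<close>

lemma ritt_of_type_resolvent_bound:
  assumes "ritt_of_type a T" "a < b" "b < pi / 2"
  shows "\<exists>K>0. \<forall>z. z \<notin> closure (stolz b) \<longrightarrow>
    z \<notin> spectrum T \<and> norm (resolvent z T) \<le> K / cmod (z - 1)"
proof -
  obtain K where K: "K > 0" "\<And>z. z \<notin> closure (stolz b) \<Longrightarrow> norm ((z - 1) *\<^sub>C resolvent z T) \<le> K"
    using assms by (auto simp: ritt_of_type_def)
  have a: "0 < a" using assms by (simp add: ritt_of_type_def)
  have "z \<notin> spectrum T \<and> norm (resolvent z T) \<le> K / cmod (z - 1)"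
    if z: "z \<notin> closure (stolz b)" for z
  proof
    show "z \<notin> spectrum T" using assms z closure_stolz_mono[of a b] by (auto simp: ritt_of_type_def)
    have "z \<noteq> 1" using z one_in_closure_stolz[of b] assms a by auto
    then show "norm (resolvent z T) \<le> K / cmod (z - 1)" using K(2)[OF z] by (simp add: norm_scaleC field_simps)
  qed
  then show ?thesis using K(1) by blast
qed

lemma resolvent_cadjoint:
  assumes "z \<notin> spectrum T"
  shows "z \<notin> spectrum (cadjoint T)" "resolvent z (cadjoint T) = cadjoint (resolvent z T)"
proof -
  have e: "z *\<^sub>C cblinfun_id - cadjoint T = cadjoint (z *\<^sub>C cblinfun_id - T)" by (simp add: cadjoint_linear)
  have "(z *\<^sub>C cblinfun_id - cadjoint T) o\<^sub>C cadjoint (resolvent z T) = cblinfun_id"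
    "cadjoint (resolvent z T) o\<^sub>C (z *\<^sub>C cblinfun_id - cadjoint T) = cblinfun_id"
    unfolding e cadjoint_compose[symmetric] resolvent_inverse[OF assms] cadjoint_linear(1) by auto
  from resolvent_eqI[OF this] show "z \<notin> spectrum (cadjoint T)"
    "resolvent z (cadjoint T) = cadjoint (resolvent z T)" by auto
qed

lemma ritt_of_type_cadjoint:
  fixes T :: "('a::complex_banach, 'a) cblinfun"
  assumes "ritt_of_type a T"
  shows "ritt_of_type a (cadjoint T)" unfolding ritt_of_type_def
proof (intro conjI allI impI)
  show "0 < a" "a < pi / 2" using assms by (auto simp: ritt_of_type_def)
  obtain C where C: "C > 0" "\<And>n. n \<ge> 1 \<Longrightarrow> norm (cpower T n) \<le> C"
    "\<And>n. n \<ge> 1 \<Longrightarrow> norm (real n *\<^sub>R (cpower T n - cpower T (n - 1))) \<le> C"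
    using assms by (auto simp: ritt_of_type_def ritt_def)
  show "ritt (cadjoint T)" unfolding ritt_def
  proof (intro exI[of _ C] conjI allI impI C(1))
    fix n :: nat assume n: "1 \<le> n"
    show "norm (cpower (cadjoint T) n) \<le> C"
      using norm_cadjoint[of "cpower T n"] C(2)[OF n] by (simp add: cadjoint_cpower)
    show "norm (real n *\<^sub>R (cpower (cadjoint T) n - cpower (cadjoint T) (n - 1))) \<le> C"
      using norm_cadjoint[of "real n *\<^sub>R (cpower T n - cpower T (n - 1))"] C(3)[OF n]
      by (simp only: cadjoint_linear cadjoint_cpower)
  qed
  show "spectrum (cadjoint T) \<subseteq> closure (stolz a)"
    using assms resolvent_cadjoint(1)[of _ T] by (auto simp: ritt_of_type_def)
  fix b assume b: "a < b \<and> b < pi / 2"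
  then obtain K where K: "K > 0" "\<And>z. z \<notin> closure (stolz b) \<Longrightarrow> norm ((z - 1) *\<^sub>C resolvent z T) \<le> K"
    using assms by (auto simp: ritt_of_type_def)
  show "\<exists>K>0. \<forall>z. z \<notin> closure (stolz b) \<longrightarrow> norm ((z - 1) *\<^sub>C resolvent z (cadjoint T)) \<le> K"
  proof (intro exI[of _ K] conjI allI impI K(1))
    fix z assume z: "z \<notin> closure (stolz b)"
    have "z \<notin> spectrum T" using assms z b closure_stolz_mono[of a b] by (auto simp: ritt_of_type_def)
    then have "(z - 1) *\<^sub>C resolvent z (cadjoint T) = cadjoint ((z - 1) *\<^sub>C resolvent z T)"
      by (simp add: resolvent_cadjoint cadjoint_linear)
    then show "norm ((z - 1) *\<^sub>C resolvent z (cadjoint T)) \<le> K"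
      using norm_cadjoint[of "(z - 1) *\<^sub>C resolvent z T"] K(2)[OF z] by simp
  qed
qed


section \<open>The R-type of an R-Ritt operator\<close>

lemma R_bound_weaken: "R_bound E C \<Longrightarrow> C \<le> D \<Longrightarrow> R_bound E D"
  unfolding R_bound_def by (meson mult_right_mono order_trans rad_norm_nonneg)

text \<open>R-bounds with constant \<open>1 / 2\<close> in a fixed point equation can be absorbed.\<close>

lemma R_bound_absorb:
  assumes E: "R_bound E C" and F: "R_bound F (1 / 2)"
    and G: "\<And>Z. Z \<in> G \<Longrightarrow> \<exists>B\<in>E. \<exists>D\<in>F. Z = B + D o\<^sub>C Z"
  shows "R_bound G (2 * C)" unfolding R_bound_def
proof (intro conjI allI impI)
  show "2 * C \<ge> 0" using R_bound_nonneg[OF E] by simp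
  fix J :: "nat set" and S and x :: "nat \<Rightarrow> 'a"
  assume J: "finite J" and S: "\<forall>k\<in>J. S k \<in> G"
  have "\<forall>k\<in>J. \<exists>p. fst p \<in> E \<and> snd p \<in> F \<and> S k = fst p + snd p o\<^sub>C S k" using G S by fastforce
  from bchoice[OF this] obtain p
    where p: "\<forall>k\<in>J. fst (p k) \<in> E \<and> snd (p k) \<in> F \<and> S k = fst (p k) + snd (p k) o\<^sub>C S k" ..
  let ?Sx = "\<lambda>k. cblinfun_apply (S k) (x k)"
  have eq: "?Sx k = cblinfun_apply (fst (p k)) (x k) + cblinfun_apply (snd (p k)) (?Sx k)"
    if "k \<in> J" for k
  proof -
    have "S k = fst (p k) + snd (p k) o\<^sub>C S k" using p that by blast
    then have "?Sx k = cblinfun_apply (fst (p k) + snd (p k) o\<^sub>C S k) (x k)" by (rule arg_cong)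
    then show ?thesis by simp
  qed
  have "rad_norm J ?Sx
      = rad_norm J (\<lambda>k. cblinfun_apply (fst (p k)) (x k) + cblinfun_apply (snd (p k)) (?Sx k))"
    by (rule rad_norm_cong) (rule eq)
  also have "\<dots> \<le> rad_norm J (\<lambda>k. cblinfun_apply (fst (p k)) (x k))
      + rad_norm J (\<lambda>k. cblinfun_apply (snd (p k)) (?Sx k))" by (rule rad_norm_triangle)
  also have "\<dots> \<le> C * rad_norm J x + 1 / 2 * rad_norm J ?Sx"
    by (rule add_mono[OF R_boundD[OF E J] R_boundD[OF F J]]) (use p in auto)
  finally show "rad_norm J ?Sx \<le> 2 * C * rad_norm J x" by simp
qed

lemma power_bounded_resolvent:
  fixes T :: "('a::complex_banach, 'a) cblinfun"
  assumes C: "\<And>n. norm (cpower T n) \<le> C" and z: "cmod z > 1"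
  shows "z \<notin> spectrum T"
proof -
  define q where "q = 1 / z"
  have "1 / cmod z < 1" using z by (subst divide_less_eq_1_pos) auto
  then have q: "cmod q < 1" "z * q = 1" using z by (auto simp: q_def norm_divide)
  have pow: "cpower (q *\<^sub>C T) n = q ^ n *\<^sub>C cpower T n" for n
    by (induction n) (simp_all add: compose_scaleC_left compose_scaleC_right scaleC_scaleC mult.commute)
  have "summable (\<lambda>n. norm (cpower (q *\<^sub>C T) n))"
  proof (rule summable_comparison_test)
    show "summable (\<lambda>n. C * cmod q ^ n)" using q by (intro summable_mult summable_geometric) auto
    have "norm (cpower (q *\<^sub>C T) n) \<le> C * cmod q ^ n" for n using mult_right_mono[OF C, of "cmod q ^ n"]
      by (simp add: pow norm_scaleC norm_power mult.commute)
    then show "\<exists>N. \<forall>n\<ge>N. norm (norm (cpower (q *\<^sub>C T) n)) \<le> C * cmod q ^ n" by simp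
  qed
  note N = neumann_series[OF this]
  have e: "z *\<^sub>C cblinfun_id - T = z *\<^sub>C (cblinfun_id - q *\<^sub>C T)"
    using q by (simp add: scaleC_simps scaleC_scaleC)
  show ?thesis by (rule resolvent_eqI(1)[of _ _ "q *\<^sub>C (\<Sum>n. cpower (q *\<^sub>C T) n)"])
       (use q in \<open>simp_all add: e compose_scaleC_left compose_scaleC_right scaleC_scaleC N mult.commute\<close>)
qed

abbreviation outer_resolvents :: "real \<Rightarrow> ('a::complex_banach, 'a) cblinfun \<Rightarrow> ('a, 'a) cblinfun set" where
  "outer_resolvents \<delta> T \<equiv> {(z - 1) *\<^sub>C resolvent z T | z. z \<notin> closure (stolz \<delta>)}"

text \<open>Outside the closed unit disc, \<open>Z = (\<lambda> - 1) R(\<lambda>, T)\<close> satisfies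
  $Z = (1 - q) \sum_{n<N} q^n T^n + q^N T^N + \frac{q^N}{\lambda - 1} T^N (T - I) Z$ with
  \<open>q = 1 / \<lambda>\<close>.  If \<open>N\<close> is a large multiple of $1 / |\lambda - 1|$, the
  coefficients of the powers remain bounded while the last term can be absorbed, because
  $(N + 1) T^N (T - I)$ stays in an R-bounded set.\<close>

lemma R_bound_outside_disc:
  fixes T :: "('a::complex_banach, 'a) cblinfun"
  assumes E0: "R_bound {cpower T n | n. True} C0"
    and E1: "R_bound {real n *\<^sub>R (cpower T n - cpower T (n - 1)) | n. n \<ge> 1} C1"
    and C1: "C1 \<ge> 1"
  shows "R_bound {(z - 1) *\<^sub>C resolvent z T | z. cmod z > 1} (2 * ((4 * C1 + 3) * (2 * C0)))"
proof -
  let ?I = "cblinfun_id :: ('a, 'a) cblinfun"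
  let ?E0 = "{cpower T n | n. True}" and ?E1 = "{real n *\<^sub>R (cpower T n - cpower T (n - 1)) | n. n \<ge> 1}"
  define E where "E = {B. \<exists>c A. (\<forall>n::nat. A n \<in> ?E0) \<and> (\<forall>m. (\<Sum>n<m. cmod (c n)) \<le> 4 * C1 + 3)
      \<and> (\<lambda>n. c n *\<^sub>C A n) sums B}"
  define F where "F = {(1 / (4 * C1)) *\<^sub>R (c *\<^sub>C B) | c B. cmod c \<le> 1 \<and> B \<in> ?E1}"
  have E: "R_bound E ((4 * C1 + 3) * (2 * C0))" by (rule R_bound_series[OF E0]) (use C1 in \<open>auto simp: E_def\<close>)
  have "R_bound {c *\<^sub>C B | c B. cmod c \<le> 1 \<and> B \<in> ?E1} (2 * C1)"
    by (rule R_bound_contraction_complex[OF E1]) blast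
  then have "R_bound F (1 / (4 * C1) * (2 * C1))" by (rule R_bound_scale) (use C1 in \<open>auto simp: F_def\<close>)
  then have F: "R_bound F (1 / 2)" using C1 by simp
  show ?thesis
  proof (rule R_bound_absorb[OF E F])
    fix Z assume "Z \<in> {(z - 1) *\<^sub>C resolvent z T | z. cmod z > 1}"
    then obtain z where z: "cmod z > 1" and Z: "Z = (z - 1) *\<^sub>C resolvent z T" by blast
    have "z \<notin> spectrum T" by (rule power_bounded_resolvent[OF _ z]) (use R_bound_norm[OF E0] in blast)
    note TR = resolvent_T[OF this]
    define q where "q = 1 / z"
    have z0: "z \<noteq> 0" "z \<noteq> 1" using z by auto
    have q: "cmod q \<le> 1" "q * z = 1" using z z0 by (auto simp: q_def norm_divide)
    have TZ: "T o\<^sub>C Z = z *\<^sub>C Z - (z - 1) *\<^sub>C ?I"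
      by (simp add: Z TR compose_scaleC_right scaleC_simps scaleC_scaleC mult.commute)
    have step: "q *\<^sub>C (T o\<^sub>C Z) = Z - (1 - q) *\<^sub>C ?I"
    proof -
      have "q * (z - 1) = 1 - q" using q(2) by (simp add: algebra_simps)
      then show ?thesis by (simp add: TZ scaleC_simps scaleC_scaleC q(2))
    qed
    have geo: "Z = (\<Sum>n<N. ((1 - q) * q ^ n) *\<^sub>C cpower T n) + q ^ N *\<^sub>C (cpower T N o\<^sub>C Z)" for N
    proof (induction N)
      case (Suc N)
      have "q ^ Suc N *\<^sub>C (cpower T (Suc N) o\<^sub>C Z) = q ^ N *\<^sub>C (cpower T N o\<^sub>C (q *\<^sub>C (T o\<^sub>C Z)))"
        by (simp only: cpower_Suc_right compose_scaleC_right scaleC_scaleC cblinfun_compose_assoc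
            power_Suc mult.commute)
      also have "\<dots> = q ^ N *\<^sub>C (cpower T N o\<^sub>C Z) - ((1 - q) * q ^ N) *\<^sub>C cpower T N"
        by (simp add: step compose_bilinear.diff_right compose_scaleC_right scaleC_simps scaleC_scaleC
            mult.commute)
      finally show ?case using Suc by simp
    qed simp
    define N where "N = nat \<lceil>4 * C1 / cmod (z - 1)\<rceil>"
    have zp: "cmod (z - 1) > 0" using z0 by simp
    have N: "4 * C1 / cmod (z - 1) \<le> real N" "real N \<le> 4 * C1 / cmod (z - 1) + 1"
      using C1 zp unfolding N_def by (auto simp: le_nat_iff of_nat_nat ceiling_le_iff intro: real_nat_ceiling_ge)
    define B where "B = (\<Sum>n<N. ((1 - q) * q ^ n) *\<^sub>C cpower T n) + q ^ N *\<^sub>C cpower T N"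
    define D where "D = (q ^ N / (z - 1)) *\<^sub>C (cpower T N o\<^sub>C (T - ?I))"
    have "Z = ?I + (1 / (z - 1)) *\<^sub>C ((T - ?I) o\<^sub>C Z)"
    proof -
      have "(T - ?I) o\<^sub>C Z = (z - 1) *\<^sub>C (Z - ?I)"
        by (simp add: compose_bilinear.diff_left TZ scaleC_simps scaleC_diff_left)
      then show ?thesis using z0 by (simp add: scaleC_scaleC)
    qed
    then have "q ^ N *\<^sub>C (cpower T N o\<^sub>C Z)
        = q ^ N *\<^sub>C (cpower T N o\<^sub>C (?I + (1 / (z - 1)) *\<^sub>C ((T - ?I) o\<^sub>C Z)))" by simp
    also have "\<dots> = q ^ N *\<^sub>C cpower T N + D o\<^sub>C Z"
      by (simp add: D_def compose_bilinear.add_right compose_scaleC_right compose_scaleC_left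
          scaleC_simps scaleC_scaleC cblinfun_compose_assoc)
    finally have "Z = B + D o\<^sub>C Z" using geo[of N] by (simp add: B_def add.assoc)
    moreover have "B \<in> E"
    proof -
      define c where "c n = (if n < N then (1 - q) * q ^ n else if n = N then q ^ N else 0)" for n
      have "(\<lambda>n. c n *\<^sub>C cpower T n) sums (\<Sum>n\<in>{..N}. c n *\<^sub>C cpower T n)"
        by (rule sums_finite) (auto simp: c_def)
      also have "(\<Sum>n\<in>{..N}. c n *\<^sub>C cpower T n) = B" by (simp add: lessThan_Suc_atMost[symmetric] B_def c_def)
      finally have "(\<lambda>n. c n *\<^sub>C cpower T n) sums B" .
      moreover have "(\<Sum>n<m. cmod (c n)) \<le> 4 * C1 + 3" for m
      proof -
        have q1: "cmod (1 - q) * real N \<le> 4 * C1 + 2"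
        proof -
          have "1 - q = q * (z - 1)" using q(2) by (simp add: algebra_simps)
          then have 1: "cmod (1 - q) \<le> cmod (z - 1)" using q(1) by (simp add: norm_mult mult_left_le_one_le)
          have 2: "cmod (1 - q) \<le> 2" using norm_triangle_ineq4[of 1 q] q(1) by simp
          have "cmod (1 - q) * real N \<le> cmod (1 - q) * (4 * C1 / cmod (z - 1) + 1)"
            by (rule mult_left_mono[OF N(2)]) simp
          also have "\<dots> = cmod (1 - q) / cmod (z - 1) * (4 * C1) + cmod (1 - q)" by (simp add: algebra_simps)
          also have "\<dots> \<le> 1 * (4 * C1) + 2" using 1 zp C1 by (intro add_mono mult_right_mono 2) auto
          finally show ?thesis by simp
        qed
        have "(\<Sum>n<m. cmod (c n)) \<le> (\<Sum>n\<in>{..<m} \<union> {..N}. cmod (c n))" by (rule sum_mono2) auto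
        also have "\<dots> = (\<Sum>n\<in>{..N}. cmod (c n))" by (rule sum.mono_neutral_right) (auto simp: c_def)
        also have "\<dots> = (\<Sum>n<N. cmod ((1 - q) * q ^ n)) + cmod (q ^ N)"
          by (simp add: lessThan_Suc_atMost[symmetric] c_def)
        also have "\<dots> \<le> (\<Sum>n<N. cmod (1 - q)) + 1" using q(1) by (intro add_mono sum_mono)
            (auto simp: norm_mult norm_power power_le_one mult_left_le)
        also have "\<dots> \<le> 4 * C1 + 3" using q1 by (simp add: mult.commute)
        finally show ?thesis .
      qed
      ultimately show ?thesis unfolding E_def by (intro CollectI exI[of _ c] exI[of _ "cpower T"]) auto
    qed
    moreover have "D \<in> F"
    proof -
      define c where "c = q ^ N * of_real (4 * C1) / (of_real (real (Suc N)) * (z - 1))"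
      have "4 * C1 \<le> real N * cmod (z - 1)" using N(1) zp by (simp add: divide_le_eq)
      also have "\<dots> \<le> real (Suc N) * cmod (z - 1)" by (intro mult_right_mono) auto
      finally have a: "4 * C1 \<le> real (Suc N) * cmod (z - 1)" .
      have "cmod c = cmod q ^ N * (4 * C1) / (real (Suc N) * cmod (z - 1))"
        unfolding c_def norm_divide norm_mult norm_power norm_of_real using C1 by simp
      also have "\<dots> \<le> 1 * (4 * C1) / (real (Suc N) * cmod (z - 1))"
        using q(1) C1 by (intro divide_right_mono mult_right_mono power_le_one) auto
      also have "\<dots> \<le> 1" using a zp by (simp add: divide_le_eq)
      finally have "cmod c \<le> 1" .
      moreover have "D = (1 / (4 * C1)) *\<^sub>R (c *\<^sub>C (real (Suc N) *\<^sub>R (cpower T (Suc N) - cpower T (Suc N - 1))))"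
      proof -
        have "cpower T (Suc N) - cpower T (Suc N - 1) = cpower T N o\<^sub>C (T - ?I)"
          by (simp only: cpower_Suc_right) (simp add: compose_bilinear.diff_right)
        then show ?thesis using C1 by (simp add: D_def c_def scaleC_scaleC del: cpower.simps of_nat_Suc
              flip: scaleC_of_real)
      qed
      moreover have "real (Suc N) *\<^sub>R (cpower T (Suc N) - cpower T (Suc N - 1)) \<in> ?E1"
        by (intro CollectI exI[of _ "Suc N"]) auto
      ultimately show ?thesis unfolding F_def by blast
    qed
    ultimately show "\<exists>B\<in>E. \<exists>D\<in>F. Z = B + D o\<^sub>C Z" by blast
  qed
qed

text \<open>A point outside a large Stolz domain has a neighbour \<open>z\<close> outside the unit disc at a distance
  that is small compared with $|z - 1|$.  The resolvent identity then carries the R-bound over,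
  again by absorption.\<close>

theorem R_ritt_sectorial:
  fixes T :: "('a::complex_banach, 'a) cblinfun"
  assumes "R_ritt T"
  obtains \<delta> where "0 < \<delta>" "\<delta> < pi / 2" "spectrum T \<subseteq> closure (stolz \<delta>)"
    "R_bounded (outer_resolvents \<delta> T)"
proof -
  obtain C0 where E0: "R_bound {cpower T n | n. True} C0"
    using assms R_bounded_imp_R_bound unfolding R_ritt_def by blast
  obtain C1' where "R_bound {real n *\<^sub>R (cpower T n - cpower T (n - 1)) | n. n \<ge> 1} C1'"
    using assms R_bounded_imp_R_bound unfolding R_ritt_def by blast
  then have E1: "R_bound {real n *\<^sub>R (cpower T n - cpower T (n - 1)) | n. n \<ge> 1} (max C1' 1)"
    by (rule R_bound_weaken) simp
  let ?W = "{(z - 1) *\<^sub>C resolvent z T | z. cmod z > 1}"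
  define C where "C = max (2 * ((4 * max C1' 1 + 3) * (2 * C0))) 1"
  have W: "R_bound ?W C" and C: "C \<ge> 1"
    unfolding C_def by (rule R_bound_weaken[OF R_bound_outside_disc[OF E0 E1]]; simp) simp
  define e where "e = 1 / (16 * C)"
  have e: "0 < e" "e \<le> 1 / 16" "4 * e * C = 1 / 4" using C by (auto simp: e_def field_simps)
  define \<delta> where "\<delta> = arccos e"
  have \<delta>: "0 < \<delta>" "\<delta> < pi / 2" using e arccos_lt_bounded[of e] arccos_less_arccos[of 0 e] by (auto simp: \<delta>_def)
  have spec: "z \<notin> spectrum T" if "cmod z > 1" for z
    by (rule power_bounded_resolvent[OF _ that]) (use R_bound_norm[OF E0] in blast)
  have near: "\<exists>z. cmod z > 1 \<and> cmod (z - \<mu>) \<le> 4 * e * cmod (z - 1) \<and> cmod (\<mu> - 1) \<le> 2 * cmod (z - 1)"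
    if \<mu>: "\<mu> \<notin> closure (stolz \<delta>)" for \<mu>
  proof (cases "cmod \<mu> > 1")
    case True
    then show ?thesis using e by (intro exI[of _ \<mu>]) auto
  next
    case False
    have "\<not> e * cmod (1 - \<mu>) \<le> 1 - cmod \<mu>" using closure_stolz_criterion[of e \<mu>] \<mu> e unfolding \<delta>_def by auto
    then have \<mu>1: "1 - cmod \<mu> < e * cmod (1 - \<mu>)" by (simp only: not_le)
    have "\<mu> \<noteq> 0" using \<mu> zero_in_stolz[OF \<delta>] closure_subset by blast
    have "\<mu> \<noteq> 1" using \<mu> one_in_closure_stolz[OF \<delta>] by blast
    define r where "r = (1 + e * cmod (1 - \<mu>)) / cmod \<mu>"
    define z where "z = of_real r * \<mu>"
    have "1 + e * cmod (1 - \<mu>) > 0" using e(1) by (intro add_pos_nonneg mult_nonneg_nonneg) auto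
    then have r: "r > 0" unfolding r_def using \<open>\<mu> \<noteq> 0\<close> by (intro divide_pos_pos) auto
    have "cmod z = r * cmod \<mu>" unfolding z_def norm_mult norm_of_real using r by simp
    then have nz: "cmod z = 1 + e * cmod (1 - \<mu>)" using \<open>\<mu> \<noteq> 0\<close> by (simp add: r_def)
    have "z - \<mu> = of_real (r - 1) * \<mu>" by (simp add: z_def algebra_simps)
    then have "cmod (z - \<mu>) = \<bar>r - 1\<bar> * cmod \<mu>" by (simp only: norm_mult norm_of_real)
    also have "\<dots> = \<bar>(r - 1) * cmod \<mu>\<bar>" by (simp add: abs_mult)
    also have "(r - 1) * cmod \<mu> = 1 + e * cmod (1 - \<mu>) - cmod \<mu>"
      using nz \<open>cmod z = r * cmod \<mu>\<close> by (simp add: left_diff_distrib)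
    finally have d: "cmod (z - \<mu>) \<le> 2 * e * cmod (1 - \<mu>)" using \<mu>1 False by simp
    have "cmod (1 - \<mu>) \<le> cmod (z - 1) + cmod (z - \<mu>)" using norm_triangle_ineq4[of "z - \<mu>" "z - 1"] by simp
    then have h: "(1 - 2 * e) * cmod (1 - \<mu>) \<le> cmod (z - 1)" using d by (simp add: algebra_simps)
    have "1 / 2 * cmod (1 - \<mu>) \<le> (1 - 2 * e) * cmod (1 - \<mu>)" using e by (intro mult_right_mono) auto
    with h have h2: "cmod (1 - \<mu>) \<le> 2 * cmod (z - 1)" by simp
    have "2 * e * cmod (1 - \<mu>) \<le> 2 * e * (2 * cmod (z - 1))" using e by (intro mult_left_mono h2) auto
    then have "cmod (z - \<mu>) \<le> 4 * e * cmod (z - 1)" using d by simp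
    moreover have "cmod z > 1" using nz e(1) \<open>\<mu> \<noteq> 1\<close> by simp
    moreover have "cmod (\<mu> - 1) \<le> 2 * cmod (z - 1)" using h2 by (simp add: norm_minus_commute)
    ultimately show ?thesis by blast
  qed
  have res: "\<mu> \<notin> spectrum T" if \<mu>: "\<mu> \<notin> closure (stolz \<delta>)" for \<mu>
  proof -
    obtain z where z: "cmod z > 1" "cmod (z - \<mu>) \<le> 4 * e * cmod (z - 1)" using near[OF \<mu>] by blast
    have "cmod (z - 1) * norm (resolvent z T) \<le> C"
      using R_bound_norm[OF W, of "(z - 1) *\<^sub>C resolvent z T"] z(1) by (auto simp: norm_scaleC)
    then have "4 * e * (cmod (z - 1) * norm (resolvent z T)) \<le> 4 * e * C" using e by (intro mult_left_mono) auto
    moreover have "cmod (\<mu> - z) * norm (resolvent z T) \<le> 4 * e * cmod (z - 1) * norm (resolvent z T)"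
      using z(2) by (intro mult_right_mono) (auto simp: norm_minus_commute)
    ultimately have "cmod (\<mu> - z) * norm (resolvent z T) < 1" using e(3) by (simp add: mult.assoc)
    from resolvent_perturb(1)[OF spec[OF z(1)] this] show ?thesis .
  qed
  have W2: "R_bound {c *\<^sub>C B | c B. cmod c \<le> 1 \<and> B \<in> ?W} (2 * C)"
    by (rule R_bound_contraction_complex[OF W]) blast
  define E where "E = {2 *\<^sub>R (c *\<^sub>C B) | c B. cmod c \<le> 1 \<and> B \<in> ?W}"
  define F where "F = {(4 * e) *\<^sub>R (c *\<^sub>C B) | c B. cmod c \<le> 1 \<and> B \<in> ?W}"
  have E: "R_bound E (2 * (2 * C))" by (rule R_bound_scale[OF W2]) (auto simp: E_def)
  have "R_bound F (4 * e * (2 * C))" by (rule R_bound_scale[OF W2]) (use e in \<open>auto simp: F_def\<close>)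
  moreover have "4 * e * (2 * C) = 1 / 2" using e(3) by simp
  ultimately have F: "R_bound F (1 / 2)" by (simp only:)
  have "R_bound (outer_resolvents \<delta> T) (2 * (2 * (2 * C)))"
  proof (rule R_bound_absorb[OF E F])
    fix Z assume "Z \<in> outer_resolvents \<delta> T"
    then obtain \<mu> where \<mu>: "\<mu> \<notin> closure (stolz \<delta>)" and Z: "Z = (\<mu> - 1) *\<^sub>C resolvent \<mu> T" by blast
    obtain z where z: "cmod z > 1" "cmod (z - \<mu>) \<le> 4 * e * cmod (z - 1)"
      "cmod (\<mu> - 1) \<le> 2 * cmod (z - 1)" using near[OF \<mu>] by blast
    define V where "V = (z - 1) *\<^sub>C resolvent z T"
    have V: "V \<in> ?W" using z(1) by (auto simp: V_def)
    have zp: "cmod (z - 1) > 0" using z(1) by auto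
    define c d where "c = (\<mu> - 1) / (of_real 2 * (z - 1))" and "d = (z - \<mu>) / (of_real (4 * e) * (z - 1))"
    have c: "cmod c \<le> 1"
      using z(3) zp unfolding c_def norm_divide norm_mult norm_of_real by (simp add: divide_le_eq)
    have d: "cmod d \<le> 1"
      using z(2) zp e unfolding d_def norm_divide norm_mult norm_of_real by (simp add: divide_le_eq)
    have "resolvent \<mu> T = resolvent z T + (z - \<mu>) *\<^sub>C (resolvent z T o\<^sub>C resolvent \<mu> T)"
      using resolvent_identity[OF spec[OF z(1)] res[OF \<mu>]] by (simp add: algebra_simps)
    then have "Z = (\<mu> - 1) *\<^sub>C (resolvent z T + (z - \<mu>) *\<^sub>C (resolvent z T o\<^sub>C resolvent \<mu> T))"
      unfolding Z by (rule arg_cong)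
    also have "\<dots> = 2 *\<^sub>R (c *\<^sub>C V) + ((4 * e) *\<^sub>R (d *\<^sub>C V)) o\<^sub>C Z"
    proof -
      have c2: "of_real 2 * c * (z - 1) = \<mu> - 1" "of_real (4 * e) * d * (z - 1) = z - \<mu>"
      proof -
        have cancel: "a * (b / (a * k)) * k = b" if "a \<noteq> 0" "k \<noteq> 0" for a b k :: complex using that by simp
        show "of_real 2 * c * (z - 1) = \<mu> - 1" "of_real (4 * e) * d * (z - 1) = z - \<mu>"
          unfolding c_def d_def using zp e by (intro cancel; simp)+
      qed
      have "2 *\<^sub>R (c *\<^sub>C V) = (\<mu> - 1) *\<^sub>C resolvent z T"
        unfolding V_def scaleC_of_real[symmetric] scaleC_scaleC using c2(1) by (simp only: mult.assoc)
      moreover have "(4 * e) *\<^sub>R (d *\<^sub>C V) = (z - \<mu>) *\<^sub>C resolvent z T"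
        unfolding V_def scaleC_of_real[symmetric] scaleC_scaleC using c2(2) by (simp only: mult.assoc)
      ultimately show ?thesis
        by (simp add: Z scaleC_add_right scaleC_scaleC compose_scaleC_left compose_scaleC_right mult.commute)
    qed
    finally show "\<exists>B\<in>E. \<exists>D\<in>F. Z = B + D o\<^sub>C Z" using V c d unfolding E_def F_def by blast
  qed
  then have "R_bounded (outer_resolvents \<delta> T)" by (rule R_bound_imp_R_bounded)
  then show ?thesis using that[OF \<delta>] res by blast
qed

lemma R_type_less:
  fixes T :: "('a::complex_banach, 'a) cblinfun"
  assumes T: "R_ritt T" and \<gamma>: "R_type T < \<gamma>"
  obtains \<delta> C where "0 < \<delta>" "\<delta> < \<gamma>" "ritt_of_type \<delta> T"
    "R_bound (outer_resolvents \<delta> T) C"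
proof -
  let ?D = "{\<delta>. 0 < \<delta> \<and> \<delta> < pi / 2 \<and> spectrum T \<subseteq> closure (stolz \<delta>) \<and>
     R_bounded (outer_resolvents \<delta> T)}"
  obtain \<delta>0 where "0 < \<delta>0" "\<delta>0 < pi / 2" "spectrum T \<subseteq> closure (stolz \<delta>0)"
    "R_bounded (outer_resolvents \<delta>0 T)" using R_ritt_sectorial[OF T] .
  then have "\<delta>0 \<in> ?D" by simp
  then have "?D \<noteq> {}" by blast
  moreover have "bdd_below ?D" by (rule bdd_belowI[of _ 0]) auto
  ultimately obtain \<delta> where \<delta>: "\<delta> \<in> ?D" "\<delta> < \<gamma>" using \<gamma> cInf_lessD[of ?D \<gamma>] unfolding R_type_def by blast
  then obtain C where C: "R_bound (outer_resolvents \<delta> T) C" using R_bounded_imp_R_bound by blast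
  have "ritt_of_type \<delta> T" unfolding ritt_of_type_def
  proof (intro conjI allI impI)
    fix b assume b: "\<delta> < b \<and> b < pi / 2"
    show "\<exists>K>0. \<forall>z. z \<notin> closure (stolz b) \<longrightarrow> norm ((z - 1) *\<^sub>C resolvent z T) \<le> K"
    proof (intro exI[of _ "max C 1"] conjI allI impI)
      fix z assume "z \<notin> closure (stolz b)"
      then have "z \<notin> closure (stolz \<delta>)" using \<delta> b closure_stolz_mono[of \<delta> b] by auto
      then have "norm ((z - 1) *\<^sub>C resolvent z T) \<le> C" by (intro R_bound_norm[OF C]) blast
      then show "norm ((z - 1) *\<^sub>C resolvent z T) \<le> max C 1" by simp
    qed auto
  qed (use \<delta> T in \<open>auto simp: R_ritt_def\<close>)
  then show ?thesis using that \<delta> C by blast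
qed


section \<open>The boundary of a Stolz domain as a contour\<close>

lemma stolz_tangent:
  "1 - of_real (sin b) * cis (pi / 2 - b) = of_real (cos b) * cis (- b)"
  "1 - of_real (sin b) * cis (b - pi / 2) = of_real (cos b) * cis b"
proof -
  have c: "cos (b - pi / 2) = sin b" "sin (b - pi / 2) = - cos b" by (simp_all add: cos_diff sin_diff)
  show "1 - of_real (sin b) * cis (pi / 2 - b) = of_real (cos b) * cis (- b)"
    "1 - of_real (sin b) * cis (b - pi / 2) = of_real (cos b) * cis b" using sin_cos_squared_add[of b]
    by (auto simp: complex_eq_iff cos_diff sin_diff c power2_eq_square algebra_simps)
qed

lemma stolz_contour_cases:
  assumes "0 < b" "t \<in> {0..1}"
  obtains (line) \<tau> \<sigma> where "0 \<le> \<tau>" "\<tau> \<le> 1" "\<sigma> = 1 \<or> \<sigma> = (- 1 :: real)"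
      "stolz_contour b t = 1 - of_real (\<tau> * cos b) * cis (\<sigma> * b)" "2 * min t (1 - t) \<le> \<tau>"
  | (arc) \<theta> where "stolz_contour b t = of_real (sin b) * cis \<theta>" "pi / 2 - b \<le> \<theta>" "\<theta> \<le> 3 * pi / 2 + b"
proof -
  consider "t \<le> 1 / 2" | "1 / 2 < t" "t \<le> 3 / 4" | "3 / 4 < t" by linarith
  then show ?thesis
  proof cases
    case 1
    have "stolz_contour b t = 1 - of_real (2 * t) * (1 - of_real (sin b) * cis (pi / 2 - b))"
      using 1 by (simp add: stolz_contour_def joinpaths_def linepath_def scaleR_conv_of_real algebra_simps)
    then show ?thesis using 1 assms by (intro line[of "2 * t" "- 1"]) (auto simp: stolz_tangent mult.assoc)
  next
    case 2
    let ?s = "4 * t - 2"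
    define \<theta> where "\<theta> = linepath (pi / 2 - b) (3 * pi / 2 + b) ?s"
    have "stolz_contour b t = part_circlepath 0 (sin b) (pi / 2 - b) (3 * pi / 2 + b) ?s"
      using 2 by (simp add: stolz_contour_def joinpaths_def algebra_simps)
    also have "\<dots> = of_real (sin b) * cis \<theta>" by (simp only: part_circlepath_def cis_conv_exp \<theta>_def add_0_left)
    finally have "stolz_contour b t = of_real (sin b) * cis \<theta>" .
    moreover have 1: "\<theta> = (pi / 2 - b) + ?s * (pi + 2 * b)" "\<theta> = (3 * pi / 2 + b) - (1 - ?s) * (pi + 2 * b)"
      by (simp_all add: \<theta>_def linepath_def field_simps)
    moreover have 2: "?s * (pi + 2 * b) \<ge> 0" "(1 - ?s) * (pi + 2 * b) \<ge> 0"
      using assms 2 by (intro mult_nonneg_nonneg; simp)+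
    ultimately show ?thesis by (intro arc[of \<theta>]) linarith+
  next
    case 3
    have "stolz_contour b t = 1 - of_real (4 * (1 - t)) * (1 - of_real (sin b) * cis (b - pi / 2))"
      using 3 by (simp add: stolz_contour_def joinpaths_def linepath_def scaleR_conv_of_real algebra_simps)
    then show ?thesis using 3 assms by (intro line[of "4 * (1 - t)" 1]) (auto simp: stolz_tangent mult.assoc)
  qed
qed

lemma cos_le_on_arc:
  assumes "0 < b" "b < pi / 2" "pi / 2 - b \<le> \<theta>" "\<theta> \<le> 3 * pi / 2 + b"
  shows "cos \<theta> \<le> sin b"
proof -
  have s: "sin b = cos (pi / 2 - b)" by (simp add: cos_diff)
  show ?thesis
  proof (cases "\<theta> \<le> pi")
    case True
    then show ?thesis unfolding s using assms by (intro cos_monotone_0_pi_le) auto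
  next
    case False
    have "cos \<theta> = cos (2 * pi - \<theta>)" by (simp add: cos_diff)
    also have "\<dots> \<le> cos (pi / 2 - b)" using False assms by (intro cos_monotone_0_pi_le) auto
    finally show ?thesis by (simp add: s)
  qed
qed

lemma stolz_contour_geometry:
  assumes b: "0 < b" "b < pi / 2" and t: "t \<in> {0..1}"
  shows "stolz_contour b t \<in> closure (stolz b)"
    and "min (2 * cos b) (1 - sin b) * min t (1 - t) \<le> cmod (1 - stolz_contour b t)"
    and "0 < a \<Longrightarrow> a < b \<Longrightarrow> stolz_contour b t \<noteq> 1 \<Longrightarrow> stolz_contour b t \<notin> closure (stolz a)"
proof -
  let ?z = "stolz_contour b t"
  note s = sin_angle[OF b]
  have c: "0 < cos b" using b by (intro cos_gt_zero) auto
  have m: "0 \<le> min t (1 - t)" "min t (1 - t) \<le> 1" using t by auto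
  have "?z \<in> closure (stolz b) \<and> min (2 * cos b) (1 - sin b) * min t (1 - t) \<le> cmod (1 - ?z)
    \<and> (0 < a \<longrightarrow> a < b \<longrightarrow> ?z \<noteq> 1 \<longrightarrow> ?z \<notin> closure (stolz a))"
  proof (rule stolz_contour_cases[OF b(1) t])
    fix \<tau> \<sigma> :: real
    assume \<tau>: "0 \<le> \<tau>" "\<tau> \<le> 1" "\<sigma> = 1 \<or> \<sigma> = - 1" "2 * min t (1 - t) \<le> \<tau>"
      and z: "?z = 1 - of_real (\<tau> * cos b) * cis (\<sigma> * b)"
    have cs: "cos (\<sigma> * b) = cos b" "(sin (\<sigma> * b))\<^sup>2 = (sin b)\<^sup>2" using \<tau>(3) by auto
    have nsq: "(cmod (?z - of_real (1 - u)))\<^sup>2 = u\<^sup>2 - 2 * u * \<tau> * (cos b)\<^sup>2 + \<tau>\<^sup>2 * (cos b)\<^sup>2" for u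
    proof -
      have "?z - of_real (1 - u) = Complex (u - \<tau> * cos b * cos b) (- (\<tau> * cos b * sin (\<sigma> * b)))"
        by (simp add: z complex_eq_iff cs)
      then have "(cmod (?z - of_real (1 - u)))\<^sup>2
          = (u - \<tau> * cos b * cos b)\<^sup>2 + (\<tau> * cos b)\<^sup>2 * (sin (\<sigma> * b))\<^sup>2"
        by (simp add: cmod_power2 power_mult_distrib)
      also have "\<dots> = u\<^sup>2 - 2 * u * \<tau> * (cos b)\<^sup>2 + \<tau>\<^sup>2 * (cos b)\<^sup>2 * ((cos b)\<^sup>2 + (sin b)\<^sup>2)"
      proof -
        have "(u - \<tau> * C * C)\<^sup>2 + (\<tau> * C)\<^sup>2 * S = u\<^sup>2 - 2 * u * \<tau> * C\<^sup>2 + \<tau>\<^sup>2 * C\<^sup>2 * (C\<^sup>2 + S)" for C S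
          by (simp add: power2_eq_square algebra_simps)
        then show ?thesis unfolding cs(2) .
      qed
      finally show ?thesis by simp
    qed
    have "(cmod (?z - of_real (1 - \<tau>)))\<^sup>2 = \<tau>\<^sup>2 * (1 - (cos b)\<^sup>2)"
      unfolding nsq by (simp add: power2_eq_square algebra_simps)
    also have "1 - (cos b)\<^sup>2 = (sin b)\<^sup>2" by (simp add: sin_squared_eq)
    finally have "(cmod (?z - of_real (1 - \<tau>)))\<^sup>2 = (\<tau> * sin b)\<^sup>2" by (simp add: power_mult_distrib)
    then have "cmod (?z - of_real (1 - \<tau>)) = \<tau> * sin b" using \<tau> s by (subst (asm) power2_eq_iff_nonneg) auto
    then have 1: "?z \<in> closure (stolz b)"
      using \<tau> by (subst closure_stolz_iff[OF b]) (intro exI[of _ \<tau>], simp del: of_real_diff)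
    have n1: "cmod (1 - ?z) = \<tau> * cos b" unfolding z using \<tau> c by (simp add: norm_mult)
    have "min (2 * cos b) (1 - sin b) * min t (1 - t) \<le> 2 * cos b * min t (1 - t)"
      using m by (intro mult_right_mono) auto
    also have "\<dots> \<le> \<tau> * cos b" using \<tau>(4) c mult_right_mono[OF \<tau>(4), of "cos b"] by simp
    finally have 2: "min (2 * cos b) (1 - sin b) * min t (1 - t) \<le> cmod (1 - ?z)" by (simp add: n1)
    have "?z \<notin> closure (stolz a)" if a: "0 < a" "a < b" "?z \<noteq> 1"
    proof
      have a2: "a < pi / 2" using a b by simp
      have "\<tau> \<noteq> 0" using a(3) z by auto
      assume "?z \<in> closure (stolz a)"
      then obtain u where u: "0 \<le> u" "u \<le> 1" "cmod (?z - of_real (1 - u)) \<le> u * sin a"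
        using a a2 by (auto simp: closure_stolz_iff)
      have "(cmod (?z - of_real (1 - u)))\<^sup>2 \<le> (u * sin a)\<^sup>2" using u by (intro power_mono) auto
      then have le: "u\<^sup>2 * (cos a)\<^sup>2 - 2 * u * \<tau> * (cos b)\<^sup>2 + \<tau>\<^sup>2 * (cos b)\<^sup>2 \<le> 0"
        unfolding nsq by (simp add: power_mult_distrib cos_squared_eq algebra_simps)
      have cab: "cos b < cos a" using a b by (intro cos_monotone_0_pi) auto
      show False
      proof (cases "u = 0")
        case True
        then show False using le \<open>\<tau> \<noteq> 0\<close> c by (simp add: mult_le_0_iff)
      next
        case False
        have "(cos b)\<^sup>2 < (cos a)\<^sup>2" using cab c by (intro power_strict_mono) auto
        then have "u\<^sup>2 * (cos b)\<^sup>2 < u\<^sup>2 * (cos a)\<^sup>2" using False by (intro mult_strict_left_mono) auto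
        then have "u\<^sup>2 * (cos b)\<^sup>2 - 2 * u * \<tau> * (cos b)\<^sup>2 + \<tau>\<^sup>2 * (cos b)\<^sup>2 < 0" using le by linarith
        moreover have "u\<^sup>2 * (cos b)\<^sup>2 - 2 * u * \<tau> * (cos b)\<^sup>2 + \<tau>\<^sup>2 * (cos b)\<^sup>2 = ((u - \<tau>) * cos b)\<^sup>2"
          by (simp add: power2_eq_square algebra_simps)
        ultimately show False by simp
      qed
    qed
    with 1 2 show ?thesis by blast
  next
    fix \<theta> assume \<theta>: "pi / 2 - b \<le> \<theta>" "\<theta> \<le> 3 * pi / 2 + b" and z: "?z = of_real (sin b) * cis \<theta>"
    have nz: "cmod ?z = sin b" using s by (simp add: z norm_mult)
    have 1: "?z \<in> closure (stolz b)" using nz by (subst closure_stolz_iff[OF b]) (intro exI[of _ 1], simp)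
    have "min (2 * cos b) (1 - sin b) * min t (1 - t) \<le> (1 - sin b) * 1" using m s by (intro mult_mono) auto
    also have "\<dots> \<le> cmod (1 - ?z)" using norm_triangle_ineq2[of 1 ?z] nz by simp
    finally have 2: "min (2 * cos b) (1 - sin b) * min t (1 - t) \<le> cmod (1 - ?z)" .
    have "?z \<notin> closure (stolz a)" if a: "0 < a" "a < b"
    proof
      have a2: "a < pi / 2" using a b by simp
      assume "?z \<in> closure (stolz a)"
      then obtain u where u: "0 \<le> u" "u \<le> 1" "cmod (?z - of_real (1 - u)) \<le> u * sin a"
        using a a2 by (auto simp: closure_stolz_iff)
      have "u \<noteq> 0"
      proof
        assume "u = 0"
        then have "?z = 1" using u by simp
        then show False using nz s by simp
      qed
      then have "u * sin a < u * sin b" using u sin_angle_mono[OF a b(2)] by (intro mult_strict_left_mono) auto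
      with u have "cmod (?z - of_real (1 - u)) < u * sin b" by linarith
      then have lt: "(cmod (?z - of_real (1 - u)))\<^sup>2 < (u * sin b)\<^sup>2" by (intro power_strict_mono) auto
      have "?z - of_real (1 - u) = Complex (sin b * cos \<theta> - (1 - u)) (sin b * sin \<theta>)"
        by (simp add: z complex_eq_iff)
      then have "(cmod (?z - of_real (1 - u)))\<^sup>2 = (sin b * cos \<theta> - (1 - u))\<^sup>2 + (sin b * sin \<theta>)\<^sup>2"
        by (simp add: cmod_power2)
      also have "\<dots> = (sin b)\<^sup>2 * ((cos \<theta>)\<^sup>2 + (sin \<theta>)\<^sup>2) - 2 * (1 - u) * sin b * cos \<theta> + (1 - u)\<^sup>2"
      proof -
        have "(S * C - v)\<^sup>2 + (S * R)\<^sup>2 = S\<^sup>2 * (C\<^sup>2 + R\<^sup>2) - 2 * v * S * C + v\<^sup>2" for S C R v :: real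
          by (simp add: power2_eq_square algebra_simps)
        then show ?thesis .
      qed
      finally have eq: "(cmod (?z - of_real (1 - u)))\<^sup>2 = (sin b)\<^sup>2 - 2 * (1 - u) * sin b * cos \<theta> + (1 - u)\<^sup>2"
        by simp
      have "2 * (1 - u) * sin b * cos \<theta> \<le> 2 * (1 - u) * sin b * sin b"
        using u s by (intro mult_left_mono cos_le_on_arc[OF b \<theta>]) auto
      then have "(sin b)\<^sup>2 - 2 * (1 - u) * (sin b)\<^sup>2 + (1 - u)\<^sup>2 < (u * sin b)\<^sup>2"
        using lt eq by (simp add: power2_eq_square mult.assoc)
      then have "(1 - u)\<^sup>2 * (1 - (sin b)\<^sup>2) < 0" by (simp add: power2_eq_square algebra_simps)
      moreover have "(1 - u)\<^sup>2 * (1 - (sin b)\<^sup>2) \<ge> 0"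
        using s by (intro mult_nonneg_nonneg) (auto simp: power_le_one)
      ultimately show False by simp
    qed
    with 1 2 show ?thesis by blast
  qed
  then show "?z \<in> closure (stolz b)"
    "min (2 * cos b) (1 - sin b) * min t (1 - t) \<le> cmod (1 - ?z)"
    "0 < a \<Longrightarrow> a < b \<Longrightarrow> ?z \<noteq> 1 \<Longrightarrow> ?z \<notin> closure (stolz a)" by auto
qed

lemma stolz_contour_lower_bound:
  assumes "0 < b" "b < pi / 2"
  shows "\<exists>c>0. \<forall>t\<in>{0<..<1}. c * min t (1 - t) \<le> cmod (1 - stolz_contour b t)"
proof (intro exI[of _ "min (2 * cos b) (1 - sin b)"] conjI ballI)
  show "min (2 * cos b) (1 - sin b) > 0" using assms sin_angle[OF assms] cos_gt_zero[of b] by auto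
  show "min (2 * cos b) (1 - sin b) * min t (1 - t) \<le> cmod (1 - stolz_contour b t)"
    if "t \<in> {0<..<1}" for t using that assms by (intro stolz_contour_geometry(2)) auto
qed

lemma stolz_contour_ne_one:
  assumes "0 < b" "b < pi / 2" "t \<in> {0<..<1}"
  shows "stolz_contour b t \<noteq> 1"
proof -
  obtain c where c: "c > 0" "\<forall>t\<in>{0<..<1}. c * min t (1 - t) \<le> cmod (1 - stolz_contour b t)"
    using stolz_contour_lower_bound[OF assms(1,2)] by blast
  have "0 < c * min t (1 - t)" using c(1) assms(3) by simp
  then show ?thesis using bspec[OF c(2) assms(3)] by auto
qed

lemma stolz_contour_in_stolz:
  assumes "0 < b" "b < c" "c < pi / 2" "t \<in> {0<..<1}"
  shows "stolz_contour b t \<in> stolz c"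
  using assms by (intro closure_stolz_subset_stolz[of b] stolz_contour_geometry(1) stolz_contour_ne_one) auto

lemma stolz_contour_norm_less:
  assumes "0 < b" "b < pi / 2" "t \<in> {0<..<1}"
  shows "cmod (stolz_contour b t) < 1"
  using closure_stolz_norm_less[OF assms(1,2) stolz_contour_geometry(1)[OF assms(1,2)]] stolz_contour_ne_one[OF assms] assms(3)
  by simp

lemma stolz_contour_not_in:
  assumes "0 < a" "a < b" "b < pi / 2" "t \<in> {0<..<1}"
  shows "stolz_contour b t \<notin> closure (stolz a)"
  using assms stolz_contour_ne_one[of b t] by (intro stolz_contour_geometry(3)) auto

lemma stolz_arc_endpoints:
  "pathstart (part_circlepath 0 (sin b) (pi / 2 - b) (3 * pi / 2 + b)) = of_real (sin b) * cis (pi / 2 - b)"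
  "pathfinish (part_circlepath 0 (sin b) (pi / 2 - b) (3 * pi / 2 + b)) = of_real (sin b) * cis (b - pi / 2)"
proof -
  have "exp (\<i> * (of_real (3 * pi / 2 + b))) = cis (2 * pi + (b - pi / 2))"
    by (simp add: cis_conv_exp algebra_simps)
  also have "\<dots> = cis (b - pi / 2)" unfolding cis_mult[symmetric] by simp
  finally show "pathfinish (part_circlepath 0 (sin b) (pi / 2 - b) (3 * pi / 2 + b))
      = of_real (sin b) * cis (b - pi / 2)" unfolding pathfinish_part_circlepath by (simp only: add_0_left)
  show "pathstart (part_circlepath 0 (sin b) (pi / 2 - b) (3 * pi / 2 + b)) = of_real (sin b) * cis (pi / 2 - b)"
    unfolding pathstart_part_circlepath cis_conv_exp by (simp only: add_0_left)
qed

lemma valid_path_stolz_contour [simp]: "valid_path (stolz_contour b)"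
  "pathstart (stolz_contour b) = 1" "pathfinish (stolz_contour b) = 1"
proof -
  show "valid_path (stolz_contour b)" unfolding stolz_contour_def
    by (intro valid_path_join valid_path_linepath valid_path_part_circlepath)
       (simp_all add: stolz_arc_endpoints del: pathstart_part_circlepath pathfinish_part_circlepath)
qed (simp_all add: stolz_contour_def)

lemma path_stolz_contour [simp]: "path (stolz_contour b)" by (rule valid_path_imp_path) simp

lemma continuous_stolz_contour: "continuous_on {0<..<1} (stolz_contour b)"
  using path_stolz_contour[of b] unfolding path_def by (rule continuous_on_subset) auto

lemma path_image_stolz_contour:
  assumes "z \<in> path_image (stolz_contour b)"
  obtains t where "t \<in> {0..1}" "z = stolz_contour b t" using assms unfolding path_image_def by blast

abbreviation contour_speed :: "real \<Rightarrow> real \<Rightarrow> complex" where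
  "contour_speed b t \<equiv> vector_derivative (stolz_contour b) (at t)"

text \<open>The velocity of the contour is piecewise continuous.  At the two corners it is some fixed value,
  which is enough for boundedness and measurability.\<close>

lemma stolz_contour_derivative:
  "\<exists>D V. D \<in> borel_measurable borel \<and> V > 0 \<and>
    (\<forall>t\<in>{0<..<1}. contour_speed b t = D t \<and> cmod (D t) \<le> V)"
proof -
  let ?g = "stolz_contour b"
  let ?w = "of_real (sin b) * cis (pi / 2 - b)" and ?w' = "of_real (sin b) * cis (b - pi / 2)"
  let ?p = "part_circlepath 0 (sin b) (pi / 2 - b) (3 * pi / 2 + b)"
  let ?p' = "\<lambda>x. \<i> * of_real (sin b) * (of_real (3 * pi / 2 + b) - of_real (pi / 2 - b))
    * exp (\<i> * of_real (linepath (pi / 2 - b) (3 * pi / 2 + b) x))"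
  define D where "D t = (if t = 1 / 2 then vector_derivative ?g (at (1 / 2))
    else if t = 3 / 4 then vector_derivative ?g (at (3 / 4))
    else if t < 1 / 2 then 2 *\<^sub>R (?w - 1)
    else if t < 3 / 4 then 4 *\<^sub>R ?p' (4 * t - 2)
    else 4 *\<^sub>R (1 - ?w'))" for t :: real
  define V where "V = cmod (vector_derivative ?g (at (1 / 2))) + cmod (vector_derivative ?g (at (3 / 4)))
    + 2 * cmod (?w - 1) + 4 * (\<bar>sin b\<bar> * cmod (of_real (3 * pi / 2 + b) - of_real (pi / 2 - b)))
    + 4 * cmod (1 - ?w') + 1"
  have meas: "D \<in> borel_measurable borel" unfolding D_def linepath_def by measurable
  have bound: "cmod (D t) \<le> V" for t
  proof -
    have "cmod (?p' x) = \<bar>sin b\<bar> * cmod (of_real (3 * pi / 2 + b) - of_real (pi / 2 - b))" for x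
      unfolding norm_mult norm_of_real by simp
    then show ?thesis unfolding D_def V_def by (auto simp del: of_real_add of_real_diff)
  qed
  have deriv: "vector_derivative ?g (at t) = D t" if t: "t \<in> {0<..<1}" for t
  proof -
    consider "t = 1 / 2" | "t = 3 / 4" | "t < 1 / 2" | "1 / 2 < t" "t < 3 / 4" | "3 / 4 < t" by linarith
    then show ?thesis
    proof cases
      case 3
      have "((\<lambda>t. linepath 1 ?w (2 * t)) has_vector_derivative 2 *\<^sub>R (?w - 1)) (at t)"
      proof -
        have "((\<lambda>t. 2 * t) has_vector_derivative 2) (at t)"
          by (auto intro!: derivative_eq_intros simp: has_real_derivative_iff_has_vector_derivative[symmetric])
        from vector_diff_chain_at[OF this has_vector_derivative_linepath_within] show ?thesis
          by (simp only: o_def)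
      qed
      then have "(?g has_vector_derivative 2 *\<^sub>R (?w - 1)) (at t)"
        by (rule has_vector_derivative_transform_within_open[of _ _ _ "{..<1 / 2}"])
           (use 3 in \<open>auto simp: stolz_contour_def joinpaths_def\<close>)
      then show ?thesis using 3 by (simp add: D_def vector_derivative_at)
    next
      case 4
      have "((\<lambda>t. ?p (4 * t - 2)) has_vector_derivative 4 *\<^sub>R ?p' (4 * t - 2)) (at t)"
      proof -
        have "((\<lambda>t. 4 * t - 2) has_vector_derivative 4) (at t)"
          by (auto intro!: derivative_eq_intros simp: has_real_derivative_iff_has_vector_derivative[symmetric])
        from vector_diff_chain_at[OF this has_vector_derivative_part_circlepath] show ?thesis
          by (simp only: o_def)
      qed
      then have "(?g has_vector_derivative 4 *\<^sub>R ?p' (4 * t - 2)) (at t)"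
        by (rule has_vector_derivative_transform_within_open[of _ _ _ "{1 / 2<..<3 / 4}"])
           (use 4 in \<open>auto simp: stolz_contour_def joinpaths_def\<close>)
      then show ?thesis using 4 by (simp add: D_def vector_derivative_at)
    next
      case 5
      have "((\<lambda>t. linepath ?w' 1 (4 * t - 3)) has_vector_derivative 4 *\<^sub>R (1 - ?w')) (at t)"
      proof -
        have "((\<lambda>t. 4 * t - 3) has_vector_derivative 4) (at t)"
          by (auto intro!: derivative_eq_intros simp: has_real_derivative_iff_has_vector_derivative[symmetric])
        from vector_diff_chain_at[OF this has_vector_derivative_linepath_within] show ?thesis
          by (simp only: o_def)
      qed
      then have "(?g has_vector_derivative 4 *\<^sub>R (1 - ?w')) (at t)"
        by (rule has_vector_derivative_transform_within_open[of _ _ _ "{3 / 4<..}"])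
           (use 5 in \<open>auto simp: stolz_contour_def joinpaths_def\<close>)
      then show ?thesis using 5 by (simp add: D_def vector_derivative_at)
    next
      case 1
      have "D (1 / 2) = vector_derivative ?g (at (1 / 2))" by (simp add: D_def)
      with 1 show ?thesis by (simp only:)
    next
      case 2
      have "D (3 / 4) = vector_derivative ?g (at (3 / 4))" by (simp add: D_def)
      with 2 show ?thesis by (simp only:)
    qed
  qed
  have "V > 0" unfolding V_def by (intro add_nonneg_pos add_nonneg_nonneg mult_nonneg_nonneg) auto
  then show ?thesis using meas deriv bound by blast
qed

lemma stolz_contour_derivative_measurable:
  "(\<lambda>t. contour_speed b t) \<in> borel_measurable unit_measure"
proof -
  obtain D :: "real \<Rightarrow> complex" where D: "D \<in> borel_measurable borel"
    "\<forall>t\<in>{0<..<1}. contour_speed b t = D t" using stolz_contour_derivative[of b] by blast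
  have "D \<in> borel_measurable unit_measure" by (rule measurable_unit_measure[OF D(1)])
  then show ?thesis by (subst measurable_cong[where g = D]) (use D(2) in auto)
qed

lemma stolz_contour_derivative_bound:
  "\<exists>V>0. \<forall>t\<in>{0<..<1}. cmod (contour_speed b t) \<le> V" using stolz_contour_derivative[of b] by metis

text \<open>The boundary meets the negative real axis only between two points with conjugate logarithms.\<close>

lemma winding_number_stolz_contour:
  assumes b: "0 < b" "b < pi / 2"
  shows "winding_number (stolz_contour b) 0 = 1"
proof -
  note s = sin_angle[OF b]
  let ?w = "of_real (sin b) * cis (pi / 2 - b)" and ?w' = "of_real (sin b) * cis (b - pi / 2)"
  let ?p = "part_circlepath 0 (sin b) (pi / 2 - b) (3 * pi / 2 + b)"
  have c: "cos (pi / 2 - b) > 0" "cos (b - pi / 2) > 0" using s by (simp_all add: cos_diff)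
  have slit: "closed_segment 1 z \<subseteq> - \<real>\<^sub>\<le>\<^sub>0" if "Re z > 0" for z
  proof -
    have "closed_segment 1 z \<subseteq> {z. Re z > 0}"
      using that by (intro closed_segment_subset convex_halfspace_Re_gt) auto
    then show ?thesis by (auto simp: complex_nonpos_Reals_iff)
  qed
  have Ln: "Ln (of_real (sin b) * cis \<theta>) = Complex (ln (sin b)) \<theta>" if "- pi < \<theta>" "\<theta> \<le> pi" for \<theta>
  proof -
    have "of_real (sin b) * cis \<theta> = exp (Complex (ln (sin b)) \<theta>)"
      using s by (simp add: exp_eq_polar exp_of_real)
    then show ?thesis using that by (simp add: Ln_exp)
  qed
  have prim: "((\<lambda>z. 1 / z) has_contour_integral (Ln (pathfinish g) - Ln (pathstart g))) g"
    if "valid_path g" "path_image g \<subseteq> - \<real>\<^sub>\<le>\<^sub>0" for g by (rule contour_integral_primitive[OF _ that])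
       (auto intro!: derivative_eq_intros simp: field_simps)
  have 1: "((\<lambda>z. 1 / z) has_contour_integral Complex (ln (sin b)) (pi / 2 - b)) (linepath 1 ?w)"
    using prim[of "linepath 1 ?w"] slit[of ?w] c s b by (simp add: Ln)
  have 3: "((\<lambda>z. 1 / z) has_contour_integral - Complex (ln (sin b)) (b - pi / 2)) (linepath ?w' 1)"
    using prim[of "linepath ?w' 1"] slit[of ?w'] c s b by (simp add: Ln closed_segment_commute)
  have 2: "((\<lambda>z. 1 / z) has_contour_integral \<i> * of_real (pi + 2 * b)) ?p"
  proof -
    have "1 / ?p x * vector_derivative ?p (at x) = \<i> * of_real (pi + 2 * b)" for x
      unfolding vector_derivative_part_circlepath using s by (simp add: part_circlepath_def field_simps)
    then show ?thesis using has_integral_const_real[of "\<i> * of_real (pi + 2 * b)" 0 1]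
      by (simp add: has_contour_integral)
  qed
  have "((\<lambda>z. 1 / z) has_contour_integral (Complex (ln (sin b)) (pi / 2 - b)
      + (\<i> * of_real (pi + 2 * b) + - Complex (ln (sin b)) (b - pi / 2)))) (stolz_contour b)"
    unfolding stolz_contour_def by (intro has_contour_integral_join 1 2 3 valid_path_join valid_path_linepath
        valid_path_part_circlepath)
      (simp_all add: stolz_arc_endpoints del: pathstart_part_circlepath pathfinish_part_circlepath)
  also have "Complex (ln (sin b)) (pi / 2 - b)
      + (\<i> * of_real (pi + 2 * b) + - Complex (ln (sin b)) (b - pi / 2)) = 2 * of_real pi * \<i>"
    by (simp add: complex_eq_iff)
  finally have int: "((\<lambda>z. 1 / z) has_contour_integral 2 * of_real pi * \<i>) (stolz_contour b)" .
  have "0 \<notin> path_image (stolz_contour b)"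
  proof
    assume "0 \<in> path_image (stolz_contour b)"
    then obtain t where t: "t \<in> {0..1}" "0 = stolz_contour b t" by (rule path_image_stolz_contour)
    have "0 \<notin> closure (stolz (b / 2))" using stolz_contour_geometry(3)[OF b t(1), of "b / 2"] b t(2) by simp
    then show False using zero_in_stolz[of "b / 2"] b closure_subset by fastforce
  qed
  then have "winding_number (stolz_contour b) 0
      = 1 / (2 * pi * \<i>) * contour_integral (stolz_contour b) (\<lambda>z. 1 / (z - 0))"
    by (intro winding_number_valid_path) auto
  then show ?thesis using contour_integral_unique[OF int] by simp
qed

lemma contour_integral_eq_lebesgue:
  assumes b: "0 < b" "b < pi / 2"
    and cont: "continuous_on (path_image (stolz_contour b)) f"
  shows "integrable unit_measure (\<lambda>t. f (stolz_contour b t) * contour_speed b t)"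
    and "contour_integral (stolz_contour b) f
      = (\<integral>t. f (stolz_contour b t) * contour_speed b t \<partial>unit_measure)"
proof -
  let ?g = "stolz_contour b" and ?F = "\<lambda>t. f (stolz_contour b t) * contour_speed b t"
  have "compact (f ` path_image ?g)" by (intro compact_continuous_image cont compact_path_image) simp
  then obtain B where "\<forall>w\<in>f ` path_image ?g. cmod w \<le> B" using compact_imp_bounded bounded_iff by metis
  then have B: "\<And>z. z \<in> path_image ?g \<Longrightarrow> cmod (f z) \<le> B" by blast
  obtain V where V: "V > 0" "\<forall>t\<in>{0<..<1}. cmod (vector_derivative ?g (at t)) \<le> V"
    using stolz_contour_derivative_bound[of b] by blast
  have im: "?g t \<in> path_image ?g" if "t \<in> {0<..<1}" for t using that by (auto simp: path_image_def)
  have "continuous_on {0<..<1} (\<lambda>t. f (?g t))"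
    using im by (intro continuous_on_compose2[OF cont continuous_stolz_contour]) auto
  then have "strongly_measurable unit_measure (\<lambda>t. f (?g t))" by (rule strongly_measurable_unit_interval)
  then have "(\<lambda>t. f (?g t)) \<in> borel_measurable unit_measure" by (rule strongly_measurable_borel)
  then have meas: "?F \<in> borel_measurable unit_measure"
    using stolz_contour_derivative_measurable by (rule borel_measurable_times)
  show int: "integrable unit_measure ?F"
  proof (rule unit_prob.integrable_const_bound[where B = "B * V", OF _ meas])
    have "cmod (?F t) \<le> B * V" if t: "t \<in> {0<..<1}" for t
      unfolding norm_mult using B[OF im[OF t]] bspec[OF V(2) t]
      by (intro mult_mono) (auto intro: order_trans[OF norm_ge_zero])
    then show "AE t in unit_measure. cmod (?F t) \<le> B * V" by (intro AE_I2) simp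
  qed
  have "integrable (restrict_space lborel {0<..<1}) ?F" using int by (simp add: unit_measure_def)
  then have si: "set_integrable lborel {0<..<1} ?F" by (simp add: integrable_restrict_space set_integrable_def)
  have "(\<integral>t. ?F t \<partial>unit_measure) = (LINT t:{0<..<1}|lborel. ?F t)"
    by (simp add: unit_measure_def integral_restrict_space set_lebesgue_integral_def)
  also have "\<dots> = integral {0<..<1} ?F" by (rule set_borel_integral_eq_integral(2)[OF si])
  also have "\<dots> = integral {0..1} ?F" by (simp add: integral_open_interval_real)
  finally show "contour_integral ?g f = (\<integral>t. ?F t \<partial>unit_measure)" by (simp add: contour_integral_integral)
qed


section \<open>Integrals over the unit interval\<close>

lemma unit_integral_eq:
  fixes f :: "real \<Rightarrow> real"
  assumes "set_integrable lborel {0<..<1} f"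
  shows "integrable unit_measure f" "(\<integral>t. f t \<partial>unit_measure) = integral {0..1} f"
proof -
  show "integrable unit_measure f"
    using assms by (simp add: unit_measure_def integrable_restrict_space set_integrable_def)
  have "(\<integral>t. f t \<partial>unit_measure) = (LINT t:{0<..<1}|lborel. f t)"
    by (simp add: unit_measure_def integral_restrict_space set_lebesgue_integral_def)
  also have "\<dots> = integral {0<..<1} f" by (rule set_borel_integral_eq_integral(2)[OF assms])
  finally show "(\<integral>t. f t \<partial>unit_measure) = integral {0..1} f" by (simp add: integral_open_interval_real)
qed

lemma unit_integral_nonneg:
  fixes f :: "real \<Rightarrow> real"
  assumes hi: "(f has_integral I) {0..1}" and nn: "\<And>t. t \<in> {0..1} \<Longrightarrow> 0 \<le> f t"
    and meas: "f \<in> borel_measurable borel"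
  shows "integrable unit_measure f" "(\<integral>t. f t \<partial>unit_measure) = I"
proof -
  have "f absolutely_integrable_on {0..1}" by (rule nonnegative_absolutely_integrable_1) (use hi nn in auto)
  then have "f absolutely_integrable_on {0<..<1}" by (rule set_integrable_subset) auto
  then have "integrable lborel (\<lambda>x. indicator {0<..<1} x *\<^sub>R f x)"
    unfolding set_integrable_def by (subst (asm) integrable_completion) (use meas in measurable)
  then have si: "set_integrable lborel {0<..<1} f" by (simp add: set_integrable_def)
  show "integrable unit_measure f" "(\<integral>t. f t \<partial>unit_measure) = I" using unit_integral_eq[OF si] hi by auto
qed

lemma integrable_unit_powr:
  assumes "s > 0"
  shows "integrable unit_measure (\<lambda>t. min t (1 - t) powr (s - 1))"
proof -
  have a: "((\<lambda>t. t powr (s - 1)) has_integral (1 powr (s - 1 + 1) / (s - 1 + 1))) {0..1}"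
    using assms by (intro has_integral_powr_from_0) auto
  have b: "((\<lambda>t. (1 - t) powr (s - 1)) has_integral (1 powr (s - 1 + 1) / (s - 1 + 1))) {0..1}"
  proof -
    have "((\<lambda>t. (- 1 * t + 1) powr (s - 1)) has_integral
        (1 / \<bar>- 1 :: real\<bar> ^ DIM(real)) *\<^sub>R (1 powr (s - 1 + 1) / (s - 1 + 1)))
        ((\<lambda>t. (1 / - 1) *\<^sub>R t + - ((1 / - 1) *\<^sub>R 1)) ` cbox 0 1)"
      using has_integral_affinity[of "\<lambda>t. t powr (s - 1)" _ 0 1 "- 1" 1] a by simp
    moreover have "(\<lambda>t :: real. 1 - t) ` {0..1} = {0..1}" by (auto simp: image_iff intro!: bexI[of _ "1 - _"])
    ultimately show ?thesis by simp
  qed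
  have "integrable unit_measure (\<lambda>t. t powr (s - 1))" "integrable unit_measure (\<lambda>t. (1 - t) powr (s - 1))"
    by (rule unit_integral_nonneg(1)[OF a] unit_integral_nonneg(1)[OF b]; simp)+
  then have "integrable unit_measure (\<lambda>t. t powr (s - 1) + (1 - t) powr (s - 1))"
    by (rule Bochner_Integration.integrable_add)
  then show ?thesis
  proof (rule Bochner_Integration.integrable_bound)
    show "(\<lambda>t. min t (1 - t) powr (s - 1)) \<in> borel_measurable unit_measure"
      by (rule measurable_unit_measure) measurable
    show "AE t in unit_measure. norm (min t (1 - t) powr (s - 1)) \<le> norm (t powr (s - 1) + (1 - t) powr (s - 1))"
      by (intro AE_I2) (auto simp: min_def)
  qed
qed

lemma unit_integral_exp:
  assumes "c > 0"
  shows "integrable unit_measure (\<lambda>t. exp (- (c * min t (1 - t))))"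
    "(\<integral>t. c * exp (- (c * min t (1 - t))) \<partial>unit_measure) \<le> 2"
proof -
  have a: "((\<lambda>t. c * exp (- (c * t))) has_integral (- exp (- (c * 1)) - - exp (- (c * 0)))) {0..1}"
    by (rule fundamental_theorem_of_calculus)
       (auto intro!: derivative_eq_intros simp: has_real_derivative_iff_has_vector_derivative[symmetric])
  have b: "((\<lambda>t. c * exp (- (c * (1 - t)))) has_integral (exp (- (c * (1 - 1))) - exp (- (c * (1 - 0))))) {0..1}"
    by (rule fundamental_theorem_of_calculus)
       (auto intro!: derivative_eq_intros simp: has_real_derivative_iff_has_vector_derivative[symmetric])
  have ia: "integrable unit_measure (\<lambda>t. c * exp (- (c * t)))" "(\<integral>t. c * exp (- (c * t)) \<partial>unit_measure) \<le> 1"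
    using unit_integral_nonneg[OF a] assms by auto
  have ib: "integrable unit_measure (\<lambda>t. c * exp (- (c * (1 - t))))"
    "(\<integral>t. c * exp (- (c * (1 - t))) \<partial>unit_measure) \<le> 1" using unit_integral_nonneg[OF b] assms by auto
  show i: "integrable unit_measure (\<lambda>t. exp (- (c * min t (1 - t))))"
  proof (rule unit_prob.integrable_const_bound[where B = 1])
    show "AE t in unit_measure. norm (exp (- (c * min t (1 - t)))) \<le> 1" using assms by (intro AE_I2) auto
    show "(\<lambda>t. exp (- (c * min t (1 - t)))) \<in> borel_measurable unit_measure"
      by (rule measurable_unit_measure) measurable
  qed
  have "(\<integral>t. c * exp (- (c * min t (1 - t))) \<partial>unit_measure)
      \<le> (\<integral>t. c * exp (- (c * t)) + c * exp (- (c * (1 - t))) \<partial>unit_measure)"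
  proof (rule integral_mono)
    show "integrable unit_measure (\<lambda>t. c * exp (- (c * min t (1 - t))))" using i by simp
    show "integrable unit_measure (\<lambda>t. c * exp (- (c * t)) + c * exp (- (c * (1 - t))))"
      by (rule Bochner_Integration.integrable_add[OF ia(1) ib(1)])
    show "c * exp (- (c * min t (1 - t))) \<le> c * exp (- (c * t)) + c * exp (- (c * (1 - t)))" for t
      using assms by (auto simp: min_def)
  qed
  also have "\<dots> = (\<integral>t. c * exp (- (c * t)) \<partial>unit_measure) + (\<integral>t. c * exp (- (c * (1 - t))) \<partial>unit_measure)"
    by (rule Bochner_Integration.integral_add[OF ia(1) ib(1)])
  finally show "(\<integral>t. c * exp (- (c * min t (1 - t))) \<partial>unit_measure) \<le> 2" using ia(2) ib(2) by linarith
qed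


section \<open>Cauchy's theorem for integrands that are singular at 1\<close>

definition stolz_integral :: "real \<Rightarrow> (complex \<Rightarrow> complex) \<Rightarrow> complex" where
  "stolz_integral b F =
     (\<integral>t. F (stolz_contour b t) * contour_speed b t \<partial>unit_measure)"

abbreviation pairing :: "('a::complex_banach, complex) cblinfun \<Rightarrow> ('a, 'a) cblinfun \<Rightarrow> 'a \<Rightarrow> complex" where
  "pairing y A x \<equiv> cblinfun_apply y (cblinfun_apply A x)"

lemma norm_pairing: "cmod (pairing y A x) \<le> norm y * norm A * norm x"
proof -
  have "cmod (pairing y A x) \<le> norm y * norm (cblinfun_apply A x)" by (rule norm_cblinfun)
  also have "\<dots> \<le> norm y * (norm A * norm x)" by (intro mult_left_mono norm_cblinfun) auto
  finally show ?thesis by (simp add: mult.assoc)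
qed

lemma stolz_integrand_measurable:
  fixes F :: "complex \<Rightarrow> complex"
  assumes "continuous_on (stolz_contour b ` {0<..<1}) F"
  shows "(\<lambda>t. F (stolz_contour b t)) \<in> borel_measurable unit_measure"
    "(\<lambda>t. F (stolz_contour b t) * contour_speed b t) \<in> borel_measurable unit_measure"
proof -
  have "continuous_on {0<..<1} (\<lambda>t. F (stolz_contour b t))"
    by (rule continuous_on_compose2[OF assms continuous_stolz_contour]) auto
  then show "(\<lambda>t. F (stolz_contour b t)) \<in> borel_measurable unit_measure"
    by (intro strongly_measurable_borel strongly_measurable_unit_interval)
  then show "(\<lambda>t. F (stolz_contour b t) * contour_speed b t) \<in> borel_measurable unit_measure"
    using stolz_contour_derivative_measurable by (rule borel_measurable_times)
qed

lemma stolz_integrable: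
  assumes F: "continuous_on (stolz_contour b ` {0<..<1}) F"
    and bound: "\<And>t. t \<in> {0<..<1} \<Longrightarrow> cmod (F (stolz_contour b t)) \<le> w t"
    and w: "integrable unit_measure w"
  shows "integrable unit_measure (\<lambda>t. F (stolz_contour b t) * contour_speed b t)"
proof -
  obtain V where V: "V > 0" "\<forall>t\<in>{0<..<1}. cmod (contour_speed b t) \<le> V"
    using stolz_contour_derivative_bound[of b] by blast
  have "integrable unit_measure (\<lambda>t. w t * V)" using w by simp
  then show ?thesis
  proof (rule Bochner_Integration.integrable_bound)
    show "(\<lambda>t. F (stolz_contour b t) * contour_speed b t) \<in> borel_measurable unit_measure"
      by (rule stolz_integrand_measurable(2)[OF F])
    have "cmod (F (stolz_contour b t) * contour_speed b t) \<le> norm (w t * V)"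
      if t: "t \<in> {0<..<1}" for t
    proof -
      have "cmod (F (stolz_contour b t) * contour_speed b t) \<le> w t * V" unfolding norm_mult
        by (rule mult_mono[OF bound[OF t] bspec[OF V(2) t] order_trans[OF norm_ge_zero bound[OF t]] norm_ge_zero])
      then show ?thesis by simp
    qed
    then show "AE t in unit_measure. cmod (F (stolz_contour b t) * contour_speed b t)
        \<le> norm (w t * V)" by (intro AE_I2) simp
  qed
qed

lemma stolz_integral_dominated_convergence:
  fixes F :: "nat \<Rightarrow> complex \<Rightarrow> complex"
  assumes F: "\<And>n. continuous_on (stolz_contour b ` {0<..<1}) (F n)"
    and lim: "\<And>t. t \<in> {0<..<1} \<Longrightarrow> (\<lambda>n. F n (stolz_contour b t)) \<longlonglongrightarrow> G (stolz_contour b t)"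
    and bound: "\<And>n t. t \<in> {0<..<1} \<Longrightarrow> cmod (F n (stolz_contour b t)) \<le> w t"
    and w: "integrable unit_measure w"
  shows "(\<lambda>n. stolz_integral b (F n)) \<longlonglongrightarrow> stolz_integral b G"
proof -
  obtain V where V: "V > 0" "\<forall>t\<in>{0<..<1}. cmod (contour_speed b t) \<le> V"
    using stolz_contour_derivative_bound[of b] by blast
  let ?v = "\<lambda>t. contour_speed b t"
  have Gm: "(\<lambda>t. G (stolz_contour b t)) \<in> borel_measurable unit_measure"
    by (rule borel_measurable_LIMSEQ_metric[OF stolz_integrand_measurable(1)[OF F]]) (use lim in simp)
  show ?thesis unfolding stolz_integral_def
  proof (rule integral_dominated_convergence[where w = "\<lambda>t. w t * V"])
    show "(\<lambda>t. G (stolz_contour b t) * ?v t) \<in> borel_measurable unit_measure"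
      using Gm stolz_contour_derivative_measurable by (rule borel_measurable_times)
    show "(\<lambda>t. F n (stolz_contour b t) * ?v t) \<in> borel_measurable unit_measure" for n
      by (rule stolz_integrand_measurable(2)[OF F])
    show "integrable unit_measure (\<lambda>t. w t * V)" using w by simp
    have "(\<lambda>n. F n (stolz_contour b t) * ?v t) \<longlonglongrightarrow> G (stolz_contour b t) * ?v t" if "t \<in> {0<..<1}" for t
      by (intro tendsto_mult tendsto_const lim that)
    then show "AE t in unit_measure. (\<lambda>n. F n (stolz_contour b t) * ?v t) \<longlonglongrightarrow> G (stolz_contour b t) * ?v t"
      by (intro AE_I2) simp
    have "cmod (F n (stolz_contour b t) * ?v t) \<le> w t * V" if t: "t \<in> {0<..<1}" for n t unfolding norm_mult
      by (rule mult_mono[OF bound[OF t] bspec[OF V(2) t] order_trans[OF norm_ge_zero bound[OF t]] norm_ge_zero])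
    then show "AE t in unit_measure. cmod (F n (stolz_contour b t) * ?v t) \<le> w t * V" for n
      by (intro AE_I2) simp
  qed
qed

lemma contour_integral_eq_stolz_integral:
  assumes "0 < b" "b < pi / 2" "continuous_on (path_image (stolz_contour b)) f"
  shows "contour_integral (stolz_contour b) f = stolz_integral b f"
  unfolding stolz_integral_def by (rule contour_integral_eq_lebesgue(2)[OF assms])

lemma path_image_stolz_contour_scale:
  assumes b: "0 < b" "b < \<gamma>" "\<gamma> < pi / 2" and r: "0 \<le> r" "r < 1"
    and z: "z \<in> path_image (stolz_contour b)"
  shows "of_real r * z \<in> stolz \<gamma>"
proof -
  obtain t where t: "t \<in> {0..1}" "z = stolz_contour b t" using z by (rule path_image_stolz_contour)
  have "z \<in> closure (stolz b)" using stolz_contour_geometry(1)[of b t] t b by auto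
  then have "z \<in> closure (stolz \<gamma>)" using closure_stolz_mono[of b \<gamma>] b by auto
  then show ?thesis using b r by (intro stolz_scale) auto
qed

lemma stolz_scaled_region:
  fixes r :: real
  shows "open {z. of_real r * z \<in> stolz \<gamma>}" "convex {z. of_real r * z \<in> stolz \<gamma>}"
proof -
  have e: "{z. of_real r * z \<in> stolz \<gamma>} = (\<lambda>z. of_real r * z) -` stolz \<gamma>" by auto
  show "open {z. of_real r * z \<in> stolz \<gamma>}" unfolding e by (intro open_vimage open_stolz continuous_intros)
  show "convex {z. of_real r * z \<in> stolz \<gamma>}"
    unfolding e by (intro convex_linear_vimage convex_stolz bounded_linear.linear bounded_linear_mult_right)
qed

lemma holomorphic_scale:
  assumes "\<psi> holomorphic_on stolz \<gamma>"
  shows "(\<lambda>z. \<psi> (of_real r * z)) holomorphic_on {z. of_real r * z \<in> stolz \<gamma>}"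
  using holomorphic_on_compose_gen[of "\<lambda>z. of_real r * z" "{z. of_real r * z \<in> stolz \<gamma>}" \<psi> "stolz \<gamma>"] assms
  by (auto simp: o_def intro!: holomorphic_intros)

text \<open>The factors used for scaling towards the point \<open>1\<close>.\<close>

definition scale_factor :: "nat \<Rightarrow> real" where
  "scale_factor n = 1 - 1 / (real n + 2)"

lemma scale_factor: "0 < scale_factor n" "scale_factor n < 1" "scale_factor \<longlonglongrightarrow> 1"
proof -
  show "0 < scale_factor n" "scale_factor n < 1" by (simp_all add: scale_factor_def)
  show "scale_factor \<longlonglongrightarrow> 1" unfolding scale_factor_def by real_asymp
qed

text \<open>Since Stolz domains are star-shaped, a function on the domain can be scaled to one that is
  holomorphic across the contour, including the point \<open>1\<close>.\<close>

lemma stolz_integral_holomorphic: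
  assumes \<psi>: "\<psi> holomorphic_on stolz \<gamma>" and b: "0 < b" "b < \<gamma>" "\<gamma> < pi / 2"
    and M: "\<And>z. z \<in> stolz \<gamma> \<Longrightarrow> cmod (\<psi> z) \<le> M"
  shows "stolz_integral b (\<lambda>z. \<psi> z * z ^ j) = 0"
proof -
  let ?F = "\<lambda>n z. \<psi> (of_real (scale_factor n) * z) * z ^ j"
  let ?S = "\<lambda>n. {z. of_real (scale_factor n) * z \<in> stolz \<gamma>}"
  have im: "path_image (stolz_contour b) \<subseteq> ?S n" for n
    using path_image_stolz_contour_scale[OF b, of "scale_factor n"] scale_factor(1,2)[of n] by auto
  have hol: "?F n holomorphic_on ?S n" for n by (intro holomorphic_intros holomorphic_scale \<psi>)
  have cont: "continuous_on (path_image (stolz_contour b)) (?F n)" for n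
    using continuous_on_subset[OF holomorphic_on_imp_continuous_on[OF hol] im] .
  have zero: "stolz_integral b (?F n) = 0" for n
  proof -
    have "(?F n has_contour_integral 0) (stolz_contour b)"
      by (rule Cauchy_theorem_convex_simple[OF hol stolz_scaled_region(2) _ im]) auto
    from contour_integral_unique[OF this] show ?thesis
      using contour_integral_eq_stolz_integral[OF b(1) _ cont] b by simp
  qed
  have sub: "stolz_contour b ` {0<..<1} \<subseteq> path_image (stolz_contour b)" by (auto simp: path_image_def)
  have st: "stolz_contour b t \<in> stolz \<gamma>" if "t \<in> {0<..<1}" for t
    using that b by (intro stolz_contour_in_stolz) auto
  have "(\<lambda>n. stolz_integral b (?F n)) \<longlonglongrightarrow> stolz_integral b (\<lambda>z. \<psi> z * z ^ j)"
  proof (rule stolz_integral_dominated_convergence[where w = "\<lambda>_. M"])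
    show "continuous_on (stolz_contour b ` {0<..<1}) (?F n)" for n by (rule continuous_on_subset[OF cont sub])
    fix t :: real assume t: "t \<in> {0<..<1}"
    let ?z = "stolz_contour b t"
    have "isCont \<psi> ?z"
      using holomorphic_on_imp_continuous_on[OF \<psi>] st[OF t] open_stolz continuous_on_eq_continuous_at by blast
    moreover have "(\<lambda>n. of_real (scale_factor n) * ?z) \<longlonglongrightarrow> of_real 1 * ?z"
      by (intro tendsto_intros scale_factor(3))
    ultimately have "(\<lambda>n. \<psi> (of_real (scale_factor n) * ?z)) \<longlonglongrightarrow> \<psi> ?z" using isCont_tendsto_compose by fastforce
    then show "(\<lambda>n. ?F n ?z) \<longlonglongrightarrow> \<psi> ?z * ?z ^ j" by (intro tendsto_mult tendsto_const)
    fix n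
    have 1: "cmod (\<psi> (of_real (scale_factor n) * ?z)) \<le> M"
      using path_image_stolz_contour_scale[OF b _ scale_factor(2), of n ?z] scale_factor(1)[of n]
        subsetD[OF sub imageI[OF t]] by (intro M) simp
    have "cmod ?z \<le> 1" using stolz_norm_less[OF _ _ st[OF t]] b by auto
    then have "cmod (?z ^ j) \<le> 1" by (simp add: norm_power power_le_one)
    then have "cmod (\<psi> (of_real (scale_factor n) * ?z)) * cmod (?z ^ j) \<le> M * 1"
      by (rule mult_mono[OF 1 _ order_trans[OF norm_ge_zero 1] norm_ge_zero])
    then show "cmod (?F n ?z) \<le> M" by (simp add: norm_mult)
  qed simp
  then show ?thesis using LIMSEQ_unique[of "\<lambda>n. stolz_integral b (?F n)"] zero by auto
qed

lemma resolvent_scale: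
  assumes r: "r \<noteq> 0" and z: "z / r \<notin> spectrum T"
  shows "z \<notin> spectrum (r *\<^sub>C T)" "resolvent z (r *\<^sub>C T) = (1 / r) *\<^sub>C resolvent (z / r) T"
proof -
  have e: "z *\<^sub>C cblinfun_id - r *\<^sub>C T = r *\<^sub>C ((z / r) *\<^sub>C cblinfun_id - T)"
    using r by (simp add: scaleC_simps scaleC_scaleC)
  have "(z *\<^sub>C cblinfun_id - r *\<^sub>C T) o\<^sub>C ((1 / r) *\<^sub>C resolvent (z / r) T) = cblinfun_id"
    "((1 / r) *\<^sub>C resolvent (z / r) T) o\<^sub>C (z *\<^sub>C cblinfun_id - r *\<^sub>C T) = cblinfun_id"
    unfolding e using r by (simp_all add: compose_scaleC_left compose_scaleC_right scaleC_scaleC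
        resolvent_inverse[OF z])
  from resolvent_eqI[OF this] show "z \<notin> spectrum (r *\<^sub>C T)"
    "resolvent z (r *\<^sub>C T) = (1 / r) *\<^sub>C resolvent (z / r) T" by auto
qed

text \<open>Resolvent bounds for the operators \<open>r T\<close> that are uniform in \<open>r\<close>.  They hold because a point
  outside a Stolz domain is as far from the segment between \<open>0\<close> and \<open>1\<close> as it is from \<open>1\<close>, up to a
  constant.\<close>

lemma scaled_resolvent_bound:
  assumes T: "ritt_of_type a T" and a: "a < b" "b < pi / 2"
  shows "\<exists>K>0. \<forall>r z. 0 < r \<and> r \<le> 1 \<and> z \<notin> closure (stolz b) \<longrightarrow> z \<notin> spectrum (of_real r *\<^sub>C T)
    \<and> z / of_real r \<notin> spectrum T
    \<and> norm (resolvent z (of_real r *\<^sub>C T)) * cmod (1 - of_real r * z) \<le> K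
    \<and> norm (resolvent z (of_real r *\<^sub>C T)) * cmod (1 - z) \<le> K"
proof -
  have b: "0 < b" using T a by (simp add: ritt_of_type_def)
  obtain K where K: "K > 0" "\<forall>z. z \<notin> closure (stolz b) \<longrightarrow>
      z \<notin> spectrum T \<and> norm (resolvent z T) \<le> K / cmod (z - 1)"
    using ritt_of_type_resolvent_bound[OF T a] by blast
  let ?s = "sin b"
  have s: "0 < ?s" using sin_angle[OF b a(2)] by simp
  define L where "L = 1 + 2 * (1 + 1 / ?s)"
  have inv: "0 < 1 / ?s" using s by simp
  have "0 < 1 + 2 * (1 + q) \<and> 1 + q \<le> 1 + 2 * (1 + q)" if "0 < q" for q :: real using that by simp
  from this[OF inv] have L: "L > 0" and L2: "1 + 1 / ?s \<le> L" unfolding L_def by auto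
  have "z \<notin> spectrum (of_real r *\<^sub>C T) \<and> z / of_real r \<notin> spectrum T
    \<and> norm (resolvent z (of_real r *\<^sub>C T)) * cmod (1 - of_real r * z) \<le> K * L
    \<and> norm (resolvent z (of_real r *\<^sub>C T)) * cmod (1 - z) \<le> K * L"
    if r: "0 < r" "r \<le> 1" and z: "z \<notin> closure (stolz b)" for r z
  proof -
    have r0: "complex_of_real r \<noteq> 0" using r by simp
    have zr: "z / of_real r \<notin> closure (stolz b)"
      using closure_stolz_scale[OF b a(2), of "z / of_real r" r] r z by auto
    then have sp: "z / of_real r \<notin> spectrum T" using K by blast
    note rs = resolvent_scale[OF r0 sp]
    let ?d = "cmod (z - of_real r)"
    have d: "(1 - r) * ?s < ?d" using dist_real_segment[OF b a(2) z, of r] r by simp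
    then have d0: "?d > 0" using r s by (smt (verit) mult_nonneg_nonneg)
    have "norm (resolvent z (of_real r *\<^sub>C T)) = norm (resolvent (z / of_real r) T) / r"
      using r by (simp add: rs(2) norm_scaleC norm_divide)
    also have "\<dots> \<le> K / cmod (z / of_real r - 1) / r" using K(2) zr r by (intro divide_right_mono) auto
    also have "cmod (z / of_real r - 1) = ?d / r"
    proof -
      have "z / of_real r - 1 = (z - of_real r) / of_real r" using r0 by (simp add: field_simps)
      then show ?thesis using r by (simp add: norm_divide)
    qed
    finally have R: "norm (resolvent z (of_real r *\<^sub>C T)) \<le> K / ?d" using r by simp
    have "1 - r \<le> ?d / ?s" using d s by (simp add: field_simps)
    moreover have "cmod (1 - z) \<le> ?d + (1 - r)"
    proof -
      have "1 - z = of_real (1 - r) - (z - of_real r)" by simp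
      then have "cmod (1 - z) \<le> cmod (complex_of_real (1 - r)) + ?d" by (metis norm_triangle_ineq4)
      also have "cmod (complex_of_real (1 - r)) = 1 - r" using r by (simp only: norm_of_real)
      finally show ?thesis by simp
    qed
    ultimately have n1: "cmod (1 - z) \<le> (1 + 1 / ?s) * ?d" by (simp add: algebra_simps)
    have "1 - of_real r * z = (z - of_real r) + of_real (1 + r) * (1 - z)" by (simp add: algebra_simps)
    then have "cmod (1 - of_real r * z) \<le> ?d + cmod (of_real (1 + r) * (1 - z))"
      using norm_triangle_ineq by metis
    also have "cmod (of_real (1 + r) * (1 - z)) = (1 + r) * cmod (1 - z)"
      unfolding norm_mult norm_of_real using r by simp
    also have "(1 + r) * cmod (1 - z) \<le> 2 * cmod (1 - z)" using r by (intro mult_right_mono) auto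
    finally have n2: "cmod (1 - of_real r * z) \<le> L * ?d" using n1 by (simp add: L_def algebra_simps)
    have n3: "cmod (1 - z) \<le> L * ?d"
    proof -
      have "(1 + 1 / ?s) * ?d \<le> L * ?d" using L2 by (rule mult_right_mono) simp
      then show ?thesis using n1 by linarith
    qed
    have fin: "norm (resolvent z (of_real r *\<^sub>C T)) * m \<le> K * L" if "m \<le> L * ?d" "0 \<le> m" for m
    proof -
      have "norm (resolvent z (of_real r *\<^sub>C T)) * m \<le> K / ?d * (L * ?d)"
        using R that K(1) by (intro mult_mono) auto
      then show ?thesis using d0 by simp
    qed
    show ?thesis using rs(1) sp fin[OF n2] fin[OF n3] by auto
  qed
  then show ?thesis using K(1) L by (intro exI[of _ "K * L"]) auto
qed

lemma scaled_resolvent_tendsto: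
  assumes z: "z \<notin> spectrum T" "\<And>n. z / of_real (scale_factor n) \<notin> spectrum T"
  shows "(\<lambda>n. pairing y (resolvent z (of_real (scale_factor n) *\<^sub>C T)) x) \<longlonglongrightarrow> pairing y (resolvent z T) x"
proof -
  have "(\<lambda>n. z / of_real (scale_factor n)) \<longlonglongrightarrow> z / of_real 1" by (intro tendsto_intros scale_factor(3)) simp
  then have "(\<lambda>n. resolvent (z / of_real (scale_factor n)) T) \<longlonglongrightarrow> resolvent z T"
    using isCont_tendsto_compose[OF resolvent_isCont[OF z(1)], of "\<lambda>n. z / of_real (scale_factor n)"] by simp
  then have "(\<lambda>n. (1 / complex_of_real (scale_factor n)) *\<^sub>C resolvent (z / of_real (scale_factor n)) T)
      \<longlonglongrightarrow> (1 / of_real 1) *\<^sub>C resolvent z T" by (intro tendsto_scaleC tendsto_intros scale_factor(3)) auto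
  moreover have "resolvent z (of_real (scale_factor n) *\<^sub>C T)
      = (1 / complex_of_real (scale_factor n)) *\<^sub>C resolvent (z / of_real (scale_factor n)) T" for n
    using scale_factor(1)[of n] by (intro resolvent_scale z) auto
  ultimately have "(\<lambda>n. resolvent z (of_real (scale_factor n) *\<^sub>C T)) \<longlonglongrightarrow> resolvent z T" by simp
  then show ?thesis by (intro bounded_linear.tendsto[OF bounded_linear_cblinfun_apply]
        bounded_linear.tendsto[OF apply_bilinear.bounded_linear_left])
qed

lemma contour_avoids_scaled_spectrum:
  assumes a: "0 < a" "a < b" "b < pi / 2" and r: "0 < r" "r < 1"
    and z: "z \<in> path_image (stolz_contour b)"
  shows "z / of_real r \<notin> closure (stolz a)"
proof
  assume z2: "z / of_real r \<in> closure (stolz a)"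
  have "of_real r * (z / of_real r) \<in> stolz a" using a r by (intro stolz_scale[OF _ _ z2]) auto
  then have za: "z \<in> stolz a" using r by simp
  then have "z \<noteq> 1" using stolz_ne_one[of a z] a by auto
  obtain t where t: "t \<in> {0..1}" "z = stolz_contour b t" using z by (rule path_image_stolz_contour)
  have "z \<notin> closure (stolz a)" using stolz_contour_geometry(3)[of b t a] a t \<open>z \<noteq> 1\<close> by auto
  then show False using za closure_subset by blast
qed

lemma scaled_resolvent_holomorphic:
  assumes T: "spectrum T \<subseteq> closure (stolz a)" and r: "0 < r"
  shows "(\<lambda>z. pairing y (resolvent z (of_real r *\<^sub>C T)) x) holomorphic_on {z. z / of_real r \<notin> closure (stolz a)}"
proof (rule resolvent_pairing_holomorphic)
  show "{z. z / of_real r \<notin> closure (stolz a)} \<inter> spectrum (of_real r *\<^sub>C T) = {}"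
    using resolvent_scale(1)[of "of_real r"] r T by fastforce
qed

lemma open_scaled_complement: "open {z. z / complex_of_real r \<notin> closure (stolz a)}"
proof -
  have "{z. z / complex_of_real r \<notin> closure (stolz a)} = (\<lambda>z. z / of_real r) -` (- closure (stolz a))" by auto
  also have "open \<dots>"
    by (intro open_vimage open_Compl closed_closure) (auto simp: divide_inverse intro!: continuous_intros)
  finally show ?thesis .
qed

text \<open>After scaling, the integrand is holomorphic in a region that contains both contours and
  whose complement lies outside or inside both, so the angle does not matter.\<close>

lemma scaled_contour_independence:
  fixes y :: "('a::complex_banach, complex) cblinfun" and x :: 'a
  assumes T: "ritt_of_type a T" and b: "a < b" "b < \<gamma>" "a < b'" "b' < \<gamma>" "\<gamma> < pi / 2"
    and \<psi>: "\<psi> holomorphic_on stolz \<gamma>" and r: "0 < r" "r < 1"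
  defines "F \<equiv> \<lambda>z. \<psi> (of_real r * z) * pairing y (resolvent z (of_real r *\<^sub>C T)) x"
  shows "stolz_integral b F = stolz_integral b' F"
    "continuous_on (path_image (stolz_contour b)) F"
    "continuous_on (path_image (stolz_contour b')) F"
proof -
  have a: "0 < a" "a < pi / 2" "spectrum T \<subseteq> closure (stolz a)" using T by (auto simp: ritt_of_type_def)
  have pos: "0 < b" "0 < b'" "b < pi / 2" "b' < pi / 2" using a b by auto
  define U where "U = {z. of_real r * z \<in> stolz \<gamma>}"
  define K where "K = {z. z / of_real r \<in> closure (stolz a)}"
  have U: "open U" "convex U" unfolding U_def by (rule stolz_scaled_region)+
  have S: "open (U - K)"
  proof -
    have "U - K = U \<inter> {z. z / of_real r \<notin> closure (stolz a)}" by (auto simp: K_def)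
    then show ?thesis using U(1) open_scaled_complement by (simp add: open_Int)
  qed
  have hol: "F holomorphic_on U - K" unfolding F_def
    by (intro holomorphic_intros holomorphic_on_subset[OF holomorphic_scale[OF \<psi>]]
        holomorphic_on_subset[OF scaled_resolvent_holomorphic[OF a(3) r(1)]])
       (auto simp: U_def K_def)
  have im: "path_image (stolz_contour b) \<subseteq> U - K" "path_image (stolz_contour b') \<subseteq> U - K"
    using path_image_stolz_contour_scale[OF _ b(2,5), of r] path_image_stolz_contour_scale[OF _ b(4,5), of r]
      contour_avoids_scaled_spectrum[OF a(1) b(1) pos(3) r]
      contour_avoids_scaled_spectrum[OF a(1) b(3) pos(4) r] r pos by (auto simp: U_def K_def)
  show cont: "continuous_on (path_image (stolz_contour b)) F"
    "continuous_on (path_image (stolz_contour b')) F"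
    using holomorphic_on_imp_continuous_on[OF hol] im continuous_on_subset by blast+
  let ?p = "stolz_contour b +++ reversepath (stolz_contour b')"
  have vp: "valid_path ?p" by (intro valid_path_join) auto
  have loop: "pathfinish ?p = pathstart ?p" by simp
  have imp: "path_image ?p \<subseteq> U - K" using im by (simp add: path_image_join)
  have "winding_number ?p w = 0" if w: "w \<notin> U - K" for w
  proof (cases "w \<in> U")
    case False
    show ?thesis
      by (rule winding_number_zero_outside[OF valid_path_imp_path[OF vp] U(2) loop False]) (use imp in auto)
  next
    case True
    then have wK: "w \<in> K" using w by simp
    have K0: "0 \<in> K" using zero_in_stolz[OF a(1,2)] closure_subset by (auto simp: K_def)
    have "convex K"
    proof -
      have "K = (\<lambda>z. z * inverse (of_real r)) -` closure (stolz a)" by (auto simp: K_def divide_inverse)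
      then show ?thesis by (simp only:) (intro convex_linear_vimage convex_closure convex_stolz
            bounded_linear.linear[OF bounded_linear_mult_left])
    qed
    then have "winding_number ?p w = winding_number ?p 0" using imp wK K0
      by (intro winding_number_eq[OF valid_path_imp_path[OF vp] loop, of _ K]) (auto intro: convex_connected)
    also have "\<dots> = winding_number (stolz_contour b) 0 + winding_number (reversepath (stolz_contour b')) 0"
      using im K0 by (intro winding_number_join) auto
    also have "winding_number (reversepath (stolz_contour b')) 0 = - winding_number (stolz_contour b') 0"
      using im K0 by (intro winding_number_reversepath) auto
    finally show ?thesis
      using winding_number_stolz_contour[OF pos(1,3)] winding_number_stolz_contour[OF pos(2,4)] by simp
  qed
  then have "(F has_contour_integral 0) ?p" by (rule Cauchy_theorem_global[OF S hol vp loop imp])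
  moreover have int: "F contour_integrable_on stolz_contour b" "F contour_integrable_on stolz_contour b'"
    using S hol im by (auto intro!: contour_integrable_holomorphic_simple)
  ultimately have "contour_integral (stolz_contour b) F - contour_integral (stolz_contour b') F = 0"
    using contour_integral_unique[of F 0 ?p]
    by (simp add: contour_integrable_reversepath contour_integral_reversepath)
  then show "stolz_integral b F = stolz_integral b' F"
    using contour_integral_eq_stolz_integral[OF pos(1,3) cont(1)]
      contour_integral_eq_stolz_integral[OF pos(2,4) cont(2)] by simp
qed

lemma stolz_integral_contour_independence:
  fixes y :: "('a::complex_banach, complex) cblinfun"
  assumes T: "ritt_of_type a T" and b: "a < b" "b < \<gamma>" "a < b'" "b' < \<gamma>" "\<gamma> < pi / 2"
    and \<psi>: "\<psi> holomorphic_on stolz \<gamma>"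
    and M: "\<And>z. z \<in> stolz \<gamma> \<Longrightarrow> cmod (\<psi> z) \<le> M * cmod (1 - z)" "M \<ge> 0"
  shows "stolz_integral b (\<lambda>z. \<psi> z * pairing y (resolvent z T) x)
    = stolz_integral b' (\<lambda>z. \<psi> z * pairing y (resolvent z T) x)"
proof -
  have a: "0 < a" using T by (simp add: ritt_of_type_def)
  let ?F = "\<lambda>n z. \<psi> (of_real (scale_factor n) * z) * pairing y (resolvent z (of_real (scale_factor n) *\<^sub>C T)) x"
  have lim: "(\<lambda>n. stolz_integral c (?F n)) \<longlonglongrightarrow> stolz_integral c (\<lambda>z. \<psi> z * pairing y (resolvent z T) x)"
    if c: "a < c" "c < \<gamma>" for c
  proof -
    define a' where "a' = (a + c) / 2"
    have a': "a < a'" "a' < c" "a' < pi / 2" using c b by (auto simp: a'_def)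
    obtain K where K: "K > 0" "\<forall>r z. 0 < r \<and> r \<le> 1 \<and> z \<notin> closure (stolz a') \<longrightarrow> z \<notin> spectrum (of_real r *\<^sub>C T)
        \<and> z / of_real r \<notin> spectrum T
        \<and> norm (resolvent z (of_real r *\<^sub>C T)) * cmod (1 - of_real r * z) \<le> K
        \<and> norm (resolvent z (of_real r *\<^sub>C T)) * cmod (1 - z) \<le> K"
      using scaled_resolvent_bound[OF T a'(1,3)] by blast
    show ?thesis
    proof (rule stolz_integral_dominated_convergence[where w = "\<lambda>_. M * (norm y * K * norm x)"])
      show "continuous_on (stolz_contour c ` {0<..<1}) (?F n)" for n
        using scaled_contour_independence(2)[OF T c c b(5) \<psi> scale_factor(1,2)]
        by (rule continuous_on_subset) (auto simp: path_image_def)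
      fix t :: real assume t: "t \<in> {0<..<1}"
      let ?z = "stolz_contour c t"
      have z\<gamma>: "?z \<in> stolz \<gamma>" using t c a b by (intro stolz_contour_in_stolz) auto
      have za: "?z \<notin> closure (stolz a')" using t c a b a' by (intro stolz_contour_not_in) auto
      have zT: "?z \<notin> spectrum T" using K(2)[rule_format, of 1 ?z] za by simp
      have rz: "(\<lambda>n. of_real (scale_factor n) * ?z) \<longlonglongrightarrow> of_real 1 * ?z" by (intro tendsto_intros scale_factor(3))
      have "isCont \<psi> ?z"
        using holomorphic_on_imp_continuous_on[OF \<psi>] z\<gamma> open_stolz continuous_on_eq_continuous_at by blast
      then have 1: "(\<lambda>n. \<psi> (of_real (scale_factor n) * ?z)) \<longlonglongrightarrow> \<psi> ?z" using isCont_tendsto_compose rz by fastforce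
      have 2: "(\<lambda>n. pairing y (resolvent ?z (of_real (scale_factor n) *\<^sub>C T)) x) \<longlonglongrightarrow> pairing y (resolvent ?z T) x"
        using K(2)[rule_format, of "scale_factor _" ?z] scale_factor(1,2) za
        by (intro scaled_resolvent_tendsto zT) (simp add: less_imp_le)
      show "(\<lambda>n. ?F n ?z) \<longlonglongrightarrow> \<psi> ?z * pairing y (resolvent ?z T) x" by (rule tendsto_mult[OF 1 2])
      fix n
      let ?r = "scale_factor n"
      have "of_real ?r * ?z \<in> stolz \<gamma>"
        using path_image_stolz_contour_scale[of c \<gamma> ?r ?z] a b c t scale_factor(1,2)[of n]
        by (auto simp: path_image_def)
      then have "cmod (?F n ?z) \<le> (M * cmod (1 - of_real ?r * ?z))
          * (norm y * norm (resolvent ?z (of_real ?r *\<^sub>C T)) * norm x)"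
        unfolding norm_mult using M(2) by (intro mult_mono M(1) norm_pairing) auto
      also have "\<dots> = M * (norm y * (norm (resolvent ?z (of_real ?r *\<^sub>C T)) * cmod (1 - of_real ?r * ?z)) * norm x)"
        by (simp add: mult_ac)
      also have "\<dots> \<le> M * (norm y * K * norm x)"
        using K(2)[rule_format, of ?r ?z] scale_factor(1,2)[of n] za M(2)
        by (intro mult_left_mono mult_right_mono) auto
      finally show "cmod (?F n ?z) \<le> M * (norm y * K * norm x)" .
    qed simp
  qed
  have "stolz_integral b (?F n) = stolz_integral b' (?F n)" for n
    by (rule scaled_contour_independence(1)[OF T b \<psi> scale_factor(1,2)])
  then show ?thesis using LIMSEQ_unique[OF lim[OF b(1,2)]] lim[OF b(3,4)] by simp
qed

text \<open>Multiplication by \<open>z\<close> under the integral amounts to applying \<open>A\<close>, because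
  $(z^n - A^n) R(z, A)$ is a polynomial in \<open>z\<close>.  By absolute convergence, the same holds for power
  series with summable coefficients.\<close>

lemma resolvent_power_telescope:
  fixes y :: "('a::complex_banach, complex) cblinfun"
  assumes z: "z \<notin> spectrum A"
  shows "z ^ n * pairing y (resolvent z A) x - pairing y (resolvent z A) (cblinfun_apply (cpower A n) x)
    = (\<Sum>j<n. z ^ j * pairing y (cpower A (n - Suc j)) x)"
proof (induction n)
  case (Suc n)
  let ?R = "resolvent z A"
  have "?R o\<^sub>C cpower A (Suc n) = (?R o\<^sub>C A) o\<^sub>C cpower A n" by (simp add: cblinfun_compose_assoc)
  also have "\<dots> = z *\<^sub>C (?R o\<^sub>C cpower A n) - cpower A n"
    by (simp add: resolvent_T[OF z] compose_bilinear.diff_left compose_scaleC_left)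
  finally have e: "pairing y (?R o\<^sub>C cpower A (Suc n)) x
      = z * pairing y ?R (cblinfun_apply (cpower A n) x) - pairing y (cpower A n) x"
    by (simp add: cblinfun_apply_scaleC)
  have "(\<Sum>j<Suc n. z ^ j * pairing y (cpower A (Suc n - Suc j)) x)
      = pairing y (cpower A n) x + z * (\<Sum>j<n. z ^ j * pairing y (cpower A (n - Suc j)) x)"
    by (subst sum.lessThan_Suc_shift) (simp add: sum_distrib_left mult.assoc)
  also have "\<dots> = z ^ Suc n * pairing y ?R x - pairing y (?R o\<^sub>C cpower A (Suc n)) x"
    unfolding Suc[symmetric] e by (simp add: algebra_simps)
  finally show ?case by simp
qed simp

lemma stolz_integral_sums:
  assumes F: "\<And>n. continuous_on (stolz_contour b ` {0<..<1}) (F n)"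
    and bound: "\<And>n t. t \<in> {0<..<1} \<Longrightarrow> cmod (F n (stolz_contour b t)) \<le> L"
    and c: "summable (\<lambda>n. cmod (c n))"
    and H: "\<And>t. t \<in> {0<..<1} \<Longrightarrow> (\<lambda>n. c n * F n (stolz_contour b t)) sums H (stolz_contour b t)"
  shows "(\<lambda>n. c n * stolz_integral b (F n)) sums stolz_integral b H"
proof -
  have int: "integrable unit_measure (\<lambda>t. F n (stolz_contour b t) * contour_speed b t)" for n
    by (rule stolz_integrable[OF F bound]) auto
  have "(\<Sum>n<N. c n * stolz_integral b (F n)) = stolz_integral b (\<lambda>z. \<Sum>n<N. c n * F n z)" for N
    unfolding stolz_integral_def using int by (simp add: sum_distrib_right mult.assoc)
  moreover have "(\<lambda>N. stolz_integral b (\<lambda>z. \<Sum>n<N. c n * F n z)) \<longlonglongrightarrow> stolz_integral b H"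
  proof (rule stolz_integral_dominated_convergence[where w = "\<lambda>_. (\<Sum>n. cmod (c n)) * L"])
    fix t :: real and N assume t: "t \<in> {0<..<1}"
    have "cmod (\<Sum>n<N. c n * F n (stolz_contour b t)) \<le> (\<Sum>n<N. cmod (c n) * L)"
      by (rule sum_norm_le) (simp only: norm_mult, intro mult_left_mono bound t, simp)
    also have "\<dots> \<le> (\<Sum>n. cmod (c n)) * L"
      unfolding sum_distrib_right[symmetric] using order_trans[OF norm_ge_zero bound[OF t]]
      by (intro mult_right_mono sum_le_suminf c) auto
    finally show "cmod (\<Sum>n<N. c n * F n (stolz_contour b t)) \<le> (\<Sum>n. cmod (c n)) * L" .
  qed (use H in \<open>auto simp: sums_def intro!: continuous_intros F\<close>)
  ultimately show ?thesis by (simp add: sums_def)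
qed

lemma stolz_integral_power_series:
  fixes y :: "('a::complex_banach, complex) cblinfun"
  assumes b: "0 < b" "b < \<gamma>" "\<gamma> < pi / 2"
    and A: "\<And>t. t \<in> {0<..<1} \<Longrightarrow> stolz_contour b t \<notin> spectrum A" and C: "\<And>n. norm (cpower A n) \<le> C"
    and \<psi>: "\<psi> holomorphic_on stolz \<gamma>" and M: "\<And>z. z \<in> stolz \<gamma> \<Longrightarrow> cmod (\<psi> z) \<le> M"
    and B: "\<And>t. t \<in> {0<..<1} \<Longrightarrow>
      cmod (\<psi> (stolz_contour b t)) * norm (resolvent (stolz_contour b t) A) \<le> B"
    and g: "\<And>t. t \<in> {0<..<1} \<Longrightarrow> (\<lambda>n. c n * stolz_contour b t ^ n) sums g (stolz_contour b t)"
    and c: "summable (\<lambda>n. cmod (c n))" and G: "(\<lambda>n. c n *\<^sub>C cpower A n) sums G"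
  shows "stolz_integral b (\<lambda>z. \<psi> z * g z * pairing y (resolvent z A) x)
    = stolz_integral b (\<lambda>z. \<psi> z * pairing y (resolvent z A) (cblinfun_apply G x))"
proof -
  let ?\<Gamma> = "stolz_contour b" and ?D = "stolz_contour b ` {0<..<1}"
  let ?R = "\<lambda>v z. pairing y (resolvent z A) v"
  have D\<gamma>: "?D \<subseteq> stolz \<gamma>" using stolz_contour_in_stolz[OF b] by auto
  have \<psi>c: "continuous_on ?D \<psi>" using holomorphic_on_imp_continuous_on[OF \<psi>] D\<gamma> by (rule continuous_on_subset)
  have Rc: "continuous_on ?D (?R v)" for v
    by (rule holomorphic_on_imp_continuous_on[OF resolvent_pairing_holomorphic]) (use A in auto)
  have \<psi>R: "cmod (\<psi> (?\<Gamma> t) * ?R v (?\<Gamma> t)) \<le> B * (norm y * norm v)" if t: "t \<in> {0<..<1}" for t v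
  proof -
    have "cmod (\<psi> (?\<Gamma> t) * ?R v (?\<Gamma> t)) \<le> cmod (\<psi> (?\<Gamma> t)) * (norm y * norm (resolvent (?\<Gamma> t) A) * norm v)"
      unfolding norm_mult by (intro mult_left_mono norm_pairing) auto
    also have "\<dots> = (cmod (\<psi> (?\<Gamma> t)) * norm (resolvent (?\<Gamma> t) A)) * (norm y * norm v)" by (simp add: mult_ac)
    finally show ?thesis using mult_right_mono[OF B[OF t], of "norm y * norm v"] by simp
  qed
  have pow: "cmod (w * ?\<Gamma> t ^ n) \<le> cmod w" if "t \<in> {0<..<1}" for w t n
  proof -
    have "cmod (?\<Gamma> t) \<le> 1" using stolz_norm_less[of \<gamma> "?\<Gamma> t"] D\<gamma> that b by fastforce
    then show ?thesis by (simp add: norm_mult norm_power power_le_one mult_left_le)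
  qed
  let ?P = "\<lambda>n z. \<psi> z * ?R x z * z ^ n" and ?Q = "\<lambda>n. \<lambda>z. \<psi> z * ?R (cblinfun_apply (cpower A n) x) z"
  have cont: "continuous_on ?D (?P n)" "continuous_on ?D (?Q n)" "continuous_on ?D (\<lambda>z. \<psi> z * z ^ n)" for n
    by (intro continuous_intros \<psi>c Rc)+
  have P: "cmod (?P n (?\<Gamma> t)) \<le> B * (norm y * norm x)" if "t \<in> {0<..<1}" for n t
    using pow[OF that] \<psi>R[OF that] by (rule order_trans)
  have Q: "cmod (?Q n (?\<Gamma> t)) \<le> B * (norm y * (C * norm x))" if t: "t \<in> {0<..<1}" for n t
  proof -
    have "B \<ge> 0" by (rule order_trans[OF _ B[OF t]]) simp
    moreover have "norm (cblinfun_apply (cpower A n) x) \<le> C * norm x"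
      by (rule order_trans[OF norm_cblinfun mult_right_mono[OF C]]) simp
    ultimately show ?thesis by (intro order_trans[OF \<psi>R[OF t]] mult_left_mono) auto
  qed
  have "stolz_integral b (?P n) = stolz_integral b (?Q n)" for n
  proof -
    let ?v = "\<lambda>t. contour_speed b t"
    have int: "integrable unit_measure (\<lambda>t. ?P n (?\<Gamma> t) * ?v t)" "integrable unit_measure (\<lambda>t. ?Q n (?\<Gamma> t) * ?v t)"
      "integrable unit_measure (\<lambda>t. \<psi> (?\<Gamma> t) * ?\<Gamma> t ^ j * ?v t)" for j
    proof -
      show "integrable unit_measure (\<lambda>t. ?P n (?\<Gamma> t) * ?v t)" "integrable unit_measure (\<lambda>t. ?Q n (?\<Gamma> t) * ?v t)"
        by (rule stolz_integrable[OF cont(1) P] stolz_integrable[OF cont(2) Q]; simp)+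
      show "integrable unit_measure (\<lambda>t. \<psi> (?\<Gamma> t) * ?\<Gamma> t ^ j * ?v t)"
        by (rule stolz_integrable[OF cont(3), where w = "\<lambda>_. M"])
          (auto intro!: order_trans[OF pow M] subsetD[OF D\<gamma>])
    qed
    have "stolz_integral b (?P n) - stolz_integral b (?Q n)
        = (\<integral>t. (\<Sum>j<n. pairing y (cpower A (n - Suc j)) x * (\<psi> (?\<Gamma> t) * ?\<Gamma> t ^ j * ?v t)) \<partial>unit_measure)"
      unfolding stolz_integral_def Bochner_Integration.integral_diff[OF int(1,2), symmetric]
    proof (intro Bochner_Integration.integral_cong refl)
      fix t assume "t \<in> space unit_measure"
      then have "?\<Gamma> t \<notin> spectrum A" using A by simp
      from arg_cong[OF resolvent_power_telescope[OF this, of n y x], of "\<lambda>u. \<psi> (?\<Gamma> t) * u * ?v t"]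
      show "?P n (?\<Gamma> t) * ?v t - ?Q n (?\<Gamma> t) * ?v t
          = (\<Sum>j<n. pairing y (cpower A (n - Suc j)) x * (\<psi> (?\<Gamma> t) * ?\<Gamma> t ^ j * ?v t))"
        by (simp add: sum_distrib_left sum_distrib_right algebra_simps)
    qed
    also have "\<dots> = (\<Sum>j<n. pairing y (cpower A (n - Suc j)) x * stolz_integral b (\<lambda>z. \<psi> z * z ^ j))"
      unfolding stolz_integral_def by (subst Bochner_Integration.integral_sum) (use int(3) in auto)
    also have "\<dots> = 0" by (intro sum.neutral ballI) (simp add: stolz_integral_holomorphic[OF \<psi> b M])
    finally show ?thesis by simp
  qed
  moreover have "(\<lambda>n. c n * stolz_integral b (?P n)) sums stolz_integral b (\<lambda>z. \<psi> z * g z * ?R x z)"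
  proof (rule stolz_integral_sums[OF cont(1) P c])
    fix t :: real assume "t \<in> {0<..<1}"
    from sums_mult[OF g[OF this], of "\<psi> (?\<Gamma> t) * ?R x (?\<Gamma> t)"]
    show "(\<lambda>n. c n * ?P n (?\<Gamma> t)) sums (\<psi> (?\<Gamma> t) * g (?\<Gamma> t) * ?R x (?\<Gamma> t))" by (simp add: mult_ac)
  qed
  moreover have "(\<lambda>n. c n * stolz_integral b (?Q n)) sums stolz_integral b (\<lambda>z. \<psi> z * ?R (cblinfun_apply G x) z)"
  proof (rule stolz_integral_sums[OF cont(2) Q c])
    fix t :: real
    have "bounded_linear (\<lambda>E. ?R (cblinfun_apply E x) (?\<Gamma> t))"
      by (intro bounded_linear_compose[OF bounded_linear_cblinfun_apply]
          bounded_linear_compose[OF bounded_linear_cblinfun_apply] apply_bilinear.bounded_linear_left)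
    from sums_mult[OF bounded_linear.sums[OF this G], of "\<psi> (?\<Gamma> t)"]
    show "(\<lambda>n. c n * ?Q n (?\<Gamma> t)) sums (\<psi> (?\<Gamma> t) * ?R (cblinfun_apply G x) (?\<Gamma> t))"
      by (simp add: cblinfun_apply_scaleC mult_ac)
  qed
  ultimately show ?thesis by (simp add: sums_iff)
qed


section \<open>Fractional powers as power series\<close>

definition frac_coeff :: "real \<Rightarrow> nat \<Rightarrow> complex" where
  "frac_coeff \<alpha> n = (- 1) ^ n * (of_real \<alpha> gchoose n)"

lemma frac_coeff_Suc: "of_nat (Suc n) * frac_coeff \<alpha> (Suc n) = (of_nat n - of_real \<alpha>) * frac_coeff \<alpha> n"
proof -
  have "of_nat (Suc n) * (complex_of_real \<alpha> gchoose Suc n)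
      = of_real \<alpha> * (of_real \<alpha> gchoose n) - of_nat n * (of_real \<alpha> gchoose n)"
    using gbinomial_mult_1[of "complex_of_real \<alpha>" n] by simp
  then have "of_nat (Suc n) * (complex_of_real \<alpha> gchoose Suc n)
      = (of_real \<alpha> - of_nat n) * (of_real \<alpha> gchoose n)" by (simp only: left_diff_distrib)
  then have "(- 1) ^ Suc n * (of_nat (Suc n) * (complex_of_real \<alpha> gchoose Suc n))
      = (- 1) ^ Suc n * ((of_real \<alpha> - of_nat n) * (of_real \<alpha> gchoose n))" by simp
  then show ?thesis unfolding frac_coeff_def by (simp add: algebra_simps)
qed

text \<open>For \<open>n \<ge> \<alpha>\<close> the moduli of the coefficients satisfy
  $\alpha |c_n| = n |c_n| - (n + 1) |c_{n+1}|$, so their sum telescopes.\<close>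

lemma summable_frac_coeff:
  assumes "\<alpha> > 0"
  shows "summable (\<lambda>n. cmod (frac_coeff \<alpha> n))"
proof -
  define N where "N = nat \<lceil>\<alpha>\<rceil>"
  have N: "real N \<ge> \<alpha>" by (simp add: N_def real_nat_ceiling_ge)
  have step: "\<alpha> * cmod (frac_coeff \<alpha> (n + N))
      = real (n + N) * cmod (frac_coeff \<alpha> (n + N)) - real (Suc n + N) * cmod (frac_coeff \<alpha> (Suc n + N))" for n
  proof -
    have "cmod (of_nat (Suc (n + N)) * frac_coeff \<alpha> (Suc (n + N)))
        = cmod ((of_nat (n + N) - of_real \<alpha>) * frac_coeff \<alpha> (n + N))" by (simp only: frac_coeff_Suc)
    moreover have "complex_of_nat (n + N) - of_real \<alpha> = of_real (real (n + N) - \<alpha>)" by simp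
    ultimately have "real (Suc (n + N)) * cmod (frac_coeff \<alpha> (Suc (n + N)))
        = \<bar>real (n + N) - \<alpha>\<bar> * cmod (frac_coeff \<alpha> (n + N))" by (simp only: norm_mult norm_of_nat norm_of_real)
    moreover have "\<bar>real (n + N) - \<alpha>\<bar> = real (n + N) - \<alpha>" using N by simp
    ultimately show ?thesis by (simp add: algebra_simps)
  qed
  have "(\<Sum>n<m. cmod (frac_coeff \<alpha> (n + N))) \<le> real N * cmod (frac_coeff \<alpha> N) / \<alpha>" for m
  proof -
    have "\<alpha> * (\<Sum>n<m. cmod (frac_coeff \<alpha> (n + N)))
        = (\<Sum>n<m. real (n + N) * cmod (frac_coeff \<alpha> (n + N)) - real (Suc n + N) * cmod (frac_coeff \<alpha> (Suc n + N)))"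
      by (simp only: sum_distrib_left step)
    also have "\<dots> = real (0 + N) * cmod (frac_coeff \<alpha> (0 + N)) - real (m + N) * cmod (frac_coeff \<alpha> (m + N))"
      by (rule sum_lessThan_telescope')
    also have "\<dots> \<le> real N * cmod (frac_coeff \<alpha> N)" by simp
    finally show ?thesis using assms by (simp add: pos_le_divide_eq mult.commute)
  qed
  then have "summable (\<lambda>n. cmod (frac_coeff \<alpha> (n + N)))"
    by (intro summableI_nonneg_bounded[where x = "real N * cmod (frac_coeff \<alpha> N) / \<alpha>"]) auto
  then show ?thesis by (rule summable_iff_shift[THEN iffD1])
qed

lemma frac_coeff_sums:
  assumes "cmod z < 1"
  shows "(\<lambda>n. frac_coeff \<alpha> n * z ^ n) sums (1 - z) powr of_real \<alpha>"
proof -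
  have "(\<lambda>n. (of_real \<alpha> gchoose n) * (- z) ^ n) sums (1 + - z) powr of_real \<alpha>"
    by (rule gen_binomial_complex) (use assms in simp)
  moreover have "(of_real \<alpha> gchoose n) * (- z) ^ n = frac_coeff \<alpha> n * z ^ n" for n
    unfolding frac_coeff_def power_minus[of z] by simp
  ultimately show ?thesis by simp
qed

definition frac_sum :: "('a::complex_banach, 'a) cblinfun \<Rightarrow> real \<Rightarrow> ('a, 'a) cblinfun" where
  "frac_sum T \<alpha> = (\<Sum>n. frac_coeff \<alpha> n *\<^sub>C cpower T n)"

lemma frac_sum_sums:
  assumes C: "\<And>n. norm (cpower T n) \<le> C" and "\<alpha> > 0"
  shows "(\<lambda>n. frac_coeff \<alpha> n *\<^sub>C cpower T n) sums frac_sum T \<alpha>" unfolding frac_sum_def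
proof (rule summable_sums, rule summable_norm_cancel, rule summable_comparison_test)
  show "summable (\<lambda>n. cmod (frac_coeff \<alpha> n) * C)"
    using summable_frac_coeff[OF assms(2)] by (rule summable_mult2)
  show "\<exists>N. \<forall>n\<ge>N. norm (norm (frac_coeff \<alpha> n *\<^sub>C cpower T n)) \<le> cmod (frac_coeff \<alpha> n) * C"
    using C by (intro exI[of _ 0]) (simp add: norm_scaleC mult_left_mono)
qed

lemma frac_sum_commute:
  assumes C: "\<And>n. norm (cpower T n) \<le> C" and "\<alpha> > 0" and S: "S o\<^sub>C T = T o\<^sub>C S"
  shows "S o\<^sub>C frac_sum T \<alpha> = frac_sum T \<alpha> o\<^sub>C S"
proof -
  note s = frac_sum_sums[OF assms(1,2)]
  have 1: "(\<lambda>n. S o\<^sub>C (frac_coeff \<alpha> n *\<^sub>C cpower T n)) sums (S o\<^sub>C frac_sum T \<alpha>)"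
    using compose_bilinear.bounded_linear_right s by (rule bounded_linear.sums)
  have 2: "(\<lambda>n. (frac_coeff \<alpha> n *\<^sub>C cpower T n) o\<^sub>C S) sums (frac_sum T \<alpha> o\<^sub>C S)"
    using compose_bilinear.bounded_linear_left s by (rule bounded_linear.sums)
  have "S o\<^sub>C (frac_coeff \<alpha> n *\<^sub>C cpower T n) = (frac_coeff \<alpha> n *\<^sub>C cpower T n) o\<^sub>C S" for n
    by (simp add: compose_scaleC_left compose_scaleC_right cpower_commute[OF S])
  with 2 have "(\<lambda>n. S o\<^sub>C (frac_coeff \<alpha> n *\<^sub>C cpower T n)) sums (frac_sum T \<alpha> o\<^sub>C S)" by (simp only:)
  with 1 show ?thesis by (rule sums_unique2)
qed

lemma cadjoint_frac_sum:
  fixes T :: "('a::complex_banach, 'a) cblinfun"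
  assumes C: "\<And>n. norm (cpower T n) \<le> C" and "\<alpha> > 0"
  shows "frac_sum (cadjoint T) \<alpha> = cadjoint (frac_sum T \<alpha>)"
proof -
  have bl: "bounded_linear (cadjoint :: ('a, 'a) cblinfun \<Rightarrow> _)"
  proof (rule bounded_linear_intro[where K = 1])
    show "cadjoint (A + B) = cadjoint A + cadjoint B" for A B :: "('a, 'a) cblinfun"
      by (auto intro!: cblinfun_eqI)
  qed (simp_all add: norm_cadjoint cadjoint_linear)
  have "(\<lambda>n. cadjoint (frac_coeff \<alpha> n *\<^sub>C cpower T n)) sums cadjoint (frac_sum T \<alpha>)"
    using bl frac_sum_sums[OF assms] by (rule bounded_linear.sums)
  then have "(\<lambda>n. frac_coeff \<alpha> n *\<^sub>C cpower (cadjoint T) n) sums cadjoint (frac_sum T \<alpha>)"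
    by (simp only: cadjoint_linear cadjoint_cpower)
  then show ?thesis unfolding frac_sum_def by (rule sums_unique[symmetric])
qed

text \<open>The integral is unchanged when the operator is multiplied
  by a smaller factor, and tends to the integral of \<open>1 / z\<close> as the factor tends to zero.\<close>

lemma scaled_resolvent_integral:
  fixes y :: "('a::complex_banach, complex) cblinfun"
  assumes T: "ritt_of_type a T" and b: "a < b" "b < pi / 2" and r: "0 < r" "r < 1"
  shows "stolz_integral b (\<lambda>z. pairing y (resolvent z (of_real r *\<^sub>C T)) x) = 2 * of_real pi * \<i> * cblinfun_apply y x"
proof -
  have a: "0 < a" "spectrum T \<subseteq> closure (stolz a)" using T by (auto simp: ritt_of_type_def)
  have b0: "0 < b" using a b by simp
  let ?\<Gamma> = "stolz_contour b"
  let ?F = "\<lambda>r z. pairing y (resolvent z (of_real r *\<^sub>C T)) x"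
  let ?\<rho> = "\<lambda>z. pairing y (resolvent z T) x"
  have out: "of_real c * ?\<Gamma> t \<notin> closure (stolz a)" if c: "c > 1" and t: "t \<in> {0..1}" for c t
  proof -
    have "?\<Gamma> t / of_real (1 / c) \<notin> closure (stolz a)"
      by (rule contour_avoids_scaled_spectrum[OF a(1) b]) (use c t in \<open>auto simp: path_image_def\<close>)
    then show ?thesis using c by (simp add: mult.commute)
  qed
  have hol: "?\<rho> holomorphic_on - closure (stolz a)" by (rule resolvent_pairing_holomorphic) (use a in auto)
  have vp: "valid_path ((*) (of_real c) \<circ> ?\<Gamma>)" for c
    by (rule valid_path_compose_holomorphic[where S = UNIV]) (auto intro!: holomorphic_intros)
  have cont: "continuous_on (path_image ?\<Gamma>) (?F r)" if r: "0 < r" "r < 1" for r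
    using holomorphic_on_imp_continuous_on[OF scaled_resolvent_holomorphic[OF a(2) r(1)]]
    by (rule continuous_on_subset) (use contour_avoids_scaled_spectrum[OF a(1) b r] in auto)
  have scaled: "contour_integral ((*) (of_real (1 / r)) \<circ> ?\<Gamma>) ?\<rho> = stolz_integral b (?F r)"
    if r: "0 < r" "r < 1" for r
  proof -
    have "contour_integral ((*) (of_real (1 / r)) \<circ> ?\<Gamma>) ?\<rho>
        = contour_integral ?\<Gamma> (\<lambda>w. deriv ((*) (of_real (1 / r))) w * ?\<rho> (of_real (1 / r) * w))"
      by (rule contour_integral_comp_analyticW[where s = UNIV]) (auto intro!: analytic_intros)
    also have "\<dots> = contour_integral ?\<Gamma> (?F r)"
    proof (rule contour_integral_cong[OF refl])
      fix w assume w: "w \<in> path_image ?\<Gamma>"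
      have "w / of_real r \<notin> spectrum T" using contour_avoids_scaled_spectrum[OF a(1) b r w] a(2) by blast
      from resolvent_scale(2)[OF _ this] r have "resolvent w (of_real r *\<^sub>C T) = (1 / of_real r) *\<^sub>C resolvent (w / of_real r) T"
        by simp
      then show "deriv ((*) (of_real (1 / r))) w * ?\<rho> (of_real (1 / r) * w) = ?F r w"
        by (simp add: cblinfun_apply_scaleC)
    qed
    also have "\<dots> = stolz_integral b (?F r)" by (rule contour_integral_eq_stolz_integral[OF b0 b(2) cont[OF r]])
    finally show ?thesis .
  qed
  have const: "stolz_integral b (?F r') = stolz_integral b (?F r)" if r': "0 < r'" "r' \<le> r" for r'
  proof -
    have "homotopic_loops (- closure (stolz a)) ((*) (of_real (1 / r')) \<circ> ?\<Gamma>) ((*) (of_real (1 / r)) \<circ> ?\<Gamma>)"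
    proof (rule homotopic_loops_linear)
      fix t :: real assume t: "t \<in> {0..1}"
      show "closed_segment (((*) (of_real (1 / r')) \<circ> ?\<Gamma>) t) (((*) (of_real (1 / r)) \<circ> ?\<Gamma>) t) \<subseteq> - closure (stolz a)"
      proof
        fix w assume "w \<in> closed_segment (((*) (of_real (1 / r')) \<circ> ?\<Gamma>) t) (((*) (of_real (1 / r)) \<circ> ?\<Gamma>) t)"
        then obtain u where u: "0 \<le> u" "u \<le> 1" "w = (1 - u) *\<^sub>R (of_real (1 / r') * ?\<Gamma> t) + u *\<^sub>R (of_real (1 / r) * ?\<Gamma> t)"
          by (auto simp: closed_segment_def)
        define c where "c = (1 - u) * (1 / r') + u * (1 / r)"
        have "1 / r \<le> 1 / r'" using r' r by (intro divide_left_mono) auto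
        then have "(1 - u) * (1 / r) + u * (1 / r) \<le> c"
          unfolding c_def using u by (intro add_mono mult_left_mono) auto
        moreover have "1 < 1 / r" using r by simp
        moreover have "(1 - u) * k + u * k = k" for k :: real by (simp add: algebra_simps)
        ultimately have "c > 1" by (metis less_le_trans)
        moreover have "w = of_real c * ?\<Gamma> t"
          unfolding u(3) c_def by (simp add: scaleR_conv_of_real algebra_simps)
        ultimately show "w \<in> - closure (stolz a)" using out t by simp
      qed
    qed (use valid_path_imp_path[OF vp[of "1 / r'"]] valid_path_imp_path[OF vp[of "1 / r"]]
        in \<open>simp_all add: pathfinish_compose pathstart_compose\<close>)
    then have "contour_integral ((*) (of_real (1 / r')) \<circ> ?\<Gamma>) ?\<rho> = contour_integral ((*) (of_real (1 / r)) \<circ> ?\<Gamma>) ?\<rho>"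
      by (rule Cauchy_theorem_homotopic_loops[OF _ _ hol vp vp]) auto
    then show ?thesis using scaled[of r'] scaled[OF r] r r' by simp
  qed
  have zero_notin: "0 \<notin> path_image ?\<Gamma>"
    using contour_avoids_scaled_spectrum[OF a(1) b r, of 0] zero_in_stolz[of a] a b closure_subset by auto
  have int0: "stolz_integral b (\<lambda>z. cblinfun_apply y x / z) = 2 * of_real pi * \<i> * cblinfun_apply y x"
  proof -
    have c1: "continuous_on (path_image ?\<Gamma>) (\<lambda>z. 1 / z)" using zero_notin by (intro continuous_intros) auto
    have "winding_number ?\<Gamma> 0 = 1 / (2 * pi * \<i>) * contour_integral ?\<Gamma> (\<lambda>w. 1 / (w - 0))"
      using zero_notin by (intro winding_number_valid_path) auto
    then have "contour_integral ?\<Gamma> (\<lambda>z. 1 / z) = 2 * of_real pi * \<i>"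
      using winding_number_stolz_contour[OF b0 b(2)] by (simp add: field_simps)
    then have "stolz_integral b (\<lambda>z. 1 / z) = 2 * of_real pi * \<i>"
      using contour_integral_eq_stolz_integral[OF b0 b(2) c1] by simp
    moreover have "stolz_integral b (\<lambda>z. cblinfun_apply y x / z) = cblinfun_apply y x * stolz_integral b (\<lambda>z. 1 / z)"
      unfolding stolz_integral_def by (simp flip: Bochner_Integration.integral_mult_right_zero)
    ultimately show ?thesis by simp
  qed
  define a' where "a' = (a + b) / 2"
  have a': "a < a'" "a' < b" "a' < pi / 2" using b by (auto simp: a'_def)
  obtain K where K: "K > 0" "\<forall>r z. 0 < r \<and> r \<le> 1 \<and> z \<notin> closure (stolz a') \<longrightarrow> z \<notin> spectrum (of_real r *\<^sub>C T)
      \<and> z / of_real r \<notin> spectrum T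
      \<and> norm (resolvent z (of_real r *\<^sub>C T)) * cmod (1 - of_real r * z) \<le> K
      \<and> norm (resolvent z (of_real r *\<^sub>C T)) * cmod (1 - z) \<le> K"
    using scaled_resolvent_bound[OF T a'(1,3)] by blast
  define \<rho> where "\<rho> n = r / (real n + 1)" for n
  have \<rho>: "0 < \<rho> n" "\<rho> n \<le> r" for n
  proof -
    show "0 < \<rho> n" using r by (simp add: \<rho>_def)
    have "r / (real n + 1) \<le> r / 1" using r by (intro divide_left_mono) auto
    then show "\<rho> n \<le> r" by (simp add: \<rho>_def)
  qed
  have \<rho>lim: "\<rho> \<longlonglongrightarrow> 0" unfolding \<rho>_def by real_asymp
  have Rb: "norm (resolvent (?\<Gamma> t) (of_real (\<rho> n) *\<^sub>C T)) \<le> K / (1 - r)" if t: "t \<in> {0<..<1}" for n t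
  proof -
    have za: "?\<Gamma> t \<notin> closure (stolz a')" using t a b a' by (intro stolz_contour_not_in) auto
    have "cmod (?\<Gamma> t) \<le> 1" using stolz_contour_norm_less[OF b0 b(2) t] by simp
    then have "cmod (of_real (\<rho> n) * ?\<Gamma> t) \<le> r * 1"
      unfolding norm_mult norm_of_real using \<rho>[of n] r by (intro mult_mono) auto
    then have "1 - r \<le> cmod (1 - of_real (\<rho> n) * ?\<Gamma> t)"
      using norm_triangle_ineq2[of 1 "of_real (\<rho> n) * ?\<Gamma> t"] by simp
    then have "norm (resolvent (?\<Gamma> t) (of_real (\<rho> n) *\<^sub>C T)) * (1 - r)
        \<le> norm (resolvent (?\<Gamma> t) (of_real (\<rho> n) *\<^sub>C T)) * cmod (1 - of_real (\<rho> n) * ?\<Gamma> t)"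
      by (rule mult_left_mono) simp
    also have "\<dots> \<le> K" using K(2)[rule_format, of "\<rho> n" "?\<Gamma> t"] za \<rho>[of n] r by auto
    finally show ?thesis using r by (simp add: pos_le_divide_eq)
  qed
  have "(\<lambda>n. stolz_integral b (?F (\<rho> n))) \<longlonglongrightarrow> stolz_integral b (\<lambda>z. cblinfun_apply y x / z)"
  proof (rule stolz_integral_dominated_convergence[where w = "\<lambda>_. norm y * (K / (1 - r)) * norm x"])
    show "continuous_on (?\<Gamma> ` {0<..<1}) (?F (\<rho> n))" for n
      by (rule continuous_on_subset[OF cont]) (use \<rho>[of n] r in \<open>auto simp: path_image_def\<close>)
    fix t :: real assume t: "t \<in> {0<..<1}"
    let ?z = "?\<Gamma> t"
    show "cmod (?F (\<rho> n) ?z) \<le> norm y * (K / (1 - r)) * norm x" for n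
      by (rule order_trans[OF norm_pairing]) (intro mult_right_mono mult_left_mono Rb t; simp)
    have z0: "?z \<noteq> 0" using zero_notin t by (auto simp: path_image_def)
    have za: "?z \<notin> closure (stolz a')" using t a b a' by (intro stolz_contour_not_in) auto
    have eq: "?F (\<rho> n) ?z = cblinfun_apply y x / ?z
        + of_real (\<rho> n) * pairing y (T o\<^sub>C resolvent ?z (of_real (\<rho> n) *\<^sub>C T)) x / ?z" for n
    proof -
      have "?z \<notin> spectrum (of_real (\<rho> n) *\<^sub>C T)" using K(2)[rule_format, of "\<rho> n" ?z] za \<rho>[of n] r by auto
      from resolvent_T(1)[OF this]
      have "?z *\<^sub>C resolvent ?z (of_real (\<rho> n) *\<^sub>C T)
          = cblinfun_id + of_real (\<rho> n) *\<^sub>C (T o\<^sub>C resolvent ?z (of_real (\<rho> n) *\<^sub>C T))"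
        by (simp add: compose_scaleC_left algebra_simps)
      then have "pairing y (?z *\<^sub>C resolvent ?z (of_real (\<rho> n) *\<^sub>C T)) x
          = pairing y (cblinfun_id + of_real (\<rho> n) *\<^sub>C (T o\<^sub>C resolvent ?z (of_real (\<rho> n) *\<^sub>C T))) x" by simp
      then have "?z * ?F (\<rho> n) ?z
          = cblinfun_apply y x + of_real (\<rho> n) * pairing y (T o\<^sub>C resolvent ?z (of_real (\<rho> n) *\<^sub>C T)) x"
        by (simp add: cblinfun_apply_scaleC)
      then show ?thesis using z0 by (simp add: field_simps)
    qed
    have "(\<lambda>n. of_real (\<rho> n) * pairing y (T o\<^sub>C resolvent ?z (of_real (\<rho> n) *\<^sub>C T)) x) \<longlonglongrightarrow> 0"
    proof (rule Lim_null_comparison)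
      show "(\<lambda>n. \<rho> n * (norm y * (norm T * (K / (1 - r))) * norm x)) \<longlonglongrightarrow> 0"
        by (rule tendsto_mult_left_zero[OF \<rho>lim])
      have "norm (of_real (\<rho> n) * pairing y (T o\<^sub>C resolvent ?z (of_real (\<rho> n) *\<^sub>C T)) x)
          \<le> \<rho> n * (norm y * (norm T * (K / (1 - r))) * norm x)" for n
      proof -
        have "norm (T o\<^sub>C resolvent ?z (of_real (\<rho> n) *\<^sub>C T)) \<le> norm T * norm (resolvent ?z (of_real (\<rho> n) *\<^sub>C T))"
          by (rule norm_cblinfun_compose)
        also have "\<dots> \<le> norm T * (K / (1 - r))" by (intro mult_left_mono Rb t) simp
        finally have "norm y * norm (T o\<^sub>C resolvent ?z (of_real (\<rho> n) *\<^sub>C T)) * norm x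
            \<le> norm y * (norm T * (K / (1 - r))) * norm x" by (intro mult_left_mono mult_right_mono) auto
        then have "cmod (pairing y (T o\<^sub>C resolvent ?z (of_real (\<rho> n) *\<^sub>C T)) x)
            \<le> norm y * (norm T * (K / (1 - r))) * norm x" using norm_pairing order_trans by blast
        then show ?thesis unfolding norm_mult norm_of_real abs_of_pos[OF \<rho>(1)]
          by (rule mult_left_mono[OF _ less_imp_le[OF \<rho>(1)]])
      qed
      then show "\<forall>\<^sub>F n in sequentially. norm (of_real (\<rho> n) * pairing y (T o\<^sub>C resolvent ?z (of_real (\<rho> n) *\<^sub>C T)) x)
          \<le> \<rho> n * (norm y * (norm T * (K / (1 - r))) * norm x)" by simp
    qed
    then have "(\<lambda>n. cblinfun_apply y x / ?z
        + of_real (\<rho> n) * pairing y (T o\<^sub>C resolvent ?z (of_real (\<rho> n) *\<^sub>C T)) x / ?z)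
        \<longlonglongrightarrow> cblinfun_apply y x / ?z + 0 / ?z" by (intro tendsto_add tendsto_const tendsto_divide z0)
    then show "(\<lambda>n. ?F (\<rho> n) ?z) \<longlonglongrightarrow> cblinfun_apply y x / ?z" by (simp only: eq) simp
  qed simp
  moreover have "stolz_integral b (?F (\<rho> n)) = stolz_integral b (?F r)" for n by (rule const[OF \<rho>])
  ultimately show ?thesis using int0 LIMSEQ_unique[OF tendsto_const[of "stolz_integral b (?F r)"]] by simp
qed

lemma contour_powr_bound:
  assumes b: "0 < b" "b < pi / 2" and s: "s > 0"
  shows "\<exists>w. integrable unit_measure w \<and> (\<forall>t\<in>{0<..<1}. cmod (1 - stolz_contour b t) powr (s - 1) \<le> w t)"
proof -
  obtain c where c: "c > 0" "\<forall>t\<in>{0<..<1}. c * min t (1 - t) \<le> cmod (1 - stolz_contour b t)"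
    using stolz_contour_lower_bound[OF b] by blast
  define w where "w t = c powr (s - 1) * min t (1 - t) powr (s - 1) + 2 powr (s - 1)" for t :: real
  have "integrable unit_measure w" unfolding w_def using integrable_unit_powr[OF s] by simp
  moreover have "cmod (1 - stolz_contour b t) powr (s - 1) \<le> w t" if t: "t \<in> {0<..<1}" for t
  proof -
    let ?d = "cmod (1 - stolz_contour b t)"
    have lo: "0 < c * min t (1 - t)" "c * min t (1 - t) \<le> ?d" using c t by auto
    have "cmod (stolz_contour b t) \<le> 1" using stolz_contour_norm_less[OF b t] by simp
    then have hi: "?d \<le> 2" using norm_triangle_ineq4[of 1 "stolz_contour b t"] by simp
    show ?thesis
    proof (cases "s \<ge> 1")
      case True
      then have "?d powr (s - 1) \<le> 2 powr (s - 1)" using hi by (intro powr_mono2) auto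
      then show ?thesis unfolding w_def by (simp add: add_increasing)
    next
      case False
      have "?d powr (s - 1) \<le> (c * min t (1 - t)) powr (s - 1)" using lo False by (intro powr_mono2') auto
      also have "\<dots> = c powr (s - 1) * min t (1 - t) powr (s - 1)" by (rule powr_mult)
      finally show ?thesis unfolding w_def using powr_ge_zero[of 2 "s - 1"] by linarith
    qed
  qed
  ultimately show ?thesis by blast
qed

lemma one_minus_powr_holomorphic: "(\<lambda>z. (1 - z) powr a) holomorphic_on {z. cmod z < 1}"
proof (intro holomorphic_intros)
  fix z :: complex assume "z \<in> {z. cmod z < 1}"
  then show "1 - z \<notin> \<real>\<^sub>\<le>\<^sub>0" using complex_Re_le_cmod[of z] by (simp add: complex_nonpos_Reals_iff)
qed

lemma contour_angle:
  assumes "ritt_of_type a T" "a < c"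
  shows "contour_angle c T < c" "\<exists>a. a < contour_angle c T \<and> ritt_of_type a T"
proof -
  have "\<exists>b. b < c \<and> (\<exists>a. a < b \<and> ritt_of_type a T)"
    using assms by (intro exI[of _ "(a + c) / 2"] conjI exI[of _ a]) auto
  from someI_ex[OF this] show "contour_angle c T < c" "\<exists>a. a < contour_angle c T \<and> ritt_of_type a T"
    unfolding contour_angle_def by auto
qed

lemma contour_resolvent_bound:
  assumes T: "ritt_of_type a T" and b: "a < b" "b < pi / 2"
  shows "\<exists>K>0. \<forall>t\<in>{0<..<1}. stolz_contour b t \<notin> spectrum T
    \<and> norm (resolvent (stolz_contour b t) T) \<le> K / cmod (1 - stolz_contour b t)"
proof -
  have a: "0 < a" using T by (simp add: ritt_of_type_def)
  define a' where "a' = (a + b) / 2"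
  have a': "a < a'" "a' < b" "a' < pi / 2" using b by (auto simp: a'_def)
  obtain K where K: "K > 0" "\<forall>z. z \<notin> closure (stolz a') \<longrightarrow>
      z \<notin> spectrum T \<and> norm (resolvent z T) \<le> K / cmod (z - 1)"
    using ritt_of_type_resolvent_bound[OF T a'(1,3)] by blast
  have "stolz_contour b t \<notin> closure (stolz a')" if "t \<in> {0<..<1}" for t
    using that a a' b by (intro stolz_contour_not_in) auto
  then show ?thesis using K by (intro exI[of _ K]) (auto simp: norm_minus_commute[of 1])
qed

text \<open>For \<open>r T\<close> with \<open>r < 1\<close> the binomial series can be moved out of the integral, where the integral
  of the bare resolvent remains.  Both sides are continuous as \<open>r\<close> tends to \<open>1\<close>.\<close>

theorem frac_power_eq_frac_sum:
  fixes T :: "('a::complex_banach, 'a) cblinfun"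
  assumes T0: "ritt_of_type a0 T" and \<alpha>: "\<alpha> > 0"
  shows "frac_power T \<alpha> = frac_sum T \<alpha>"
proof (rule cblinfun_eq_by_pairing)
  fix x :: 'a and y :: "('a, complex) cblinfun"
  define b where "b = contour_angle (pi / 2) T"
  have "a0 < pi / 2" using T0 by (simp add: ritt_of_type_def)
  from contour_angle[OF T0 this] obtain a where T: "ritt_of_type a T" and b: "a < b" "b < pi / 2"
    unfolding b_def by blast
  have a: "0 < a" "ritt T" using T by (auto simp: ritt_of_type_def)
  have b0: "0 < b" using a b by simp
  obtain C where C: "C \<ge> 1" "\<And>n. norm (cpower T n) \<le> C" using ritt_power_bounded[OF a(2)] by blast
  let ?\<Gamma> = "stolz_contour b"
  let ?p = "\<lambda>z. (1 - z) powr complex_of_real \<alpha>"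
  obtain K where K: "K > 0" "\<forall>t\<in>{0<..<1}. ?\<Gamma> t \<notin> spectrum T \<and> norm (resolvent (?\<Gamma> t) T) \<le> K / cmod (1 - ?\<Gamma> t)"
    using contour_resolvent_bound[OF T b] by blast
  obtain w where w: "integrable unit_measure w" "\<forall>t\<in>{0<..<1}. cmod (1 - ?\<Gamma> t) powr (\<alpha> - 1) \<le> w t"
    using contour_powr_bound[OF b0 b(2) \<alpha>] by blast
  obtain V where V: "V > 0" "\<forall>t\<in>{0<..<1}. cmod (contour_speed b t) \<le> V"
    using stolz_contour_derivative_bound[of b] by blast
  have nz: "1 - ?\<Gamma> t \<noteq> 0" if "t \<in> {0<..<1}" for t using stolz_contour_ne_one[OF b0 b(2) that] by simp
  have lt1: "cmod (?\<Gamma> t) < 1" if "t \<in> {0<..<1}" for t by (rule stolz_contour_norm_less[OF b0 b(2) that])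
  have pn: "cmod (?p (?\<Gamma> t)) = cmod (1 - ?\<Gamma> t) powr (\<alpha> - 1) * cmod (1 - ?\<Gamma> t)" if t: "t \<in> {0<..<1}" for t
  proof -
    have "cmod (?p (?\<Gamma> t)) = cmod (1 - ?\<Gamma> t) powr \<alpha>"
      using norm_powr_real_powr'[of "complex_of_real \<alpha>" "1 - ?\<Gamma> t"] by simp
    also have "\<dots> = cmod (1 - ?\<Gamma> t) powr ((\<alpha> - 1) + 1)" by simp
    also have "\<dots> = cmod (1 - ?\<Gamma> t) powr (\<alpha> - 1) * cmod (1 - ?\<Gamma> t) powr 1" by (rule powr_add)
    finally show ?thesis using nz[OF t] by simp
  qed
  have pc: "continuous_on (?\<Gamma> ` {0<..<1}) ?p"
    by (rule continuous_on_subset[OF holomorphic_on_imp_continuous_on[OF one_minus_powr_holomorphic]])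
       (use lt1 in auto)
  let ?I = "\<lambda>t. (?p (?\<Gamma> t) * contour_speed b t) *\<^sub>C resolvent (?\<Gamma> t) T"
  have sm: "strongly_measurable unit_measure ?I"
  proof (rule strongly_measurable_scaleC)
    have "continuous_on {0<..<1} (\<lambda>t. resolvent (?\<Gamma> t) T)"
    proof (rule continuous_on_compose2[OF _ continuous_stolz_contour])
      show "continuous_on (- spectrum T) (\<lambda>z. resolvent z T)"
        by (intro continuous_at_imp_continuous_on ballI resolvent_isCont) auto
    qed (use K in auto)
    then show "strongly_measurable unit_measure (\<lambda>t. resolvent (?\<Gamma> t) T)"
      by (rule strongly_measurable_unit_interval)
    show "(\<lambda>t. ?p (?\<Gamma> t) * contour_speed b t) \<in> borel_measurable unit_measure"
      by (rule stolz_integrand_measurable(2)[OF pc])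
  qed
  have "(\<integral>\<^sup>+t. norm (?I t) \<partial>unit_measure) \<le> (\<integral>\<^sup>+t. norm (w t * (V * K)) \<partial>unit_measure)"
  proof (rule nn_integral_mono)
    fix t assume "t \<in> space unit_measure"
    then have t: "t \<in> {0<..<1}" by simp
    have "norm (?I t) = (cmod (1 - ?\<Gamma> t) powr (\<alpha> - 1) * cmod (contour_speed b t))
        * (cmod (1 - ?\<Gamma> t) * norm (resolvent (?\<Gamma> t) T))" unfolding norm_scaleC norm_mult pn[OF t] by simp
    also have "\<dots> \<le> (w t * V) * K"
    proof (rule mult_mono)
      show "cmod (1 - ?\<Gamma> t) powr (\<alpha> - 1) * cmod (contour_speed b t) \<le> w t * V"
        by (rule mult_mono[OF bspec[OF w(2) t] bspec[OF V(2) t] order_trans[OF powr_ge_zero bspec[OF w(2) t]] norm_ge_zero])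
      show "cmod (1 - ?\<Gamma> t) * norm (resolvent (?\<Gamma> t) T) \<le> K"
        using bspec[OF K(2) t] nz[OF t] by (simp add: pos_le_divide_eq mult.commute)
      show "0 \<le> w t * V" using order_trans[OF powr_ge_zero bspec[OF w(2) t]] V(1) by simp
    qed simp
    finally show "ennreal (norm (?I t)) \<le> ennreal (norm (w t * (V * K)))"
      by (intro ennreal_leI) (simp add: mult.assoc)
  qed
  also have "\<dots> < \<infinity>"
  proof -
    have "integrable unit_measure (\<lambda>t. w t * (V * K))" using w(1) by simp
    then show ?thesis unfolding integrable_iff_bounded by (rule conjunct2)
  qed
  finally have fin: "(\<integral>\<^sup>+t. norm (?I t) \<partial>unit_measure) < \<infinity>" .
  have lhs: "pairing y (frac_power T \<alpha>) x
      = 1 / (2 * of_real pi * \<i>) * stolz_integral b (\<lambda>z. ?p z * pairing y (resolvent z T) x)"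
  proof -
    have "pairing y (frac_power T \<alpha>) x = 1 / (2 * of_real pi * \<i>) * pairing y (strong_integral unit_measure ?I) x"
      by (simp add: frac_power_def b_def[symmetric] Let_def cblinfun_apply_scaleC)
    also have "pairing y (strong_integral unit_measure ?I) x = (\<integral>t. pairing y (?I t) x \<partial>unit_measure)"
      by (rule strong_integral_pairing(2)[OF sm fin])
    also have "\<dots> = stolz_integral b (\<lambda>z. ?p z * pairing y (resolvent z T) x)" unfolding stolz_integral_def
      by (intro Bochner_Integration.integral_cong refl) (simp add: cblinfun_apply_scaleC mult_ac)
    finally show ?thesis .
  qed
  define a' where "a' = (a + b) / 2"
  have a': "a < a'" "a' < b" "a' < pi / 2" using b by (auto simp: a'_def)
  obtain L where L: "L > 0" "\<forall>r z. 0 < r \<and> r \<le> 1 \<and> z \<notin> closure (stolz a') \<longrightarrow> z \<notin> spectrum (of_real r *\<^sub>C T)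
      \<and> z / of_real r \<notin> spectrum T
      \<and> norm (resolvent z (of_real r *\<^sub>C T)) * cmod (1 - of_real r * z) \<le> L
      \<and> norm (resolvent z (of_real r *\<^sub>C T)) * cmod (1 - z) \<le> L"
    using scaled_resolvent_bound[OF T a'(1,3)] by blast
  have za: "?\<Gamma> t \<notin> closure (stolz a')" if "t \<in> {0<..<1}" for t
    using that a b a' by (intro stolz_contour_not_in) auto
  let ?r = "\<lambda>n. scale_factor n"
  let ?F = "\<lambda>n z. ?p z * pairing y (resolvent z (of_real (?r n) *\<^sub>C T)) x"
  define G where "G n = (\<Sum>k. (frac_coeff \<alpha> k * of_real (?r n) ^ k) *\<^sub>C cpower T k)" for n
  have pow: "cpower (c *\<^sub>C T) k = c ^ k *\<^sub>C cpower T k" for c k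
    by (induction k) (simp_all add: compose_scaleC_left compose_scaleC_right scaleC_scaleC mult.commute)
  have rn: "norm (frac_coeff \<alpha> k * of_real (?r n) ^ k) \<le> cmod (frac_coeff \<alpha> k)" for k n
    using scale_factor(1,2)[of n] by (simp add: norm_mult norm_power power_le_one mult_left_le)
  have Gs: "(\<lambda>k. frac_coeff \<alpha> k *\<^sub>C cpower (of_real (?r n) *\<^sub>C T) k) sums G n" for n
  proof -
    have "summable (\<lambda>k. (frac_coeff \<alpha> k * of_real (?r n) ^ k) *\<^sub>C cpower T k)"
    proof (rule summable_norm_cancel, rule summable_comparison_test)
      show "summable (\<lambda>k. cmod (frac_coeff \<alpha> k) * C)" using summable_frac_coeff[OF \<alpha>] by (rule summable_mult2)
      show "\<exists>N. \<forall>k\<ge>N. norm (norm ((frac_coeff \<alpha> k * of_real (?r n) ^ k) *\<^sub>C cpower T k)) \<le> cmod (frac_coeff \<alpha> k) * C"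
        using mult_mono[OF rn C(2)] by (intro exI[of _ 0]) (simp add: norm_scaleC)
    qed
    from summable_sums[OF this] show ?thesis by (simp add: G_def pow scaleC_scaleC)
  qed
  have int_eq: "stolz_integral b (?F n) = 2 * of_real pi * \<i> * pairing y (G n) x" for n
  proof -
    define \<gamma> where "\<gamma> = (b + pi / 2) / 2"
    have \<gamma>: "b < \<gamma>" "\<gamma> < pi / 2" using b by (auto simp: \<gamma>_def)
    let ?A = "of_real (?r n) *\<^sub>C T"
    have "stolz_integral b (\<lambda>z. 1 * ?p z * pairing y (resolvent z ?A) x)
        = stolz_integral b (\<lambda>z. 1 * pairing y (resolvent z ?A) (cblinfun_apply (G n) x))"
    proof (rule stolz_integral_power_series[OF b0 \<gamma>, where C = C and M = 1 and B = "L / (1 - ?r n)" and c = "frac_coeff \<alpha>"])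
      show "?\<Gamma> t \<notin> spectrum ?A" if "t \<in> {0<..<1}" for t
        using L(2)[rule_format, of "?r n" "?\<Gamma> t"] za[OF that] scale_factor(1,2)[of n] by auto
      show "norm (cpower ?A k) \<le> C" for k
      proof -
        have "\<bar>?r n\<bar> ^ k * norm (cpower T k) \<le> 1 * C"
          using scale_factor(1,2)[of n] C(2)[of k] by (intro mult_mono) (auto simp: power_le_one)
        then show ?thesis by (simp add: pow norm_scaleC norm_power)
      qed
      show "cmod 1 * norm (resolvent (?\<Gamma> t) ?A) \<le> L / (1 - ?r n)" if t: "t \<in> {0<..<1}" for t
      proof -
        have "cmod (of_real (?r n) * ?\<Gamma> t) \<le> ?r n * 1"
          unfolding norm_mult norm_of_real using scale_factor(1,2)[of n] lt1[OF t] by (intro mult_mono) auto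
        then have "1 - ?r n \<le> cmod (1 - of_real (?r n) * ?\<Gamma> t)"
          using norm_triangle_ineq2[of 1 "of_real (?r n) * ?\<Gamma> t"] by simp
        then have "norm (resolvent (?\<Gamma> t) ?A) * (1 - ?r n) \<le> norm (resolvent (?\<Gamma> t) ?A) * cmod (1 - of_real (?r n) * ?\<Gamma> t)"
          by (rule mult_left_mono) simp
        also have "\<dots> \<le> L" using L(2)[rule_format, of "?r n" "?\<Gamma> t"] za[OF t] scale_factor(1,2)[of n] by auto
        finally show ?thesis using scale_factor(2)[of n] by (simp add: pos_le_divide_eq)
      qed
      show "(\<lambda>k. frac_coeff \<alpha> k * ?\<Gamma> t ^ k) sums ?p (?\<Gamma> t)" if "t \<in> {0<..<1}" for t
        by (rule frac_coeff_sums[OF lt1[OF that]])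
      show "summable (\<lambda>k. cmod (frac_coeff \<alpha> k))" by (rule summable_frac_coeff[OF \<alpha>])
      show "(\<lambda>k. frac_coeff \<alpha> k *\<^sub>C cpower ?A k) sums G n" by (rule Gs)
    qed auto
    then show ?thesis
      using scaled_resolvent_integral[OF T b scale_factor(1,2), of y n "cblinfun_apply (G n) x"] by simp
  qed
  have lim1: "(\<lambda>n. stolz_integral b (?F n)) \<longlonglongrightarrow> stolz_integral b (\<lambda>z. ?p z * pairing y (resolvent z T) x)"
  proof (rule stolz_integral_dominated_convergence[where w = "\<lambda>t. w t * (norm y * L * norm x)"])
    show "integrable unit_measure (\<lambda>t. w t * (norm y * L * norm x))" using w(1) by simp
    show "continuous_on (?\<Gamma> ` {0<..<1}) (?F n)" for n
    proof (rule continuous_on_mult[OF pc holomorphic_on_imp_continuous_on[OF resolvent_pairing_holomorphic]])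
      show "?\<Gamma> ` {0<..<1} \<inter> spectrum (of_real (?r n) *\<^sub>C T) = {}"
        using L(2)[rule_format, of "?r n"] za scale_factor(1,2)[of n] by fastforce
    qed
    fix t :: real assume t: "t \<in> {0<..<1}"
    let ?z = "?\<Gamma> t"
    have zT: "?z \<notin> spectrum T" using K(2) t by blast
    show "(\<lambda>n. ?F n ?z) \<longlonglongrightarrow> ?p ?z * pairing y (resolvent ?z T) x"
      using L(2)[rule_format, of "?r _" ?z] scale_factor(1,2) za[OF t]
      by (intro tendsto_mult tendsto_const scaled_resolvent_tendsto zT) (simp add: less_imp_le)
    fix n
    have "cmod (?F n ?z) \<le> cmod (?p ?z) * (norm y * norm (resolvent ?z (of_real (?r n) *\<^sub>C T)) * norm x)"
      unfolding norm_mult by (intro mult_left_mono norm_pairing) auto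
    also have "\<dots> = cmod (1 - ?z) powr (\<alpha> - 1)
        * (norm y * (norm (resolvent ?z (of_real (?r n) *\<^sub>C T)) * cmod (1 - ?z)) * norm x)"
      unfolding pn[OF t] by (simp add: mult_ac)
    also have "\<dots> \<le> w t * (norm y * L * norm x)"
    proof (rule mult_mono)
      show "norm y * (norm (resolvent ?z (of_real (?r n) *\<^sub>C T)) * cmod (1 - ?z)) * norm x \<le> norm y * L * norm x"
        using L(2)[rule_format, of "?r n" ?z] za[OF t] scale_factor(1,2)[of n]
        by (intro mult_right_mono mult_left_mono) auto
      show "cmod (1 - ?z) powr (\<alpha> - 1) \<le> w t" using w(2) t by blast
      then show "0 \<le> w t" by (rule order_trans[OF powr_ge_zero])
    qed simp
    finally show "cmod (?F n ?z) \<le> w t * (norm y * L * norm x)" .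
  qed
  have lim2: "(\<lambda>n. pairing y (G n) x) \<longlonglongrightarrow> pairing y (frac_sum T \<alpha>) x"
  proof -
    have bl: "bounded_linear (\<lambda>D. pairing y D x)"
      by (intro bounded_linear_compose[OF bounded_linear_cblinfun_apply] apply_bilinear.bounded_linear_left)
    let ?q = "\<lambda>k. frac_coeff \<alpha> k * pairing y (cpower T k) x"
    have 1: "pairing y (G n) x = (\<Sum>k. ?q k * of_real (?r n) ^ k)" for n
      using sums_unique[OF bounded_linear.sums[OF bl Gs[of n]]] by (simp add: pow cblinfun_apply_scaleC mult_ac)
    have 2: "pairing y (frac_sum T \<alpha>) x = (\<Sum>k. ?q k)"
      using sums_unique[OF bounded_linear.sums[OF bl frac_sum_sums[OF C(2) \<alpha>]]]
      by (simp add: cblinfun_apply_scaleC)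
    have "((\<lambda>n. \<Sum>k. ?q k * of_real (?r n) ^ k) \<longlongrightarrow> (\<Sum>k. ?q k)) sequentially"
    proof (rule tannerys_theorem[THEN conjunct2, THEN conjunct2])
      show "summable (\<lambda>k. cmod (frac_coeff \<alpha> k) * (norm y * C * norm x))"
        using summable_frac_coeff[OF \<alpha>] by (rule summable_mult2)
      have "norm (?q k * of_real (?r n) ^ k) \<le> cmod (frac_coeff \<alpha> k) * (norm y * C * norm x)" for k n
      proof -
        have "norm (?q k * of_real (?r n) ^ k) = norm (frac_coeff \<alpha> k * of_real (?r n) ^ k) * cmod (pairing y (cpower T k) x)"
          by (simp add: norm_mult mult_ac)
        also have "\<dots> \<le> cmod (frac_coeff \<alpha> k) * (norm y * norm (cpower T k) * norm x)"
          by (intro mult_mono rn norm_pairing) auto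
        also have "\<dots> \<le> cmod (frac_coeff \<alpha> k) * (norm y * C * norm x)"
          by (intro mult_left_mono mult_right_mono C(2)) auto
        finally show ?thesis .
      qed
      then show "\<forall>\<^sub>F (k, n) in sequentially \<times>\<^sub>F sequentially.
          norm (?q k * of_real (?r n) ^ k) \<le> cmod (frac_coeff \<alpha> k) * (norm y * C * norm x)"
        by (intro always_eventually) auto
      fix k
      have "(\<lambda>n. ?q k * of_real (?r n) ^ k) \<longlonglongrightarrow> ?q k * of_real 1 ^ k" by (intro tendsto_intros scale_factor(3))
      then show "(\<lambda>n. ?q k * of_real (?r n) ^ k) \<longlonglongrightarrow> ?q k" by simp
    qed simp
    then show ?thesis by (simp only: 1 2)
  qed
  have "stolz_integral b (\<lambda>z. ?p z * pairing y (resolvent z T) x)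
      = 2 * of_real pi * \<i> * pairing y (frac_sum T \<alpha>) x"
    using LIMSEQ_unique[OF lim1] tendsto_mult[OF tendsto_const lim2, of "2 * of_real pi * \<i>"]
    by (simp only: int_eq)
  then show "pairing y (frac_power T \<alpha>) x = pairing y (frac_sum T \<alpha>) x" using lhs by simp
qed


section \<open>Moving fractional powers out of the integral\<close>

lemma one_minus_powr_bound:
  assumes "cmod z \<le> 1" "\<alpha> > 0"
  shows "cmod ((1 - z) powr of_real \<alpha>) \<le> 2 powr \<alpha>"
proof -
  have "cmod ((1 - z) powr of_real \<alpha>) = cmod (1 - z) powr \<alpha>"
    using norm_powr_real_powr'[of "complex_of_real \<alpha>" "1 - z"] by simp
  also have "\<dots> \<le> 2 powr \<alpha>" using norm_triangle_ineq4[of 1 z] assms by (intro powr_mono2) auto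
  finally show ?thesis .
qed

text \<open>Each of the three factors is a power series with summable coefficients and can be moved from the
  scalar side to the vector.  When \<open>\<psi>\<close> alone is left, the angle can be changed.  The change matters
  because the angle in the definition of the calculus need not exceed the R-type.\<close>

lemma exchange_one_variable:
  fixes y :: "('a::complex_banach, complex) cblinfun"
  assumes T: "ritt_of_type a T" and b: "a < b" "b < \<gamma>" "a < b'" "b' < \<gamma>" "\<gamma> < pi / 2"
    and pos: "\<alpha> > 0" "\<beta> > 0"
    and \<psi>: "\<psi> holomorphic_on stolz \<gamma>"
    and M: "\<And>z. z \<in> stolz \<gamma> \<Longrightarrow> cmod (\<psi> z) \<le> M * cmod (1 - z)" "M \<ge> 0"
  shows "stolz_integral b (\<lambda>z. \<psi> z * (z ^ j * (1 - z) powr of_real \<alpha> * (1 - z) powr of_real \<beta>)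
      * pairing y (resolvent z T) x)
    = stolz_integral b' (\<lambda>z. \<psi> z * pairing y (resolvent z T)
        (cblinfun_apply (cpower T j o\<^sub>C frac_power T \<alpha> o\<^sub>C frac_power T \<beta>) x))"
proof -
  have a: "0 < a" "ritt T" using T by (auto simp: ritt_of_type_def)
  have b0: "0 < b" "b < pi / 2" using a b by auto
  have g0: "0 < \<gamma>" using b0 b by simp
  obtain C where C: "C \<ge> 1" "\<And>n. norm (cpower T n) \<le> C" using ritt_power_bounded[OF a(2)] by blast
  obtain K where K: "K > 0" "\<forall>t\<in>{0<..<1}. stolz_contour b t \<notin> spectrum T
      \<and> norm (resolvent (stolz_contour b t) T) \<le> K / cmod (1 - stolz_contour b t)"
    using contour_resolvent_bound[OF T b(1) b0(2)] by blast
  have lt1: "cmod z < 1" if "z \<in> stolz \<gamma>" for z using stolz_norm_less[OF g0 b(5) that] .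
  have le2: "cmod (1 - z) \<le> 2" if "z \<in> stolz \<gamma>" for z using norm_triangle_ineq4[of 1 z] lt1[OF that] by simp
  have in\<gamma>: "stolz_contour b t \<in> stolz \<gamma>" if "t \<in> {0<..<1}" for t
    using that b b0 by (intro stolz_contour_in_stolz) auto
  have powhol: "(\<lambda>z. (1 - z) powr of_real \<alpha>) holomorphic_on stolz \<gamma>" for \<alpha> :: real
    by (rule holomorphic_on_subset[OF one_minus_powr_holomorphic]) (use lt1 in auto)
  have rule: "stolz_integral b (\<lambda>z. \<phi> z * g z * pairing y (resolvent z T) x)
      = stolz_integral b (\<lambda>z. \<phi> z * pairing y (resolvent z T) (cblinfun_apply G x))"
    if \<phi>: "\<phi> holomorphic_on stolz \<gamma>" and N: "\<And>z. z \<in> stolz \<gamma> \<Longrightarrow> cmod (\<phi> z) \<le> N * cmod (1 - z)" "N \<ge> 0"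
      and g: "\<And>z. cmod z < 1 \<Longrightarrow> (\<lambda>n. c n * z ^ n) sums g z"
      and c: "summable (\<lambda>n. cmod (c n))" and G: "(\<lambda>n. c n *\<^sub>C cpower T n) sums G" for \<phi> N g c G x
  proof (rule stolz_integral_power_series[OF b0(1) b(2,5), where C = C and M = "N * 2" and B = "N * K" and c = c])
    show "stolz_contour b t \<notin> spectrum T" if "t \<in> {0<..<1}" for t using K that by blast
    show "norm (cpower T n) \<le> C" for n by (rule C(2))
    show "\<phi> holomorphic_on stolz \<gamma>" by (rule \<phi>)
    show "cmod (\<phi> z) \<le> N * 2" if "z \<in> stolz \<gamma>" for z
      using N(1)[OF that] mult_left_mono[OF le2[OF that] N(2)] by linarith
    show "cmod (\<phi> (stolz_contour b t)) * norm (resolvent (stolz_contour b t) T) \<le> N * K"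
      if t: "t \<in> {0<..<1}" for t
    proof -
      let ?z = "stolz_contour b t"
      have nz: "cmod (1 - ?z) > 0" using stolz_contour_ne_one[OF b0 t] by simp
      have R: "norm (resolvent ?z T) \<le> K / cmod (1 - ?z)" using K t by blast
      have "cmod (\<phi> ?z) * norm (resolvent ?z T) \<le> (N * cmod (1 - ?z)) * (K / cmod (1 - ?z))"
        by (rule mult_mono[OF N(1)[OF in\<gamma>[OF t]] R]) (use N(2) in auto)
      then show ?thesis using nz by simp
    qed
    show "(\<lambda>n. c n * stolz_contour b t ^ n) sums g (stolz_contour b t)" if "t \<in> {0<..<1}" for t
      by (rule g[OF lt1[OF in\<gamma>[OF that]]])
    show "summable (\<lambda>n. cmod (c n))" by (rule c)
    show "(\<lambda>n. c n *\<^sub>C cpower T n) sums G" by (rule G)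
  qed
  have frac: "frac_power T \<alpha> = frac_sum T \<alpha>" "frac_power T \<beta> = frac_sum T \<beta>"
    using frac_power_eq_frac_sum[OF T] pos by auto
  let ?a = "\<lambda>z. (1 - z) powr complex_of_real \<alpha>" and ?b = "\<lambda>z. (1 - z) powr complex_of_real \<beta>"
  have bound2: "cmod (\<psi> z * z ^ j) \<le> M * cmod (1 - z)" if z: "z \<in> stolz \<gamma>" for z
  proof -
    have "cmod (z ^ j) \<le> 1" using lt1[OF z] by (simp add: norm_power power_le_one)
    then have "cmod (\<psi> z) * cmod (z ^ j) \<le> (M * cmod (1 - z)) * 1" using M(2) by (intro mult_mono M(1) z) auto
    then show ?thesis by (simp add: norm_mult)
  qed
  have bound3: "cmod (\<psi> z * z ^ j * ?a z) \<le> (M * 2 powr \<alpha>) * cmod (1 - z)" if z: "z \<in> stolz \<gamma>" for z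
  proof -
    have "cmod (\<psi> z * z ^ j) * cmod (?a z) \<le> (M * cmod (1 - z)) * 2 powr \<alpha>"
      using M(2) lt1[OF z] pos(1) by (intro mult_mono bound2 z one_minus_powr_bound) auto
    then show ?thesis by (simp add: norm_mult mult_ac)
  qed
  have "stolz_integral b (\<lambda>z. \<psi> z * (z ^ j * ?a z * ?b z) * pairing y (resolvent z T) x)
      = stolz_integral b (\<lambda>z. (\<psi> z * z ^ j * ?a z) * ?b z * pairing y (resolvent z T) x)" by (simp add: mult_ac)
  also have "\<dots> = stolz_integral b (\<lambda>z. (\<psi> z * z ^ j * ?a z) * pairing y (resolvent z T) (cblinfun_apply (frac_sum T \<beta>) x))"
    by (rule rule[OF _ bound3 _ frac_coeff_sums summable_frac_coeff[OF pos(2)] frac_sum_sums[OF C(2) pos(2)]])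
       (use \<psi> M in \<open>auto intro!: holomorphic_intros powhol\<close>)
  also have "\<dots> = stolz_integral b (\<lambda>z. (\<psi> z * z ^ j) * pairing y (resolvent z T)
      (cblinfun_apply (frac_sum T \<alpha>) (cblinfun_apply (frac_sum T \<beta>) x)))"
    by (rule rule[OF _ bound2 M(2) frac_coeff_sums summable_frac_coeff[OF pos(1)] frac_sum_sums[OF C(2) pos(1)]])
       (use \<psi> in \<open>auto intro!: holomorphic_intros\<close>)
  also have "\<dots> = stolz_integral b (\<lambda>z. \<psi> z * pairing y (resolvent z T)
      (cblinfun_apply (cpower T j) (cblinfun_apply (frac_sum T \<alpha>) (cblinfun_apply (frac_sum T \<beta>) x))))"
  proof (rule rule[OF \<psi> M, where c = "\<lambda>n. if n = j then 1 else 0"])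
    show "(\<lambda>n. (if n = j then 1 else 0) * z ^ n) sums z ^ j" for z :: complex
    proof -
      have "(if n = j then 1 else 0) * z ^ n = (if n = j then z ^ n else 0)" for n by simp
      then show ?thesis using sums_single[of j "\<lambda>n. z ^ n"] by simp
    qed
    have "(\<lambda>n. if n = j then cpower T n else 0) sums cpower T j" by (rule sums_single)
    moreover have "(if n = j then 1 else 0) *\<^sub>C cpower T n = (if n = j then cpower T n else 0)" for n by simp
    ultimately show "(\<lambda>n. (if n = j then 1 else 0) *\<^sub>C cpower T n) sums cpower T j" by simp
    have "(\<lambda>n. cmod (if n = j then 1 else 0)) = (\<lambda>n. if n = j then 1 else 0)" by auto
    then show "summable (\<lambda>n. cmod (if n = j then 1 else 0))"
      using sums_single[of j "\<lambda>_. 1 :: real"] by (auto simp: summable_def)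
  qed
  also have "\<dots> = stolz_integral b' (\<lambda>z. \<psi> z * pairing y (resolvent z T)
      (cblinfun_apply (cpower T j) (cblinfun_apply (frac_sum T \<alpha>) (cblinfun_apply (frac_sum T \<beta>) x))))"
    by (rule stolz_integral_contour_independence[OF T b \<psi> M])
  finally show ?thesis by (simp add: frac)
qed


section \<open>A partition of unity\<close>

text \<open>The constant function \<open>1\<close> is the product of $(1 - z)^p$ and $\sum_n c_n z^n$ with the
  binomial coefficients \<open>c\<close> of exponent \<open>- p\<close>.  The terms are grouped in threes, so that the
  group with number \<open>k\<close> contains $z^{3(k-1)}$: one factor $z^{k-1}$ for each of the two square functions, and
  one that makes the remaining weight integrable.\<close>

definition neg_coeff :: "real \<Rightarrow> nat \<Rightarrow> complex" where
  "neg_coeff p = frac_coeff (- p)"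

lemma Bernoulli_inequality_powr:
  fixes a x :: real
  assumes "a \<ge> 1" "x \<ge> 0"
  shows "1 + a * x \<le> (1 + x) powr a"
proof -
  let ?f = "\<lambda>x. (1 + x) powr a - a * x"
  have "?f 0 \<le> ?f x"
  proof (rule DERIV_nonneg_imp_nondecreasing[OF assms(2)])
    fix u :: real assume u: "0 \<le> u" "u \<le> x"
    have "(?f has_real_derivative a * (1 + u) powr (a - 1) - a) (at u)"
      by (rule derivative_eq_intros refl | use u in simp)+
    moreover have "a * (1 + u) powr (a - 1) - a \<ge> 0"
      using assms(1) u mult_left_mono[OF ge_one_powr_ge_zero[of "1 + u" "a - 1"], of a] by simp
    ultimately show "\<exists>y. (?f has_real_derivative y) (at u) \<and> 0 \<le> y" by blast
  qed
  then show ?thesis by simp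
qed

lemma neg_coeff:
  assumes "p \<ge> 2"
  shows "neg_coeff p n = of_real (cmod (neg_coeff p n))" "cmod (neg_coeff p n) \<le> real (n + 1) powr (p - 1)"
proof -
  have rec: "neg_coeff p (Suc n) = of_real ((real n + p) / real (Suc n)) * neg_coeff p n" for n
  proof -
    have "of_nat (Suc n) * neg_coeff p (Suc n) = of_real (real n + p) * neg_coeff p n"
      using frac_coeff_Suc[of n "- p"] by (simp add: neg_coeff_def)
    then have "neg_coeff p (Suc n) = of_real (real n + p) * neg_coeff p n / of_nat (Suc n)"
      by (metis nonzero_mult_div_cancel_left of_nat_neq_0)
    then show ?thesis by simp
  qed
  have "neg_coeff p n = of_real (cmod (neg_coeff p n)) \<and> cmod (neg_coeff p n) \<le> real (n + 1) powr (p - 1)"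
  proof (induction n)
    case 0
    show ?case by (simp add: neg_coeff_def frac_coeff_def)
  next
    case (Suc n)
    have q: "0 \<le> (real n + p) / real (Suc n)" using assms by simp
    have q': "\<bar>real n + p\<bar> = real n + p" using assms by simp
    have cm: "cmod (neg_coeff p (Suc n)) = (real n + p) / real (Suc n) * cmod (neg_coeff p n)"
      unfolding rec norm_mult norm_of_real using q q' by simp
    have 1: "neg_coeff p (Suc n) = of_real (cmod (neg_coeff p (Suc n)))"
      unfolding cm of_real_mult using Suc rec[of n] q' by simp
    have "(real n + p) / real (Suc n) = 1 + (p - 1) * (1 / real (Suc n))" by (simp add: field_simps)
    also have "\<dots> \<le> (1 + 1 / real (Suc n)) powr (p - 1)"
      using Bernoulli_inequality_powr[of "p - 1" "1 / real (Suc n)"] assms by simp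
    also have "1 + 1 / real (Suc n) = real (Suc n + 1) / real (n + 1)" by (simp add: field_simps)
    finally have B: "(real n + p) / real (Suc n) \<le> (real (Suc n + 1) / real (n + 1)) powr (p - 1)" .
    have "cmod (neg_coeff p (Suc n)) \<le> (real (Suc n + 1) / real (n + 1)) powr (p - 1) * real (n + 1) powr (p - 1)"
      unfolding cm using B Suc q by (intro mult_mono) auto
    also have "\<dots> = (real (Suc n + 1) / real (n + 1) * real (n + 1)) powr (p - 1)" by (rule powr_mult[symmetric])
    also have "\<dots> = real (Suc n + 1) powr (p - 1)" by simp
    finally show ?case using 1 by simp
  qed
  then show "neg_coeff p n = of_real (cmod (neg_coeff p n))" "cmod (neg_coeff p n) \<le> real (n + 1) powr (p - 1)"
    by auto
qed

definition unity_term :: "real \<Rightarrow> nat \<Rightarrow> complex \<Rightarrow> complex" where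
  "unity_term p k z = z ^ (k - 1) * (1 - z)\<^sup>2 * (\<Sum>r<3. neg_coeff p (3 * (k - 1) + r) * z ^ r)"

lemma unity_partial_sum:
  assumes z: "cmod z < 1"
  shows "(\<Sum>k=1..N. unity_term (\<alpha> + \<beta> + 2) k z
      * (z ^ (2 * (k - 1)) * (1 - z) powr of_real \<alpha> * (1 - z) powr of_real \<beta>))
    = (\<Sum>n<3 * N. neg_coeff (\<alpha> + \<beta> + 2) n * z ^ n) * (1 - z) powr of_real (\<alpha> + \<beta> + 2)"
proof (induction N)
  case (Suc N)
  let ?p = "\<alpha> + \<beta> + 2"
  have z1: "1 - z \<noteq> 0" using z by auto
  have pw: "(1 - z) powr of_real ?p = (1 - z) powr of_real \<alpha> * (1 - z) powr of_real \<beta> * (1 - z)\<^sup>2"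
    using z1 by (simp add: powr_add powr_numeral)
  have split: "(\<Sum>n<3 * Suc N. neg_coeff ?p n * z ^ n)
      = (\<Sum>n<3 * N. neg_coeff ?p n * z ^ n) + (\<Sum>r<3. neg_coeff ?p (3 * N + r) * z ^ (3 * N + r))"
    by (simp add: numeral_3_eq_3 algebra_simps)
  have grp: "(\<Sum>r<3. neg_coeff ?p (3 * N + r) * z ^ (3 * N + r)) = z ^ N * z ^ (2 * N) * (\<Sum>r<3. neg_coeff ?p (3 * N + r) * z ^ r)"
  proof -
    have "z ^ (3 * N + r) = z ^ N * z ^ (2 * N) * z ^ r" for r by (simp flip: power_add)
    then show ?thesis by (simp add: sum_distrib_left mult_ac)
  qed
  have "(\<Sum>k=1..Suc N. unity_term ?p k z * (z ^ (2 * (k - 1)) * (1 - z) powr of_real \<alpha> * (1 - z) powr of_real \<beta>))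
      = (\<Sum>n<3 * N. neg_coeff ?p n * z ^ n) * (1 - z) powr of_real ?p
        + unity_term ?p (Suc N) z * (z ^ (2 * N) * (1 - z) powr of_real \<alpha> * (1 - z) powr of_real \<beta>)"
    using Suc by simp
  also have "unity_term ?p (Suc N) z * (z ^ (2 * N) * (1 - z) powr of_real \<alpha> * (1 - z) powr of_real \<beta>)
      = (\<Sum>r<3. neg_coeff ?p (3 * N + r) * z ^ (3 * N + r)) * (1 - z) powr of_real ?p"
    unfolding grp pw unity_term_def diff_Suc_1 by (simp only: mult_ac)
  finally show ?case unfolding split by (simp only: distrib_right)
qed simp

lemma unity_partial_sum_limit:
  assumes z: "cmod z < 1" and "\<alpha> > 0" "\<beta> > 0"
  shows "(\<lambda>N. \<Sum>k=1..N. unity_term (\<alpha> + \<beta> + 2) k z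
      * (z ^ (2 * (k - 1)) * (1 - z) powr of_real \<alpha> * (1 - z) powr of_real \<beta>)) \<longlonglongrightarrow> 1"
proof -
  let ?p = "\<alpha> + \<beta> + 2"
  have "(\<lambda>n. \<Sum>n<n. neg_coeff ?p n * z ^ n) \<longlonglongrightarrow> (1 - z) powr of_real (- ?p)"
    using frac_coeff_sums[OF z, of "- ?p"] by (simp add: neg_coeff_def sums_def)
  then have "(\<lambda>N. \<Sum>n<3 * N. neg_coeff ?p n * z ^ n) \<longlonglongrightarrow> (1 - z) powr of_real (- ?p)"
    by (rule filterlim_compose) (rule filterlim_subseq, simp add: strict_mono_def)
  then have "(\<lambda>N. (\<Sum>n<3 * N. neg_coeff ?p n * z ^ n) * (1 - z) powr of_real ?p)
      \<longlonglongrightarrow> (1 - z) powr of_real (- ?p) * (1 - z) powr of_real ?p" by (rule tendsto_mult[OF _ tendsto_const])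
  also have "(1 - z) powr of_real (- ?p) * (1 - z) powr of_real ?p = 1"
  proof -
    have "1 - z \<noteq> 0" using z by auto
    then show ?thesis by (simp flip: powr_add)
  qed
  finally show ?thesis by (simp only: unity_partial_sum[OF z])
qed

lemma unity_partial_sum_bound:
  assumes z: "cmod z < 1" and c: "c > 0" "c * cmod (1 - z) \<le> 1 - cmod z" and pos: "\<alpha> > 0" "\<beta> > 0"
  shows "cmod (\<Sum>k=1..N. unity_term (\<alpha> + \<beta> + 2) k z
      * (z ^ (2 * (k - 1)) * (1 - z) powr of_real \<alpha> * (1 - z) powr of_real \<beta>)) \<le> c powr (- (\<alpha> + \<beta> + 2))"
proof -
  let ?p = "\<alpha> + \<beta> + 2" and ?r = "cmod z"
  have p: "?p \<ge> 2" using pos by simp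
  have d: "cmod (1 - z) > 0" using z by auto
  have e: "complex_of_real (cmod (neg_coeff ?p n) * ?r ^ n) = neg_coeff ?p n * of_real ?r ^ n" for n
  proof -
    have "complex_of_real (cmod (neg_coeff ?p n) * ?r ^ n) = of_real (cmod (neg_coeff ?p n)) * of_real ?r ^ n" by simp
    then show ?thesis using neg_coeff(1)[OF p, of n] by simp
  qed
  have "(\<lambda>n. neg_coeff ?p n * of_real ?r ^ n) sums (1 - of_real ?r) powr of_real (- ?p)"
    unfolding neg_coeff_def by (rule frac_coeff_sums) (use z in simp)
  also have "(1 - complex_of_real ?r) powr of_real (- ?p) = of_real ((1 - ?r) powr (- ?p))"
    using powr_of_real[of "1 - ?r" "- ?p"] z by simp
  finally have "(\<lambda>n. complex_of_real (cmod (neg_coeff ?p n) * ?r ^ n)) sums of_real ((1 - ?r) powr (- ?p))"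
    by (simp only: e)
  then have s: "(\<lambda>n. cmod (neg_coeff ?p n) * ?r ^ n) sums ((1 - ?r) powr (- ?p))"
    by (simp only: sums_of_real_iff)
  have "cmod (\<Sum>n<3 * N. neg_coeff ?p n * z ^ n) \<le> (\<Sum>n<3 * N. cmod (neg_coeff ?p n) * ?r ^ n)"
    by (rule order_trans[OF norm_sum]) (simp add: norm_mult norm_power)
  also have "\<dots> \<le> (1 - ?r) powr (- ?p)"
    unfolding sums_unique[OF s] by (rule sum_le_suminf[OF sums_summable[OF s]]) auto
  also have "\<dots> \<le> (c * cmod (1 - z)) powr (- ?p)" by (rule powr_mono2') (use c d pos in auto)
  finally have 1: "cmod (\<Sum>n<3 * N. neg_coeff ?p n * z ^ n) \<le> (c * cmod (1 - z)) powr (- ?p)" .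
  have 2: "cmod ((1 - z) powr of_real ?p) = cmod (1 - z) powr ?p"
    using norm_powr_real_powr'[of "complex_of_real ?p" "1 - z"] by simp
  have "cmod (\<Sum>n<3 * N. neg_coeff ?p n * z ^ n) * cmod ((1 - z) powr of_real ?p)
      \<le> (c * cmod (1 - z)) powr (- ?p) * cmod (1 - z) powr ?p" unfolding 2 by (rule mult_right_mono[OF 1]) simp
  also have "\<dots> = c powr (- ?p) * (cmod (1 - z) powr (- ?p) * cmod (1 - z) powr ?p)"
    by (simp only: powr_mult mult.assoc)
  also have "cmod (1 - z) powr (- ?p) * cmod (1 - z) powr ?p = 1" using d by (simp flip: powr_add)
  finally show ?thesis unfolding unity_partial_sum[OF z] norm_mult by simp
qed

lemma unity_term_bound:
  assumes "cmod z \<le> 1" "k \<ge> 1" "p \<ge> 2"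
  shows "cmod (unity_term p k z) \<le> 3 powr p * real k powr (p - 1) * (cmod (1 - z))\<^sup>2 * cmod z ^ (k - 1)"
proof -
  have c: "cmod (neg_coeff p (3 * (k - 1) + r)) \<le> 3 powr (p - 1) * real k powr (p - 1)" if "r < 3" for r
  proof -
    have "cmod (neg_coeff p (3 * (k - 1) + r)) \<le> real (3 * (k - 1) + r + 1) powr (p - 1)"
      by (rule neg_coeff(2)[OF assms(3)])
    also have "\<dots> \<le> (3 * real k) powr (p - 1)" using that assms by (intro powr_mono2) auto
    also have "\<dots> = 3 powr (p - 1) * real k powr (p - 1)" by (rule powr_mult)
    finally show ?thesis .
  qed
  have "cmod (\<Sum>r<3. neg_coeff p (3 * (k - 1) + r) * z ^ r) \<le> (\<Sum>r<3::nat. 3 powr (p - 1) * real k powr (p - 1))"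
  proof (rule sum_norm_le)
    fix r :: nat assume r: "r \<in> {..<3}"
    have "cmod (neg_coeff p (3 * (k - 1) + r)) * cmod z ^ r \<le> (3 powr (p - 1) * real k powr (p - 1)) * 1"
      using c[of r] r assms(1) by (intro mult_mono) (auto simp: power_le_one)
    then show "cmod (neg_coeff p (3 * (k - 1) + r) * z ^ r) \<le> 3 powr (p - 1) * real k powr (p - 1)"
      by (simp add: norm_mult norm_power)
  qed
  also have "\<dots> = (3 * 3 powr (p - 1)) * real k powr (p - 1)" by simp
  also have "3 * 3 powr (p - 1) = (3::real) powr p" using powr_add[of "3::real" 1 "p - 1"] by simp
  finally have q: "cmod (\<Sum>r<3. neg_coeff p (3 * (k - 1) + r) * z ^ r) \<le> 3 powr p * real k powr (p - 1)" .
  have "cmod (unity_term p k z) = cmod z ^ (k - 1) * (cmod (1 - z))\<^sup>2 * cmod (\<Sum>r<3. neg_coeff p (3 * (k - 1) + r) * z ^ r)"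
    unfolding unity_term_def norm_mult norm_power by simp
  also have "\<dots> \<le> cmod z ^ (k - 1) * (cmod (1 - z))\<^sup>2 * (3 powr p * real k powr (p - 1))"
    by (rule mult_left_mono[OF q]) simp
  finally show ?thesis by (simp add: mult_ac)
qed

text \<open>The weights that remain after the square functions and one resolvent have been split off.\<close>

definition unity_weight :: "real \<Rightarrow> real \<Rightarrow> real \<Rightarrow> nat \<Rightarrow> real \<Rightarrow> real" where
  "unity_weight b \<alpha> \<beta> k t = real k powr (1 - \<alpha> - \<beta>) * cmod (unity_term (\<alpha> + \<beta> + 2) k (stolz_contour b t))
     * cmod (contour_speed b t) / cmod (1 - stolz_contour b t)"

definition weight_bound :: "real \<Rightarrow> (real \<Rightarrow> real) \<Rightarrow> (real \<Rightarrow> real) \<Rightarrow> bool" where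
  "weight_bound \<kappa> u w \<longleftrightarrow> integrable unit_measure w \<and> (\<integral>t. w t \<partial>unit_measure) \<le> \<kappa> \<and> (\<forall>t\<in>{0<..<1}. u t \<le> w t)"

text \<open>On the contour the weights are at most of size $k e^{- c k d}$, where \<open>d\<close> is the distance to \<open>1\<close>.
  Hence their integrals are uniformly bounded.\<close>

lemma unity_weight_integral:
  assumes b: "0 < b" "b < pi / 2" and pos: "\<alpha> > 0" "\<beta> > 0"
  shows "\<exists>\<kappa>>0. \<exists>w. \<forall>k\<ge>1. weight_bound \<kappa> (unity_weight b \<alpha> \<beta> k) (w k)"
proof -
  let ?p = "\<alpha> + \<beta> + 2" and ?\<Gamma> = "stolz_contour b"
  note s = sin_angle[OF b]
  define c where "c = (1 - sin b) / 2"
  have c: "c > 0" using s by (simp add: c_def)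
  obtain c1 where c1: "c1 > 0" "\<forall>t\<in>{0<..<1}. c1 * min t (1 - t) \<le> cmod (1 - ?\<Gamma> t)"
    using stolz_contour_lower_bound[OF b] by blast
  obtain V where V: "V > 0" "\<forall>t\<in>{0<..<1}. cmod (contour_speed b t) \<le> V"
    using stolz_contour_derivative_bound[of b] by blast
  define A where "A = 3 powr ?p * V * exp (2 * c) * (2 / c)"
  have A: "A > 0" unfolding A_def using V(1) c by (intro mult_pos_pos) auto
  define l where "l k = c / 2 * c1 * real k" for k :: nat
  define w where "w k t = A / (c / 2 * c1) * (l k * exp (- (l k * min t (1 - t))))" for k :: nat and t :: real
  have lk: "l k > 0" if "k \<ge> 1" for k using that c c1(1) by (simp add: l_def)
  have "integrable unit_measure (w k)" if "k \<ge> 1" for k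
    unfolding w_def using unit_integral_exp(1)[OF lk[OF that]] by simp
  moreover have "(\<integral>t. w k t \<partial>unit_measure) \<le> A / (c / 2 * c1) * 2" if "k \<ge> 1" for k
  proof -
    have "(\<integral>t. w k t \<partial>unit_measure) = A / (c / 2 * c1) * (\<integral>t. l k * exp (- (l k * min t (1 - t))) \<partial>unit_measure)"
      unfolding w_def by (rule Bochner_Integration.integral_mult_right_zero)
    also have "\<dots> \<le> A / (c / 2 * c1) * 2"
      by (rule mult_left_mono[OF unit_integral_exp(2)[OF lk[OF that]]]) (use A c c1(1) in simp)
    finally show ?thesis .
  qed
  moreover have "real k powr (1 - \<alpha> - \<beta>) * cmod (unity_term ?p k (?\<Gamma> t))
      * cmod (contour_speed b t) / cmod (1 - ?\<Gamma> t) \<le> w k t" if k: "k \<ge> 1" and t: "t \<in> {0<..<1}" for k t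
  proof -
    let ?z = "?\<Gamma> t" and ?d = "cmod (1 - ?\<Gamma> t)"
    have d: "?d > 0" using stolz_contour_ne_one[OF b t] by simp
    have zc: "?z \<in> closure (stolz b)" using stolz_contour_geometry(1)[OF b] t by simp
    have cz: "c * ?d \<le> 1 - cmod ?z" using closure_stolz_one_minus_norm[OF b zc] by (simp add: c_def)
    have z1: "cmod ?z \<le> 1" using cz c d by (smt (verit) mult_nonneg_nonneg)
    have d2: "?d \<le> 2" using norm_triangle_ineq4[of 1 ?z] z1 by simp
    have k0: "real k > 0" using k by simp
    have "cmod ?z ^ (k - 1) \<le> exp (- (c * ?d)) ^ (k - 1)"
    proof (rule power_mono)
      have "cmod ?z \<le> 1 + - (c * ?d)" using cz by simp
      also have "\<dots> \<le> exp (- (c * ?d))" by (rule exp_ge_add_one_self)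
      finally show "cmod ?z \<le> exp (- (c * ?d))" .
    qed simp
    also have "\<dots> = exp (c * ?d) * exp (- (c * ?d * real k))"
    proof -
      have "exp (- (c * ?d)) ^ (k - 1) = exp (real (k - 1) * (- (c * ?d)))" by (rule exp_of_nat_mult[symmetric])
      also have "real (k - 1) * (- (c * ?d)) = c * ?d + - (c * ?d * real k)"
        using k by (simp add: of_nat_diff algebra_simps)
      finally show ?thesis by (simp only: exp_add)
    qed
    also have "\<dots> \<le> exp (2 * c) * exp (- (c * ?d * real k))" using d2 c by (intro mult_right_mono) auto
    finally have decay: "cmod ?z ^ (k - 1) \<le> exp (2 * c) * exp (- (c * ?d * real k))" .
    define u where "u = c / 2 * ?d * real k"
    have u0: "u \<ge> 0" using c d k0 by (simp add: u_def)
    have ud: "?d * real k = 2 / c * u" "c * ?d * real k = u + u" using c by (auto simp: u_def field_simps)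
    have "u * exp (- u) \<le> 1"
    proof -
      have "u \<le> exp u" using exp_ge_add_one_self[of u] by linarith
      then show ?thesis by (simp add: exp_minus field_simps)
    qed
    then have "u * exp (- u) * exp (- u) \<le> 1 * exp (- u)" by (rule mult_right_mono) simp
    then have uu: "u * exp (- (u + u)) \<le> exp (- u)" by (simp add: exp_add[symmetric] mult.assoc)
    have "real k powr (1 - \<alpha> - \<beta>) * cmod (unity_term ?p k ?z)
        \<le> real k powr (1 - \<alpha> - \<beta>) * (3 powr ?p * real k powr (?p - 1) * ?d\<^sup>2 * cmod ?z ^ (k - 1))"
      using pos k by (intro mult_left_mono unity_term_bound z1) auto
    also have "\<dots> = 3 powr ?p * (real k powr (1 - \<alpha> - \<beta>) * real k powr (?p - 1)) * ?d\<^sup>2 * cmod ?z ^ (k - 1)"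
      by (simp only: mult_ac)
    also have "real k powr (1 - \<alpha> - \<beta>) * real k powr (?p - 1) = (real k)\<^sup>2"
      using k0 by (simp flip: powr_add add: powr_numeral)
    finally have 1: "real k powr (1 - \<alpha> - \<beta>) * cmod (unity_term ?p k ?z) \<le> 3 powr ?p * (real k)\<^sup>2 * ?d\<^sup>2 * cmod ?z ^ (k - 1)" .
    have "real k powr (1 - \<alpha> - \<beta>) * cmod (unity_term ?p k ?z) * cmod (contour_speed b t) / ?d
        \<le> 3 powr ?p * (real k)\<^sup>2 * ?d\<^sup>2 * cmod ?z ^ (k - 1) * V / ?d"
      by (intro divide_right_mono mult_mono[OF 1 bspec[OF V(2) t]]) auto
    also have "\<dots> = 3 powr ?p * V * real k * (?d * real k) * cmod ?z ^ (k - 1)"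
      using d by (simp add: power2_eq_square)
    also have "\<dots> \<le> 3 powr ?p * V * real k * (?d * real k) * (exp (2 * c) * exp (- (c * ?d * real k)))"
      using V(1) by (intro mult_left_mono[OF decay]) auto
    also have "\<dots> = A * real k * (u * exp (- (u + u)))" unfolding ud A_def by (simp only: mult_ac)
    also have "\<dots> \<le> A * real k * exp (- u)" using A by (intro mult_left_mono[OF uu]) auto
    also have "\<dots> \<le> A * real k * exp (- (l k * min t (1 - t)))"
    proof (rule mult_left_mono)
      have "c / 2 * real k * (c1 * min t (1 - t)) \<le> c / 2 * real k * ?d"
        using c by (intro mult_left_mono bspec[OF c1(2) t]) auto
      then show "exp (- u) \<le> exp (- (l k * min t (1 - t)))" by (simp add: u_def l_def mult_ac)
    qed (use A in simp)
    also have "\<dots> = w k t" using c c1(1) by (simp add: w_def l_def)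
    finally show ?thesis .
  qed
  ultimately have "\<forall>k\<ge>1. weight_bound (A / (c / 2 * c1) * 2) (unity_weight b \<alpha> \<beta> k) (w k)"
    by (simp add: weight_bound_def unity_weight_def)
  moreover have "A / (c / 2 * c1) * 2 > 0" using A c c1(1) by simp
  ultimately show ?thesis by blast
qed


section \<open>Integrals over products of contours\<close>

lemma holomorphic_several_isCont:
  assumes "holomorphic_several f U" "z \<in> U"
  shows "isCont f z" using assms has_derivative_continuous unfolding holomorphic_several_def by blast

lemma holomorphic_several_slice:
  fixes f :: "complex ^ 'd \<Rightarrow> complex" and q :: "'d::finite \<Rightarrow> complex"
  assumes f: "holomorphic_several f (stolz_prod \<gamma>)" and q: "\<And>j. j \<noteq> i \<Longrightarrow> q j \<in> stolz (\<gamma> j)"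
  shows "(\<lambda>\<zeta>. f (\<chi> j. if j = i then \<zeta> else q j)) holomorphic_on stolz (\<gamma> i)" unfolding holomorphic_on_def
proof
  let ?g = "\<lambda>\<zeta>. \<chi> j. if j = i then \<zeta> else q j"
  fix \<zeta> assume \<zeta>: "\<zeta> \<in> stolz (\<gamma> i)"
  have "?g \<zeta> \<in> stolz_prod \<gamma>" using \<zeta> q by (auto simp: stolz_prod_def)
  then obtain D where D: "(f has_derivative D) (at (?g \<zeta>))" "\<And>c v. D (c *s v) = c * D v"
    using f unfolding holomorphic_several_def by blast
  have g: "?g = (\<lambda>\<zeta>. axis i \<zeta> + ?g 0)" by (auto simp: fun_eq_iff vec_eq_iff axis_def)
  have "linear (axis i :: complex \<Rightarrow> complex ^ 'd)" by (rule linearI) (auto simp: vec_eq_iff axis_def)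
  then have "bounded_linear (axis i :: complex \<Rightarrow> complex ^ 'd)" by (simp add: linear_conv_bounded_linear)
  then have "(?g has_derivative (\<lambda>h. axis i h + 0)) (at \<zeta>)"
    by (subst g) (intro has_derivative_add bounded_linear_imp_has_derivative has_derivative_const)
  then have "((\<lambda>\<zeta>. f (?g \<zeta>)) has_derivative (\<lambda>h. D (axis i h + 0))) (at \<zeta>)"
    by (rule has_derivative_compose[where g = f]) (rule D(1))
  moreover have "D (axis i h + 0) = D (axis i 1) * h" for h
  proof -
    have "axis i h + 0 = h *s axis i 1" by (auto simp: vec_eq_iff axis_def)
    then show ?thesis by (simp add: D(2) mult.commute)
  qed
  ultimately have "((\<lambda>\<zeta>. f (?g \<zeta>)) has_field_derivative D (axis i 1)) (at \<zeta>)"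
    by (simp only: has_field_derivative_def)
  then show "(\<lambda>\<zeta>. f (?g \<zeta>)) field_differentiable at \<zeta> within stolz (\<gamma> i)"
    using field_differentiable_def field_differentiable_at_within by blast
qed

lemma tendsto_cprod:
  fixes A :: "nat \<Rightarrow> 'i \<Rightarrow> ('a::complex_normed_vector, 'a) cblinfun"
  assumes "finite S"
    and "\<And>n j k. j \<in> S \<Longrightarrow> k \<in> S \<Longrightarrow> A n j o\<^sub>C A n k = A n k o\<^sub>C A n j"
    and "\<And>j k. j \<in> S \<Longrightarrow> k \<in> S \<Longrightarrow> B j o\<^sub>C B k = B k o\<^sub>C B j"
    and "\<And>j. j \<in> S \<Longrightarrow> (\<lambda>n. A n j) \<longlonglongrightarrow> B j"
  shows "(\<lambda>n. cprod S (A n)) \<longlonglongrightarrow> cprod S B" using assms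
proof (induction S rule: finite_induct)
  case empty
  then show ?case by (simp add: cprod_def)
next
  case (insert i S)
  have "(\<lambda>n. A n i o\<^sub>C cprod S (A n)) \<longlonglongrightarrow> B i o\<^sub>C cprod S B" using insert by (intro compose_bilinear.tendsto) auto
  moreover have "cprod (insert i S) (A n) = A n i o\<^sub>C cprod S (A n)" for n
    by (rule cprod_insert[OF insert.hyps]) (use insert.prems(1) in blast)
  moreover have "cprod (insert i S) B = B i o\<^sub>C cprod S B"
    by (rule cprod_insert[OF insert.hyps]) (use insert.prems(2) in blast)
  ultimately show ?case by simp
qed

text \<open>The integrals below are taken over a path \<open>p i\<close> in each variable \<open>i \<in> \<Lambda>\<close>, with a scalar weight
  \<open>w i\<close> that contains the derivative of the path.  The function \<open>h\<close> measures the decay that the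
  integrated function provides near \<open>1\<close>.\<close>

definition contour_kernel ::
  "real \<Rightarrow> ('a::complex_banach, 'a) cblinfun \<Rightarrow> (complex \<Rightarrow> real) \<Rightarrow> (real \<Rightarrow> complex) \<Rightarrow> (real \<Rightarrow> complex) \<Rightarrow> bool" where
  "contour_kernel \<gamma> T h p w \<longleftrightarrow> continuous_on {0<..<1} p \<and> (\<forall>t\<in>{0<..<1}. p t \<in> stolz \<gamma> \<and> p t \<notin> spectrum T)
     \<and> w \<in> borel_measurable unit_measure
     \<and> (\<exists>v. integrable unit_measure v \<and> (\<forall>t\<in>{0<..<1}. h (p t) * cmod (w t) * norm (resolvent (p t) T) \<le> v t))"

definition contour_point :: "'d set \<Rightarrow> ('d \<Rightarrow> real \<Rightarrow> complex) \<Rightarrow> ('d \<Rightarrow> real) \<Rightarrow> complex ^ 'd::finite" where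
  "contour_point \<Lambda> p t = (\<chi> i. if i \<in> \<Lambda> then p i (t i) else 0)"

definition contour_integrand :: "('d::finite \<Rightarrow> ('a::complex_banach, 'a) cblinfun) \<Rightarrow> 'd set \<Rightarrow>
    (complex ^ 'd \<Rightarrow> complex) \<Rightarrow> ('d \<Rightarrow> real \<Rightarrow> complex) \<Rightarrow> ('d \<Rightarrow> real \<Rightarrow> complex) \<Rightarrow> ('d \<Rightarrow> real) \<Rightarrow> ('a, 'a) cblinfun" where
  "contour_integrand T \<Lambda> f p w t = (f (contour_point \<Lambda> p t) * (\<Prod>i\<in>\<Lambda>. w i (t i)))
     *\<^sub>C cprod \<Lambda> (\<lambda>i. resolvent (p i (t i)) (T i))"

locale commuting_tuple =
  fixes \<gamma> :: "'d::finite \<Rightarrow> real" and T :: "'d \<Rightarrow> ('a::complex_banach, 'a) cblinfun"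
  assumes angles: "\<And>i. 0 < \<gamma> i" "\<And>i. \<gamma> i < pi / 2"
    and commute: "\<And>i j. T i o\<^sub>C T j = T j o\<^sub>C T i"
begin

lemma resolvents_commute':
  "z \<notin> spectrum (T i) \<Longrightarrow> w \<notin> spectrum (T j) \<Longrightarrow>
    resolvent z (T i) o\<^sub>C resolvent w (T j) = resolvent w (T j) o\<^sub>C resolvent z (T i)"
  by (rule resolvents_commute[OF _ _ commute])

lemma contour_point_in:
  assumes "\<And>i. i \<in> \<Lambda> \<Longrightarrow> contour_kernel (\<gamma> i) (T i) (h i) (p i) (w i)" "\<And>i. i \<in> \<Lambda> \<Longrightarrow> t i \<in> {0<..<1}"
  shows "contour_point \<Lambda> p t \<in> stolz_prod \<gamma>"
  using assms zero_in_stolz[OF angles] unfolding contour_kernel_def contour_point_def stolz_prod_def by auto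

lemma contour_integrand_measurable:
  assumes k: "\<And>i. i \<in> \<Lambda> \<Longrightarrow> contour_kernel (\<gamma> i) (T i) (h i) (p i) (w i)"
    and f: "holomorphic_several f (stolz_prod \<gamma>)"
  shows "strongly_measurable (cube \<Lambda>) (contour_integrand T \<Lambda> f p w)" unfolding contour_integrand_def
proof (rule strongly_measurable_scaleC)
  have lim: "(\<lambda>n. p i (mesh n (t i))) \<longlonglongrightarrow> p i (t i)" if "t \<in> \<Lambda> \<rightarrow>\<^sub>E {0<..<1}" "i \<in> \<Lambda>" for t i
  proof -
    have ti: "t i \<in> {0<..<1}" using that by auto
    have "isCont (p i) (t i)" using k[OF that(2)] ti unfolding contour_kernel_def
      by (meson continuous_on_eq_continuous_at open_greaterThanLessThan)
    then show ?thesis by (rule isCont_tendsto_compose[OF _ mesh_tendsto])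
  qed
  have sp: "p i s \<notin> spectrum (T i)" if "i \<in> \<Lambda>" "s \<in> {0<..<1}" for i s
    using k that unfolding contour_kernel_def by blast
  show "strongly_measurable (cube \<Lambda>) (\<lambda>t. cprod \<Lambda> (\<lambda>i. resolvent (p i (t i)) (T i)))"
  proof (rule strongly_measurable_cube)
    fix t assume t: "t \<in> \<Lambda> \<rightarrow>\<^sub>E {0<..<1::real}"
    have ti: "t i \<in> {0<..<1}" if "i \<in> \<Lambda>" for i using t that by auto
    have "(\<lambda>n. cprod \<Lambda> (\<lambda>i. resolvent (p i (mesh n (t i))) (T i))) \<longlonglongrightarrow> cprod \<Lambda> (\<lambda>i. resolvent (p i (t i)) (T i))"
    proof (rule tendsto_cprod)
      show "(\<lambda>n. resolvent (p i (mesh n (t i))) (T i)) \<longlonglongrightarrow> resolvent (p i (t i)) (T i)" if "i \<in> \<Lambda>" for i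
        by (rule isCont_tendsto_compose[OF resolvent_isCont[OF sp[OF that ti[OF that]]] lim[OF t that]])
    qed (simp, (intro resolvents_commute' sp mesh_in ti; assumption)+)
    also have "(\<lambda>n. cprod \<Lambda> (\<lambda>i. resolvent (p i (mesh n (t i))) (T i)))
        = (\<lambda>n. cprod \<Lambda> (\<lambda>i. resolvent (p i ((\<lambda>i\<in>\<Lambda>. mesh n (t i)) i)) (T i)))" by (intro ext cprod_cong) simp
    finally show "(\<lambda>n. cprod \<Lambda> (\<lambda>i. resolvent (p i ((\<lambda>i\<in>\<Lambda>. mesh n (t i)) i)) (T i)))
        \<longlonglongrightarrow> cprod \<Lambda> (\<lambda>i. resolvent (p i (t i)) (T i))" .
  qed simp
  have "strongly_measurable (cube \<Lambda>) (\<lambda>t. f (contour_point \<Lambda> p t))"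
  proof (rule strongly_measurable_cube)
    fix t assume t: "t \<in> \<Lambda> \<rightarrow>\<^sub>E {0<..<1::real}"
    have "contour_point \<Lambda> p t \<in> stolz_prod \<gamma>" by (rule contour_point_in[OF k]) (use t in auto)
    then have c: "isCont f (contour_point \<Lambda> p t)" by (rule holomorphic_several_isCont[OF f])
    have "(\<lambda>n. contour_point \<Lambda> p (\<lambda>i\<in>\<Lambda>. mesh n (t i))) \<longlonglongrightarrow> contour_point \<Lambda> p t" unfolding contour_point_def
    proof (rule tendsto_vec_lambda)
      show "(\<lambda>n. if i \<in> \<Lambda> then p i ((\<lambda>i\<in>\<Lambda>. mesh n (t i)) i) else 0) \<longlonglongrightarrow> (if i \<in> \<Lambda> then p i (t i) else 0)" for i
        using lim[OF t] by (cases "i \<in> \<Lambda>") auto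
    qed
    then show "(\<lambda>n. f (contour_point \<Lambda> p (\<lambda>i\<in>\<Lambda>. mesh n (t i)))) \<longlonglongrightarrow> f (contour_point \<Lambda> p t)"
      by (rule isCont_tendsto_compose[OF c])
  qed simp
  then have 1: "(\<lambda>t. f (contour_point \<Lambda> p t)) \<in> borel_measurable (cube \<Lambda>)" by (rule strongly_measurable_borel)
  have 2: "(\<lambda>t. w i (t i)) \<in> borel_measurable (cube \<Lambda>)" if "i \<in> \<Lambda>" for i
    by (rule measurable_compose[OF measurable_component_singleton[OF that]])
      (use k[OF that] in \<open>simp add: contour_kernel_def\<close>)
  show "(\<lambda>t. f (contour_point \<Lambda> p t) * (\<Prod>i\<in>\<Lambda>. w i (t i))) \<in> borel_measurable (cube \<Lambda>)"
    by (intro borel_measurable_times 1 borel_measurable_prod 2)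
qed

lemma contour_integrand_bound:
  assumes k: "\<And>i. i \<in> \<Lambda> \<Longrightarrow> contour_kernel (\<gamma> i) (T i) (h i) (p i) (w i)" and h: "\<And>i z. h i z \<ge> 0"
    and c: "c \<ge> 0" "\<And>z. z \<in> stolz_prod \<gamma> \<Longrightarrow> cmod (f z) \<le> c * (\<Prod>i\<in>\<Lambda>. h i (z $ i))"
  shows "\<exists>V. integrable (cube \<Lambda>) V \<and>
    (\<forall>t\<in>space (cube \<Lambda>). norm (contour_integrand T \<Lambda> f p w t) \<le> V t)"
proof -
  have "\<forall>i\<in>\<Lambda>. \<exists>v. integrable unit_measure v \<and>
      (\<forall>t\<in>{0<..<1}. h i (p i t) * cmod (w i t) * norm (resolvent (p i t) (T i)) \<le> v t)"
    using k unfolding contour_kernel_def by blast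
  from bchoice[OF this] obtain v where v: "\<forall>i\<in>\<Lambda>. integrable unit_measure (v i) \<and>
      (\<forall>t\<in>{0<..<1}. h i (p i t) * cmod (w i t) * norm (resolvent (p i t) (T i)) \<le> v i t)" by (elim exE)
  let ?V = "\<lambda>t. c * (\<Prod>i\<in>\<Lambda>. v i (t i))"
  have "integrable (cube \<Lambda>) ?V"
    by (rule integrable_mult_right, rule unit_cube.product_integrable_prod) (use v in auto)
  moreover have "norm (contour_integrand T \<Lambda> f p w t) \<le> ?V t" if t: "t \<in> space (cube \<Lambda>)" for t
  proof -
    have ti: "t i \<in> {0<..<1}" if "i \<in> \<Lambda>" for i using t that by (auto simp: space_cube)
    have sp: "p i (t i) \<notin> spectrum (T i)" if "i \<in> \<Lambda>" for i
      using k[OF that] ti[OF that] unfolding contour_kernel_def by blast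
    have "norm (contour_integrand T \<Lambda> f p w t)
        = cmod (f (contour_point \<Lambda> p t)) * (\<Prod>i\<in>\<Lambda>. cmod (w i (t i))) * norm (cprod \<Lambda> (\<lambda>i. resolvent (p i (t i)) (T i)))"
      by (simp add: contour_integrand_def norm_scaleC norm_mult prod_norm)
    also have "\<dots> \<le> (c * (\<Prod>i\<in>\<Lambda>. h i (contour_point \<Lambda> p t $ i))) * (\<Prod>i\<in>\<Lambda>. cmod (w i (t i)))
        * (\<Prod>i\<in>\<Lambda>. norm (resolvent (p i (t i)) (T i)))"
    proof (rule mult_mono[OF mult_right_mono])
      show "cmod (f (contour_point \<Lambda> p t)) \<le> c * (\<Prod>i\<in>\<Lambda>. h i (contour_point \<Lambda> p t $ i))"
        by (rule c(2)[OF contour_point_in[OF k ti]])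
      show "norm (cprod \<Lambda> (\<lambda>i. resolvent (p i (t i)) (T i))) \<le> (\<Prod>i\<in>\<Lambda>. norm (resolvent (p i (t i)) (T i)))"
        by (rule norm_cprod_le) (auto intro!: resolvents_commute' sp)
      show "0 \<le> (c * (\<Prod>i\<in>\<Lambda>. h i (contour_point \<Lambda> p t $ i))) * (\<Prod>i\<in>\<Lambda>. cmod (w i (t i)))"
        using c(1) h by (intro mult_nonneg_nonneg prod_nonneg) auto
    qed (auto intro: prod_nonneg)
    also have "\<dots> = c * (\<Prod>i\<in>\<Lambda>. h i (p i (t i)) * cmod (w i (t i)) * norm (resolvent (p i (t i)) (T i)))"
    proof -
      have "(\<Prod>i\<in>\<Lambda>. h i (contour_point \<Lambda> p t $ i)) = (\<Prod>i\<in>\<Lambda>. h i (p i (t i)))"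
        by (rule prod.cong) (auto simp: contour_point_def)
      then show ?thesis by (simp only: prod.distrib mult.assoc)
    qed
    also have "\<dots> \<le> ?V t" using c(1) h v ti by (intro mult_left_mono prod_mono conjI mult_nonneg_nonneg) auto
    finally show ?thesis .
  qed
  ultimately show ?thesis by (intro exI[of _ ?V] conjI ballI)
qed

lemma contour_integrand_integrable:
  assumes k: "\<And>i. i \<in> \<Lambda> \<Longrightarrow> contour_kernel (\<gamma> i) (T i) (h i) (p i) (w i)" and h: "\<And>i z. h i z \<ge> 0"
    and c: "c \<ge> 0" "\<And>z. z \<in> stolz_prod \<gamma> \<Longrightarrow> cmod (f z) \<le> c * (\<Prod>i\<in>\<Lambda>. h i (z $ i))"
    and f: "holomorphic_several f (stolz_prod \<gamma>)"
  shows "integrable (cube \<Lambda>) (\<lambda>t. pairing y (contour_integrand T \<Lambda> f p w t) x)"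
    and "pairing y (strong_integral (cube \<Lambda>) (contour_integrand T \<Lambda> f p w)) x
      = (\<integral>t. pairing y (contour_integrand T \<Lambda> f p w t) x \<partial>cube \<Lambda>)"
proof -
  let ?M = "cube \<Lambda>" and ?F = "contour_integrand T \<Lambda> f p w"
  obtain V where V: "integrable ?M V" "\<forall>t\<in>space ?M. norm (?F t) \<le> V t"
    using contour_integrand_bound[where h = h, OF k h c] by blast
  have m: "strongly_measurable ?M ?F" by (rule contour_integrand_measurable[OF k f])
  have "integrable ?M (\<lambda>t. norm (?F t))"
    by (rule Bochner_Integration.integrable_bound[OF V(1) strongly_measurable_norm[OF m]])
      (intro AE_I2, use V(2) in \<open>simp, smt (verit) abs_ge_self\<close>)
  then have fin: "(\<integral>\<^sup>+t. ennreal (norm (?F t)) \<partial>?M) < \<infinity>" by (simp add: integrable_iff_bounded)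
  show "integrable ?M (\<lambda>t. pairing y (?F t) x)"
    "pairing y (strong_integral ?M ?F) x = (\<integral>t. pairing y (?F t) x \<partial>?M)"
    by (rule strong_integral_pairing[OF m fin])+
qed

text \<open>An exchange rule in the variable \<open>i\<close> alone carries over to the integral in all variables:
  the remaining variables enter as constants, through a slice of \<open>f\<close> and through the functional
  that is composed with the remaining resolvents.\<close>

lemma contour_exchange_step:
  assumes k: "\<And>j. j \<in> \<Lambda> \<Longrightarrow> contour_kernel (\<gamma> j) (T j) (\<lambda>_. 1) (p j) (w j)"
    and k': "\<And>j. j \<in> \<Lambda> \<Longrightarrow> contour_kernel (\<gamma> j) (T j) (\<lambda>_. 1) (p' j) (w' j)"
    and i: "i \<in> \<Lambda>" and same: "\<And>j. j \<noteq> i \<Longrightarrow> p' j = p j \<and> w' j = w j"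
    and f: "holomorphic_several f (stolz_prod \<gamma>)" "\<And>z. z \<in> stolz_prod \<gamma> \<Longrightarrow> cmod (f z) \<le> c" "c \<ge> 0"
    and ex: "\<And>\<phi> y. \<phi> holomorphic_on stolz (\<gamma> i) \<Longrightarrow> (\<And>z. z \<in> stolz (\<gamma> i) \<Longrightarrow> cmod (\<phi> z) \<le> c) \<Longrightarrow>
      (\<integral>t. \<phi> (p i t) * w i t * pairing y (resolvent (p i t) (T i)) x \<partial>unit_measure)
      = (\<integral>t. \<phi> (p' i t) * w' i t * pairing y (resolvent (p' i t) (T i)) x' \<partial>unit_measure)"
  shows "(\<integral>t. pairing y (contour_integrand T \<Lambda> f p w t) x \<partial>cube \<Lambda>)
    = (\<integral>t. pairing y (contour_integrand T \<Lambda> f p' w' t) x' \<partial>cube \<Lambda>)"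
proof -
  define I where "I = \<Lambda> - {i}"
  have L: "\<Lambda> = insert i I" and iI: "i \<notin> I" and fin: "finite I" using i by (auto simp: I_def)
  let ?M = "cube \<Lambda>"
  have f': "cmod (f z) \<le> c * (\<Prod>i\<in>\<Lambda>. (\<lambda>_ _. 1) i (z $ i))" if "z \<in> stolz_prod \<gamma>" for z
    using f(2)[OF that] by simp
  have slice: "pairing y (contour_integrand T \<Lambda> f q u (t(i := s))) v
      = f (\<chi> j. if j = i then q i s else contour_point I q t $ j) * u i s
        * pairing ((\<Prod>j\<in>I. u j (t j)) *\<^sub>C (y o\<^sub>C cprod I (\<lambda>j. resolvent (q j (t j)) (T j)))) (resolvent (q i s) (T i)) v"
    if kq: "\<And>j. j \<in> \<Lambda> \<Longrightarrow> contour_kernel (\<gamma> j) (T j) (\<lambda>_. 1) (q j) (u j)"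
      and t: "t \<in> space (cube I)" and s: "s \<in> {0<..<1}" for q u t s v
  proof -
    let ?R = "\<lambda>j. resolvent (q j ((t(i := s)) j)) (T j)"
    have sp: "q j ((t(i := s)) j) \<notin> spectrum (T j)" if "j \<in> \<Lambda>" for j
      using kq[OF that] t s that iI unfolding contour_kernel_def L by (auto simp: space_cube)
    have RR: "?R j o\<^sub>C ?R k = ?R k o\<^sub>C ?R j" if "j \<in> \<Lambda>" "k \<in> \<Lambda>" for j k
      by (rule resolvents_commute'[OF sp[OF that(1)] sp[OF that(2)]])
    have "cprod \<Lambda> ?R = ?R i o\<^sub>C cprod I ?R" unfolding L by (rule cprod_insert[OF fin iI]) (use RR L in blast)
    also have "\<dots> = cprod I ?R o\<^sub>C ?R i" by (rule cprod_commute[OF fin]) (use RR L in blast)+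
    also have "cprod I ?R = cprod I (\<lambda>j. resolvent (q j (t j)) (T j))" by (rule cprod_cong) (use iI in auto)
    finally have R: "cprod \<Lambda> ?R = cprod I (\<lambda>j. resolvent (q j (t j)) (T j)) o\<^sub>C resolvent (q i s) (T i)" by simp
    have P: "(\<Prod>j\<in>\<Lambda>. u j ((t(i := s)) j)) = u i s * (\<Prod>j\<in>I. u j (t j))"
    proof -
      have "(\<Prod>j\<in>I. u j ((t(i := s)) j)) = (\<Prod>j\<in>I. u j (t j))" by (rule prod.cong) (use iI in auto)
      then show ?thesis unfolding L using fin iI by simp
    qed
    have Z: "contour_point \<Lambda> q (t(i := s)) = (\<chi> j. if j = i then q i s else contour_point I q t $ j)"
      by (auto simp: contour_point_def vec_eq_iff L)
    show ?thesis unfolding contour_integrand_def R P Z by (simp add: cblinfun_apply_scaleC)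
  qed
  have split: "(\<integral>t. pairing y (contour_integrand T \<Lambda> f q u t) v \<partial>?M)
      = (\<integral>t. (\<integral>s. pairing y (contour_integrand T \<Lambda> f q u (t(i := s))) v \<partial>unit_measure) \<partial>cube I)"
    if kq: "\<And>j. j \<in> \<Lambda> \<Longrightarrow> contour_kernel (\<gamma> j) (T j) (\<lambda>_. 1) (q j) (u j)" for q u v unfolding L
    by (rule unit_cube.product_integral_insert[OF fin iI], fold L,
      rule contour_integrand_integrable(1)[where h = "\<lambda>_ _. 1", OF kq _ f(3) f' f(1)]) simp_all
  have "(\<integral>s. pairing y (contour_integrand T \<Lambda> f p w (t(i := s))) x \<partial>unit_measure)
      = (\<integral>s. pairing y (contour_integrand T \<Lambda> f p' w' (t(i := s))) x' \<partial>unit_measure)"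
    if t: "t \<in> space (cube I)" for t
  proof -
    let ?q = "\<lambda>j. contour_point I p t $ j"
    let ?\<phi> = "\<lambda>\<zeta>. f (\<chi> j. if j = i then \<zeta> else ?q j)"
    let ?y = "(\<Prod>j\<in>I. w j (t j)) *\<^sub>C (y o\<^sub>C cprod I (\<lambda>j. resolvent (p j (t j)) (T j)))"
    have "contour_point I p t \<in> stolz_prod \<gamma>"
      by (rule contour_point_in[OF k]) (use t in \<open>auto simp: L space_cube\<close>)
    then have q: "?q j \<in> stolz (\<gamma> j)" for j by (auto simp: stolz_prod_def)
    have pp: "contour_point I p' t = contour_point I p t" "(\<Prod>j\<in>I. w' j (t j)) = (\<Prod>j\<in>I. w j (t j))"
      "cprod I (\<lambda>j. resolvent (p' j (t j)) (T j)) = cprod I (\<lambda>j. resolvent (p j (t j)) (T j))"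
    proof -
      have "p' j = p j \<and> w' j = w j" if "j \<in> I" for j using same[of j] that iI by blast
      then show "contour_point I p' t = contour_point I p t" "(\<Prod>j\<in>I. w' j (t j)) = (\<Prod>j\<in>I. w j (t j))"
        "cprod I (\<lambda>j. resolvent (p' j (t j)) (T j)) = cprod I (\<lambda>j. resolvent (p j (t j)) (T j))"
        by (auto simp: contour_point_def vec_eq_iff intro!: prod.cong cprod_cong)
    qed
    have "(\<integral>s. pairing y (contour_integrand T \<Lambda> f p w (t(i := s))) x \<partial>unit_measure)
        = (\<integral>s. ?\<phi> (p i s) * w i s * pairing ?y (resolvent (p i s) (T i)) x \<partial>unit_measure)"
      by (intro Bochner_Integration.integral_cong refl slice[OF k t]) simp_all
    also have "\<dots> = (\<integral>s. ?\<phi> (p' i s) * w' i s * pairing ?y (resolvent (p' i s) (T i)) x' \<partial>unit_measure)"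
    proof (rule ex)
      show "?\<phi> holomorphic_on stolz (\<gamma> i)" by (rule holomorphic_several_slice[OF f(1) q])
      show "cmod (?\<phi> z) \<le> c" if "z \<in> stolz (\<gamma> i)" for z
        by (rule f(2)) (use that q in \<open>auto simp: stolz_prod_def\<close>)
    qed
    also have "\<dots> = (\<integral>s. pairing y (contour_integrand T \<Lambda> f p' w' (t(i := s))) x' \<partial>unit_measure)"
      by (intro Bochner_Integration.integral_cong refl, subst slice[OF k' t]) (simp_all cong del: if_weak_cong add: pp)
    finally show ?thesis .
  qed
  then have "(\<integral>t. (\<integral>s. pairing y (contour_integrand T \<Lambda> f p w (t(i := s))) x \<partial>unit_measure) \<partial>cube I)
    = (\<integral>t. (\<integral>s. pairing y (contour_integrand T \<Lambda> f p' w' (t(i := s))) x' \<partial>unit_measure) \<partial>cube I)"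
    by (rule Bochner_Integration.integral_cong[OF refl])
  then show ?thesis by (simp only: split[of p w x, OF k, simplified] split[of p' w' x', OF k', simplified])
qed

lemma contour_exchange:
  assumes k: "\<And>j. j \<in> \<Lambda> \<Longrightarrow> contour_kernel (\<gamma> j) (T j) (\<lambda>_. 1) (p j) (w j)"
    and k': "\<And>j. j \<in> \<Lambda> \<Longrightarrow> contour_kernel (\<gamma> j) (T j) (\<lambda>_. 1) (p' j) (w' j)"
    and E: "\<And>i j. i \<in> \<Lambda> \<Longrightarrow> j \<in> \<Lambda> \<Longrightarrow> E i o\<^sub>C E j = E j o\<^sub>C E i"
    and f: "holomorphic_several f (stolz_prod \<gamma>)" "\<And>z. z \<in> stolz_prod \<gamma> \<Longrightarrow> cmod (f z) \<le> c" "c \<ge> 0"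
    and ex: "\<And>i \<phi> y x. i \<in> \<Lambda> \<Longrightarrow> \<phi> holomorphic_on stolz (\<gamma> i) \<Longrightarrow> (\<And>z. z \<in> stolz (\<gamma> i) \<Longrightarrow> cmod (\<phi> z) \<le> c) \<Longrightarrow>
      (\<integral>t. \<phi> (p i t) * w i t * pairing y (resolvent (p i t) (T i)) x \<partial>unit_measure)
      = (\<integral>t. \<phi> (p' i t) * w' i t * pairing y (resolvent (p' i t) (T i)) (cblinfun_apply (E i) x) \<partial>unit_measure)"
  shows "(\<integral>t. pairing y (contour_integrand T \<Lambda> f p w t) x \<partial>cube \<Lambda>)
    = (\<integral>t. pairing y (contour_integrand T \<Lambda> f p' w' t) (cblinfun_apply (cprod \<Lambda> E) x) \<partial>cube \<Lambda>)"
proof -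
  let ?p = "\<lambda>J i. if i \<in> J then p' i else p i" and ?w = "\<lambda>J i. if i \<in> J then w' i else w i"
  have "(\<integral>t. pairing y (contour_integrand T \<Lambda> f p w t) x \<partial>cube \<Lambda>)
    = (\<integral>t. pairing y (contour_integrand T \<Lambda> f (?p J) (?w J) t) (cblinfun_apply (cprod J E) x) \<partial>cube \<Lambda>)"
    if "J \<subseteq> \<Lambda>" for J using finite[of J] that
  proof (induction J rule: finite_induct)
    case empty
    then show ?case by (simp add: cprod_def)
  next
    case (insert i J)
    have kk: "contour_kernel (\<gamma> j) (T j) (\<lambda>_. 1) (?p J j) (?w J j)" if "j \<in> \<Lambda>" for J j
      using k[OF that] k'[OF that] by simp
    have step: "(\<integral>t. pairing y (contour_integrand T \<Lambda> f (?p J) (?w J) t) (cblinfun_apply (cprod J E) x) \<partial>cube \<Lambda>)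
      = (\<integral>t. pairing y (contour_integrand T \<Lambda> f (?p (insert i J)) (?w (insert i J)) t)
          (cblinfun_apply (E i) (cblinfun_apply (cprod J E) x)) \<partial>cube \<Lambda>)"
    proof (rule contour_exchange_step[OF kk kk, where i = i and c = c])
      show "i \<in> \<Lambda>" using insert by simp
      fix \<phi> and y :: "('a, complex) cblinfun"
      assume \<phi>: "\<phi> holomorphic_on stolz (\<gamma> i)" "\<And>z. z \<in> stolz (\<gamma> i) \<Longrightarrow> cmod (\<phi> z) \<le> c"
      show "(\<integral>t. \<phi> (?p J i t) * ?w J i t * pairing y (resolvent (?p J i t) (T i)) (cblinfun_apply (cprod J E) x) \<partial>unit_measure)
        = (\<integral>t. \<phi> (?p (insert i J) i t) * ?w (insert i J) i t * pairing y (resolvent (?p (insert i J) i t) (T i))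
            (cblinfun_apply (E i) (cblinfun_apply (cprod J E) x)) \<partial>unit_measure)"
        using ex[of i \<phi>] insert.hyps insert.prems \<phi> by simp
    qed (use f in auto)
    have "cprod (insert i J) E = E i o\<^sub>C cprod J E"
      by (rule cprod_insert[OF insert.hyps]) (use insert.prems E in blast)
    then have "cblinfun_apply (cprod (insert i J) E) x = cblinfun_apply (E i) (cblinfun_apply (cprod J E) x)" by simp
    then show ?case using insert.IH insert.prems step by simp
  qed
  from this[OF order_refl]
  have "(\<integral>t. pairing y (contour_integrand T \<Lambda> f p w t) x \<partial>cube \<Lambda>)
    = (\<integral>t. pairing y (contour_integrand T \<Lambda> f (?p \<Lambda>) (?w \<Lambda>) t) (cblinfun_apply (cprod \<Lambda> E) x) \<partial>cube \<Lambda>)" .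
  moreover have "contour_integrand T \<Lambda> f (?p \<Lambda>) (?w \<Lambda>) t = contour_integrand T \<Lambda> f p' w' t" for t
  proof -
    have "contour_point \<Lambda> (?p \<Lambda>) t = contour_point \<Lambda> p' t" by (auto simp: contour_point_def vec_eq_iff)
    moreover have "(\<Prod>i\<in>\<Lambda>. ?w \<Lambda> i (t i)) = (\<Prod>i\<in>\<Lambda>. w' i (t i))" by (rule prod.cong) auto
    moreover have "cprod \<Lambda> (\<lambda>i. resolvent (?p \<Lambda> i (t i)) (T i)) = cprod \<Lambda> (\<lambda>i. resolvent (p' i (t i)) (T i))"
      by (rule cprod_cong) simp
    ultimately show ?thesis by (simp only: contour_integrand_def)
  qed
  ultimately show ?thesis by simp
qed

end


section \<open>The joint functional calculus on one summand\<close>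

text \<open>The operators in the definition of the square functions.\<close>

definition square_op :: "('a::complex_banach, 'a) cblinfun \<Rightarrow> real \<Rightarrow> nat \<Rightarrow> ('a, 'a) cblinfun" where
  "square_op T \<alpha> k = real k powr (\<alpha> - 1 / 2) *\<^sub>R (cpower T (k - 1) o\<^sub>C frac_power T \<alpha>)"

lemma square_family_eq: "square_family T \<Lambda> \<alpha> x k = cblinfun_apply (cprod \<Lambda> (\<lambda>i. square_op (T i) (\<alpha> i) (k i))) x"
  by (simp add: square_family_def square_op_def)

lemma frac_power_commute:
  assumes T: "ritt_of_type a T" and "\<alpha> > 0" and S: "S o\<^sub>C T = T o\<^sub>C S"
  shows "S o\<^sub>C frac_power T \<alpha> = frac_power T \<alpha> o\<^sub>C S"
proof -
  have "ritt T" using T by (simp add: ritt_of_type_def)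
  then obtain C where "\<And>n. norm (cpower T n) \<le> C" using ritt_power_bounded by blast
  from frac_sum_commute[OF this assms(2) S] show ?thesis by (simp add: frac_power_eq_frac_sum[OF T assms(2)])
qed

lemma square_op_commute:
  assumes T: "ritt_of_type a T" and "\<alpha> > 0" and S: "S o\<^sub>C T = T o\<^sub>C S"
  shows "S o\<^sub>C square_op T \<alpha> k = square_op T \<alpha> k o\<^sub>C S"
proof -
  have "S o\<^sub>C (cpower T (k - 1) o\<^sub>C frac_power T \<alpha>) = cpower T (k - 1) o\<^sub>C frac_power T \<alpha> o\<^sub>C S"
    by (metis cblinfun_compose_assoc cpower_commute[OF S] frac_power_commute[OF assms])
  then show ?thesis by (simp add: square_op_def compose_bilinear.scaleR_left compose_bilinear.scaleR_right)
qed

lemma cadjoint_square_op: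
  fixes T :: "('a::complex_banach, 'a) cblinfun"
  assumes T: "ritt_of_type a T" and \<alpha>: "\<alpha> > 0"
  shows "cadjoint (square_op T \<alpha> k) = square_op (cadjoint T) \<alpha> k"
proof -
  have "ritt T" using T by (simp add: ritt_of_type_def)
  then obtain C where C: "\<And>n. norm (cpower T n) \<le> C" using ritt_power_bounded by blast
  have F: "cadjoint (frac_power T \<alpha>) = frac_power (cadjoint T) \<alpha>"
    using cadjoint_frac_sum[OF C \<alpha>] frac_power_eq_frac_sum[OF T \<alpha>]
      frac_power_eq_frac_sum[OF ritt_of_type_cadjoint[OF T] \<alpha>] by simp
  have "frac_power T \<alpha> o\<^sub>C cpower T (k - 1) = cpower T (k - 1) o\<^sub>C frac_power T \<alpha>"
    by (rule cpower_commute) (rule frac_power_commute[OF T \<alpha> refl, symmetric])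
  then have "cadjoint (cpower T (k - 1) o\<^sub>C frac_power T \<alpha>) = cadjoint (frac_power T \<alpha> o\<^sub>C cpower T (k - 1))"
    by simp
  also have "\<dots> = cpower (cadjoint T) (k - 1) o\<^sub>C frac_power (cadjoint T) \<alpha>"
    by (simp add: cadjoint_compose cadjoint_cpower F)
  finally show ?thesis by (simp add: square_op_def cadjoint_linear)
qed

definition unity_factor :: "real \<Rightarrow> real \<Rightarrow> nat \<Rightarrow> complex \<Rightarrow> complex" where
  "unity_factor \<alpha> \<beta> k z = unity_term (\<alpha> + \<beta> + 2) k z
     * (z ^ (2 * (k - 1)) * (1 - z) powr of_real \<alpha> * (1 - z) powr of_real \<beta>)"

lemma unity_term_holomorphic: "unity_term p k holomorphic_on U"
  unfolding unity_term_def[abs_def] by (intro holomorphic_intros)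

lemma unity_factor_holomorphic: "unity_factor \<alpha> \<beta> k holomorphic_on {z. cmod z < 1}"
  unfolding unity_factor_def[abs_def]
  by (intro holomorphic_on_mult unity_term_holomorphic one_minus_powr_holomorphic holomorphic_intros)

lemma unity_term_decay:
  assumes "\<alpha> > 0" "\<beta> > 0" "k \<ge> 1"
  shows "\<exists>C\<ge>0. \<forall>z. cmod z < 1 \<longrightarrow> cmod (unity_term (\<alpha> + \<beta> + 2) k z) \<le> C * cmod (1 - z)
    \<and> cmod (unity_factor \<alpha> \<beta> k z) \<le> C * cmod (1 - z)"
proof -
  let ?p = "\<alpha> + \<beta> + 2"
  define A where "A = 3 powr ?p * real k powr (?p - 1)"
  have A: "A \<ge> 0" by (simp add: A_def)
  define P where "P = max 1 (2 powr \<alpha> * 2 powr \<beta>)"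
  have P: "P \<ge> 1" "2 powr \<alpha> * 2 powr \<beta> \<le> P" by (auto simp: P_def)
  have 1: "cmod (unity_term ?p k z) \<le> A * 2 * cmod (1 - z)" if z: "cmod z < 1" for z
  proof -
    have d2: "cmod (1 - z) \<le> 2" using norm_triangle_ineq4[of 1 z] z by simp
    have "cmod (unity_term ?p k z) \<le> A * (cmod (1 - z))\<^sup>2 * cmod z ^ (k - 1)"
      unfolding A_def by (rule unity_term_bound) (use assms z in auto)
    also have "\<dots> \<le> A * (cmod (1 - z))\<^sup>2 * 1" using A z by (intro mult_left_mono power_le_one) auto
    also have "\<dots> = A * cmod (1 - z) * cmod (1 - z)" by (simp add: power2_eq_square)
    also have "\<dots> \<le> A * cmod (1 - z) * 2" using A d2 by (intro mult_left_mono) auto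
    finally show ?thesis by (simp add: mult_ac)
  qed
  have 2: "cmod (unity_factor \<alpha> \<beta> k z) \<le> A * 2 * P * cmod (1 - z)" if z: "cmod z < 1" for z
  proof -
    have zz: "cmod (z ^ (2 * (k - 1))) \<le> 1" using z by (simp add: norm_power power_le_one)
    have "cmod (z ^ (2 * (k - 1))) * cmod ((1 - z) powr of_real \<alpha>) \<le> 1 * 2 powr \<alpha>"
      using z assms by (intro mult_mono zz one_minus_powr_bound) auto
    then have "cmod (z ^ (2 * (k - 1))) * cmod ((1 - z) powr of_real \<alpha>) * cmod ((1 - z) powr of_real \<beta>)
        \<le> (1 * 2 powr \<alpha>) * 2 powr \<beta>" by (rule mult_mono) (use z assms one_minus_powr_bound in auto)
    then have q: "cmod (z ^ (2 * (k - 1)) * (1 - z) powr of_real \<alpha> * (1 - z) powr of_real \<beta>) \<le> P"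
      using P(2) by (simp add: norm_mult)
    have "cmod (unity_factor \<alpha> \<beta> k z) \<le> (A * 2 * cmod (1 - z)) * P"
      unfolding unity_factor_def norm_mult[of "unity_term ?p k z"]
      by (rule mult_mono[OF 1[OF z] q]) (use A in auto)
    then show ?thesis by (simp add: mult_ac)
  qed
  have "cmod (unity_term ?p k z) \<le> A * 2 * P * cmod (1 - z)" if z: "cmod z < 1" for z
  proof -
    have "A * 2 * cmod (1 - z) * 1 \<le> A * 2 * cmod (1 - z) * P" by (rule mult_left_mono[OF P(1)]) (use A in auto)
    then show ?thesis using 1[OF z] by (simp add: mult_ac)
  qed
  with 2 show ?thesis using A P(1) by (intro exI[of _ "A * 2 * P"]) auto
qed

lemma exchange_unity_factor:
  fixes y :: "('a::complex_banach, complex) cblinfun"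
  assumes T: "ritt_of_type a T" and b: "a < b" "b < \<gamma>" "a < b'" "b' < \<gamma>" "\<gamma> < pi / 2"
    and pos: "\<alpha> > 0" "\<beta> > 0" and k: "k \<ge> 1"
    and \<phi>: "\<phi> holomorphic_on stolz \<gamma>" "\<And>z. z \<in> stolz \<gamma> \<Longrightarrow> cmod (\<phi> z) \<le> c" "c \<ge> 0"
  shows "(\<integral>t. \<phi> (stolz_contour b t) * (unity_factor \<alpha> \<beta> k (stolz_contour b t) * contour_speed b t)
        * pairing y (resolvent (stolz_contour b t) T) x \<partial>unit_measure)
    = (\<integral>t. \<phi> (stolz_contour b' t) * (unity_term (\<alpha> + \<beta> + 2) k (stolz_contour b' t) * contour_speed b' t)
        * pairing y (resolvent (stolz_contour b' t) T)
          (cblinfun_apply (complex_of_real (real k powr (1 - \<alpha> - \<beta>)) *\<^sub>C (square_op T \<beta> k o\<^sub>C square_op T \<alpha> k)) x) \<partial>unit_measure)"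
proof -
  let ?p = "\<alpha> + \<beta> + 2"
  have g0: "0 < \<gamma>" using T b by (auto simp: ritt_of_type_def)
  obtain C where C: "C \<ge> 0" "\<forall>z. cmod z < 1 \<longrightarrow> cmod (unity_term ?p k z) \<le> C * cmod (1 - z)
    \<and> cmod (unity_factor \<alpha> \<beta> k z) \<le> C * cmod (1 - z)" using unity_term_decay[OF pos k] by blast
  let ?P = "cpower T (k - 1)" and ?F = "frac_power T \<alpha>" and ?G = "frac_power T \<beta>"
  have E: "complex_of_real (real k powr (1 - \<alpha> - \<beta>)) *\<^sub>C (square_op T \<beta> k o\<^sub>C square_op T \<alpha> k)
      = cpower T (2 * (k - 1)) o\<^sub>C ?F o\<^sub>C ?G"
  proof -
    have GP: "?G o\<^sub>C ?P = ?P o\<^sub>C ?G"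
      by (rule cpower_commute) (rule frac_power_commute[OF T pos(2) refl, symmetric])
    have "?G o\<^sub>C T = T o\<^sub>C ?G" by (rule frac_power_commute[OF T pos(2) refl, symmetric])
    then have GF: "?G o\<^sub>C ?F = ?F o\<^sub>C ?G" by (rule frac_power_commute[OF T pos(1)])
    have "(?P o\<^sub>C ?G) o\<^sub>C (?P o\<^sub>C ?F) = (?P o\<^sub>C ?P) o\<^sub>C ?F o\<^sub>C ?G" by (metis cblinfun_compose_assoc GP GF)
    also have "?P o\<^sub>C ?P = cpower T (2 * (k - 1))" by (simp add: cpower_add[symmetric] mult_2)
    finally have "square_op T \<beta> k o\<^sub>C square_op T \<alpha> k
        = (real k powr (\<alpha> - 1 / 2) * real k powr (\<beta> - 1 / 2)) *\<^sub>R (cpower T (2 * (k - 1)) o\<^sub>C ?F o\<^sub>C ?G)"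
      by (simp add: square_op_def compose_bilinear.scaleR_left compose_bilinear.scaleR_right)
    moreover have "real k powr (1 - \<alpha> - \<beta>) * (real k powr (\<alpha> - 1 / 2) * real k powr (\<beta> - 1 / 2)) = 1"
      using k by (simp flip: powr_add)
    ultimately show ?thesis by (simp add: scaleC_of_real)
  qed
  have "stolz_integral b (\<lambda>z. (\<phi> z * unity_term ?p k z) * (z ^ (2 * (k - 1)) * (1 - z) powr of_real \<alpha> * (1 - z) powr of_real \<beta>)
      * pairing y (resolvent z T) x)
    = stolz_integral b' (\<lambda>z. (\<phi> z * unity_term ?p k z) * pairing y (resolvent z T)
        (cblinfun_apply (cpower T (2 * (k - 1)) o\<^sub>C ?F o\<^sub>C ?G) x))"
  proof (rule exchange_one_variable[OF T b pos, where M = "c * C"])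
    show "(\<lambda>z. \<phi> z * unity_term ?p k z) holomorphic_on stolz \<gamma>"
      by (intro holomorphic_on_mult \<phi> unity_term_holomorphic)
    show "cmod (\<phi> z * unity_term ?p k z) \<le> c * C * cmod (1 - z)" if z: "z \<in> stolz \<gamma>" for z
    proof -
      have "cmod z < 1" by (rule stolz_norm_less[OF g0 b(5) z])
      then have "cmod (\<phi> z) * cmod (unity_term ?p k z) \<le> c * (C * cmod (1 - z))"
        using C(2) \<phi>(3) by (intro mult_mono \<phi>(2) z) auto
      then show ?thesis by (simp add: norm_mult mult.assoc)
    qed
    show "0 \<le> c * C" using C(1) \<phi>(3) by simp
  qed
  then show ?thesis unfolding E stolz_integral_def unity_factor_def by (simp only: mult_ac)
qed

lemma contour_kernelI:
  assumes T: "ritt_of_type a T" and b: "a < b" "b < \<gamma>" "\<gamma> < pi / 2"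
    and g: "continuous_on (stolz \<gamma>) g" and C: "C \<ge> 0" "s > 0"
      "\<And>z. z \<in> stolz \<gamma> \<Longrightarrow> h z * cmod (g z) \<le> C * cmod (1 - z) powr s"
    and h: "\<And>z. h z \<ge> 0"
  shows "contour_kernel \<gamma> T h (stolz_contour b) (\<lambda>t. g (stolz_contour b t) * contour_speed b t)"
  unfolding contour_kernel_def
proof (intro conjI continuous_stolz_contour ballI)
  let ?\<Gamma> = "stolz_contour b"
  have b0: "0 < b" "b < pi / 2" using T b by (auto simp: ritt_of_type_def)
  have b1: "b < pi / 2" by (rule b0(2))
  obtain K where K: "K > 0" "\<forall>t\<in>{0<..<1}. ?\<Gamma> t \<notin> spectrum T \<and> norm (resolvent (?\<Gamma> t) T) \<le> K / cmod (1 - ?\<Gamma> t)"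
    using contour_resolvent_bound[OF T b(1) b1] by blast
  obtain V where V: "V > 0" "\<forall>t\<in>{0<..<1}. cmod (contour_speed b t) \<le> V"
    using stolz_contour_derivative_bound[of b] by blast
  obtain w where w: "integrable unit_measure w" "\<forall>t\<in>{0<..<1}. cmod (1 - ?\<Gamma> t) powr (s - 1) \<le> w t"
    using contour_powr_bound[OF b0 C(2)] by blast
  have inS: "?\<Gamma> t \<in> stolz \<gamma>" if "t \<in> {0<..<1}" for t by (rule stolz_contour_in_stolz[OF b0(1) b(2,3) that])
  show "?\<Gamma> t \<in> stolz \<gamma>" "?\<Gamma> t \<notin> spectrum T" if "t \<in> {0<..<1}" for t using inS[OF that] K(2) that by auto
  show "(\<lambda>t. g (?\<Gamma> t) * contour_speed b t) \<in> borel_measurable unit_measure"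
    by (rule stolz_integrand_measurable(2), rule continuous_on_subset[OF g]) (use inS in auto)
  show "\<exists>v. integrable unit_measure v \<and> (\<forall>t\<in>{0<..<1}. h (?\<Gamma> t) * cmod (g (?\<Gamma> t) * contour_speed b t)
      * norm (resolvent (?\<Gamma> t) T) \<le> v t)"
  proof (intro exI[of _ "\<lambda>t. C * V * K * w t"] conjI ballI)
    show "integrable unit_measure (\<lambda>t. C * V * K * w t)" using w(1) by simp
    fix t :: real assume t: "t \<in> {0<..<1}"
    have d: "cmod (1 - ?\<Gamma> t) > 0" using stolz_contour_ne_one[OF b0 t] by simp
    have "h (?\<Gamma> t) * cmod (g (?\<Gamma> t)) * cmod (contour_speed b t) * norm (resolvent (?\<Gamma> t) T)
        \<le> (C * cmod (1 - ?\<Gamma> t) powr s * V) * (K / cmod (1 - ?\<Gamma> t))"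
    proof (rule mult_mono[OF mult_mono])
      show "h (?\<Gamma> t) * cmod (g (?\<Gamma> t)) \<le> C * cmod (1 - ?\<Gamma> t) powr s" by (rule C(3)[OF inS[OF t]])
      show "cmod (contour_speed b t) \<le> V" "norm (resolvent (?\<Gamma> t) T) \<le> K / cmod (1 - ?\<Gamma> t)"
        using V(2) K(2) t by auto
    qed (use C(1) V(1) in auto)
    also have "\<dots> = C * V * K * cmod (1 - ?\<Gamma> t) powr (s - 1)" using d by (simp add: powr_diff)
    also have "\<dots> \<le> C * V * K * w t" using C(1) V(1) K(1) w(2) t by (intro mult_left_mono) auto
    finally show "h (?\<Gamma> t) * cmod (g (?\<Gamma> t) * contour_speed b t) * norm (resolvent (?\<Gamma> t) T) \<le> C * V * K * w t"
      by (simp add: norm_mult mult.assoc)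
  qed
qed

lemma R_bound_identity: "R_bound {cblinfun_id} 1"
proof -
  have "rad_norm J (\<lambda>k. cblinfun_apply (S k) (x k)) \<le> 1 * rad_norm J x"
    if "\<forall>k\<in>J. S k \<in> {cblinfun_id}" for J :: "nat set" and S and x :: "nat \<Rightarrow> 'a::complex_banach"
    using that rad_norm_cong[of J "\<lambda>k. cblinfun_apply (S k) (x k)" x] by simp
  then show ?thesis unfolding R_bound_def by simp
qed

lemma contour_integrand_weights:
  "contour_integrand T \<Lambda> f p (\<lambda>i t. u i t * w i t) t = (\<Prod>i\<in>\<Lambda>. u i (t i)) *\<^sub>C contour_integrand T \<Lambda> f p w t"
  unfolding contour_integrand_def by (simp add: prod.distrib scaleC_scaleC mult_ac)

context commuting_tuple
begin

lemma R_bound_resolvent_products: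
  assumes sp: "\<And>i. spectrum (T i) \<subseteq> closure (stolz (\<delta> i))"
    and R: "\<And>i. R_bound (outer_resolvents (\<delta> i) (T i)) (C i)"
  shows "R_bound {cprod \<Lambda> (\<lambda>i. (z i - 1) *\<^sub>C resolvent (z i) (T i)) | z. \<forall>i\<in>\<Lambda>. z i \<notin> closure (stolz (\<delta> i))} (\<Prod>i\<in>\<Lambda>. C i)"
  using finite[of \<Lambda>]
proof (induction \<Lambda> rule: finite_induct)
  case empty
  show ?case using R_bound_identity by simp
next
  case (insert j \<Lambda>)
  let ?E = "\<lambda>\<Lambda>. {cprod \<Lambda> (\<lambda>i. (z i - 1) *\<^sub>C resolvent (z i) (T i)) | z. \<forall>i\<in>\<Lambda>. z i \<notin> closure (stolz (\<delta> i))}"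
  have "R_bound (?E (insert j \<Lambda>)) (C j * (\<Prod>i\<in>\<Lambda>. C i))"
  proof (rule R_bound_compose[OF R[of j] insert.IH])
    fix A assume "A \<in> ?E (insert j \<Lambda>)"
    then obtain z where z: "\<forall>i\<in>insert j \<Lambda>. z i \<notin> closure (stolz (\<delta> i))"
      and A: "A = cprod (insert j \<Lambda>) (\<lambda>i. (z i - 1) *\<^sub>C resolvent (z i) (T i))" by blast
    have "A = ((z j - 1) *\<^sub>C resolvent (z j) (T j)) o\<^sub>C cprod \<Lambda> (\<lambda>i. (z i - 1) *\<^sub>C resolvent (z i) (T i))"
      unfolding A
    proof (rule cprod_insert[OF insert.hyps])
      fix i k assume "i \<in> insert j \<Lambda>" "k \<in> insert j \<Lambda>"
      then have "z i \<notin> spectrum (T i)" "z k \<notin> spectrum (T k)" using z sp by blast+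
      then show "((z i - 1) *\<^sub>C resolvent (z i) (T i)) o\<^sub>C ((z k - 1) *\<^sub>C resolvent (z k) (T k))
          = ((z k - 1) *\<^sub>C resolvent (z k) (T k)) o\<^sub>C ((z i - 1) *\<^sub>C resolvent (z i) (T i))"
        by (simp add: compose_scaleC_left compose_scaleC_right scaleC_scaleC resolvents_commute'[of "z i" i "z k" k] mult.commute)
    qed
    then show "\<exists>B\<in>outer_resolvents (\<delta> j) (T j). \<exists>B'\<in>?E \<Lambda>. A = B o\<^sub>C B'" using z by blast
  qed
  then show ?case using insert.hyps by simp
qed

lemma square_ops_commute:
  assumes "ritt_of_type a (T i)" "ritt_of_type a' (T j)" "\<alpha> > 0" "\<beta> > 0"
  shows "square_op (T i) \<alpha> k o\<^sub>C square_op (T j) \<beta> l = square_op (T j) \<beta> l o\<^sub>C square_op (T i) \<alpha> k"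
proof -
  have "T j o\<^sub>C square_op (T i) \<alpha> k = square_op (T i) \<alpha> k o\<^sub>C T j"
    by (rule square_op_commute[OF assms(1,3) commute])
  then show ?thesis by (intro square_op_commute[OF assms(2,4)]) simp
qed

lemma square_op_products_commute:
  assumes "ritt_of_type a (T i)" "ritt_of_type a' (T j)" "0 < \<alpha> i \<and> 0 < \<beta> i" "0 < \<alpha> j \<and> 0 < \<beta> j"
  shows "(square_op (T i) (\<beta> i) k o\<^sub>C square_op (T i) (\<alpha> i) k) o\<^sub>C (square_op (T j) (\<beta> j) l o\<^sub>C square_op (T j) (\<alpha> j) l)
    = (square_op (T j) (\<beta> j) l o\<^sub>C square_op (T j) (\<alpha> j) l) o\<^sub>C (square_op (T i) (\<beta> i) k o\<^sub>C square_op (T i) (\<alpha> i) k)"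
proof -
  have sq: "S o\<^sub>C (square_op (T i) (\<beta> i) k o\<^sub>C square_op (T i) (\<alpha> i) k) = (square_op (T i) (\<beta> i) k o\<^sub>C square_op (T i) (\<alpha> i) k) o\<^sub>C S"
    if "ritt_of_type a (T i)" "0 < \<alpha> i \<and> 0 < \<beta> i" "S o\<^sub>C T i = T i o\<^sub>C S" for a i S k
    using square_op_commute[OF that(1) _ that(3), of "\<alpha> i"] square_op_commute[OF that(1) _ that(3), of "\<beta> i"] that(2)
    by (metis cblinfun_compose_assoc)
  show ?thesis by (rule sq[OF assms(2,4)], rule sq[OF assms(1,3) commute, symmetric])
qed

text \<open>Half of the operators is moved to the functional, and one factor \<open>1 / (z i - 1)\<close> is split
  off from every resolvent; what remains between the members of the two square functions lies in an
  \<open>R\<close>-bounded set.\<close>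

lemma contour_integrand_split:
  fixes y :: "('a, complex) cblinfun"
  assumes T: "\<And>i. ritt_of_type (\<delta> i) (T i)" and pos: "\<And>i. i \<in> \<Lambda> \<Longrightarrow> 0 < \<alpha> i \<and> 0 < \<beta> i"
    and z: "\<And>i. i \<in> \<Lambda> \<Longrightarrow> z i \<notin> closure (stolz (\<delta> i)) \<and> z i \<noteq> 1"
  shows "pairing y (cprod \<Lambda> (\<lambda>i. resolvent (z i) (T i)))
      (cblinfun_apply (cprod \<Lambda> (\<lambda>i. e i *\<^sub>C (square_op (T i) (\<beta> i) (k i) o\<^sub>C square_op (T i) (\<alpha> i) (k i)))) x)
    = (\<Prod>i\<in>\<Lambda>. e i / (z i - 1)) * pairing (square_family (\<lambda>i. cadjoint (T i)) \<Lambda> \<beta> y k)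
        (cprod \<Lambda> (\<lambda>i. (z i - 1) *\<^sub>C resolvent (z i) (T i))) (square_family T \<Lambda> \<alpha> x k)"
proof -
  let ?A = "\<lambda>i. square_op (T i) (\<alpha> i) (k i)" and ?B = "\<lambda>i. square_op (T i) (\<beta> i) (k i)"
  let ?R = "\<lambda>i. resolvent (z i) (T i)"
  let ?W = "\<lambda>i. (z i - 1) *\<^sub>C ?R i"
  have sp: "z i \<notin> spectrum (T i)" if "i \<in> \<Lambda>" for i using z[OF that] T[of i] unfolding ritt_of_type_def by blast
  have RR: "?R i o\<^sub>C ?R j = ?R j o\<^sub>C ?R i" if "i \<in> \<Lambda>" "j \<in> \<Lambda>" for i j
    by (rule resolvents_commute'[OF sp[OF that(1)] sp[OF that(2)]])
  have WW: "?W i o\<^sub>C ?W j = ?W j o\<^sub>C ?W i" if "i \<in> \<Lambda>" "j \<in> \<Lambda>" for i j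
    by (simp add: compose_scaleC_left compose_scaleC_right scaleC_scaleC RR[OF that] mult.commute)
  have AA: "?A i o\<^sub>C ?A j = ?A j o\<^sub>C ?A i" and BB: "?B i o\<^sub>C ?B j = ?B j o\<^sub>C ?B i" and BA: "?B i o\<^sub>C ?A j = ?A j o\<^sub>C ?B i"
    if "i \<in> \<Lambda>" "j \<in> \<Lambda>" for i j using pos that by (auto intro!: square_ops_commute[OF T T])
  have BW: "?B i o\<^sub>C ?W j = ?W j o\<^sub>C ?B i" if "i \<in> \<Lambda>" "j \<in> \<Lambda>" for i j
  proof -
    have "T j o\<^sub>C ?B i = ?B i o\<^sub>C T j" by (rule square_op_commute[OF T _ commute]) (use pos that in auto)
    then have "?B i o\<^sub>C ?R j = ?R j o\<^sub>C ?B i" by (intro resolvent_commute sp that) simp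
    then show ?thesis by (simp add: compose_scaleC_left compose_scaleC_right)
  qed
  have "cprod \<Lambda> ?R = cprod \<Lambda> (\<lambda>i. (1 / (z i - 1)) *\<^sub>C ?W i)"
    by (rule cprod_cong) (use z in \<open>simp add: scaleC_scaleC\<close>)
  also have "\<dots> = (\<Prod>i\<in>\<Lambda>. 1 / (z i - 1)) *\<^sub>C cprod \<Lambda> ?W" by (rule cprod_scaleC) (use WW in auto)
  finally have R: "cprod \<Lambda> ?R = (\<Prod>i\<in>\<Lambda>. 1 / (z i - 1)) *\<^sub>C cprod \<Lambda> ?W" .
  have "cprod \<Lambda> (\<lambda>i. e i *\<^sub>C (?B i o\<^sub>C ?A i)) = (\<Prod>i\<in>\<Lambda>. e i) *\<^sub>C cprod \<Lambda> (\<lambda>i. ?B i o\<^sub>C ?A i)"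
    by (rule cprod_scaleC) (use square_op_products_commute[OF T T] pos in auto)
  also have "cprod \<Lambda> (\<lambda>i. ?B i o\<^sub>C ?A i) = cprod \<Lambda> ?B o\<^sub>C cprod \<Lambda> ?A"
    by (rule cprod_compose) (use AA BB BA in auto)
  finally have E: "cprod \<Lambda> (\<lambda>i. e i *\<^sub>C (?B i o\<^sub>C ?A i)) = (\<Prod>i\<in>\<Lambda>. e i) *\<^sub>C (cprod \<Lambda> ?B o\<^sub>C cprod \<Lambda> ?A)" .
  have "cprod \<Lambda> ?W o\<^sub>C cprod \<Lambda> ?B = cprod \<Lambda> ?B o\<^sub>C cprod \<Lambda> ?W"
  proof (rule cprod_commute)
    fix j assume j: "j \<in> \<Lambda>"
    have "?B j o\<^sub>C cprod \<Lambda> ?W = cprod \<Lambda> ?W o\<^sub>C ?B j" by (rule cprod_commute) (use WW BW j in auto)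
    then show "cprod \<Lambda> ?W o\<^sub>C ?B j = ?B j o\<^sub>C cprod \<Lambda> ?W" by simp
  qed (use BB in auto)
  from arg_cong[OF this, of cblinfun_apply]
  have W: "cblinfun_apply (cprod \<Lambda> ?W) (cblinfun_apply (cprod \<Lambda> ?B) v)
      = cblinfun_apply (cprod \<Lambda> ?B) (cblinfun_apply (cprod \<Lambda> ?W) v)" for v
    by (simp only: fun_eq_iff cblinfun_apply_compose)
  have "square_family (\<lambda>i. cadjoint (T i)) \<Lambda> \<beta> y k = cblinfun_apply (cprod \<Lambda> (\<lambda>i. cadjoint (?B i))) y"
    unfolding square_family_eq
    by (intro arg_cong2[where f = cblinfun_apply] cprod_cong refl) (use cadjoint_square_op[OF T] pos in simp)
  also have "\<dots> = y o\<^sub>C cprod \<Lambda> ?B" by (subst cprod_cadjoint) (use BB in auto)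
  finally have Y: "square_family (\<lambda>i. cadjoint (T i)) \<Lambda> \<beta> y k = y o\<^sub>C cprod \<Lambda> ?B" .
  have P: "(\<Prod>i\<in>\<Lambda>. e i / (z i - 1)) = (\<Prod>i\<in>\<Lambda>. e i) * (\<Prod>i\<in>\<Lambda>. 1 / (z i - 1))" by (simp flip: prod.distrib)
  show ?thesis unfolding R E Y P unfolding square_family_eq by (simp add: cblinfun_apply_scaleC W)
qed

text \<open>In a single term of the expansion, the operators that stay between the two square functions
  contribute at most \<open>s\<close>, whatever the point of the contour.  What is left factorizes over the
  variables.\<close>

lemma contour_term_bound:
  fixes y :: "('a, complex) cblinfun"
  assumes T: "\<And>i. ritt_of_type (\<delta> i) (T i)" and b: "\<And>i. \<delta> i < b i" "\<And>i. b i < \<gamma> i"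
    and pos: "\<And>i. i \<in> \<Lambda> \<Longrightarrow> 0 < \<alpha> i \<and> 0 < \<beta> i" and k: "\<And>i. i \<in> \<Lambda> \<Longrightarrow> k i \<ge> 1"
    and f: "holomorphic_several f (stolz_prod \<gamma>)" "\<And>z. z \<in> stolz_prod \<gamma> \<Longrightarrow> cmod (f z) \<le> c" "c \<ge> 0"
    and wb: "\<And>i. i \<in> \<Lambda> \<Longrightarrow> weight_bound (\<kappa> i) (unity_weight (b i) (\<alpha> i) (\<beta> i) (k i)) (v i)"
    and s: "\<And>z. \<forall>i\<in>\<Lambda>. z i \<notin> closure (stolz (\<delta> i)) \<Longrightarrow> cmod (pairing (square_family (\<lambda>i. cadjoint (T i)) \<Lambda> \<beta> y k)
        (cprod \<Lambda> (\<lambda>i. (z i - 1) *\<^sub>C resolvent (z i) (T i))) (square_family T \<Lambda> \<alpha> x k)) \<le> s"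
  defines "p \<equiv> \<lambda>i. stolz_contour (b i)"
    and "w \<equiv> \<lambda>i t. unity_term (\<alpha> i + \<beta> i + 2) (k i) (stolz_contour (b i) t) * contour_speed (b i) t"
    and "e \<equiv> \<lambda>i. complex_of_real (real (k i) powr (1 - \<alpha> i - \<beta> i))"
  assumes kern: "\<And>i. i \<in> \<Lambda> \<Longrightarrow> contour_kernel (\<gamma> i) (T i) (\<lambda>_. 1) (p i) (w i)"
  shows "cmod (\<integral>t. pairing y (contour_integrand T \<Lambda> f p w t)
      (cblinfun_apply (cprod \<Lambda> (\<lambda>i. e i *\<^sub>C (square_op (T i) (\<beta> i) (k i) o\<^sub>C square_op (T i) (\<alpha> i) (k i)))) x) \<partial>cube \<Lambda>)
    \<le> c * (\<Prod>i\<in>\<Lambda>. \<kappa> i) * s"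
proof -
  let ?M = "cube \<Lambda>"
  let ?x = "cblinfun_apply (cprod \<Lambda> (\<lambda>i. e i *\<^sub>C (square_op (T i) (\<beta> i) (k i) o\<^sub>C square_op (T i) (\<alpha> i) (k i)))) x"
  let ?g = "\<lambda>t. pairing y (contour_integrand T \<Lambda> f p w t) ?x"
  have w: "integrable unit_measure (v i)" "(\<integral>t. v i t \<partial>unit_measure) \<le> \<kappa> i"
    "t \<in> {0<..<1} \<Longrightarrow> unity_weight (b i) (\<alpha> i) (\<beta> i) (k i) t \<le> v i t" if "i \<in> \<Lambda>" for i t
    using wb[OF that] by (simp_all add: weight_bound_def)
  have d0: "0 < \<delta> i" for i using T[of i] by (simp add: ritt_of_type_def)
  have b0: "0 < b i" "b i < pi / 2" for i using d0[of i] b[of i] angles(2)[of i] by linarith+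
  have out: "p i t \<notin> closure (stolz (\<delta> i))" if "t \<in> {0<..<1}" for i t
    unfolding p_def by (rule stolz_contour_not_in[OF d0 b(1) b0(2) that])
  have ne: "p i t \<noteq> 1" if "t \<in> {0<..<1}" for i t unfolding p_def by (rule stolz_contour_ne_one[OF b0 that])
  have s0: "s \<ge> 0"
  proof -
    have "\<forall>i\<in>\<Lambda>. p i (1 / 2) \<notin> closure (stolz (\<delta> i))" using out by simp
    from s[OF this] show ?thesis by (rule order_trans[OF norm_ge_zero])
  qed
  have v0: "0 \<le> v i t" if "i \<in> \<Lambda>" "t \<in> {0<..<1}" for i t
    by (rule order_trans[OF _ w(3)[OF that]]) (simp add: unity_weight_def)
  have bound: "cmod (?g t) \<le> c * s * (\<Prod>i\<in>\<Lambda>. v i (t i))" if t: "t \<in> space ?M" for t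
  proof -
    have ti: "t i \<in> {0<..<1}" if "i \<in> \<Lambda>" for i using t that by (auto simp: space_cube)
    let ?z = "\<lambda>i. p i (t i)"
    let ?W = "pairing (square_family (\<lambda>i. cadjoint (T i)) \<Lambda> \<beta> y k)
        (cprod \<Lambda> (\<lambda>i. (?z i - 1) *\<^sub>C resolvent (?z i) (T i))) (square_family T \<Lambda> \<alpha> x k)"
    have "?g t = f (contour_point \<Lambda> p t) * (\<Prod>i\<in>\<Lambda>. w i (t i)) * pairing y (cprod \<Lambda> (\<lambda>i. resolvent (?z i) (T i))) ?x"
      by (simp add: contour_integrand_def cblinfun_apply_scaleC)
    also have "pairing y (cprod \<Lambda> (\<lambda>i. resolvent (?z i) (T i))) ?x = (\<Prod>i\<in>\<Lambda>. e i / (?z i - 1)) * ?W"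
      by (rule contour_integrand_split[OF T pos]) (use out ne ti in auto)
    finally have "cmod (?g t) = cmod (f (contour_point \<Lambda> p t)) * (\<Prod>i\<in>\<Lambda>. cmod (w i (t i)) * cmod (e i / (?z i - 1))) * cmod ?W"
      by (simp add: norm_mult prod_norm[symmetric] prod.distrib)
    also have "(\<Prod>i\<in>\<Lambda>. cmod (w i (t i)) * cmod (e i / (?z i - 1)))
        = (\<Prod>i\<in>\<Lambda>. unity_weight (b i) (\<alpha> i) (\<beta> i) (k i) (t i))"
      by (intro prod.cong refl) (simp add: w_def e_def p_def unity_weight_def norm_mult norm_divide norm_minus_commute)
    also have "cmod (f (contour_point \<Lambda> p t)) * \<dots> * cmod ?W \<le> c * (\<Prod>i\<in>\<Lambda>. v i (t i)) * s"
    proof (rule mult_mono[OF mult_mono])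
      show "cmod (f (contour_point \<Lambda> p t)) \<le> c" by (rule f(2)[OF contour_point_in[OF kern ti]])
      show "cmod ?W \<le> s" by (rule s) (use out ti in blast)
      show "(\<Prod>i\<in>\<Lambda>. unity_weight (b i) (\<alpha> i) (\<beta> i) (k i) (t i)) \<le> (\<Prod>i\<in>\<Lambda>. v i (t i))"
        by (intro prod_mono conjI w(3) ti) (simp_all add: unity_weight_def)
      show "0 \<le> c * (\<Prod>i\<in>\<Lambda>. v i (t i))" using f(3) v0 ti by (intro mult_nonneg_nonneg prod_nonneg) auto
    qed (use f(3) in \<open>auto intro!: prod_nonneg simp: unity_weight_def\<close>)
    finally show ?thesis by (simp add: mult_ac)
  qed
  have f': "cmod (f z) \<le> c * (\<Prod>i\<in>\<Lambda>. (\<lambda>_ _. 1) i (z $ i))" if "z \<in> stolz_prod \<gamma>" for z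
    using f(2)[OF that] by simp
  have int: "integrable ?M ?g"
    by (rule contour_integrand_integrable(1)[where h = "\<lambda>_ _. 1", OF kern _ f(3) f' f(1)]) simp_all
  have intv: "integrable ?M (\<lambda>t. c * s * (\<Prod>i\<in>\<Lambda>. v i (t i)))"
    by (rule integrable_mult_right, rule unit_cube.product_integrable_prod) (use w(1) in auto)
  have "cmod (\<integral>t. ?g t \<partial>?M) \<le> (\<integral>t. cmod (?g t) \<partial>?M)" by (rule integral_norm_bound)
  also have "\<dots> \<le> (\<integral>t. c * s * (\<Prod>i\<in>\<Lambda>. v i (t i)) \<partial>?M)"
    by (rule integral_mono[OF integrable_norm[OF int] intv bound])
  also have "\<dots> = c * s * (\<Prod>i\<in>\<Lambda>. \<integral>t. v i t \<partial>unit_measure)"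
    using unit_cube.product_integral_prod[OF finite[of \<Lambda>], of v] w(1) by simp
  also have "\<dots> \<le> c * s * (\<Prod>i\<in>\<Lambda>. \<kappa> i)"
    using f(3) s0 by (intro mult_left_mono prod_mono conjI w(2) Bochner_Integration.integral_nonneg v0) auto
  finally show ?thesis by (simp add: mult_ac)
qed

text \<open>The partial sums of the partition of unity are bounded on the Stolz domain, so they can be
  inserted by dominated convergence.  Every partial sum is a finite sum of terms to which the exchange rule
  and the estimate above apply; R-boundedness makes the sum of their bounds independent of the number of terms.\<close>

lemma H0_calculus_bound:
  assumes R: "\<And>i. R_ritt (T i)" "\<And>i. R_type (T i) < \<gamma> i"
    and pos: "\<And>i. i \<in> \<Lambda> \<Longrightarrow> 0 < \<alpha> i \<and> 0 < \<beta> i" and C: "C > 0"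
    and sq: "\<And>x. square_enorm T \<Lambda> \<alpha> x \<le> ennreal (C * norm x)"
      "\<And>y. square_enorm (\<lambda>i. cadjoint (T i)) \<Lambda> \<beta> y \<le> ennreal (C * norm y)"
    and L: "\<Lambda> \<noteq> {}"
  shows "\<exists>K\<ge>0. \<forall>f\<in>H0 \<gamma> \<Lambda>. \<forall>c\<ge>0. (\<forall>z\<in>stolz_prod \<gamma>. cmod (f z) \<le> c) \<longrightarrow> norm (H0_calculus \<gamma> T \<Lambda> f) \<le> K * c"
proof -
  let ?M = "cube \<Lambda>"
  have "\<forall>i. \<exists>d. 0 < fst d \<and> fst d < \<gamma> i \<and> ritt_of_type (fst d) (T i)
      \<and> R_bound (outer_resolvents (fst d) (T i)) (snd d)"
  proof
    fix i
    obtain \<delta> D where "0 < \<delta>" "\<delta> < \<gamma> i" "ritt_of_type \<delta> (T i)"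
      "R_bound (outer_resolvents \<delta> (T i)) D" by (rule R_type_less[OF R])
    then show "\<exists>d. 0 < fst d \<and> fst d < \<gamma> i \<and> ritt_of_type (fst d) (T i)
      \<and> R_bound (outer_resolvents (fst d) (T i)) (snd d)" by (intro exI[of _ "(\<delta>, D)"]) simp
  qed
  from choice[OF this] obtain d where d: "\<forall>i. 0 < fst (d i) \<and> fst (d i) < \<gamma> i \<and> ritt_of_type (fst (d i)) (T i)
      \<and> R_bound (outer_resolvents (fst (d i)) (T i)) (snd (d i))" by (elim exE)
  define \<delta> where "\<delta> i = fst (d i)" for i
  define D where "D i = snd (d i)" for i
  have \<delta>: "0 < \<delta> i" "\<delta> i < \<gamma> i" "ritt_of_type (\<delta> i) (T i)"
    "R_bound (outer_resolvents (\<delta> i) (T i)) (D i)" for i using d by (simp_all add: \<delta>_def D_def)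
  define b where "b i = contour_angle (\<gamma> i) (T i)" for i
  \<comment> \<open>\<open>b\<close> may be smaller than the R-types, \<open>b'\<close> is not.\<close>
  define b' where "b' i = (\<delta> i + \<gamma> i) / 2" for i
  have b': "\<delta> i < b' i" "b' i < \<gamma> i" "0 < b' i" "b' i < pi / 2" for i
    using \<delta>(1,2)[of i] angles(2)[of i] by (auto simp: b'_def)
  have b\<gamma>: "b i < \<gamma> i" for i unfolding b_def by (rule contour_angle(1)[OF \<delta>(3,2)])
  \<comment> \<open>For a change of the contour, both angles must exceed one and the same type.\<close>
  have type: "\<exists>a. ritt_of_type a (T i) \<and> a < b i \<and> a < b' i" for i
  proof -
    obtain a where a: "a < b i" "ritt_of_type a (T i)"
      using contour_angle(2)[OF \<delta>(3,2)] unfolding b_def by blast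
    show ?thesis
    proof (cases "a < b' i")
      case True
      then show ?thesis using a by blast
    next
      case False
      then show ?thesis using a(1) b'(1)[of i] \<delta>(3)[of i] by (intro exI[of _ "\<delta> i"]) auto
    qed
  qed
  have lt1: "cmod z < 1" if "z \<in> stolz (\<gamma> i)" for z i by (rule stolz_norm_less[OF angles that])
  have "\<forall>i\<in>\<Lambda>. \<exists>kw. fst kw > (0::real) \<and> (\<forall>k\<ge>1. weight_bound (fst kw) (unity_weight (b' i) (\<alpha> i) (\<beta> i) k) (snd kw k))"
  proof
    fix i assume "i \<in> \<Lambda>"
    then have p: "0 < \<alpha> i" "0 < \<beta> i" using pos by auto
    obtain \<kappa> w where "\<kappa> > 0" "\<forall>k\<ge>1. weight_bound \<kappa> (unity_weight (b' i) (\<alpha> i) (\<beta> i) k) (w k)"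
      using unity_weight_integral[OF b'(3,4) p] by blast
    then show "\<exists>kw. fst kw > (0::real) \<and> (\<forall>k\<ge>1. weight_bound (fst kw) (unity_weight (b' i) (\<alpha> i) (\<beta> i) k) (snd kw k))"
      by (intro exI[of _ "(\<kappa>, w)"]) simp
  qed
  from bchoice[OF this] obtain kw where kw: "\<forall>i\<in>\<Lambda>. fst (kw i) > (0::real)
      \<and> (\<forall>k\<ge>1. weight_bound (fst (kw i)) (unity_weight (b' i) (\<alpha> i) (\<beta> i) k) (snd (kw i) k))" by (elim exE)
  define \<kappa> where "\<kappa> i = fst (kw i)" for i
  define v where "v i = snd (kw i)" for i
  have \<kappa>0: "(\<Prod>i\<in>\<Lambda>. \<kappa> i) \<ge> 0" using kw by (intro prod_nonneg) (auto simp: \<kappa>_def less_imp_le)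
  define W where "W = {cprod \<Lambda> (\<lambda>i. (z i - 1) *\<^sub>C resolvent (z i) (T i)) | z. \<forall>i\<in>\<Lambda>. z i \<notin> closure (stolz (\<delta> i))}"
  have RW: "R_bound W (\<Prod>i\<in>\<Lambda>. D i)"
    unfolding W_def by (rule R_bound_resolvent_products[OF _ \<delta>(4)]) (use \<delta>(3) in \<open>simp add: ritt_of_type_def\<close>)
  define B where "B = (\<Prod>i\<in>\<Lambda>. \<kappa> i) * (2 * (\<Prod>i\<in>\<Lambda>. D i) * (C * C))"
  have B0: "B \<ge> 0" using \<kappa>0 C R_bound_nonneg[OF RW] by (simp add: B_def)
  let ?p = "\<lambda>i. stolz_contour (b i)" and ?p' = "\<lambda>i. stolz_contour (b' i)"
  let ?w0 = "\<lambda>i t. vector_derivative (?p i) (at t)"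
  let ?u = "\<lambda>i k. unity_factor (\<alpha> i) (\<beta> i) k"
  let ?wk = "\<lambda>k i t. ?u i (k i) (?p i t) * ?w0 i t"
  let ?wk' = "\<lambda>k i t. unity_term (\<alpha> i + \<beta> i + 2) (k i) (?p' i t) * vector_derivative (?p' i) (at t)"
  have kern: "contour_kernel (\<gamma> i) (T i) (\<lambda>_. 1) (?p i) (?wk k i)" "contour_kernel (\<gamma> i) (T i) (\<lambda>_. 1) (?p' i) (?wk' k i)"
    if i: "i \<in> \<Lambda>" and k: "k i \<ge> 1" for i k
  proof -
    have p: "0 < \<alpha> i" "0 < \<beta> i" using pos i by auto
    obtain A where A: "A \<ge> 0" "\<forall>z. cmod z < 1 \<longrightarrow> cmod (unity_term (\<alpha> i + \<beta> i + 2) (k i) z) \<le> A * cmod (1 - z)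
      \<and> cmod (?u i (k i) z) \<le> A * cmod (1 - z)" using unity_term_decay[OF p k] by blast
    obtain a where a: "ritt_of_type a (T i)" "a < b i" "a < b' i" using type by blast
    show "contour_kernel (\<gamma> i) (T i) (\<lambda>_. 1) (?p i) (?wk k i)"
    proof (rule contour_kernelI[OF a(1,2) b\<gamma> angles(2), where C = A and s = 1])
      show "continuous_on (stolz (\<gamma> i)) (?u i (k i))"
        by (rule holomorphic_on_imp_continuous_on, rule holomorphic_on_subset[OF unity_factor_holomorphic]) (use lt1 in auto)
    qed (use A lt1 in auto)
    show "contour_kernel (\<gamma> i) (T i) (\<lambda>_. 1) (?p' i) (?wk' k i)"
      by (rule contour_kernelI[OF a(1,3) b'(2) angles(2), where C = A and s = 1])
        (use A lt1 in \<open>auto intro!: holomorphic_on_imp_continuous_on unity_term_holomorphic\<close>)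
  qed
  have main: "cmod (pairing y (H0_calculus \<gamma> T \<Lambda> f) x) \<le> cmod (1 / (2 * pi * \<i>)) ^ card \<Lambda> * (c * B * (norm x * norm y))"
    if f: "f \<in> H0 \<gamma> \<Lambda>" and c: "c \<ge> 0" "\<And>z. z \<in> stolz_prod \<gamma> \<Longrightarrow> cmod (f z) \<le> c" for f c x and y :: "('a, complex) cblinfun"
  proof -
    have hol: "holomorphic_several f (stolz_prod \<gamma>)" using f by (simp add: H0_def)
    obtain c0 s where c0: "c0 > 0" "\<forall>i\<in>\<Lambda>. s i > 0"
      "\<forall>z\<in>stolz_prod \<gamma>. cmod (f z) \<le> c0 * (\<Prod>i\<in>\<Lambda>. cmod (1 - z $ i) powr s i)" using f unfolding H0_def by blast
    have kern0: "contour_kernel (\<gamma> i) (T i) (\<lambda>z. cmod (1 - z) powr s i) (?p i) (?w0 i)" if i: "i \<in> \<Lambda>" for i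
    proof -
      obtain a where a: "ritt_of_type a (T i)" "a < b i" using type by blast
      have "contour_kernel (\<gamma> i) (T i) (\<lambda>z. cmod (1 - z) powr s i) (?p i) (\<lambda>t. (\<lambda>_. 1) (?p i t) * ?w0 i t)"
        by (rule contour_kernelI[OF a b\<gamma> angles(2), where C = 1 and s = "s i"]) (use c0(2) i in auto)
      then show ?thesis by simp
    qed
    define G where "G t = pairing y (contour_integrand T \<Lambda> f ?p ?w0 t) x" for t
    have c0': "0 \<le> c0" "cmod (f z) \<le> c0 * (\<Prod>i\<in>\<Lambda>. (\<lambda>i z. cmod (1 - z) powr s i) i (z $ i))" if "z \<in> stolz_prod \<gamma>" for z
      using c0 that by auto
    have c00: "0 \<le> c0" using c0(1) by simp
    have G: "integrable ?M G"
      "pairing y (strong_integral ?M (contour_integrand T \<Lambda> f ?p ?w0)) x = (\<integral>t. G t \<partial>?M)" unfolding G_def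
      by (rule contour_integrand_integrable[where h = "\<lambda>i z. cmod (1 - z) powr s i", OF kern0 _ c00 c0'(2) hol]; simp)+
    have H: "pairing y (H0_calculus \<gamma> T \<Lambda> f) x = (1 / (2 * pi * \<i>)) ^ card \<Lambda> * (\<integral>t. G t \<partial>?M)"
    proof -
      have "H0_calculus \<gamma> T \<Lambda> f = (1 / (2 * pi * \<i>)) ^ card \<Lambda> *\<^sub>C strong_integral ?M (contour_integrand T \<Lambda> f ?p ?w0)"
        using L unfolding H0_calculus_def contour_integrand_def contour_point_def b_def by (simp add: Let_def)
      then show ?thesis by (simp add: cblinfun_apply_scaleC G(2))
    qed
    define S where "S N t = (\<Prod>i\<in>\<Lambda>. \<Sum>k=1..N. ?u i k (?p i (t i)))" for N and t :: "'d \<Rightarrow> real"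
    have p1: "?p i t \<in> stolz (\<gamma> i)" if "t \<in> {0<..<1}" "i \<in> \<Lambda>" for i t
      using kern0[OF that(2)] that(1) unfolding contour_kernel_def by blast
    define P where "P i = ((1 - sin (\<gamma> i)) / 2) powr (- (\<alpha> i + \<beta> i + 2))" for i
    have SB: "cmod (S N t) \<le> (\<Prod>i\<in>\<Lambda>. P i)" if t: "t \<in> space ?M" for N t
    proof -
      have "cmod (\<Sum>k=1..N. ?u i k (?p i (t i))) \<le> P i" if i: "i \<in> \<Lambda>" for i
      proof -
        have ti: "t i \<in> {0<..<1}" using t i by (auto simp: space_cube)
        have z: "?p i (t i) \<in> closure (stolz (\<gamma> i))" using p1[OF ti i] closure_subset by blast
        show ?thesis unfolding P_def unity_factor_def
          by (rule unity_partial_sum_bound[OF lt1[OF p1[OF ti i]] _ closure_stolz_one_minus_norm[OF angles z]])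
            (use sin_angle[OF angles(1)[of i] angles(2)] pos[OF i] in auto)
      qed
      then show ?thesis unfolding S_def prod_norm[symmetric] by (intro prod_mono conjI) auto
    qed
    have Slim: "(\<lambda>N. S N t) \<longlonglongrightarrow> 1" if t: "t \<in> space ?M" for t
    proof -
      have "(\<lambda>N. S N t) \<longlonglongrightarrow> (\<Prod>i\<in>\<Lambda>. 1)" unfolding S_def
      proof (rule tendsto_prod)
        fix i assume i: "i \<in> \<Lambda>"
        have ti: "t i \<in> {0<..<1}" using t i by (auto simp: space_cube)
        show "(\<lambda>N. \<Sum>k=1..N. ?u i k (?p i (t i))) \<longlonglongrightarrow> 1" unfolding unity_factor_def
          by (rule unity_partial_sum_limit[OF lt1[OF p1[OF ti i]]]) (use pos[OF i] in auto)
      qed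
      then show ?thesis by simp
    qed
    have f1: "cmod (f z) \<le> c * (\<Prod>i\<in>\<Lambda>. (\<lambda>_ _. 1) i (z $ i))" if "z \<in> stolz_prod \<gamma>" for z
      using c(2)[OF that] by simp
    have SG: "S N t * G t = (\<Sum>k\<in>\<Lambda> \<rightarrow>\<^sub>E {1..N}. pairing y (contour_integrand T \<Lambda> f ?p (?wk k) t) x)" for N t
    proof -
      have "S N t = (\<Sum>k\<in>\<Lambda> \<rightarrow>\<^sub>E {1..N}. \<Prod>i\<in>\<Lambda>. ?u i (k i) (?p i (t i)))"
        unfolding S_def by (rule prod_sum_PiE) auto
      then show ?thesis
        unfolding G_def contour_integrand_weights by (simp add: sum_distrib_right cblinfun_apply_scaleC)
    qed
    have intk: "integrable ?M (\<lambda>t. pairing y (contour_integrand T \<Lambda> f ?p (?wk k) t) x)" if "k \<in> \<Lambda> \<rightarrow>\<^sub>E {1..N}" for k N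
      by (rule contour_integrand_integrable(1)[where h = "\<lambda>_ _. 1", OF kern(1) _ c(1) f1 hol]) (use that in auto)
    have lim: "(\<lambda>N. \<integral>t. S N t * G t \<partial>?M) \<longlonglongrightarrow> (\<integral>t. G t \<partial>?M)"
    proof (rule integral_dominated_convergence[where w = "\<lambda>t. (\<Prod>i\<in>\<Lambda>. P i) * cmod (G t)"])
      show "G \<in> borel_measurable ?M" using G(1) by simp
      show "(\<lambda>t. S N t * G t) \<in> borel_measurable ?M" for N
        unfolding SG using intk by (intro borel_measurable_sum) auto
      show "integrable ?M (\<lambda>t. (\<Prod>i\<in>\<Lambda>. P i) * cmod (G t))" using G(1) by simp
      show "AE t in ?M. (\<lambda>N. S N t * G t) \<longlonglongrightarrow> G t"
        by (rule AE_I2) (use tendsto_mult[OF Slim tendsto_const] in fastforce)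
      show "AE t in ?M. norm (S N t * G t) \<le> (\<Prod>i\<in>\<Lambda>. P i) * cmod (G t)" for N
        by (rule AE_I2) (simp add: norm_mult mult_right_mono SB)
    qed
    have bound: "cmod (\<integral>t. S N t * G t \<partial>?M) \<le> c * B * (norm x * norm y)" for N
    proof -
      let ?J = "\<Lambda> \<rightarrow>\<^sub>E {1..N}"
      have J: "finite ?J" "?J \<subseteq> \<Lambda> \<rightarrow>\<^sub>E {1..}" by (auto intro!: finite_PiE)
      let ?x = "square_family T \<Lambda> \<alpha> x" and ?y = "square_family (\<lambda>i. cadjoint (T i)) \<Lambda> \<beta> y"
      obtain s where s: "\<And>k A. k \<in> ?J \<Longrightarrow> A \<in> W \<Longrightarrow> cmod (pairing (?y k) A (?x k)) \<le> s k"
        "(\<Sum>k\<in>?J. s k) \<le> 2 * (\<Prod>i\<in>\<Lambda>. D i) * (rad_norm ?J ?x * rad_norm ?J ?y)"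
        by (rule R_bound_pairing_sup[OF RW J(1), where y = ?y and x = ?x]) blast
      have rx: "rad_norm ?J ?x \<le> C * norm x" and ry: "rad_norm ?J ?y \<le> C * norm y"
        using rad_norm_le_rad_series_enorm[OF sq(1)[unfolded square_enorm_def] _ J]
          rad_norm_le_rad_series_enorm[OF sq(2)[unfolded square_enorm_def] _ J] C by auto
      have each: "cmod (\<integral>t. pairing y (contour_integrand T \<Lambda> f ?p (?wk k) t) x \<partial>?M) \<le> c * (\<Prod>i\<in>\<Lambda>. \<kappa> i) * s k"
        if k: "k \<in> ?J" for k
      proof -
        have k1: "k i \<ge> 1" if "i \<in> \<Lambda>" for i using k that by auto
        let ?e = "\<lambda>i. complex_of_real (real (k i) powr (1 - \<alpha> i - \<beta> i))"
        let ?E = "\<lambda>i. ?e i *\<^sub>C (square_op (T i) (\<beta> i) (k i) o\<^sub>C square_op (T i) (\<alpha> i) (k i))"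
        have EE: "?E i o\<^sub>C ?E j = ?E j o\<^sub>C ?E i" if "i \<in> \<Lambda>" "j \<in> \<Lambda>" for i j
          by (simp add: compose_scaleC_left compose_scaleC_right scaleC_scaleC mult.commute
              square_op_products_commute[where \<alpha> = \<alpha> and \<beta> = \<beta>, OF \<delta>(3) \<delta>(3) pos[OF that(1)] pos[OF that(2)]])
        have "(\<integral>t. pairing y (contour_integrand T \<Lambda> f ?p (?wk k) t) x \<partial>?M)
          = (\<integral>t. pairing y (contour_integrand T \<Lambda> f ?p' (?wk' k) t) (cblinfun_apply (cprod \<Lambda> ?E) x) \<partial>?M)"
        proof (rule contour_exchange[OF kern(1) kern(2) EE hol c(2) c(1)])
          fix i \<phi> and y :: "('a, complex) cblinfun" and x
          assume i: "i \<in> \<Lambda>" and \<phi>: "\<phi> holomorphic_on stolz (\<gamma> i)" "\<And>z. z \<in> stolz (\<gamma> i) \<Longrightarrow> cmod (\<phi> z) \<le> c"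
          obtain a where a: "ritt_of_type a (T i)" "a < b i" "a < b' i" using type by blast
          show "(\<integral>t. \<phi> (?p i t) * ?wk k i t * pairing y (resolvent (?p i t) (T i)) x \<partial>unit_measure)
            = (\<integral>t. \<phi> (?p' i t) * ?wk' k i t * pairing y (resolvent (?p' i t) (T i)) (cblinfun_apply (?E i) x) \<partial>unit_measure)"
            by (rule exchange_unity_factor[OF a(1,2) b\<gamma> a(3) b'(2) angles(2) _ _ k1[OF i] \<phi> c(1)]) (use pos[OF i] in auto)
        qed (use k1 in auto)
        moreover have "cmod (\<integral>t. pairing y (contour_integrand T \<Lambda> f ?p' (?wk' k) t) (cblinfun_apply (cprod \<Lambda> ?E) x) \<partial>?M)
            \<le> c * (\<Prod>i\<in>\<Lambda>. \<kappa> i) * s k"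
        proof (rule contour_term_bound[OF \<delta>(3) b'(1,2) pos k1 hol c(2) c(1), where v = "\<lambda>i. v i (k i)"])
          show "weight_bound (\<kappa> i) (unity_weight (b' i) (\<alpha> i) (\<beta> i) (k i)) (v i (k i))" if "i \<in> \<Lambda>" for i
            using kw k1 that by (auto simp: v_def \<kappa>_def)
          show "contour_kernel (\<gamma> i) (T i) (\<lambda>_. 1) (?p' i) (?wk' k i)" if "i \<in> \<Lambda>" for i
            using kern(2)[of i k] that k1[OF that] by blast
          show "cmod (pairing (?y k) (cprod \<Lambda> (\<lambda>i. (z i - 1) *\<^sub>C resolvent (z i) (T i))) (?x k)) \<le> s k"
            if "\<forall>i\<in>\<Lambda>. z i \<notin> closure (stolz (\<delta> i))" for z by (rule s(1)[OF k]) (use that in \<open>auto simp: W_def\<close>)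
        qed
        ultimately show ?thesis by simp
      qed
      have "(\<integral>t. S N t * G t \<partial>?M) = (\<Sum>k\<in>?J. \<integral>t. pairing y (contour_integrand T \<Lambda> f ?p (?wk k) t) x \<partial>?M)"
        unfolding SG by (rule Bochner_Integration.integral_sum) (rule intk)
      also have "cmod \<dots> \<le> (\<Sum>k\<in>?J. c * (\<Prod>i\<in>\<Lambda>. \<kappa> i) * s k)" by (rule sum_norm_le) (rule each)
      also have "\<dots> = c * (\<Prod>i\<in>\<Lambda>. \<kappa> i) * (\<Sum>k\<in>?J. s k)" by (simp add: sum_distrib_left)
      also have "\<dots> \<le> c * (\<Prod>i\<in>\<Lambda>. \<kappa> i) * (2 * (\<Prod>i\<in>\<Lambda>. D i) * (rad_norm ?J ?x * rad_norm ?J ?y))"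
        by (rule mult_left_mono[OF s(2)]) (use c(1) \<kappa>0 in simp)
      also have "\<dots> \<le> c * (\<Prod>i\<in>\<Lambda>. \<kappa> i) * (2 * (\<Prod>i\<in>\<Lambda>. D i) * ((C * norm x) * (C * norm y)))"
        using c(1) \<kappa>0 R_bound_nonneg[OF RW] C by (intro mult_left_mono mult_mono[OF rx ry]) auto
      also have "\<dots> = c * B * (norm x * norm y)" by (simp add: B_def mult_ac)
      finally show ?thesis .
    qed
    have "cmod (\<integral>t. G t \<partial>?M) \<le> c * B * (norm x * norm y)"
      by (rule Lim_bounded[OF tendsto_norm[OF lim]]) (use bound in blast)
    then show ?thesis unfolding H norm_mult norm_power by (rule mult_left_mono) simp
  qed
  let ?K = "cmod (1 / (2 * pi * \<i>)) ^ card \<Lambda> * B"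
  have "norm (H0_calculus \<gamma> T \<Lambda> f) \<le> ?K * c"
    if "f \<in> H0 \<gamma> \<Lambda>" "c \<ge> 0" "\<forall>z\<in>stolz_prod \<gamma>. cmod (f z) \<le> c" for f c
  proof (rule cblinfun_norm_le_by_pairing)
    show "0 \<le> ?K * c" using B0 that(2) by simp
    show "cmod (pairing y (H0_calculus \<gamma> T \<Lambda> f) x) \<le> ?K * c * norm x * norm y" for x and y :: "('a, complex) cblinfun"
      using main[of f c y x] that by (simp add: mult_ac)
  qed
  then show ?thesis using B0 by (intro exI[of _ ?K]) auto
qed

end


section \<open>Decomposition of a bounded holomorphic function\<close>

text \<open>Letting the variables outside \<open>\<Lambda>\<close> tend to \<open>1\<close> kills the components that depend on one of
  them, and leaves the sum of the components over the subsets of \<open>\<Lambda>\<close>, with no loss in the norm.\<close>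

lemma decomposition_partial_sum_bound:
  fixes \<gamma> :: "'d::finite \<Rightarrow> real"
  assumes \<gamma>: "\<And>i. 0 < \<gamma> i" "\<And>i. \<gamma> i < pi / 2" and g: "H01_decomposition \<gamma> f g"
    and f: "\<And>z. z \<in> stolz_prod \<gamma> \<Longrightarrow> cmod (f z) \<le> c" and z: "z \<in> stolz_prod \<gamma>"
  shows "cmod (\<Sum>\<Lambda>'\<in>Pow \<Lambda>. g \<Lambda>' z) \<le> c"
proof -
  define Z where "Z n = (\<chi> i. if i \<in> \<Lambda> then z $ i else of_real (scale_factor n))" for n
  have Z: "Z n \<in> stolz_prod \<gamma>" for n
  proof -
    have "of_real (scale_factor n) \<in> stolz (\<gamma> i)" for i
      using stolz_scale[OF \<gamma> one_in_closure_stolz[OF \<gamma>], of "scale_factor n" i] scale_factor(1,2)[of n] by simp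
    then show ?thesis using z by (simp add: Z_def stolz_prod_def)
  qed
  have gH: "g \<Lambda>' \<in> H0 \<gamma> \<Lambda>'" for \<Lambda>' using g by (simp add: H01_decomposition_def)
  have lim: "(\<lambda>n. g \<Lambda>' (Z n)) \<longlonglongrightarrow> (if \<Lambda>' \<in> Pow \<Lambda> then g \<Lambda>' z else 0)" for \<Lambda>'
  proof (cases "\<Lambda>' \<subseteq> \<Lambda>")
    case True
    have "\<forall>z\<in>stolz_prod \<gamma>. \<forall>w\<in>stolz_prod \<gamma>. (\<forall>i\<in>\<Lambda>'. z $ i = w $ i) \<longrightarrow> g \<Lambda>' z = g \<Lambda>' w"
      using gH[of \<Lambda>'] unfolding H0_def mem_Collect_eq by (elim conjE)
    from this[rule_format, OF Z z]
    have "g \<Lambda>' (Z n) = g \<Lambda>' z" for n using True by (simp add: Z_def subset_iff)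
    then show ?thesis using True by simp
  next
    case False
    then obtain j where j: "j \<in> \<Lambda>'" "j \<notin> \<Lambda>" by blast
    have "\<exists>c>0. \<exists>s. (\<forall>i\<in>\<Lambda>'. s i > 0) \<and>
        (\<forall>z\<in>stolz_prod \<gamma>. cmod (g \<Lambda>' z) \<le> c * (\<Prod>i\<in>\<Lambda>'. cmod (1 - z $ i) powr s i))"
      using gH[of \<Lambda>'] unfolding H0_def mem_Collect_eq by (elim conjE)
    then obtain c0 s where s: "\<forall>i\<in>\<Lambda>'. s i > (0::real)"
      "\<forall>z\<in>stolz_prod \<gamma>. cmod (g \<Lambda>' z) \<le> c0 * (\<Prod>i\<in>\<Lambda>'. cmod (1 - z $ i) powr s i)" by blast
    have 1: "(\<lambda>n. cmod (1 - Z n $ i) powr s i) \<longlonglongrightarrow> (if i \<in> \<Lambda> then cmod (1 - z $ i) powr s i else 0)"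
      if "i \<in> \<Lambda>'" for i
    proof (cases "i \<in> \<Lambda>")
      case False
      have "(\<lambda>n. cmod (1 - of_real (scale_factor n))) \<longlonglongrightarrow> cmod (1 - of_real 1)"
        by (intro tendsto_intros scale_factor(3))
      then have "(\<lambda>n. cmod (1 - of_real (scale_factor n)) powr s i) \<longlonglongrightarrow> 0"
        by (intro tendsto_zero_powrI[where b = "s i"]) (use s(1) that in auto)
      then show ?thesis using False by (simp add: Z_def)
    qed (simp add: Z_def)
    have "(\<lambda>n. c0 * (\<Prod>i\<in>\<Lambda>'. cmod (1 - Z n $ i) powr s i))
        \<longlonglongrightarrow> c0 * (\<Prod>i\<in>\<Lambda>'. if i \<in> \<Lambda> then cmod (1 - z $ i) powr s i else 0)"
      by (intro tendsto_mult tendsto_const tendsto_prod 1)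
    also have "(\<Prod>i\<in>\<Lambda>'. if i \<in> \<Lambda> then cmod (1 - z $ i) powr s i else 0) = 0" using j by (intro prod_zero) auto
    finally have 2: "(\<lambda>n. c0 * (\<Prod>i\<in>\<Lambda>'. cmod (1 - Z n $ i) powr s i)) \<longlonglongrightarrow> 0" by simp
    have "(\<lambda>n. g \<Lambda>' (Z n)) \<longlonglongrightarrow> 0"
      by (rule Lim_null_comparison[OF _ 2]) (use s(2) Z in \<open>auto intro: always_eventually\<close>)
    then show ?thesis using False by simp
  qed
  have "(\<lambda>n. \<Sum>\<Lambda>'\<in>UNIV. g \<Lambda>' (Z n)) \<longlonglongrightarrow> (\<Sum>\<Lambda>'\<in>UNIV. if \<Lambda>' \<in> Pow \<Lambda> then g \<Lambda>' z else 0)" by (intro tendsto_sum lim)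
  moreover have "(\<Sum>\<Lambda>'\<in>UNIV. if \<Lambda>' \<in> Pow \<Lambda> then g \<Lambda>' z else 0) = (\<Sum>\<Lambda>'\<in>Pow \<Lambda>. g \<Lambda>' z)"
    by (rule sum.mono_neutral_cong_right) auto
  moreover have "(\<Sum>\<Lambda>'\<in>UNIV. g \<Lambda>' (Z n)) = f (Z n)" for n using g Z unfolding H01_decomposition_def by simp
  ultimately have "(\<lambda>n. f (Z n)) \<longlonglongrightarrow> (\<Sum>\<Lambda>'\<in>Pow \<Lambda>. g \<Lambda>' z)" by simp
  then show ?thesis by (rule Lim_bounded[OF tendsto_norm]) (use f Z in blast)
qed

text \<open>By induction on \<open>\<Lambda>\<close>, the components of the proper subsets are subtracted from the partial sum.\<close>

lemma decomposition_bound: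
  fixes \<gamma> :: "'d::finite \<Rightarrow> real"
  assumes \<gamma>: "\<And>i. 0 < \<gamma> i" "\<And>i. \<gamma> i < pi / 2"
  shows "\<exists>B\<ge>0. \<forall>f g c. H01_decomposition \<gamma> f g \<longrightarrow> (\<forall>z\<in>stolz_prod \<gamma>. cmod (f z) \<le> c) \<longrightarrow>
    (\<forall>z\<in>stolz_prod \<gamma>. cmod (g \<Lambda> z) \<le> B * c)" using finite[of \<Lambda>]
proof (induction \<Lambda> rule: finite_psubset_induct)
  case (psubset \<Lambda>)
  let ?P = "\<lambda>\<Lambda> B. B \<ge> 0 \<and> (\<forall>f g c. H01_decomposition \<gamma> f g \<longrightarrow> (\<forall>z\<in>stolz_prod \<gamma>. cmod (f z) \<le> c) \<longrightarrow>
    (\<forall>z\<in>stolz_prod \<gamma>. cmod (g \<Lambda> z) \<le> B * c))"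
  have "\<forall>\<Lambda>'\<in>Pow \<Lambda> - {\<Lambda>}. \<exists>B. ?P \<Lambda>' B" using psubset.IH by auto
  from bchoice[OF this] obtain B where B: "\<forall>\<Lambda>'\<in>Pow \<Lambda> - {\<Lambda>}. ?P \<Lambda>' (B \<Lambda>')" by (elim exE)
  let ?B = "1 + (\<Sum>\<Lambda>'\<in>Pow \<Lambda> - {\<Lambda>}. B \<Lambda>')"
  have "cmod (g \<Lambda> z) \<le> ?B * c"
    if g: "H01_decomposition \<gamma> f g" and f: "\<forall>z\<in>stolz_prod \<gamma>. cmod (f z) \<le> c" and z: "z \<in> stolz_prod \<gamma>" for f g c z
  proof -
    have "g \<Lambda> z = (\<Sum>\<Lambda>'\<in>Pow \<Lambda>. g \<Lambda>' z) - (\<Sum>\<Lambda>'\<in>Pow \<Lambda> - {\<Lambda>}. g \<Lambda>' z)" by (simp add: sum.remove[of "Pow \<Lambda>" \<Lambda>])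
    then have "cmod (g \<Lambda> z) \<le> cmod (\<Sum>\<Lambda>'\<in>Pow \<Lambda>. g \<Lambda>' z) + cmod (\<Sum>\<Lambda>'\<in>Pow \<Lambda> - {\<Lambda>}. g \<Lambda>' z)"
      by (simp only: norm_triangle_ineq4)
    also have "cmod (\<Sum>\<Lambda>'\<in>Pow \<Lambda> - {\<Lambda>}. g \<Lambda>' z) \<le> (\<Sum>\<Lambda>'\<in>Pow \<Lambda> - {\<Lambda>}. B \<Lambda>' * c)"
      by (rule sum_norm_le) (use B g f z in blast)
    also have "cmod (\<Sum>\<Lambda>'\<in>Pow \<Lambda>. g \<Lambda>' z) \<le> c"
      by (rule decomposition_partial_sum_bound[OF \<gamma> g _ z]) (use f in blast)
    finally show ?thesis by (simp add: algebra_simps sum_distrib_left)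
  qed
  moreover have "?B \<ge> 0" using B by (intro add_nonneg_nonneg sum_nonneg) auto
  ultimately show ?case by blast
qed


section \<open>The joint functional calculus\<close>

theorem theorem4p3:
  fixes T :: "'d::finite \<Rightarrow> ('a::complex_banach, 'a) cblinfun"
    and \<delta> :: "'d \<Rightarrow> real"
  assumes "reflexive_space TYPE('a)"
    and "finite_cotype TYPE('a)"
    and "finite_cotype TYPE(('a, complex) cblinfun)"
    and "\<And>i j. T i o\<^sub>C T j = T j o\<^sub>C T i"
    and "\<And>k. R_ritt (T k)"
    and "\<And>k. 0 < \<delta> k \<and> \<delta> k < pi / 2 \<and> R_type (T k) = \<delta> k"
    and "\<exists>C>0. \<forall>\<Lambda>. \<exists>\<alpha> \<beta>. (\<forall>k\<in>\<Lambda>. 0 < \<alpha> k \<and> 0 < \<beta> k) \<and>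
           (\<forall>x. square_enorm T \<Lambda> \<alpha> x \<le> ennreal (C * norm x)) \<and>
           (\<forall>y. square_enorm (\<lambda>k. cadjoint (T k)) \<Lambda> \<beta> y \<le> ennreal (C * norm y))"
  shows "\<forall>\<gamma>. (\<forall>k. \<delta> k < \<gamma> k \<and> \<gamma> k < pi / 2) \<longrightarrow> admits_joint_calculus \<gamma> T"
proof (intro allI impI)
  fix \<gamma> :: "'d \<Rightarrow> real" assume \<gamma>: "\<forall>k. \<delta> k < \<gamma> k \<and> \<gamma> k < pi / 2"
  have ang: "0 < \<gamma> k" "\<gamma> k < pi / 2" and rt: "R_type (T k) < \<gamma> k" for k
    using \<gamma> assms(6)[of k] less_trans by auto
  interpret commuting_tuple \<gamma> T by standard (use ang assms(4) in auto)
  obtain C where C: "C > 0" "\<forall>\<Lambda>. \<exists>\<alpha> \<beta>. (\<forall>k\<in>\<Lambda>. 0 < \<alpha> k \<and> 0 < \<beta> k) \<and>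
           (\<forall>x. square_enorm T \<Lambda> \<alpha> x \<le> ennreal (C * norm x)) \<and>
           (\<forall>y. square_enorm (\<lambda>k. cadjoint (T k)) \<Lambda> \<beta> y \<le> ennreal (C * norm y))" using assms(7) by blast
  have zero: "0 \<in> stolz_prod \<gamma>" using zero_in_stolz[OF ang] by (simp add: stolz_prod_def)
  have "\<forall>\<Lambda>. \<exists>K\<ge>0. \<forall>f\<in>H0 \<gamma> \<Lambda>. \<forall>c\<ge>0. (\<forall>z\<in>stolz_prod \<gamma>. cmod (f z) \<le> c) \<longrightarrow> norm (H0_calculus \<gamma> T \<Lambda> f) \<le> K * c"
  proof
    fix \<Lambda> :: "'d set"
    show "\<exists>K\<ge>0. \<forall>f\<in>H0 \<gamma> \<Lambda>. \<forall>c\<ge>0. (\<forall>z\<in>stolz_prod \<gamma>. cmod (f z) \<le> c) \<longrightarrow> norm (H0_calculus \<gamma> T \<Lambda> f) \<le> K * c"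
    proof (cases "\<Lambda> = {}")
      case True
      have id: "norm (cblinfun_id :: ('a, 'a) cblinfun) \<le> 1" by (rule norm_cblinfun_bound) auto
      have "norm (H0_calculus \<gamma> T \<Lambda> f) \<le> 1 * c" if c: "c \<ge> 0" "\<forall>z\<in>stolz_prod \<gamma>. cmod (f z) \<le> c" for f c
      proof -
        have "cmod (f 0) \<le> c" using c zero by blast
        then have "cmod (f 0) * norm (cblinfun_id :: ('a, 'a) cblinfun) \<le> c * 1"
          using c(1) id by (intro mult_mono) auto
        then show ?thesis using True by (simp add: H0_calculus_def norm_scaleC)
      qed
      then show ?thesis by (intro exI[of _ 1]) auto
    next
      case False
      obtain \<alpha> \<beta> where ab: "\<forall>k\<in>\<Lambda>. 0 < \<alpha> k \<and> 0 < \<beta> k" "\<forall>x. square_enorm T \<Lambda> \<alpha> x \<le> ennreal (C * norm x)"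
           "\<forall>y. square_enorm (\<lambda>k. cadjoint (T k)) \<Lambda> \<beta> y \<le> ennreal (C * norm y)" using C(2) by blast
      show ?thesis by (rule H0_calculus_bound[OF assms(5) rt _ C(1) _ _ False, of \<alpha> \<beta>]) (use ab in auto)
    qed
  qed
  from choice[OF this] obtain K where K: "\<forall>\<Lambda>. K \<Lambda> \<ge> 0 \<and> (\<forall>f\<in>H0 \<gamma> \<Lambda>. \<forall>c\<ge>0. (\<forall>z\<in>stolz_prod \<gamma>. cmod (f z) \<le> c) \<longrightarrow>
      norm (H0_calculus \<gamma> T \<Lambda> f) \<le> K \<Lambda> * c)" by (elim exE)
  have "\<forall>\<Lambda>. \<exists>B\<ge>0. \<forall>f g c. H01_decomposition \<gamma> f g \<longrightarrow> (\<forall>z\<in>stolz_prod \<gamma>. cmod (f z) \<le> c) \<longrightarrow>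
      (\<forall>z\<in>stolz_prod \<gamma>. cmod (g \<Lambda> z) \<le> B * c)" using decomposition_bound[OF ang] by (rule allI)
  from choice[OF this] obtain B where B: "\<forall>\<Lambda>. B \<Lambda> \<ge> 0 \<and> (\<forall>f g c. H01_decomposition \<gamma> f g \<longrightarrow>
      (\<forall>z\<in>stolz_prod \<gamma>. cmod (f z) \<le> c) \<longrightarrow> (\<forall>z\<in>stolz_prod \<gamma>. cmod (g \<Lambda> z) \<le> B \<Lambda> * c))" by (elim exE)
  define Q where "Q = (\<Sum>\<Lambda>\<in>UNIV. K \<Lambda> * B \<Lambda>) + 1"
  have Q: "(\<Sum>\<Lambda>\<in>UNIV. K \<Lambda> * B \<Lambda>) \<ge> 0" using K B by (intro sum_nonneg) simp
  have "norm (H01_calculus \<gamma> T f) \<le> Q * (SUP z\<in>stolz_prod \<gamma>. cmod (f z))" if f: "f \<in> H01 \<gamma>" for f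
  proof -
    define g where "g = (SOME g. H01_decomposition \<gamma> f g)"
    have g: "H01_decomposition \<gamma> f g" using f unfolding H01_def mem_Collect_eq g_def by (rule someI_ex)
    let ?c = "SUP z\<in>stolz_prod \<gamma>. cmod (f z)"
    have "\<exists>b. \<forall>z\<in>stolz_prod \<gamma>. cmod (g \<Lambda> z) \<le> b" for \<Lambda>
    proof -
      have "g \<Lambda> \<in> H0 \<gamma> \<Lambda>" using g by (simp add: H01_decomposition_def)
      then have "bounded (g \<Lambda> ` stolz_prod \<gamma>)" unfolding H0_def mem_Collect_eq by (elim conjE)
      then show ?thesis by (simp add: bounded_iff)
    qed
    then have "\<forall>\<Lambda>. \<exists>b. \<forall>z\<in>stolz_prod \<gamma>. cmod (g \<Lambda> z) \<le> b" by (rule allI)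
    from choice[OF this] obtain b where b: "\<forall>\<Lambda>. \<forall>z\<in>stolz_prod \<gamma>. cmod (g \<Lambda> z) \<le> b \<Lambda>" by (elim exE)
    have "cmod (f z) \<le> (\<Sum>\<Lambda>\<in>UNIV. b \<Lambda>)" if z: "z \<in> stolz_prod \<gamma>" for z
    proof -
      have "f z = (\<Sum>\<Lambda>\<in>UNIV. g \<Lambda> z)" using g z by (simp add: H01_decomposition_def)
      then show ?thesis using b z by (auto intro: sum_norm_le)
    qed
    then have "bdd_above ((\<lambda>z. cmod (f z)) ` stolz_prod \<gamma>)" by (intro bdd_aboveI2)
    then have fc: "\<forall>z\<in>stolz_prod \<gamma>. cmod (f z) \<le> ?c" by (intro ballI cSUP_upper)
    have c0: "?c \<ge> 0" using fc zero order_trans[OF norm_ge_zero] by blast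
    have "norm (H01_calculus \<gamma> T f) \<le> (\<Sum>\<Lambda>\<in>UNIV. norm (H0_calculus \<gamma> T \<Lambda> (g \<Lambda>)))"
      unfolding H01_calculus_def g_def[symmetric] Let_def by (rule norm_sum)
    also have "\<dots> \<le> (\<Sum>\<Lambda>\<in>UNIV. K \<Lambda> * B \<Lambda> * ?c)"
    proof (rule sum_mono)
      fix \<Lambda>
      have "\<forall>z\<in>stolz_prod \<gamma>. cmod (g \<Lambda> z) \<le> B \<Lambda> * ?c" using B g fc by blast
      moreover have "g \<Lambda> \<in> H0 \<gamma> \<Lambda>" using g by (simp add: H01_decomposition_def)
      moreover have "B \<Lambda> * ?c \<ge> 0" using B c0 by simp
      ultimately have "norm (H0_calculus \<gamma> T \<Lambda> (g \<Lambda>)) \<le> K \<Lambda> * (B \<Lambda> * ?c)" using K by blast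
      then show "norm (H0_calculus \<gamma> T \<Lambda> (g \<Lambda>)) \<le> K \<Lambda> * B \<Lambda> * ?c" by (simp add: mult.assoc)
    qed
    also have "\<dots> = (\<Sum>\<Lambda>\<in>UNIV. K \<Lambda> * B \<Lambda>) * ?c" by (simp add: sum_distrib_right)
    also have "\<dots> \<le> Q * ?c" using c0 by (intro mult_right_mono) (auto simp: Q_def)
    finally show ?thesis .
  qed
  moreover have "\<exists>a<\<gamma> k. ritt_of_type a (T k)" for k by (rule R_type_less[OF assms(5) rt]) blast
  moreover have "Q > 0" using Q by (simp add: Q_def)
  ultimately show "admits_joint_calculus \<gamma> T" unfolding admits_joint_calculus_def by blast
qed

end
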